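(* Let $f\in C_c^\infty(W)$, let $u\in H^s(\mathbb{R}^d)$ be the unique solution of $(-\Delta)^su+qu=0$ in $\Omega$, $u=f$ in $\Omega_e$, let $g=((-\Delta)^su)|_W$, and assume $W\subset\subset\Omega_e$ with $\operatorname{dist}(W,\Omega)=d_0>0$. Write $u=u_0+\bar u_f$ with $u_0\in\widetilde H^s(\Omega)$, $\mathcal Lu_0=\mu$. Let $\|g_W^\delta-g_W\|_Y\le\delta$, let $\mu_W^\delta$ be the corresponding preprocessed data vector, and $\eta(h,R)$ the deterministic consistency error. Assume the source condition: there exist $\nu\in(0,1]$, $w\in\widetilde H^s(\Omega)$, $r_u\in\widetilde H^s(\Omega)$ with \[ u_0=A^\nu w+r_u,\qquad \|r_u\|_{H^s(\mathbb{R}^d)}\le\epsilon_u,\qquad \epsilon_u=\mathcal O\big((\delta+\eta(h,R))^{\frac{2\nu}{2\nu+1}}\big). \] Let $\widehat u_{0,h}^\alpha\in V_{h,0}$ be the minimizer of the discrete Tikhonov functional with the exact sampled data $\mu_W$ in place of $\mu_W^\delta$, and define $\rho_{h,R}(\alpha):=\|\widehat u_{0,h}^\alpha-u_0^\alpha\|_{H^s(\mathbb{R}^d)}$. After extending $u_{0,h}^\alpha$, $\widehat u_{0,h}^\alpha$, $u_{h,f}$ by zero outside $\Omega_R$ and setting $u_h^\alpha=u_{0,h}^\alpha+u_{h,f}$, there exists $C>0$, independent of $h,R,\delta,\alpha$, such that \[ \|u_h^\alpha-u\|_{H^s(\mathbb{R}^d)}\le C\Big(\frac{\delta+\eta(h,R)}{\sqrt\alpha}+\rho_{h,R}(\alpha)+\|u_{h,f}-\bar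 u_f\|_{H^s(\mathbb{R}^d)}+\alpha^\nu\|w\|_{H^s(\mathbb{R}^d)}+\epsilon_u\Big). \] In particular, if $u_0\in\operatorname{Range}(A^\nu)$, then one may take $\epsilon_u=0$. Moreover, for each fixed $\alpha>0$, $\rho_{h,R}(\alpha)\to0$ as $h\to0$ and $R\to\infty$. If, in addition, \[ \rho_{h,R}(\alpha)+\|u_{h,f}-\bar u_f\|_{H^s(\mathbb{R}^d)}+\epsilon_u=\mathcal O\big((\delta+\eta(h,R))^{\frac{2\nu}{2\nu+1}}\big) \] and $\|w\|_{H^s(\mathbb{R}^d)}$ remains bounded independently of $h,R,\delta,\alpha$, then the choice \[ c_1(\delta+\eta(h,R))^{\frac2{2\nu+1}}\le\alpha\le c_2(\delta+\eta(h,R))^{\frac2{2\nu+1}} \] for some constants $c_1,c_2>0$ independent of $h,R,\delta$ yields \[ \|u_h^\alpha-u\|_{H^s(\mathbb{R}^d)}=\mathcal O\big((\delta+\eta(h,R))^{\frac{2\nu}{2\nu+1}}\big)\qquad\text{as }\delta+\eta(h,R)\to0. \]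
   Context: Continuous setting. $d\ge1$, $s\in(0,1)$; $\Omega\subset\mathbb{R}^d$ is a bounded Lipschitz polygonal/polyhedral domain, $\Omega_e=\mathbb{R}^d\setminus\overline\Omega$; $W$ is a nonempty bounded open set. $(-\Delta)^s u(x)=c_{d,s}\,\mathrm{P.V.}\int_{\mathbb{R}^d}\frac{u(x)-u(y)}{|x-y|^{d+2s}}dy$ with a normalization constant $c_{d,s}>0$, $a(u,v)=\frac{c_{d,s}}2\iint_{\mathbb{R}^d\times\mathbb{R}^d}\frac{(u(x)-u(y))(v(x)-v(y))}{|x-y|^{d+2s}}dxdy$, $\|v\|_{H^s(\mathbb{R}^d)}^2=\|v\|_{L^2(\mathbb{R}^d)}^2+a(v,v)$, and $\widetilde H^s(\Omega)$ is the closure of $C_c^\infty(\Omega)$ in $H^s(\mathbb{R}^d)$. $q\in L^\infty(\Omega)$ is real-valued and such that the only $w\in\widetilde H^s(\Omega)$ with $a(w,\phi)+\int_\Omega qw\phi\,dx=0$ for all $\phi\in\widetilde H^s(\Omega)$ is $w=0$. The solution $u$ is the unique $u\in H^s(\mathbb{R}^d)$ with $u=f$ in $\Omega_e$ and $a(u,\phi)+\int_\Omega qu\phi\,dx=0$ for all $\phi\in\widetilde H^s(\Omega)$. $\bar u_f$ is the zero extension of $f$ to $\mathbb{R}^d$. For $v\in L^2(\Omega)$ (extended by zero) and $x\in\overline W$, $(\mathcal Lv)(x)=-c_{d,s}\int_\Omega\frac{v(y)}{|x-y|^{d+2s}}dy=(-\Delta)^sv(x)$. The preprocessed measurement is $\mu=g-((-\Delta)^s\bar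 u_f)|_W$. For $\alpha>0$, $u_0^\alpha$ is the unique minimizer over $v\in\widetilde H^s(\Omega)$ of $J_\alpha(v)=\|\mathcal Lv-\mu\|_{L^2(W)}^2+\alpha\|v\|_{H^s(\mathbb{R}^d)}^2$. Operator $A$. $\mathcal L:\widetilde H^s(\Omega)\to L^2(W)$ is bounded, injective (by unique continuation for the fractional Laplacian) and compact; $\mathcal L^*$ is its Hilbert adjoint with respect to $(\cdot,\cdot)_{H^s(\mathbb{R}^d)}$ and $(\cdot,\cdot)_{L^2(W)}$; $A=\mathcal L^*\mathcal L$ on $\widetilde H^s(\Omega)$ is compact, self-adjoint, positive, with orthonormal eigenbasis $\{e_j\}$ and eigenvalues $\lambda_j>0$; $A^\nu v=\sum_j\lambda_j^\nu(v,e_j)_{H^s(\mathbb{R}^d)}e_j$. Discrete setting. $\Omega_R=(-R,R)^d\supset\Omega\cup W$. $\mathcal T_h$ is a quasi-uniform mesh of $\Omega_R$ of size $h$, fitted to $\Omega$ ($\partial\Omega$ is a union of faces) for all small $h$; $V_h\subset H^1(\Omega_R)$ is the continuous piecewise polynomial finite element space of degree $p\ge1$ and $V_{h,0}=\{v_h\in V_h:v_h=0\text{ on }\Omega_R\setminus\Omega\}$. $u_{h,f}=I_h\bar u_f\in V_h$ is the nodal interpolant on $\Omega_R$. $\mathcal T_h^W$ is a shape-regular quasi-uniform mesh of $W$, $S_h^W\subset C(\overline W)$ the continuous piecewise polynomial space on it with nodal basis $\{\vartheta_k\}_{k=1}^{N_W}$ and nodes $x_k\in\overline W$; $I_h^W\psi=\sum_k\psi(x_k)\vartheta_k$;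 $\mathbf W_{ij}=\int_W\vartheta_i\vartheta_j\,dx$; $Y=\mathbb{R}^{N_W}$ with $\|y\|_Y^2=y^\top\mathbf Wy$; for continuous $\psi$, $\psi_W=(\psi(x_k))_k\in Y$. Standing assumption: there are an integer $m>d/2$ and $C>0$ independent of $h$ with $\|I_h^W\phi-\phi\|_{L^2(W)}\le Ch^m\|\phi\|_{H^m(W)}$ for all $\phi\in H^m(W)$. $(\mathcal L_{h,R}v)_k=c_{d,s}\,\mathrm{P.V.}\int_{\Omega_R}\frac{v(x_k)-v(y)}{|x_k-y|^{d+2s}}dy$; $\mu_W^\delta=(g^\delta(x_k)-(\mathcal L_{h,R}u_{h,f})_k)_k$. The point values of $(-\Delta)^su_{h,f}$ on $W$ are taken to be well defined. The consistency error is $\eta(h,R)=\eta_I(h)+\eta_t(h,R)$, $\eta_I(h)=\|((-\Delta)^s\bar u_f)_W-((-\Delta)^su_{h,f})_W\|_Y$, $\eta_t(h,R)=\|((-\Delta)^su_{h,f})_W-\mathcal L_{h,R}u_{h,f}\|_Y$. With $a_R(u,v)=\frac{c_{d,s}}{2}\iint_{\Omega_R\times\Omega_R}\frac{(u(x)-u(y))(v(x)-v(y))}{|x-y|^{d+2s}}dxdy+c_{d,s}\int_{\Omega_R}u(x)v(x)\big(\int_{\mathbb{R}^d\setminus\Omega_R}\frac{dy}{|x-y|^{d+2s}}\big)dx$ and $\|v_h\|_{s,R,h}^2=a_R(v_h,v_h)+\|v_h\|_{L^2(\Omega_R)}^2$, the discrete Tikhonov functional is $v_h\mapsto\|(\mathcal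 Lv_h)_W-\mu_W^\delta\|_Y^2+\alpha\|v_h\|_{s,R,h}^2$ on $V_{h,0}$, and $u_{0,h}^\alpha\in V_{h,0}$ is its unique minimizer. *)

theory Defs
  imports "HOL-Analysis.Analysis" "HOL-Library.Landau_Symbols"
begin

text \<open>
  The ambient space is an arbitrary Euclidean space \<open>'a\<close> of dimension \<open>d = DIM('a)\<close>.
  Elements of \<open>L\<^sup>2\<close>, \<open>H\<^sup>s\<close>, \<dots> are Borel functions \<open>'a \<Rightarrow> real\<close>; equality in these spaces is
  equality almost everywhere.  The normalization constant \<open>c\<close> is an arbitrary positive number.
\<close>

subsection \<open>Domains\<close>

definition exterior :: "'a::euclidean_space set \<Rightarrow> 'a set" where
  "exterior \<Omega> = - closure \<Omega>"

text \<open>Locally, up to a rigid motion, the set is the region strictly below a Lipschitz graph.\<close>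

definition lipschitz_boundary :: "'a::euclidean_space set \<Rightarrow> bool" where
  "lipschitz_boundary \<Omega> \<longleftrightarrow>
     (\<forall>z\<in>frontier \<Omega>. \<exists>U n \<gamma> K. open U \<and> z \<in> U \<and> norm n = 1 \<and> K-lipschitz_on UNIV \<gamma> \<and>
        \<Omega> \<inter> U = {x \<in> U. x \<bullet> n < (\<gamma> (x - (x \<bullet> n) *\<^sub>R n) :: real)})"

definition lipschitz_polyhedral_domain :: "'a::euclidean_space set \<Rightarrow> bool" where
  "lipschitz_polyhedral_domain \<Omega> \<longleftrightarrow>
     open \<Omega> \<and> connected \<Omega> \<and> \<Omega> \<noteq> {} \<and> bounded \<Omega> \<and> lipschitz_boundary \<Omega> \<and>
     (\<exists>\<P>. finite \<P> \<and> (\<forall>Q\<in>\<P>. polytope Q) \<and> closure \<Omega> = \<Union>\<P>)"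

definition cube :: "real \<Rightarrow> 'a::euclidean_space set" where
  "cube R = box (- R *\<^sub>R One) (R *\<^sub>R One)"

subsection \<open>Smooth functions and test functions\<close>

definition partial_deriv :: "'a::euclidean_space \<Rightarrow> ('a \<Rightarrow> real) \<Rightarrow> 'a \<Rightarrow> real" where
  "partial_deriv b \<phi> x = frechet_derivative \<phi> (at x) b"

fun C_k :: "nat \<Rightarrow> ('a::euclidean_space \<Rightarrow> real) \<Rightarrow> bool" where
  "C_k 0 \<phi> \<longleftrightarrow> continuous_on UNIV \<phi>"
| "C_k (Suc k) \<phi> \<longleftrightarrow>
     (\<forall>x. \<phi> differentiable at x) \<and> (\<forall>b\<in>Basis. C_k k (partial_deriv b \<phi>))"

definition test_functions :: "'a::euclidean_space set \<Rightarrow> ('a \<Rightarrow> real) set" where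
  "test_functions D =
     {\<phi>. (\<forall>k. C_k k \<phi>) \<and> compact (closure {x. \<phi> x \<noteq> 0}) \<and> closure {x. \<phi> x \<noteq> 0} \<subseteq> D}"

definition multi_indices :: "nat \<Rightarrow> ('a::euclidean_space \<Rightarrow> nat) set" where
  "multi_indices m = {\<beta>. (\<forall>b. b \<notin> Basis \<longrightarrow> \<beta> b = 0) \<and> (\<Sum>b\<in>Basis. \<beta> b) \<le> m}"

text \<open>
  The partial derivative \<open>\<partial>\<^sup>\<beta> \<phi>\<close>.  The order in which the basis directions are processed is an
  arbitrary fixed one; it is immaterial because the operator is only applied to smooth functions.
\<close>

definition multi_deriv ::
  "('a::euclidean_space \<Rightarrow> nat) \<Rightarrow> ('a \<Rightarrow> real) \<Rightarrow> 'a \<Rightarrow> real" where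
  "multi_deriv \<beta> \<phi> =
     foldr (\<lambda>b \<psi>. (partial_deriv b ^^ \<beta> b) \<psi>) (SOME bs. distinct bs \<and> set bs = Basis) \<phi>"

subsection \<open>Lebesgue and integer-order Sobolev spaces\<close>

definition L2 :: "'a::euclidean_space set \<Rightarrow> ('a \<Rightarrow> real) set" where
  "L2 D = {v. set_borel_measurable lborel D v \<and> set_integrable lborel D (\<lambda>x. (v x)\<^sup>2)}"

definition L2_inner ::
  "'a::euclidean_space set \<Rightarrow> ('a \<Rightarrow> real) \<Rightarrow> ('a \<Rightarrow> real) \<Rightarrow> real" where
  "L2_inner D v w = (LINT x:D|lborel. v x * w x)"

definition L2_norm :: "'a::euclidean_space set \<Rightarrow> ('a \<Rightarrow> real) \<Rightarrow> real" where
  "L2_norm D v = sqrt (L2_inner D v v)"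

definition L_infinity :: "'a::euclidean_space set \<Rightarrow> ('a \<Rightarrow> real) set" where
  "L_infinity D =
     {v. set_borel_measurable lborel D v \<and> (\<exists>B. AE x in lborel. x \<in> D \<longrightarrow> \<bar>v x\<bar> \<le> B)}"

definition is_weak_deriv ::
  "'a::euclidean_space set \<Rightarrow> ('a \<Rightarrow> nat) \<Rightarrow> ('a \<Rightarrow> real) \<Rightarrow> ('a \<Rightarrow> real) \<Rightarrow> bool" where
  "is_weak_deriv D \<beta> v g \<longleftrightarrow>
     (\<forall>\<phi>\<in>test_functions D. (LINT x:D|lborel. v x * multi_deriv \<beta> \<phi> x)
        = (-1) ^ (\<Sum>b\<in>Basis. \<beta> b) * (LINT x:D|lborel. g x * \<phi> x))"

definition weak_deriv ::
  "'a::euclidean_space set \<Rightarrow> ('a \<Rightarrow> nat) \<Rightarrow> ('a \<Rightarrow> real) \<Rightarrow> 'a \<Rightarrow> real" where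
  "weak_deriv D \<beta> v = (SOME g. g \<in> L2 D \<and> is_weak_deriv D \<beta> v g)"

definition Hm :: "nat \<Rightarrow> 'a::euclidean_space set \<Rightarrow> ('a \<Rightarrow> real) set" where
  "Hm m D = {v \<in> L2 D. \<forall>\<beta>\<in>multi_indices m. \<exists>g\<in>L2 D. is_weak_deriv D \<beta> v g}"

definition Hm_norm :: "nat \<Rightarrow> 'a::euclidean_space set \<Rightarrow> ('a \<Rightarrow> real) \<Rightarrow> real" where
  "Hm_norm m D v = sqrt (\<Sum>\<beta>\<in>multi_indices m. (L2_norm D (weak_deriv D \<beta> v))\<^sup>2)"

subsection \<open>Fractional Sobolev spaces\<close>

definition frac_kernel :: "real \<Rightarrow> 'a::euclidean_space \<Rightarrow> 'a \<Rightarrow> real" where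
  "frac_kernel s x y = 1 / norm (x - y) powr (real DIM('a) + 2 * s)"

definition frac_form ::
  "real \<Rightarrow> real \<Rightarrow> ('a::euclidean_space \<Rightarrow> real) \<Rightarrow> ('a \<Rightarrow> real) \<Rightarrow> real" where
  "frac_form c s u v =
     c / 2 * (\<integral>(x, y). (u x - u y) * (v x - v y) * frac_kernel s x y \<partial>(lborel \<Otimes>\<^sub>M lborel))"

definition Hs :: "real \<Rightarrow> ('a::euclidean_space \<Rightarrow> real) set" where
  "Hs s = {v. v \<in> borel_measurable lborel \<and> integrable lborel (\<lambda>x. (v x)\<^sup>2) \<and>
     integrable (lborel \<Otimes>\<^sub>M lborel) (\<lambda>(x, y). (v x - v y)\<^sup>2 * frac_kernel s x y)}"

definition Hs_inner ::
  "real \<Rightarrow> real \<Rightarrow> ('a::euclidean_space \<Rightarrow> real) \<Rightarrow> ('a \<Rightarrow> real) \<Rightarrow> real" where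
  "Hs_inner c s u v = L2_inner UNIV u v + frac_form c s u v"

definition Hs_norm :: "real \<Rightarrow> real \<Rightarrow> ('a::euclidean_space \<Rightarrow> real) \<Rightarrow> real" where
  "Hs_norm c s v = sqrt ((L2_norm UNIV v)\<^sup>2 + frac_form c s v v)"

definition Hs_tilde ::
  "real \<Rightarrow> real \<Rightarrow> 'a::euclidean_space set \<Rightarrow> ('a \<Rightarrow> real) set" where
  "Hs_tilde c s \<Omega> =
     {v \<in> Hs s. \<forall>\<epsilon>>0. \<exists>\<phi>\<in>test_functions \<Omega>. Hs_norm c s (\<lambda>x. v x - \<phi> x) < \<epsilon>}"

definition Hs_sums ::
  "real \<Rightarrow> real \<Rightarrow> (nat \<Rightarrow> 'a::euclidean_space \<Rightarrow> real) \<Rightarrow> ('a \<Rightarrow> real) \<Rightarrow> bool" where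
  "Hs_sums c s F z \<longleftrightarrow>
     z \<in> Hs s \<and> (\<lambda>n. Hs_norm c s (\<lambda>x. z x - (\<Sum>j<n. F j x))) \<longlonglongrightarrow> 0"

subsection \<open>The fractional Laplacian, pointwise\<close>

text \<open>
  With \<open>D = UNIV\<close> this is \<open>(-\<Delta>)\<^sup>s v(x)\<close>; with \<open>D\<close> the cube of half-width \<open>R\<close> it is the
  truncated operator used in the discretization.
\<close>

definition frac_lap_cutoff ::
  "real \<Rightarrow> real \<Rightarrow> 'a::euclidean_space set \<Rightarrow> ('a \<Rightarrow> real) \<Rightarrow> 'a \<Rightarrow> real \<Rightarrow> real" where
  "frac_lap_cutoff c s D v x \<epsilon> =
     c * (LINT y:D - ball x \<epsilon>|lborel. (v x - v y) * frac_kernel s x y)"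

definition frac_lap_on ::
  "real \<Rightarrow> real \<Rightarrow> 'a::euclidean_space set \<Rightarrow> ('a \<Rightarrow> real) \<Rightarrow> 'a \<Rightarrow> real" where
  "frac_lap_on c s D v x = Lim (at_right 0) (frac_lap_cutoff c s D v x)"

abbreviation frac_lap :: "real \<Rightarrow> real \<Rightarrow> ('a::euclidean_space \<Rightarrow> real) \<Rightarrow> 'a \<Rightarrow> real" where
  "frac_lap c s \<equiv> frac_lap_on c s UNIV"

definition frac_lap_exists ::
  "real \<Rightarrow> real \<Rightarrow> ('a::euclidean_space \<Rightarrow> real) \<Rightarrow> 'a \<Rightarrow> bool" where
  "frac_lap_exists c s v x \<longleftrightarrow>
     (\<forall>\<epsilon>>0. set_integrable lborel (UNIV - ball x \<epsilon>) (\<lambda>y. (v x - v y) * frac_kernel s x y)) \<and>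
     (\<exists>l. (frac_lap_cutoff c s UNIV v x \<longlongrightarrow> l) (at_right 0))"

subsection \<open>The exterior value problem and the measurement operator\<close>

definition zero_extension :: "'a set \<Rightarrow> ('a \<Rightarrow> real) \<Rightarrow> 'a \<Rightarrow> real" where
  "zero_extension D f x = (if x \<in> D then f x else 0)"

definition only_trivial_solution ::
  "real \<Rightarrow> real \<Rightarrow> 'a::euclidean_space set \<Rightarrow> ('a \<Rightarrow> real) \<Rightarrow> bool" where
  "only_trivial_solution c s \<Omega> q \<longleftrightarrow>
     (\<forall>w\<in>Hs_tilde c s \<Omega>.
        (\<forall>\<phi>\<in>Hs_tilde c s \<Omega>. frac_form c s w \<phi> + (LINT x:\<Omega>|lborel. q x * w x * \<phi> x) = 0)
        \<longrightarrow> (AE x in lborel. w x = 0))"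

text \<open>
  The exterior condition is required at every point: this selects the representative of the
  solution whose point values enter the pointwise fractional Laplacian in the exterior.
\<close>

definition exterior_value_solution ::
  "real \<Rightarrow> real \<Rightarrow> 'a::euclidean_space set \<Rightarrow> ('a \<Rightarrow> real) \<Rightarrow> ('a \<Rightarrow> real) \<Rightarrow> ('a \<Rightarrow> real) \<Rightarrow> bool"
where
  "exterior_value_solution c s \<Omega> q f u \<longleftrightarrow>
     u \<in> Hs s \<and> (\<forall>x\<in>exterior \<Omega>. u x = f x) \<and>
     (\<forall>\<phi>\<in>Hs_tilde c s \<Omega>. frac_form c s u \<phi> + (LINT x:\<Omega>|lborel. q x * u x * \<phi> x) = 0)"

definition meas_op ::
  "real \<Rightarrow> real \<Rightarrow> 'a::euclidean_space set \<Rightarrow> ('a \<Rightarrow> real) \<Rightarrow> 'a \<Rightarrow> real" where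
  "meas_op c s \<Omega> v x = - c * (LINT y:\<Omega>|lborel. v y * frac_kernel s x y)"

definition hilbert_adjoint ::
  "real \<Rightarrow> real \<Rightarrow> 'a::euclidean_space set \<Rightarrow> 'a set \<Rightarrow>
   (('a \<Rightarrow> real) \<Rightarrow> 'a \<Rightarrow> real) \<Rightarrow> (('a \<Rightarrow> real) \<Rightarrow> 'a \<Rightarrow> real) \<Rightarrow> bool" where
  "hilbert_adjoint c s \<Omega> W L Lstar \<longleftrightarrow>
     (\<forall>\<psi>\<in>L2 W. Lstar \<psi> \<in> Hs_tilde c s \<Omega> \<and>
        (\<forall>v\<in>Hs_tilde c s \<Omega>. Hs_inner c s v (Lstar \<psi>) = L2_inner W (L v) \<psi>))"

definition orthonormal_eigenbasis ::
  "real \<Rightarrow> real \<Rightarrow> 'a::euclidean_space set \<Rightarrow> (('a \<Rightarrow> real) \<Rightarrow> 'a \<Rightarrow> real) \<Rightarrow>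
   (nat \<Rightarrow> 'a \<Rightarrow> real) \<Rightarrow> (nat \<Rightarrow> real) \<Rightarrow> bool" where
  "orthonormal_eigenbasis c s \<Omega> A e lam \<longleftrightarrow>
     (\<forall>j. e j \<in> Hs_tilde c s \<Omega>) \<and>
     (\<forall>i j. Hs_inner c s (e i) (e j) = (if i = j then 1 else 0)) \<and>
     (\<forall>v\<in>Hs_tilde c s \<Omega>. Hs_sums c s (\<lambda>j x. Hs_inner c s v (e j) * e j x) v) \<and>
     (\<forall>j. lam j > 0 \<and> (AE x in lborel. A (e j) x = lam j * e j x))"

text \<open>\<open>z = A\<^sup>\<nu> v\<close>, where \<open>e\<close>, \<open>lam\<close> is the eigensystem of \<open>A\<close>.\<close>

definition frac_power_eq ::
  "real \<Rightarrow> real \<Rightarrow> (nat \<Rightarrow> 'a::euclidean_space \<Rightarrow> real) \<Rightarrow> (nat \<Rightarrow> real) \<Rightarrow> real \<Rightarrow>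
   ('a \<Rightarrow> real) \<Rightarrow> ('a \<Rightarrow> real) \<Rightarrow> bool" where
  "frac_power_eq c s e lam \<nu> v z \<longleftrightarrow>
     Hs_sums c s (\<lambda>j x. lam j powr \<nu> * Hs_inner c s v (e j) * e j x) z"

definition tikhonov ::
  "real \<Rightarrow> real \<Rightarrow> 'a::euclidean_space set \<Rightarrow> 'a set \<Rightarrow> ('a \<Rightarrow> real) \<Rightarrow> real \<Rightarrow>
   ('a \<Rightarrow> real) \<Rightarrow> real" where
  "tikhonov c s \<Omega> W \<mu> \<alpha> v =
     (L2_norm W (\<lambda>x. meas_op c s \<Omega> v x - \<mu> x))\<^sup>2 + \<alpha> * (Hs_norm c s v)\<^sup>2"

subsection \<open>Finite elements\<close>

definition simplicial_mesh :: "'a::euclidean_space set set \<Rightarrow> 'a set \<Rightarrow> bool" where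
  "simplicial_mesh \<T> D \<longleftrightarrow>
     triangulation \<T> \<and> (\<forall>K\<in>\<T>. int DIM('a) simplex K) \<and> \<Union>\<T> = closure D"

definition mesh_size :: "'a::euclidean_space set set \<Rightarrow> real" where
  "mesh_size \<T> = Max (diameter ` \<T>)"

definition shape_regular :: "real \<Rightarrow> 'a::euclidean_space set set \<Rightarrow> bool" where
  "shape_regular \<sigma> \<T> \<longleftrightarrow> (\<forall>K\<in>\<T>. \<exists>z. cball z (diameter K / \<sigma>) \<subseteq> K)"

definition quasi_uniform :: "real \<Rightarrow> 'a::euclidean_space set set \<Rightarrow> bool" where
  "quasi_uniform \<sigma> \<T> \<longleftrightarrow>
     shape_regular \<sigma> \<T> \<and> (\<forall>K\<in>\<T>. mesh_size \<T> \<le> \<sigma> * diameter K)"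

definition fitted_to :: "'a::euclidean_space set set \<Rightarrow> 'a set \<Rightarrow> bool" where
  "fitted_to \<T> \<Omega> \<longleftrightarrow> (\<exists>\<F>. \<F> \<subseteq> {F. \<exists>K\<in>\<T>. F facet_of K} \<and> frontier \<Omega> = \<Union>\<F>)"

definition polynomials_upto :: "nat \<Rightarrow> ('a::euclidean_space \<Rightarrow> real) set" where
  "polynomials_upto p =
     {Q. \<exists>a. Q = (\<lambda>x. \<Sum>\<beta>\<in>multi_indices p. a \<beta> * (\<Prod>b\<in>Basis. (x \<bullet> b) ^ \<beta> b))}"

text \<open>
  Continuous piecewise polynomials on the closure of \<open>D\<close>; as total functions on the whole space they
  are extended by zero.
\<close>

definition fe_space ::
  "nat \<Rightarrow> 'a::euclidean_space set set \<Rightarrow> 'a set \<Rightarrow> ('a \<Rightarrow> real) set" where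
  "fe_space p \<T> D =
     {v. continuous_on (closure D) v \<and>
         (\<forall>K\<in>\<T>. \<exists>Q\<in>polynomials_upto p. \<forall>x\<in>K. v x = Q x) \<and>
         (\<forall>x. x \<notin> closure D \<longrightarrow> v x = 0)}"

text \<open>
  The condition \<open>v = 0\<close> outside \<open>\<Omega>\<close> is read on the closed box.  This is automatic by continuity
  unless \<open>\<Omega>\<close> touches the boundary of the box, and makes the extension by zero continuous in that
  case, too.
\<close>

definition fe_space_0 ::
  "nat \<Rightarrow> 'a::euclidean_space set set \<Rightarrow> 'a set \<Rightarrow> 'a set \<Rightarrow> ('a \<Rightarrow> real) set" where
  "fe_space_0 p \<T> D \<Omega> = {v \<in> fe_space p \<T> D. \<forall>x\<in>closure D - \<Omega>. v x = 0}"

text \<open>Degree-\<open>p\<close> Lagrange nodes: the points whose barycentric coordinates are multiples of \<open>1/p\<close>.\<close>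

definition lagrange_nodes :: "nat \<Rightarrow> 'a::euclidean_space set set \<Rightarrow> 'a set" where
  "lagrange_nodes p \<T> =
     {z. \<exists>K\<in>\<T>. \<exists>k :: 'a \<Rightarrow> nat. (\<Sum>v\<in>{v. v extreme_point_of K}. k v) = p \<and>
        z = (\<Sum>v\<in>{v. v extreme_point_of K}. (real (k v) / real p) *\<^sub>R v)}"

definition is_nodal_interpolant ::
  "nat \<Rightarrow> 'a::euclidean_space set set \<Rightarrow> 'a set \<Rightarrow> ('a \<Rightarrow> real) \<Rightarrow> ('a \<Rightarrow> real) \<Rightarrow> bool" where
  "is_nodal_interpolant p \<T> D \<psi> v \<longleftrightarrow>
     v \<in> fe_space p \<T> D \<and> (\<forall>z\<in>lagrange_nodes p \<T>. v z = \<psi> z)"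

definition nodal_basis ::
  "'a::euclidean_space set \<Rightarrow> ('a \<Rightarrow> real) set \<Rightarrow> nat \<Rightarrow> (nat \<Rightarrow> 'a) \<Rightarrow> (nat \<Rightarrow> 'a \<Rightarrow> real) \<Rightarrow> bool"
where
  "nodal_basis D S n X \<theta> \<longleftrightarrow>
     (\<forall>k<n. X k \<in> closure D \<and> \<theta> k \<in> S) \<and>
     (\<forall>k<n. \<forall>l<n. \<theta> k (X l) = (if k = l then 1 else 0)) \<and>
     (\<forall>v\<in>S. \<forall>x\<in>closure D. v x = (\<Sum>k<n. v (X k) * \<theta> k x))"

definition nodal_interp ::
  "nat \<Rightarrow> (nat \<Rightarrow> 'a) \<Rightarrow> (nat \<Rightarrow> 'a \<Rightarrow> real) \<Rightarrow> ('a \<Rightarrow> real) \<Rightarrow> 'a \<Rightarrow> real" where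
  "nodal_interp n X \<theta> \<psi> x = (\<Sum>k<n. \<psi> (X k) * \<theta> k x)"

subsection \<open>The discrete data space and the discrete Tikhonov functional\<close>

text \<open>Vectors in \<open>Y\<close> (of dimension \<open>n\<close>) are functions \<open>nat \<Rightarrow> real\<close> of which only the entries below
  \<open>n\<close> are used.\<close>

definition Y_norm ::
  "'a::euclidean_space set \<Rightarrow> nat \<Rightarrow> (nat \<Rightarrow> 'a \<Rightarrow> real) \<Rightarrow> (nat \<Rightarrow> real) \<Rightarrow> real" where
  "Y_norm W n \<theta> y =
     sqrt (\<Sum>i<n. \<Sum>j<n. y i * (LINT x:W|lborel. \<theta> i x * \<theta> j x) * y j)"

definition box_form ::
  "real \<Rightarrow> real \<Rightarrow> real \<Rightarrow> ('a::euclidean_space \<Rightarrow> real) \<Rightarrow> ('a \<Rightarrow> real) \<Rightarrow> real" where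
  "box_form c s R u v =
     c / 2 * (LINT z:cube R \<times> cube R|lborel \<Otimes>\<^sub>M lborel.
        (u (fst z) - u (snd z)) * (v (fst z) - v (snd z)) * frac_kernel s (fst z) (snd z))
     + c * (LINT x:cube R|lborel. u x * v x * (LINT y:- cube R|lborel. frac_kernel s x y))"

definition box_norm :: "real \<Rightarrow> real \<Rightarrow> real \<Rightarrow> ('a::euclidean_space \<Rightarrow> real) \<Rightarrow> real" where
  "box_norm c s R v = sqrt (box_form c s R v v + (L2_norm (cube R) v)\<^sup>2)"

definition discrete_tikhonov ::
  "real \<Rightarrow> real \<Rightarrow> 'a::euclidean_space set \<Rightarrow> 'a set \<Rightarrow> real \<Rightarrow>
   nat \<Rightarrow> (nat \<Rightarrow> 'a) \<Rightarrow> (nat \<Rightarrow> 'a \<Rightarrow> real) \<Rightarrow> (nat \<Rightarrow> real) \<Rightarrow> real \<Rightarrow> ('a \<Rightarrow> real) \<Rightarrow> real" where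
  "discrete_tikhonov c s \<Omega> W R n X \<theta> y \<alpha> v =
     (Y_norm W n \<theta> (\<lambda>k. meas_op c s \<Omega> v (X k) - y k))\<^sup>2 + \<alpha> * (box_norm c s R v)\<^sup>2"

definition interp_consistency ::
  "real \<Rightarrow> real \<Rightarrow> 'a::euclidean_space set \<Rightarrow> nat \<Rightarrow> (nat \<Rightarrow> 'a) \<Rightarrow> (nat \<Rightarrow> 'a \<Rightarrow> real) \<Rightarrow>
   ('a \<Rightarrow> real) \<Rightarrow> ('a \<Rightarrow> real) \<Rightarrow> real" where
  "interp_consistency c s W n X \<theta> ubar uh =
     Y_norm W n \<theta> (\<lambda>k. frac_lap c s ubar (X k) - frac_lap c s uh (X k))"

definition trunc_consistency ::
  "real \<Rightarrow> real \<Rightarrow> 'a::euclidean_space set \<Rightarrow> real \<Rightarrow> nat \<Rightarrow> (nat \<Rightarrow> 'a) \<Rightarrow>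
   (nat \<Rightarrow> 'a \<Rightarrow> real) \<Rightarrow> ('a \<Rightarrow> real) \<Rightarrow> real" where
  "trunc_consistency c s W R n X \<theta> uh =
     Y_norm W n \<theta> (\<lambda>k. frac_lap c s uh (X k) - frac_lap_on c s (cube R) uh (X k))"

end

theory Submission
  imports Defs "HOL-Computational_Algebra.Polynomial"
begin

text \<open>
  The total error splits into \<open>u0h - uhat\<close>, \<open>uhat - u0a\<close>, \<open>u0a - u0\<close> and the
  interpolation error of the exterior datum.  Subtracting the two discrete variational equations bounds the first part by the data error over
  \<open>sqrt \<alpha>\<close>; the third is read off the eigenbasis, where the Tikhonov filter satisfies
  \<open>\<alpha> \<lambda>\<^sup>\<nu> / (\<lambda> + \<alpha>) \<le> \<alpha>\<^sup>\<nu>\<close>.  The second part tends to zero because \<open>W\<close> and \<open>\<Omega>\<close> are at positive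
  distance: the measurement of \<open>v\<close> has weak derivatives of all orders controlled by the \<open>L\<^sup>2\<close> norm of
  \<open>v\<close>, so the sampled measurement operators converge in operator norm, and the strongly convex
  functionals can be compared directly.  This uses that finite element functions vanishing outside
  \<open>\<Omega>\<close> lie in \<open>Hs_tilde\<close> (truncate, then mollify) and approximate test functions (piecewise linear
  interpolation).
\<close>

section \<open>Semi-inner products and Tikhonov functionals\<close>

text \<open>Elements of the function spaces are functions rather than classes modulo null sets, so
  the inner products are only positive semidefinite and linearity is a pointwise matter. The
  abstract layer therefore works with sets of functions closed under pointwise combinations, and
  minimizers enter through their variational equations. The discrete penalty of a function vanishing
  off \<Omega> equals its full \<open>Hs\<close> norm, because the tail term of the box form is
  exactly the interaction with the exterior of the cube. Both regularized problems thus share one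
  inner product, and all constants are independent of R. Smallness in \<open>Hs\<close> is always
  obtained in the same way: a fixed Lipschitz constant L together with a small supremum \<epsilon>,
  through differences bounded by \<open>(L n)^(1+s) * (2 \<epsilon>)^(1-s)\<close>. Truncation,
  mollification and interpolation are arranged so that they keep a Lipschitz constant; uniform error
  bounds are then enough. The weak derivatives in the interpolation hypothesis are arbitrary
  choices. Their norms become computable through uniqueness of weak derivatives, after all
  derivatives have been moved onto the kernel.\<close>

locale semi_inner =
  fixes V :: "('b \<Rightarrow> real) set" and B :: "('b \<Rightarrow> real) \<Rightarrow> ('b \<Rightarrow> real) \<Rightarrow> real"
  assumes zero_mem: "(\<lambda>x. 0) \<in> V"
    and lincomb_mem: "u \<in> V \<Longrightarrow> v \<in> V \<Longrightarrow> (\<lambda>x. a * u x + b * v x) \<in> V"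
    and lincomb_left: "u \<in> V \<Longrightarrow> v \<in> V \<Longrightarrow> z \<in> V \<Longrightarrow>
          B (\<lambda>x. a * u x + b * v x) z = a * B u z + b * B v z"
    and commute: "B u v = B v u"
    and nonneg: "u \<in> V \<Longrightarrow> 0 \<le> B u u"
begin

lemma add_mem: "u \<in> V \<Longrightarrow> v \<in> V \<Longrightarrow> (\<lambda>x. u x + v x) \<in> V"
  and diff_mem: "u \<in> V \<Longrightarrow> v \<in> V \<Longrightarrow> (\<lambda>x. u x - v x) \<in> V"
  and scale_mem: "u \<in> V \<Longrightarrow> (\<lambda>x. a * u x) \<in> V"
  using lincomb_mem[of u v 1 1] lincomb_mem[of u v 1 "-1"] lincomb_mem[of u "\<lambda>x. 0" a 0] zero_mem
  by simp_all

lemma add_left: "u \<in> V \<Longrightarrow> v \<in> V \<Longrightarrow> z \<in> V \<Longrightarrow> B (\<lambda>x. u x + v x) z = B u z + B v z"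
  and diff_left: "u \<in> V \<Longrightarrow> v \<in> V \<Longrightarrow> z \<in> V \<Longrightarrow> B (\<lambda>x. u x - v x) z = B u z - B v z"
  and scale_left: "u \<in> V \<Longrightarrow> z \<in> V \<Longrightarrow> B (\<lambda>x. a * u x) z = a * B u z"
  using lincomb_left[of u v z 1 1] lincomb_left[of u v z 1 "-1"]
    lincomb_left[of u "\<lambda>x. 0" z a 0] zero_mem
  by simp_all

lemma add_right: "u \<in> V \<Longrightarrow> v \<in> V \<Longrightarrow> z \<in> V \<Longrightarrow> B z (\<lambda>x. u x + v x) = B z u + B z v"
  and scale_right: "u \<in> V \<Longrightarrow> z \<in> V \<Longrightarrow> B z (\<lambda>x. a * u x) = a * B z u"
  using add_left[of u v z] scale_left[of u z a] by (simp_all add: commute)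

lemma square_lincomb:
  assumes "u \<in> V" "v \<in> V"
  shows "B (\<lambda>x. u x + t * v x) (\<lambda>x. u x + t * v x) = B u u + 2 * t * B u v + t\<^sup>2 * B v v"
  using assms lincomb_mem[OF assms, of 1 t] scale_mem[OF assms(2), of t]
  by (simp add: add_left add_right scale_left scale_right commute[of v u] power2_eq_square
      algebra_simps)

lemma square_diff:
  assumes "u \<in> V" "v \<in> V"
  shows "B (\<lambda>x. u x - v x) (\<lambda>x. u x - v x) = B u u - 2 * B u v + B v v"
  using square_lincomb[OF assms, of "-1"] by simp

lemma Cauchy_Schwarz:
  assumes "u \<in> V" "v \<in> V"
  shows "\<bar>B u v\<bar> \<le> sqrt (B u u) * sqrt (B v v)"
proof -
  have q: "0 \<le> B u u + 2 * t * B u v + t\<^sup>2 * B v v" for t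
    using nonneg[OF lincomb_mem[OF assms, of 1 t]] square_lincomb[OF assms, of t] by simp
  have "(B u v)\<^sup>2 \<le> B u u * B v v"
  proof (cases "B v v = 0")
    case True
    have "B u v = 0"
    proof (rule ccontr)
      assume "B u v \<noteq> 0"
      \<comment> \<open>With \<open>B v v = 0\<close> the quadratic is affine in t, and this t gives
        it the value -1.\<close>
      then show False
        using q[of "- (B u u + 1) / (2 * B u v)"] True by (simp add: field_simps)
    qed
    with True show ?thesis by simp
  next
    case False
    with nonneg[OF assms(2)] have "B v v > 0" by simp
    with q[of "- B u v / B v v"] show ?thesis
      by (simp add: field_simps power2_eq_square)
  qed
  then have "sqrt ((B u v)\<^sup>2) \<le> sqrt (B u u * B v v)" by (rule real_sqrt_le_mono)
  then show ?thesis by (simp add: real_sqrt_mult)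
qed

lemma triangle:
  assumes "u \<in> V" "v \<in> V"
  shows "sqrt (B (\<lambda>x. u x + v x) (\<lambda>x. u x + v x)) \<le> sqrt (B u u) + sqrt (B v v)"
proof (rule real_le_lsqrt)
  have "B (\<lambda>x. u x + v x) (\<lambda>x. u x + v x) = B u u + 2 * B u v + B v v"
    using square_lincomb[OF assms, of 1] by simp
  also have "\<dots> \<le> (sqrt (B u u) + sqrt (B v v))\<^sup>2"
    using Cauchy_Schwarz[OF assms] nonneg[OF assms(1)] nonneg[OF assms(2)]
    by (simp add: power2_sum)
  finally show "B (\<lambda>x. u x + v x) (\<lambda>x. u x + v x) \<le> (sqrt (B u u) + sqrt (B v v))\<^sup>2" .
qed (use nonneg assms in auto)

lemma triangle_diff:
  assumes "u \<in> V" "v \<in> V"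
  shows "\<bar>sqrt (B u u) - sqrt (B v v)\<bar> \<le> sqrt (B (\<lambda>x. u x - v x) (\<lambda>x. u x - v x))"
proof -
  have "B (\<lambda>x. v x - u x) (\<lambda>x. v x - u x) = B (\<lambda>x. u x - v x) (\<lambda>x. u x - v x)"
    using square_diff[OF assms] square_diff[OF assms(2,1)] commute[of u v] by simp
  then show ?thesis
    using triangle[OF diff_mem[OF assms] assms(2)] triangle[OF diff_mem[OF assms(2,1)] assms(1)]
    by simp
qed

end

text \<open>Every form below is an L2 integral composed with a pointwise linear map: multiplication
  by an indicator yields L2 of a set, the Gagliardo quotient yields the fractional form. Linearity
  of \<open>\<Phi>\<close> is asked for on all functions, so that it carries no domain
  condition.\<close>

lemma semi_inner_pullback:
  assumes "semi_inner V B"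
    and "\<And>a b u v. \<Phi> (\<lambda>x. a * u x + b * v x) = (\<lambda>y. a * \<Phi> u y + b * \<Phi> v y)"
  shows "semi_inner {u. \<Phi> u \<in> V} (\<lambda>u v. B (\<Phi> u) (\<Phi> v))"
proof -
  interpret semi_inner V B by fact
  have "\<Phi> (\<lambda>x. 0) = (\<lambda>y. 0)" using assms(2)[of 0 "\<lambda>x. 0" 0 "\<lambda>x. 0"] by simp
  then show ?thesis
    by unfold_locales (auto simp: assms(2) zero_mem lincomb_mem lincomb_left nonneg intro: commute)
qed

lemma semi_inner_plus:
  assumes "semi_inner V B" "semi_inner V' B'" "0 \<le> k"
  shows "semi_inner (V \<inter> V') (\<lambda>u v. B u v + k * B' u v)"
proof -
  interpret B: semi_inner V B by fact
  interpret B': semi_inner V' B' by fact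
  show ?thesis
    using \<open>0 \<le> k\<close>
    by unfold_locales (auto simp: B.zero_mem B'.zero_mem B.lincomb_mem B'.lincomb_mem
      B.lincomb_left B'.lincomb_left B.nonneg B'.nonneg algebra_simps intro: B.commute
      arg_cong2[where f = "(+)"] arg_cong2[where f = "(*)"] B'.commute)
qed

section \<open>Minimizers of quadratic Tikhonov functionals\<close>

lemma linear_part_eq_0:
  fixes l q :: real
  assumes "\<And>t. 0 \<le> 2 * t * l + t\<^sup>2 * q"
  shows "l = 0"
proof (rule ccontr)
  assume l: "l \<noteq> 0"
  \<comment> \<open>At t = - l / k the quadratic has the value
    \<open>(l / k)^2 * (q - 2 * k)\<close>, which is negative as soon as 2 k exceeds q.\<close>
  define k where "k = \<bar>q\<bar> + 1"
  have k: "k > 0" "q < 2 * k" by (auto simp: k_def)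
  have "0 \<le> 2 * (- l / k) * l + (- l / k)\<^sup>2 * q" by (rule assms)
  also have "\<dots> = (l\<^sup>2 / k\<^sup>2) * (q - 2 * k)"
    using k by (simp add: field_simps power2_eq_square)
  also have "\<dots> < 0"
    using k l by (intro mult_pos_neg) auto
  finally show False by simp
qed

lemma is_arg_min_cong:
  "(\<And>v. P v \<Longrightarrow> f v = g v) \<Longrightarrow> is_arg_min f P u \<Longrightarrow> is_arg_min g P u"
  by (auto simp: is_arg_min_def)

text \<open>Both problems are instances: S = \<open>Hs_tilde\<close> with T =
  \<open>meas_cut\<close>, and S = \<open>fe_space_0\<close> with T = the nodal interpolant of the
  measurement. The forms live on the larger spaces V and V'; closure of S under
  \<open>u + t * v\<close> is what a variation along a line uses.\<close>

locale tikhonov_setting =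
  H: semi_inner V B + Y: semi_inner V' B'
  for V :: "('b \<Rightarrow> real) set" and B and V' :: "('c \<Rightarrow> real) set" and B' +
  fixes S :: "('b \<Rightarrow> real) set" and T :: "('b \<Rightarrow> real) \<Rightarrow> 'c \<Rightarrow> real" and \<alpha> :: real
  assumes S_subset: "S \<subseteq> V"
    and S_lincomb: "u \<in> S \<Longrightarrow> v \<in> S \<Longrightarrow> (\<lambda>x. u x + t * v x) \<in> S"
    and T_mem: "u \<in> S \<Longrightarrow> T u \<in> V'"
    and T_lincomb: "u \<in> S \<Longrightarrow> v \<in> S \<Longrightarrow> T (\<lambda>x. u x + t * v x) = (\<lambda>x. T u x + t * T v x)"
    and alpha_pos: "0 < \<alpha>"
begin

definition J :: "('c \<Rightarrow> real) \<Rightarrow> ('b \<Rightarrow> real) \<Rightarrow> real" where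
  "J y v = B' (\<lambda>x. T v x - y x) (\<lambda>x. T v x - y x) + \<alpha> * B v v"

lemma T_diff: "u \<in> S \<Longrightarrow> v \<in> S \<Longrightarrow> T (\<lambda>x. u x - v x) = (\<lambda>x. T u x - T v x)"
  using T_lincomb[of u v "-1"] by simp

lemma S_diff: "u \<in> S \<Longrightarrow> v \<in> S \<Longrightarrow> (\<lambda>x. u x - v x) \<in> S"
  using S_lincomb[of u v "-1"] by simp

lemma J_lincomb:
  assumes "y \<in> V'" "u \<in> S" "v \<in> S"
  shows "J y (\<lambda>x. u x + t * v x)
     = J y u + 2 * t * (B' (\<lambda>x. T u x - y x) (T v) + \<alpha> * B u v) + t\<^sup>2 * (B' (T v) (T v) + \<alpha> * B v v)"
proof -
  have "(\<lambda>x. T (\<lambda>x. u x + t * v x) x - y x) = (\<lambda>x. (T u x - y x) + t * T v x)"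
    using T_lincomb[of u v t] assms by (auto simp: fun_eq_iff)
  moreover have "u \<in> V" "v \<in> V" using assms S_subset by auto
  ultimately show ?thesis
    using Y.square_lincomb[of "\<lambda>x. T u x - y x" "T v" t] H.square_lincomb[of u v t] assms
      T_mem Y.diff_mem[of "T u" y]
    unfolding J_def by (simp add: distrib_left distrib_right mult_ac)
qed

lemma minimizer_equation:
  assumes "y \<in> V'" "is_arg_min (J y) (\<lambda>v. v \<in> S) u" "v \<in> S"
  shows "B' (\<lambda>x. T u x - y x) (T v) + \<alpha> * B u v = 0"
proof (rule linear_part_eq_0)
  fix t
  have u: "u \<in> S" and "J y u \<le> J y (\<lambda>x. u x + t * v x)"
    using assms S_lincomb[of u v t] by (auto simp: is_arg_min_linorder)
  then show "0 \<le> 2 * t * (B' (\<lambda>x. T u x - y x) (T v) + \<alpha> * B u v)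
      + t\<^sup>2 * (B' (T v) (T v) + \<alpha> * B v v)"
    using J_lincomb[OF assms(1) u assms(3), of t] by simp
qed

text \<open>The first variation at the minimizer vanishes, so the gap is exactly the second-order
  term. Its part \<open>\<alpha> * B d d\<close> is the strong convexity that turns a comparison of
  functional values into a distance between minimizers.\<close>

lemma minimizer_gap:
  assumes "y \<in> V'" "is_arg_min (J y) (\<lambda>v. v \<in> S) u" "v \<in> S"
  shows "J y v - J y u = B' (T (\<lambda>x. v x - u x)) (T (\<lambda>x. v x - u x))
           + \<alpha> * B (\<lambda>x. v x - u x) (\<lambda>x. v x - u x)"
proof -
  have u: "u \<in> S" using assms(2) by (simp add: is_arg_min_linorder)
  have d: "(\<lambda>x. v x - u x) \<in> S" using S_diff[OF assms(3) u] .
  show ?thesis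
    using J_lincomb[OF assms(1) u d, of 1] minimizer_equation[OF assms(1,2) d] by simp
qed

lemma minimizer_stable:
  assumes y: "y \<in> V'" "y' \<in> V'"
    and u: "is_arg_min (J y) (\<lambda>v. v \<in> S) u" and u': "is_arg_min (J y') (\<lambda>v. v \<in> S) u'"
  shows "sqrt \<alpha> * sqrt (B (\<lambda>x. u x - u' x) (\<lambda>x. u x - u' x))
    \<le> sqrt (B' (\<lambda>x. y x - y' x) (\<lambda>x. y x - y' x))"
proof -
  have uS: "u \<in> S" "u' \<in> S" using u u' by (auto simp: is_arg_min_linorder)
  define d where "d = (\<lambda>x. u x - u' x)"
  define e where "e = (\<lambda>x. y x - y' x)"
  have d: "d \<in> S" "d \<in> V" unfolding d_def using S_diff[OF uS] S_subset by auto
  have e: "e \<in> V'" unfolding e_def using Y.diff_mem[OF y] .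
  have Tm: "T u \<in> V'" "T u' \<in> V'" "T d \<in> V'" using T_mem uS d by auto
  have Td: "T d = (\<lambda>x. T u x - T u' x)" unfolding d_def using T_diff[OF uS] .
  have "B' (T d) (T d) + \<alpha> * B d d = B' e (T d)"
  proof -
    have "B' (\<lambda>x. T u x - y x) (T d) = B' (T u) (T d) - B' y (T d)"
      "B' (\<lambda>x. T u' x - y' x) (T d) = B' (T u') (T d) - B' y' (T d)"
      "B' (T d) (T d) = B' (T u) (T d) - B' (T u') (T d)"
      "B' e (T d) = B' y (T d) - B' y' (T d)"
      using Y.diff_left Tm y e_def Td by auto
    moreover have "B d d = B u d - B u' d"
      using H.diff_left[of u u' d] uS d S_subset unfolding d_def by auto
    moreover have "\<alpha> * B d d = \<alpha> * B u d - \<alpha> * B u' d"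
      using calculation by (simp add: right_diff_distrib)
    ultimately show ?thesis
      using minimizer_equation[OF y(1) u d(1)] minimizer_equation[OF y(2) u' d(1)]
      by linarith
  qed
  moreover have "B' e (T d) \<le> sqrt (B' e e) * sqrt (B' (T d) (T d))"
    using Y.Cauchy_Schwarz[OF e Tm(3)] by simp
  \<comment> \<open>The crude Young inequality \<open>a * b \<le> a^2 + b^2\<close> is enough:
    exactly one copy of \<open>B' (T d) (T d)\<close> stands on the left and absorbs the last
    summand.\<close>
  moreover have "sqrt (B' e e) * sqrt (B' (T d) (T d)) \<le> B' e e + B' (T d) (T d)"
  proof -
    define a b where "a = sqrt (B' e e)" and "b = sqrt (B' (T d) (T d))"
    have "a * b \<le> a\<^sup>2 + b\<^sup>2"
      using sum_squares_bound[of a b] zero_le_power2[of a] zero_le_power2[of b] by linarith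
    then show ?thesis
      using Y.nonneg[OF e] Y.nonneg[OF Tm(3)] by (simp add: a_def b_def)
  qed
  ultimately have "\<alpha> * B d d \<le> B' e e" by simp
  then have "sqrt (\<alpha> * B d d) \<le> sqrt (B' e e)" by (rule real_sqrt_le_mono)
  then show ?thesis by (simp add: real_sqrt_mult d_def e_def)
qed

end

section \<open>Lebesgue and fractional Sobolev spaces\<close>

text \<open>Formulated over an arbitrary measure, since it is used both for \<open>lborel\<close>
  and for the product measure that carries the Gagliardo quotient.\<close>

definition square_integrable :: "'b measure \<Rightarrow> ('b \<Rightarrow> real) set" where
  "square_integrable M = {f \<in> borel_measurable M. integrable M (\<lambda>x. (f x)\<^sup>2)}"

lemma square_integrable_mult:
  assumes "f \<in> square_integrable M" "g \<in> square_integrable M"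
  shows "integrable M (\<lambda>x. f x * g x)"
proof (rule Bochner_Integration.integrable_bound)
  show "integrable M (\<lambda>x. (f x)\<^sup>2 + (g x)\<^sup>2)"
    using assms by (auto simp: square_integrable_def)
  show "(\<lambda>x. f x * g x) \<in> borel_measurable M"
    using assms by (auto simp: square_integrable_def)
  have "\<bar>a * b\<bar> \<le> a\<^sup>2 + b\<^sup>2" for a b :: real
    using sum_squares_bound[of "\<bar>a\<bar>" "\<bar>b\<bar>"] abs_ge_zero[of "a * b"]
    unfolding abs_mult power2_abs by linarith
  then show "AE x in M. norm (f x * g x) \<le> norm ((f x)\<^sup>2 + (g x)\<^sup>2)" by auto
qed

lemma square_integrable_lincomb:
  assumes "f \<in> square_integrable M" "g \<in> square_integrable M"
  shows "(\<lambda>x. a * f x + b * g x) \<in> square_integrable M"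
proof -
  have "integrable M (\<lambda>x. a\<^sup>2 * (f x)\<^sup>2 + (2 * a * b * (f x * g x) + b\<^sup>2 * (g x)\<^sup>2))"
    using assms square_integrable_mult[OF assms] by (auto simp: square_integrable_def)
  moreover have "(\<lambda>x. a\<^sup>2 * (f x)\<^sup>2 + (2 * a * b * (f x * g x) + b\<^sup>2 * (g x)\<^sup>2))
      = (\<lambda>x. (a * f x + b * g x)\<^sup>2)"
    by (auto simp: power2_eq_square algebra_simps)
  ultimately show ?thesis using assms by (auto simp: square_integrable_def)
qed

lemma semi_inner_square_integrable:
  "semi_inner (square_integrable M) (\<lambda>f g. \<integral>x. f x * g x \<partial>M)"
proof
  fix u v z and a b :: real
  assume uvz: "u \<in> square_integrable M" "v \<in> square_integrable M" "z \<in> square_integrable M"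
  show "(\<integral>x. (a * u x + b * v x) * z x \<partial>M) = a * (\<integral>x. u x * z x \<partial>M) + b * (\<integral>x. v x * z x \<partial>M)"
    using square_integrable_mult[OF uvz(1,3)] square_integrable_mult[OF uvz(2,3)]
    by (simp add: distrib_right mult.assoc)
qed (auto simp: square_integrable_lincomb mult.commute, simp add: square_integrable_def)

lemma L2_iff: "v \<in> L2 D \<longleftrightarrow> (\<lambda>x. indicator D x * v x) \<in> square_integrable lborel"
proof -
  have "(\<lambda>x. (indicator D x * v x)\<^sup>2) = (\<lambda>x. indicator D x *\<^sub>R (v x)\<^sup>2)"
    by (auto split: split_indicator)
  then show ?thesis
    by (simp add: L2_def square_integrable_def set_borel_measurable_def set_integrable_def)
qed

lemma L2_inner_eq:
  "L2_inner D v w = (\<integral>x. (indicator D x * v x) * (indicator D x * w x) \<partial>lborel)"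
  unfolding L2_inner_def set_lebesgue_integral_def
  by (rule Bochner_Integration.integral_cong) (auto split: split_indicator)

interpretation L2: semi_inner "L2 D" "L2_inner D" for D :: "'a::euclidean_space set"
proof -
  have "semi_inner {v. (\<lambda>x. indicator D x * v x) \<in> square_integrable (lborel :: 'a measure)}
     (\<lambda>v w. \<integral>x. (indicator D x * v x) * (indicator D x * w x) \<partial>lborel)"
    by (rule semi_inner_pullback[OF semi_inner_square_integrable])
      (simp add: fun_eq_iff algebra_simps)
  then show "semi_inner (L2 D) (L2_inner D)"
    unfolding L2_inner_eq[abs_def] L2_iff[symmetric] by simp
qed

lemma L2_norm_power2: "v \<in> L2 D \<Longrightarrow> (L2_norm D v)\<^sup>2 = L2_inner D v v"
  by (simp add: L2_norm_def L2.nonneg)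

lemma L2_norm_triangle_diff: "u \<in> L2 D \<Longrightarrow> v \<in> L2 D \<Longrightarrow> \<bar>L2_norm D u - L2_norm D v\<bar> \<le> L2_norm D (\<lambda>x. u x - v x)"
  using L2.triangle_diff[of u D v] by (simp add: L2_norm_def)

lemma L2_norm_cong: "(\<And>x. x \<in> D \<Longrightarrow> u x = v x) \<Longrightarrow> L2_norm D u = L2_norm D v"
  unfolding L2_norm_def L2_inner_eq
  by (intro arg_cong[where f = sqrt] Bochner_Integration.integral_cong) (auto split: split_indicator)

lemma L2_UNIV: "L2 UNIV = square_integrable lborel"
  by (auto simp: L2_iff)

lemma L2_UNIV_borel: "v \<in> L2 UNIV \<Longrightarrow> v \<in> borel_measurable borel"
  by (simp add: L2_UNIV square_integrable_def)

section \<open>The kernel, the Gagliardo quotient and the fractional inner product\<close>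

lemma frac_kernel_nonneg [simp]: "0 \<le> frac_kernel s x y"
  by (simp add: frac_kernel_def)

lemma frac_kernel_commute: "frac_kernel s x y = frac_kernel s y x"
  by (simp add: frac_kernel_def norm_minus_commute)

lemma frac_kernel_diff: "frac_kernel s x y = frac_kernel s (x - y) 0"
  by (simp add: frac_kernel_def)

lemma borel_measurable_frac_kernel [measurable]:
  "(\<lambda>p. frac_kernel s (fst p) (snd p)) \<in> borel_measurable (lborel \<Otimes>\<^sub>M lborel)"
  unfolding frac_kernel_def by measurable

lemma borel_measurable_frac_kernel1 [measurable]:
  "(\<lambda>y. frac_kernel s x y) \<in> borel_measurable borel"
  "(\<lambda>x. frac_kernel s x y) \<in> borel_measurable borel"
  unfolding frac_kernel_def by measurable

text \<open>The square root divides the kernel evenly between the two arguments of the form. The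
  form then becomes an L2 inner product on the product space, and its bilinearity and Cauchy-Schwarz
  inequality come by pullback. On the diagonal the kernel has the default value 0.\<close>

definition gagliardo_quotient ::
  "real \<Rightarrow> ('a::euclidean_space \<Rightarrow> real) \<Rightarrow> 'a \<times> 'a \<Rightarrow> real" where
  "gagliardo_quotient s v p = (v (fst p) - v (snd p)) * sqrt (frac_kernel s (fst p) (snd p))"

lemma gagliardo_quotient_lincomb:
  "gagliardo_quotient s (\<lambda>x. a * u x + b * v x)
     = (\<lambda>p. a * gagliardo_quotient s u p + b * gagliardo_quotient s v p)"
  by (auto simp: gagliardo_quotient_def algebra_simps)

lemma gagliardo_quotient_measurable [measurable]:
  assumes [measurable]: "v \<in> borel_measurable borel"
  shows "gagliardo_quotient s v \<in> borel_measurable (lborel \<Otimes>\<^sub>M lborel)"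
proof -
  have [measurable]: "v \<in> borel_measurable lborel" by simp
  show ?thesis unfolding gagliardo_quotient_def by measurable
qed

lemma gagliardo_quotient_mult:
  "gagliardo_quotient s u p * gagliardo_quotient s v p
    = (u (fst p) - u (snd p)) * (v (fst p) - v (snd p)) * frac_kernel s (fst p) (snd p)"
  by (simp add: gagliardo_quotient_def mult_ac)

lemma frac_form_eq:
  "frac_form c s u v
    = c / 2 * (\<integral>p. gagliardo_quotient s u p * gagliardo_quotient s v p \<partial>(lborel \<Otimes>\<^sub>M lborel))"
  unfolding frac_form_def gagliardo_quotient_mult by (simp add: case_prod_beta')

lemma Hs_iff:
  "v \<in> Hs s \<longleftrightarrow> v \<in> square_integrable lborel
     \<and> gagliardo_quotient s v \<in> square_integrable (lborel \<Otimes>\<^sub>M lborel)"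
proof -
  have "(\<lambda>p. (gagliardo_quotient s v p)\<^sup>2) = (\<lambda>(x, y). (v x - v y)\<^sup>2 * frac_kernel s x y)"
    by (auto simp: gagliardo_quotient_def power_mult_distrib)
  then show ?thesis
    by (auto simp: Hs_def square_integrable_def)
qed

lemma semi_inner_Hs:
  assumes "0 < c"
  shows "semi_inner (Hs s :: ('a::euclidean_space \<Rightarrow> real) set) (Hs_inner c s)"
proof -
  have eq: "(Hs s :: ('a \<Rightarrow> real) set) = {u. u \<in> square_integrable lborel} \<inter>
      {u. gagliardo_quotient s u \<in> square_integrable (lborel \<Otimes>\<^sub>M lborel)}"
    by (auto simp: Hs_iff)
  have "Hs_inner c s = (\<lambda>u v :: 'a \<Rightarrow> real. (\<integral>x. u x * v x \<partial>lborel) + c / 2 *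
      (\<integral>p. gagliardo_quotient s u p * gagliardo_quotient s v p \<partial>(lborel \<Otimes>\<^sub>M lborel)))"
    by (simp add: fun_eq_iff Hs_inner_def L2_inner_eq frac_form_eq)
  then show ?thesis
    unfolding eq using \<open>0 < c\<close>
    by (simp only:, intro semi_inner_plus
        semi_inner_pullback[OF semi_inner_square_integrable gagliardo_quotient_lincomb]
        semi_inner_pullback[where \<Phi> = "\<lambda>x. x", OF semi_inner_square_integrable]) auto
qed

lemma frac_form_nonneg: "0 < c \<Longrightarrow> 0 \<le> frac_form c s v v"
  by (simp add: frac_form_eq)

lemma L2_norm_UNIV_power2: "(L2_norm UNIV v)\<^sup>2 = L2_inner UNIV v v"
  by (simp add: L2_norm_def L2_inner_eq)

lemma Hs_norm_eq: "Hs_norm c s v = sqrt (Hs_inner c s v v)"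
  by (simp add: Hs_norm_def Hs_inner_def L2_norm_UNIV_power2)

lemma Hs_norm_nonneg: "0 < c \<Longrightarrow> 0 \<le> Hs_norm c s v"
  by (simp add: Hs_norm_def frac_form_nonneg)

lemma L2_norm_nonneg [simp]: "0 \<le> L2_norm D v"
  by (simp add: L2_norm_def L2_inner_eq)

lemma Hs_norm_power2: "0 < c \<Longrightarrow> (Hs_norm c s v)\<^sup>2 = Hs_inner c s v v"
  by (simp add: Hs_norm_eq Hs_inner_def L2_inner_eq frac_form_nonneg)

lemma L2_norm_le_Hs_norm: "0 < c \<Longrightarrow> L2_norm UNIV v \<le> Hs_norm c s v"
  unfolding Hs_norm_def by (rule real_le_rsqrt) (simp add: frac_form_nonneg)

lemma Hs_subset_L2: "v \<in> Hs s \<Longrightarrow> v \<in> L2 UNIV"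
  by (simp add: Hs_iff L2_UNIV)

text \<open>If \<open>v\<close> is only in \<open>L\<^sup>2\<close>, then both form integrals take the junk value \<open>0\<close>.\<close>

lemma Hs_norm_triangle:
  assumes "0 < c" "u \<in> Hs s" "v \<in> L2 UNIV"
  shows "Hs_norm c s (\<lambda>x. u x + v x) \<le> Hs_norm c s u + Hs_norm c s v"
proof -
  interpret semi_inner "Hs s" "Hs_inner c s" using semi_inner_Hs[OF \<open>0 < c\<close>] .
  show ?thesis
  proof (cases "v \<in> Hs s")
    case True
    then show ?thesis using triangle[OF assms(2)] by (simp add: Hs_norm_eq)
  next
    case False
    have "(\<lambda>x. u x + v x) \<notin> Hs s"
    proof
      assume "(\<lambda>x. u x + v x) \<in> Hs s"
      from diff_mem[OF this assms(2)] False show False by simp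
    qed
    moreover have "(\<lambda>x. u x + v x) \<in> L2 UNIV"
      using L2.add_mem[OF Hs_subset_L2[OF assms(2)] assms(3)] .
    moreover have "frac_form c s z z = 0" if "z \<in> L2 UNIV" "z \<notin> Hs s" for z :: "'a \<Rightarrow> real"
    proof -
      have "\<not> integrable (lborel \<Otimes>\<^sub>M lborel) (\<lambda>p. (gagliardo_quotient s z p)\<^sup>2)"
        using that unfolding Hs_iff L2_UNIV by (auto simp: square_integrable_def)
      then show ?thesis
        by (simp add: frac_form_eq not_integrable_integral_eq flip: power2_eq_square)
    qed
    ultimately have "Hs_norm c s (\<lambda>x. u x + v x) = L2_norm UNIV (\<lambda>x. u x + v x)"
      "Hs_norm c s v = L2_norm UNIV v"
      using False assms(3) by (simp_all add: Hs_norm_def)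
    then show ?thesis
      using L2.triangle[OF Hs_subset_L2[OF assms(2)] assms(3)] L2_norm_le_Hs_norm[OF \<open>0 < c\<close>, of u s]
      by (simp add: L2_norm_def)
  qed
qed

text \<open>The Gagliardo quotient evaluates a function at both coordinates, so an exceptional null
  set produces two strips, each of them null in the product.\<close>

lemma AE_lborel_pair:
  assumes "AE x in lborel. P x"
  shows "AE p in lborel \<Otimes>\<^sub>M lborel. P (fst p) \<and> P (snd (p :: 'a::euclidean_space \<times> 'a))"
proof -
  obtain N where N: "{x. \<not> P x} \<subseteq> N" "N \<in> null_sets lborel"
    using assms unfolding eventually_ae_filter by auto
  have "N \<times> UNIV \<in> null_sets (lborel \<Otimes>\<^sub>M lborel)" "UNIV \<times> N \<in> null_sets (lborel \<Otimes>\<^sub>M lborel)"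
    using N(2) by (auto simp: null_sets_def lborel.emeasure_pair_measure_Times)
  then have "N \<times> UNIV \<union> UNIV \<times> N \<in> null_sets (lborel \<Otimes>\<^sub>M lborel)" by auto
  then show ?thesis
    by (rule AE_I') (use N in auto)
qed

text \<open>The eigenvalue equations and the source condition are equalities almost everywhere; this
  lemma allows them to be inserted into inner products.\<close>

lemma Hs_inner_cong_AE:
  assumes "AE x in lborel. u x = u' x"
    and "u \<in> borel_measurable borel" "u' \<in> borel_measurable borel" "v \<in> borel_measurable borel"
  shows "Hs_inner c s u v = Hs_inner c s u' v"
proof -
  have "AE p in lborel \<Otimes>\<^sub>M lborel. gagliardo_quotient s u p * gagliardo_quotient s v p
      = gagliardo_quotient s u' p * gagliardo_quotient s v p"
    using AE_lborel_pair[OF assms(1)] by eventually_elim (simp add: gagliardo_quotient_def)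
  then have "(\<integral>p. gagliardo_quotient s u p * gagliardo_quotient s v p \<partial>(lborel \<Otimes>\<^sub>M lborel))
      = (\<integral>p. gagliardo_quotient s u' p * gagliardo_quotient s v p \<partial>(lborel \<Otimes>\<^sub>M lborel))"
    using assms by (intro integral_cong_AE) auto
  moreover have "L2_inner UNIV u v = L2_inner UNIV u' v"
    unfolding L2_inner_eq using assms by (intro integral_cong_AE) auto
  ultimately show ?thesis by (simp add: Hs_inner_def frac_form_eq)
qed

section \<open>Smooth functions\<close>

lemma partial_deriv_eq: "(\<phi> has_derivative D) (at x) \<Longrightarrow> partial_deriv b \<phi> x = D b"
  unfolding partial_deriv_def by (metis frechet_derivative_at)

lemma C_k_SucD: "C_k (Suc k) \<phi> \<Longrightarrow> C_k k \<phi>"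
proof (induction k arbitrary: \<phi>)
  case 0
  then show ?case
    by (auto intro!: continuous_at_imp_continuous_on differentiable_imp_continuous_within)
next
  case (Suc k)
  then show ?case by simp
qed

lemma C_k_le: "C_k n \<phi> \<Longrightarrow> k \<le> n \<Longrightarrow> C_k k \<phi>"
proof (induction n)
  case (Suc n)
  then show ?case by (cases "k = Suc n") (auto simp del: C_k.simps dest: C_k_SucD)
qed simp

lemma C_k_continuous: "C_k k \<phi> \<Longrightarrow> continuous_on A \<phi>"
  using C_k_le[of k \<phi> 0] by (auto intro: continuous_on_subset)

lemma C_k_const: "C_k k (\<lambda>x. a)"
proof (induction k arbitrary: a)
  case (Suc k)
  have "partial_deriv b (\<lambda>x::'a. a) = (\<lambda>x. 0)" for b
    by (auto simp: fun_eq_iff intro!: partial_deriv_eq derivative_eq_intros)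
  with Suc show ?case by simp
qed simp

lemma C_k_affine: "C_k k (\<lambda>x. a + x \<bullet> v)"
proof (cases k)
  case (Suc n)
  have "((\<lambda>x. a + x \<bullet> v) has_derivative (\<lambda>h. h \<bullet> v)) (at x)" for x
    by (auto intro!: derivative_eq_intros)
  then have "partial_deriv b (\<lambda>x. a + x \<bullet> v) = (\<lambda>x. b \<bullet> v)" for b
    by (auto simp: fun_eq_iff intro!: partial_deriv_eq)
  moreover have "(\<lambda>x. a + x \<bullet> v) differentiable at x" for x
    using \<open>((\<lambda>x. a + x \<bullet> v) has_derivative (\<lambda>h. h \<bullet> v)) (at x)\<close> by (auto simp: differentiable_def)
  ultimately show ?thesis using Suc by (simp add: C_k_const)
qed (auto intro!: continuous_intros)

lemma has_derivative_frechet: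
  "\<phi> differentiable at x \<Longrightarrow> (\<phi> has_derivative frechet_derivative \<phi> (at x)) (at x)"
  using frechet_derivative_works by blast

lemma partial_deriv_lincomb:
  assumes "\<phi> differentiable at x" "\<psi> differentiable at x"
  shows "partial_deriv b (\<lambda>x. \<alpha> * \<phi> x + \<beta> * \<psi> x) x
    = \<alpha> * partial_deriv b \<phi> x + \<beta> * partial_deriv b \<psi> x"
  by (rule partial_deriv_eq[THEN trans])
     (auto intro!: derivative_eq_intros has_derivative_frechet assms simp: partial_deriv_def)

lemma partial_deriv_mult:
  assumes "\<phi> differentiable at x" "\<psi> differentiable at x"
  shows "partial_deriv b (\<lambda>x. \<phi> x * \<psi> x) x
    = \<phi> x * partial_deriv b \<psi> x + partial_deriv b \<phi> x * \<psi> x"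
  by (rule partial_deriv_eq[THEN trans])
     (auto intro!: derivative_eq_intros has_derivative_frechet assms simp: partial_deriv_def)

lemma C_k_lincomb: "C_k k \<phi> \<Longrightarrow> C_k k \<psi> \<Longrightarrow> C_k k (\<lambda>x. \<alpha> * \<phi> x + \<beta> * \<psi> x)"
proof (induction k arbitrary: \<phi> \<psi>)
  case (Suc k)
  have "partial_deriv b (\<lambda>x. \<alpha> * \<phi> x + \<beta> * \<psi> x)
      = (\<lambda>x. \<alpha> * partial_deriv b \<phi> x + \<beta> * partial_deriv b \<psi> x)" for b
    using Suc.prems by (auto simp: partial_deriv_lincomb)
  with Suc show ?case by (auto intro!: derivative_intros)
qed (auto intro!: continuous_intros)

lemma C_k_add: "C_k k \<phi> \<Longrightarrow> C_k k \<psi> \<Longrightarrow> C_k k (\<lambda>x. \<phi> x + \<psi> x)"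
  using C_k_lincomb[of k \<phi> \<psi> 1 1] by simp

lemma C_k_mult: "C_k k \<phi> \<Longrightarrow> C_k k \<psi> \<Longrightarrow> C_k k (\<lambda>x. \<phi> x * \<psi> x)"
proof (induction k arbitrary: \<phi> \<psi>)
  case (Suc k)
  have "partial_deriv b (\<lambda>x. \<phi> x * \<psi> x)
      = (\<lambda>x. \<phi> x * partial_deriv b \<psi> x + partial_deriv b \<phi> x * \<psi> x)" for b
    using Suc.prems by (auto simp: partial_deriv_mult)
  moreover have "C_k k \<phi>" "C_k k \<psi>" using C_k_SucD Suc.prems by blast+
  ultimately show ?case
    using Suc.prems by (simp add: C_k_add Suc.IH differentiable_mult)
qed (auto intro!: continuous_intros)

lemma C_k_prod:
  "finite A \<Longrightarrow> (\<And>i. i \<in> A \<Longrightarrow> C_k k (\<phi> i)) \<Longrightarrow> C_k k (\<lambda>x. \<Prod>i\<in>A. \<phi> i x)"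
  by (induction A rule: finite_induct) (auto simp: C_k_const C_k_mult)

text \<open>Instead of iterated derivatives of the outer function, a class G closed under
  differentiation is fixed. The chain rule leaves the factor \<open>g' (\<phi> x)\<close> with g' in
  G, to which the induction hypothesis applies again.\<close>

lemma C_k_compose:
  fixes G :: "(real \<Rightarrow> real) set"
  assumes G: "\<And>g. g \<in> G \<Longrightarrow> \<exists>g'\<in>G. \<forall>t. (g has_real_derivative g' t) (at t)"
  shows "g \<in> G \<Longrightarrow> C_k k \<phi> \<Longrightarrow> C_k k (\<lambda>x. g (\<phi> x))"
proof (induction k arbitrary: g \<phi>)
  case 0
  obtain g' where "(g has_real_derivative g' t) (at t)" for t using G[OF 0(1)] by auto
  then have "continuous_on UNIV g" by (auto intro!: DERIV_continuous_on)
  then show ?case using 0 by (auto intro: continuous_on_compose2)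
next
  case (Suc k)
  obtain g' where g': "g' \<in> G" "\<And>t. (g has_real_derivative g' t) (at t)" using G[OF Suc(2)] by auto
  have d: "((\<lambda>x. g (\<phi> x)) has_derivative (\<lambda>h. frechet_derivative \<phi> (at x) h * g' (\<phi> x))) (at x)" for x
    using has_derivative_compose[OF has_derivative_frechet, of \<phi> x g "\<lambda>h. h * g' (\<phi> x)"] Suc.prems g'(2)
    by (auto simp: has_field_derivative_def mult_commute_abs)
  then have "partial_deriv b (\<lambda>x. g (\<phi> x)) = (\<lambda>x. partial_deriv b \<phi> x * g' (\<phi> x))" for b
    by (auto simp: fun_eq_iff partial_deriv_def[of b \<phi>] intro!: partial_deriv_eq[THEN trans])
  moreover have "(\<lambda>x. g (\<phi> x)) differentiable at x" for x using d by (auto simp: differentiable_def)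
  moreover have "C_k k (\<lambda>x. g' (\<phi> x))" using Suc.IH[OF g'(1)] C_k_SucD[OF Suc.prems(2)] by blast
  ultimately show ?case using Suc.prems by (auto intro!: C_k_mult)
qed

section \<open>Test functions\<close>

lemma test_functions_iff:
  "\<phi> \<in> test_functions D \<longleftrightarrow> (\<forall>k. C_k k \<phi>) \<and> (\<exists>K. compact K \<and> K \<subseteq> D \<and> (\<forall>x. x \<notin> K \<longrightarrow> \<phi> x = 0))"
proof safe
  fix k K
  assume "\<forall>k. C_k k \<phi>" and K: "compact K" "K \<subseteq> D" "\<forall>x. x \<notin> K \<longrightarrow> \<phi> x = 0"
  then have "closure {x. \<phi> x \<noteq> 0} \<subseteq> K" by (intro closure_minimal compact_imp_closed) auto
  moreover from this have "compact (closure {x. \<phi> x \<noteq> 0})"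
    using K(1) by (meson bounded_subset closed_closure compact_eq_bounded_closed)
  ultimately show "\<phi> \<in> test_functions D"
    using \<open>\<forall>k. C_k k \<phi>\<close> K by (auto simp: test_functions_def)
next
  assume "\<phi> \<in> test_functions D"
  then show "\<exists>K. compact K \<and> K \<subseteq> D \<and> (\<forall>x. x \<notin> K \<longrightarrow> \<phi> x = 0)"
    by (intro exI[of _ "closure {x. \<phi> x \<noteq> 0}"])
       (auto simp: test_functions_def intro: closure_subset[THEN subsetD])
qed (simp add: test_functions_def)

lemma test_functions_lincomb:
  assumes "\<phi> \<in> test_functions D" "\<psi> \<in> test_functions D"
  shows "(\<lambda>x. \<alpha> * \<phi> x + \<beta> * \<psi> x) \<in> test_functions D"
proof -
  obtain K K' where "compact K" "K \<subseteq> D" "\<forall>x. x \<notin> K \<longrightarrow> \<phi> x = 0"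
      "compact K'" "K' \<subseteq> D" "\<forall>x. x \<notin> K' \<longrightarrow> \<psi> x = 0"
    using assms by (auto simp: test_functions_iff)
  then have "compact (K \<union> K') \<and> K \<union> K' \<subseteq> D \<and> (\<forall>x. x \<notin> K \<union> K' \<longrightarrow> \<alpha> * \<phi> x + \<beta> * \<psi> x = 0)"
    by (auto intro: compact_Un)
  then show ?thesis using assms unfolding test_functions_iff by (blast intro: C_k_lincomb)
qed

lemma partial_deriv_eq_0:
  assumes "compact K" "\<And>x. x \<notin> K \<Longrightarrow> \<phi> x = 0" "x \<notin> K"
  shows "partial_deriv b \<phi> x = 0"
proof -
  have "open (- K)" using assms(1) by (simp add: compact_imp_closed open_Compl)
  then have "(\<phi> has_derivative (\<lambda>h. 0)) (at x)"
    using assms(2,3)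
    by (intro has_derivative_transform_within_open[of "\<lambda>x. 0" "\<lambda>h. 0" x UNIV "- K" \<phi>]) auto
  then show ?thesis by (rule partial_deriv_eq)
qed

lemma test_functions_partial_deriv:
  assumes "\<phi> \<in> test_functions D" "b \<in> Basis"
  shows "partial_deriv b \<phi> \<in> test_functions D"
proof -
  obtain K where K: "compact K" "K \<subseteq> D" "\<forall>x. x \<notin> K \<longrightarrow> \<phi> x = 0"
    using assms by (auto simp: test_functions_iff)
  have "partial_deriv b \<phi> x = 0" if "x \<notin> K" for x
    using partial_deriv_eq_0[OF K(1) _ that] K(3) by blast
  moreover have "C_k k (partial_deriv b \<phi>)" for k
    using assms C_k.simps(2)[of k \<phi>] unfolding test_functions_iff by blast
  ultimately show ?thesis using K unfolding test_functions_iff by blast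
qed

lemma frechet_derivative_sum:
  fixes \<phi> :: "'a::euclidean_space \<Rightarrow> real"
  assumes "\<phi> differentiable at x"
  shows "frechet_derivative \<phi> (at x) h = (\<Sum>b\<in>Basis. (h \<bullet> b) * partial_deriv b \<phi> x)"
proof -
  have "linear (frechet_derivative \<phi> (at x))"
    using has_derivative_frechet[OF assms] by (rule has_derivative_linear)
  then have "frechet_derivative \<phi> (at x) (\<Sum>b\<in>Basis. (h \<bullet> b) *\<^sub>R b)
      = (\<Sum>b\<in>Basis. (h \<bullet> b) * partial_deriv b \<phi> x)"
    by (simp only: linear_sum linear_scale partial_deriv_def real_scaleR_def)
  then show ?thesis by (simp only: euclidean_representation)
qed

lemma compact_support_bounded:
  fixes \<phi> :: "'a::euclidean_space \<Rightarrow> real"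
  assumes "continuous_on UNIV \<phi>" "compact K" "\<And>x. x \<notin> K \<Longrightarrow> \<phi> x = 0"
  obtains B where "\<And>x. \<bar>\<phi> x\<bar> \<le> B" "0 \<le> B"
proof -
  have "bounded (\<phi> ` K)"
    using assms by (meson compact_continuous_image compact_imp_bounded continuous_on_subset top_greatest)
  then obtain B where "\<forall>x\<in>K. \<bar>\<phi> x\<bar> \<le> B" by (auto simp: bounded_iff)
  with assms(3) have "\<bar>\<phi> x\<bar> \<le> max B 0" for x by (cases "x \<in> K") auto
  then show thesis by (intro that[of "max B 0"]) auto
qed

lemma test_function_bounded:
  assumes "\<phi> \<in> test_functions D"
  obtains B where "\<And>x. \<bar>\<phi> x\<bar> \<le> B" "0 \<le> B"
  using assms compact_support_bounded[of \<phi>] C_k_continuous unfolding test_functions_iff by metis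

lemma test_function_gradient_bound:
  fixes \<phi> :: "'a::euclidean_space \<Rightarrow> real"
  assumes "\<phi> \<in> test_functions D"
  obtains L where "0 \<le> L" "\<And>x h. \<bar>frechet_derivative \<phi> (at x) h\<bar> \<le> L * norm h"
proof -
  have "\<exists>B. \<forall>x. \<bar>partial_deriv b \<phi> x\<bar> \<le> B" if "b \<in> Basis" for b
    using test_function_bounded[OF test_functions_partial_deriv[OF assms that]] by metis
  then obtain B where B: "\<And>b x. b \<in> Basis \<Longrightarrow> \<bar>partial_deriv b \<phi> x\<bar> \<le> B b" by metis
  have "\<phi> differentiable at x" for x using assms C_k.simps(2)[of 0 \<phi>] by (auto simp: test_functions_iff)
  then have "\<bar>frechet_derivative \<phi> (at x) h\<bar> \<le> (\<Sum>b\<in>Basis. \<bar>(h \<bullet> b) * partial_deriv b \<phi> x\<bar>)" for x h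
    by (simp add: frechet_derivative_sum)
  also have "(\<Sum>b\<in>Basis. \<bar>(h \<bullet> b) * partial_deriv b \<phi> x\<bar>) \<le> (\<Sum>b\<in>Basis. B b * norm h)" for x h
    by (intro sum_mono, subst mult.commute[of "B _"]) (auto simp: abs_mult intro!: mult_mono Basis_le_norm B)
  finally have "\<bar>frechet_derivative \<phi> (at x) h\<bar> \<le> (\<Sum>b\<in>Basis. B b) * norm h" for x h
    unfolding sum_distrib_right .
  moreover have "0 \<le> B b" if "b \<in> Basis" for b using B[OF that, of 0] by linarith
  ultimately show thesis by (intro that[of "\<Sum>b\<in>Basis. B b"]) (auto intro: sum_nonneg)
qed

lemma test_function_lipschitz:
  fixes \<phi> :: "'a::euclidean_space \<Rightarrow> real"
  assumes "\<phi> \<in> test_functions D"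
  obtains L where "0 \<le> L" "\<And>x y. \<bar>\<phi> x - \<phi> y\<bar> \<le> L * norm (x - y)"
proof -
  obtain L where L: "0 \<le> L" "\<And>x h. \<bar>frechet_derivative \<phi> (at x) h\<bar> \<le> L * norm h"
    using test_function_gradient_bound[OF assms] by blast
  have d: "\<phi> differentiable at x" for x
    using assms C_k.simps(2)[of 0 \<phi>] by (auto simp: test_functions_iff)
  have "norm (\<phi> x - \<phi> y) \<le> L * norm (x - y)" for x y
    by (rule differentiable_bound[OF convex_UNIV, where f' = "\<lambda>x. frechet_derivative \<phi> (at x)"])
       (use has_derivative_frechet[OF d] L in \<open>auto intro!: onorm_bound\<close>)
  with L(1) show thesis by (intro that[of L]) auto
qed

subsection \<open>A smooth bump\<close>

text \<open>With q = 1 this is the classical function exp(-1/t), flat at 0. The polynomial factors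
  in 1/t make the family closed under differentiation, as \<open>C_k_compose\<close>
  demands.\<close>

definition flat_exp :: "real poly \<Rightarrow> real \<Rightarrow> real" where
  "flat_exp q t = (if t > 0 then poly q (1 / t) * exp (- (1 / t)) else 0)"

lemma poly_exp_tendsto_0: "((\<lambda>x::real. poly q x * exp (- x)) \<longlongrightarrow> 0) at_top"
proof -
  have "((\<lambda>x. \<Sum>i\<le>degree q. coeff q i * (x ^ i / exp x)) \<longlongrightarrow> (\<Sum>i\<le>degree q. coeff q i * 0)) at_top"
    by (intro tendsto_sum tendsto_mult tendsto_const tendsto_power_div_exp_0)
  moreover have "(\<lambda>x. \<Sum>i\<le>degree q. coeff q i * (x ^ i / exp x)) = (\<lambda>x. poly q x * exp (- x))"
    by (auto simp: poly_altdef sum_distrib_right exp_minus field_simps fun_eq_iff sum_divide_distrib)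
  ultimately show ?thesis by simp
qed

lemma flat_exp_tendsto_0: "(flat_exp q \<longlongrightarrow> 0) (at_right 0)"
proof -
  have "((\<lambda>t. poly q (inverse t) * exp (- inverse t)) \<longlongrightarrow> 0) (at_right (0::real))"
    using filterlim_compose[OF poly_exp_tendsto_0 filterlim_inverse_at_top_right] .
  then show ?thesis
    by (rule Lim_transform_eventually)
       (auto simp: eventually_at_right_field flat_exp_def inverse_eq_divide intro: exI[of _ 1])
qed

text \<open>For t > 0 the derivative of q(1/t) exp(-1/t) is (1/t)^2 (q - q')(1/t) exp(-1/t), which
  explains the factor \<open>[:0, 0, 1:]\<close>.\<close>

lemma flat_exp_derivative:
  "(flat_exp q has_real_derivative flat_exp ([:0, 0, 1:] * (q - pderiv q)) t) (at t)"
proof -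
  consider "t > 0" | "t < 0" | "t = 0" by linarith
  then show ?thesis
  proof cases
    case 1
    have d: "((\<lambda>t. - (1 / t)) has_real_derivative (1 / t)\<^sup>2) (at t)"
      "((\<lambda>t. 1 / t) has_real_derivative - ((1 / t)\<^sup>2)) (at t)"
      using 1 by (auto intro!: derivative_eq_intros simp: power2_eq_square)
    have "((\<lambda>t. poly q (1 / t) * exp (- (1 / t))) has_real_derivative
        poly (pderiv q) (1 / t) * (- ((1 / t)\<^sup>2)) * exp (- (1 / t))
        + exp (- (1 / t)) * (1 / t)\<^sup>2 * poly q (1 / t)) (at t)"
      by (rule DERIV_mult[OF DERIV_chain2[OF poly_DERIV d(2)] DERIV_chain2[OF DERIV_exp d(1)]])
    also have "poly (pderiv q) (1 / t) * (- ((1 / t)\<^sup>2)) * exp (- (1 / t))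
        + exp (- (1 / t)) * (1 / t)\<^sup>2 * poly q (1 / t) = flat_exp ([:0, 0, 1:] * (q - pderiv q)) t"
      using 1 by (simp add: flat_exp_def power2_eq_square algebra_simps)
    finally have d: "((\<lambda>t. poly q (1 / t) * exp (- (1 / t))) has_real_derivative
        flat_exp ([:0, 0, 1:] * (q - pderiv q)) t) (at t)" .
    have "eventually (\<lambda>t. poly q (1 / t) * exp (- (1 / t)) = flat_exp q t) (nhds t)"
      using eventually_nhds_in_open[of "{0<..}" t] 1
      by (auto elim!: eventually_mono simp: flat_exp_def)
    from DERIV_cong_ev[OF refl this refl] d show ?thesis by simp
  next
    case 2
    have "eventually (\<lambda>t. 0 = flat_exp q t) (nhds t)"
      using eventually_nhds_in_open[of "{..<0}" t] 2
      by (auto elim!: eventually_mono simp: flat_exp_def)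
    then have "(flat_exp q has_real_derivative 0) (at t)"
      using DERIV_cong_ev[OF refl, of "\<lambda>t. 0" "flat_exp q" t 0 0] by auto
    then show ?thesis using 2 by (simp add: flat_exp_def)
  next
    case 3
    \<comment> \<open>Dividing by t multiplies the polynomial by its variable, so the difference
      quotient at 0 is again a member of the family and tends to 0.\<close>
    have "((\<lambda>t. flat_exp q t / t) \<longlongrightarrow> 0) (at_right 0)"
      by (rule Lim_transform_eventually[OF flat_exp_tendsto_0[of "[:0, 1:] * q"]])
         (auto simp: eventually_at_right_field flat_exp_def intro: exI[of _ 1])
    moreover have "((\<lambda>t. flat_exp q t / t) \<longlongrightarrow> 0) (at_left 0)"
      by (rule Lim_transform_eventually[OF tendsto_const])
         (auto simp: eventually_at_left_field flat_exp_def intro: exI[of _ "-1"])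
    ultimately have "((\<lambda>t. flat_exp q t / t) \<longlongrightarrow> 0) (at 0)"
      by (simp add: filterlim_split_at)
    then show ?thesis using 3 by (simp add: DERIV_def flat_exp_def)
  qed
qed

definition box_bump :: "'a::euclidean_space \<Rightarrow> 'a \<Rightarrow> 'a \<Rightarrow> real" where
  "box_bump a b x = (\<Prod>i\<in>Basis. flat_exp 1 ((x - a) \<bullet> i) * flat_exp 1 ((b - x) \<bullet> i))"

lemma C_k_box_bump: "C_k k (box_bump a b)"
proof -
  have *: "C_k k (\<lambda>x. flat_exp 1 (\<alpha> + x \<bullet> v))" for \<alpha> and v :: 'a
    by (rule C_k_compose[where G = "range flat_exp"]) (auto intro: C_k_affine flat_exp_derivative)
  show ?thesis
    unfolding box_bump_def[abs_def] inner_diff_left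
    using *[of "- (a \<bullet> i)" i for i] *[of "b \<bullet> i" "- i" for i]
    by (intro C_k_prod C_k_mult) (auto simp: algebra_simps)
qed

lemma box_bump_nonneg: "0 \<le> box_bump a b x"
  by (auto simp: box_bump_def flat_exp_def intro!: prod_nonneg)

lemma box_bump_pos: "x \<in> box a b \<Longrightarrow> 0 < box_bump a b x"
  by (auto simp: box_bump_def flat_exp_def mem_box inner_diff_left intro!: prod_pos)

lemma box_bump_eq_0: "x \<notin> box a b \<Longrightarrow> box_bump a b x = 0"
  by (auto simp: box_bump_def flat_exp_def mem_box inner_diff_left)

lemma box_bump_test_function: "cbox a b \<subseteq> D \<Longrightarrow> box_bump a b \<in> test_functions D"
  unfolding test_functions_iff
  by (intro conjI allI exI[of _ "cbox a b"] C_k_box_bump compact_cbox impI box_bump_eq_0)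
     (use box_subset_cbox in auto)

text \<open>The functions \<open>1 - exp (- n * bump)\<close> lie between 0 and 1, vanish off the
  box and tend to 1 wherever the bump is positive. Boxes are the right sets to approximate because
  they generate the Borel sets.\<close>

lemma box_indicator_approx:
  assumes "cbox a b \<subseteq> D"
  obtains \<psi> :: "nat \<Rightarrow> 'a::euclidean_space \<Rightarrow> real" where
    "\<And>n. \<psi> n \<in> test_functions D" "\<And>n x. 0 \<le> \<psi> n x" "\<And>n x. \<psi> n x \<le> indicator (box a b) x"
    "\<And>x. (\<lambda>n. \<psi> n x) \<longlonglongrightarrow> indicator (box a b) x"
proof
  let ?\<psi> = "\<lambda>n x. 1 + (-1) * exp (- real n * box_bump a b x)"
  show "?\<psi> n \<in> test_functions D" for n
  proof -
    have "C_k k (?\<psi> n)" for k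
    proof (rule C_k_compose[where g = "\<lambda>t. 1 + (-1) * exp (- real n * t)"])
      let ?G = "range (\<lambda>(\<alpha>, \<beta>) t. \<alpha> + \<beta> * exp (- real n * t))"
      show "(\<lambda>t. 1 + (-1) * exp (- real n * t)) \<in> ?G" by (rule range_eqI[of _ _ "(1, -1)"]) simp
      fix g assume "g \<in> ?G"
      then obtain \<alpha> \<beta> where g: "g = (\<lambda>t. \<alpha> + \<beta> * exp (- real n * t))" by auto
      show "\<exists>g'\<in>?G. \<forall>t. (g has_real_derivative g' t) (at t)"
        unfolding g
        by (rule bexI[of _ "\<lambda>t. 0 + (- real n * \<beta>) * exp (- real n * t)"])
           (auto intro!: derivative_eq_intros range_eqI[of _ _ "(0, - real n * \<beta>)"] simp: mult_ac)
    qed (rule C_k_box_bump)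
    moreover have "?\<psi> n x = 0" if "x \<notin> cbox a b" for x
      using that box_subset_cbox by (subst box_bump_eq_0) auto
    ultimately show ?thesis
      unfolding test_functions_iff
      by (intro conjI allI exI[of _ "cbox a b"] compact_cbox impI assms)
  qed
  show "0 \<le> ?\<psi> n x" "?\<psi> n x \<le> indicator (box a b) x" for n x
    using box_bump_nonneg[of a b x] box_bump_eq_0[of x a b] by (auto simp: indicator_def)
  show "(\<lambda>n. ?\<psi> n x) \<longlonglongrightarrow> indicator (box a b) x" for x
  proof (cases "x \<in> box a b")
    case True
    then have "filterlim (\<lambda>n. - real n * box_bump a b x) at_bot sequentially"
      using filterlim_tendsto_pos_mult_at_top[OF tendsto_const box_bump_pos[OF True] filterlim_real_sequentially]
      by (simp add: filterlim_uminus_at_bot mult.commute)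
    then have "(\<lambda>n. exp (- real n * box_bump a b x)) \<longlonglongrightarrow> 0"
      by (rule filterlim_compose[OF exp_at_bot])
    then have "(\<lambda>n. ?\<psi> n x) \<longlonglongrightarrow> 1 + (-1) * 0" by (intro tendsto_intros)
    then show ?thesis using True by simp
  qed (simp add: box_bump_eq_0)
qed

section \<open>Integrability of the kernel and Lipschitz functions in fractional spaces\<close>

lemma dyadic_shell_outer:
  assumes "1 \<le> (x::real)"
  shows "\<exists>k::nat. 2 powr real k \<le> x \<and> x < 2 powr (real k + 1)"
proof -
  let ?k = "nat \<lfloor>log 2 x\<rfloor>"
  have "0 \<le> log 2 x" using assms by simp
  then have k: "real ?k \<le> log 2 x" "log 2 x < real ?k + 1" by linarith+
  then have "2 powr real ?k \<le> 2 powr log 2 x" "2 powr log 2 x < 2 powr (real ?k + 1)" by simp_all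
  then show ?thesis using assms by (intro exI[of _ ?k]) simp
qed

lemma dyadic_shell_inner:
  assumes "0 < (x::real)" "x < 1"
  shows "\<exists>k::nat. 2 powr (- real k - 1) \<le> x \<and> x < 2 powr (- real k)"
proof -
  let ?k = "nat (\<lceil>- log 2 x\<rceil> - 1)"
  have "0 < - log 2 x" using assms by simp
  then have k: "- real ?k - 1 \<le> log 2 x" "log 2 x < - real ?k" by linarith+
  then have "2 powr (- real ?k - 1) \<le> 2 powr log 2 x" "2 powr log 2 x < 2 powr (- real ?k)" by simp_all
  then show ?thesis using assms by (intro exI[of _ ?k]) simp
qed

text \<open>The weight makes the kernel integrable: what remains is |z|^(1-s-d) near the origin and
  |z|^(-d-2s) far away. The exponent 1 + s lies strictly between 2s, the threshold of integrability
  at the origin, and 2, the order to which squared Lipschitz differences and second differences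
  vanish. The spare power 1 - s can then be traded for smallness.\<close>

definition cut_kernel :: "real \<Rightarrow> 'a::euclidean_space \<Rightarrow> real" where
  "cut_kernel s z = min 1 (norm z powr (1 + s)) * frac_kernel s z 0"

lemma cut_kernel_nonneg [simp]: "0 \<le> cut_kernel s z"
  by (simp add: cut_kernel_def)

lemma cut_kernel_minus: "cut_kernel s (x - y) = cut_kernel s (y - x)"
  by (simp add: cut_kernel_def frac_kernel_def norm_minus_commute)

lemma borel_measurable_cut_kernel [measurable]: "cut_kernel s \<in> borel_measurable borel"
  unfolding cut_kernel_def[abs_def] by measurable

text \<open>A substitute for polar coordinates: a radial function is dominated by a series of
  multiples of indicators of dyadic balls, whose integrals form a geometric series.\<close>

lemma nn_integral_ball_series:
  assumes "0 \<le> q" "q < 1" "\<And>k. 0 \<le> r k" "\<And>k. 0 \<le> a k"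
    and "\<And>k. a k * r k ^ DIM('a) = A * q ^ k" "0 \<le> A"
  shows "(\<integral>\<^sup>+z. (\<Sum>k::nat. ennreal (a k) * indicator (ball (0::'a::euclidean_space) (r k)) z) \<partial>lborel) < \<infinity>"
proof -
  let ?V = "unit_ball_vol (real DIM('a))"
  have "(\<integral>\<^sup>+z. (\<Sum>k::nat. ennreal (a k) * indicator (ball (0::'a) (r k)) z) \<partial>lborel)
     = (\<Sum>k. \<integral>\<^sup>+z. ennreal (a k) * indicator (ball (0::'a) (r k)) z \<partial>lborel)"
    by (intro nn_integral_suminf borel_measurable_times_ennreal borel_measurable_const
        borel_measurable_indicator) auto
  also have "\<dots> = (\<Sum>k. ennreal (?V * A * q ^ k))"
  proof (intro suminf_cong)
    fix k
    have "(\<integral>\<^sup>+z. ennreal (a k) * indicator (ball (0::'a) (r k)) z \<partial>lborel)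
        = ennreal (a k) * ennreal (?V * r k ^ DIM('a))"
      using assms(3) by (simp add: nn_integral_cmult_indicator emeasure_ball)
    also have "\<dots> = ennreal (a k * (?V * r k ^ DIM('a)))"
      using assms(4) by (simp add: ennreal_mult')
    also have "a k * (?V * r k ^ DIM('a)) = ?V * (a k * r k ^ DIM('a))" by simp
    finally show "(\<integral>\<^sup>+z. ennreal (a k) * indicator (ball (0::'a) (r k)) z \<partial>lborel)
        = ennreal (?V * A * q ^ k)"
      by (simp add: assms(5) mult.assoc)
  qed
  also have "\<dots> < \<infinity>"
  proof -
    have "(\<Sum>k. ennreal (?V * A * q ^ k)) \<noteq> \<infinity>"
      unfolding infinity_ennreal_def
      using assms by (intro ennreal_suminf_neq_top summable_mult summable_geometric) auto
    then show ?thesis by (simp add: less_top)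
  qed
  finally show ?thesis .
qed

lemma ennreal_le_suminf: "f k \<le> (\<Sum>k::nat. f k :: ennreal)"
  using sum_le_suminf[of f "{k}"] by simp

lemma borel_measurable_ball_series:
  fixes a r :: "nat \<Rightarrow> real"
  shows "(\<lambda>z. \<Sum>k. ennreal (a k) * indicator (ball (0::'a::euclidean_space) (r k)) z) \<in> borel_measurable lborel"
proof -
  have [measurable]: "ball (0::'a) (r k) \<in> sets borel" for k by simp
  show ?thesis by measurable
qed

lemma two_powr_power: "(2 powr a) ^ n = 2 powr (a * real n)" for a :: real
  by (induction n) (simp_all add: powr_add[symmetric] algebra_simps)

lemma integrable_cut_kernel:
  assumes "0 < s" "s < 1"
  shows "integrable lborel (cut_kernel s :: 'a::euclidean_space \<Rightarrow> real)"
proof (rule integrableI_bounded)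
  let ?d = "real DIM('a)"
  \<comment> \<open>Both exponents are nonpositive, so on a dyadic shell the bound is taken at the
    inner radius, while the ball has the outer radius. The resulting series have the ratios 2^(-2s)
    far away and 2^(s-1) near the origin.\<close>
  let ?a = "\<lambda>k::nat. (2 powr real k) powr - (?d + 2 * s)"
  let ?b = "\<lambda>k::nat. (2 powr (- real k - 1)) powr (1 - s - ?d)"
  let ?A = "\<lambda>z::'a. \<Sum>k. ennreal (?a k) * indicator (ball 0 (2 powr (real k + 1))) z"
  let ?B = "\<lambda>z::'a. \<Sum>k. ennreal (?b k) * indicator (ball 0 (2 powr (- real k))) z"
  have d: "?d \<ge> 1" using DIM_positive[where 'a = 'a] by linarith
  have nonpos: "- (?d + 2 * s) \<le> 0" "1 - s - ?d \<le> 0" by (use assms d in linarith)+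
  have bound: "ennreal (norm (cut_kernel s z)) \<le> ?A z + ?B z" for z :: 'a
  proof (cases "norm z \<ge> 1")
    case True
    then obtain k :: nat where k: "2 powr real k \<le> norm z" "norm z < 2 powr (real k + 1)"
      using dyadic_shell_outer by blast
    have "cut_kernel s z \<le> 1 * frac_kernel s z 0"
      unfolding cut_kernel_def by (intro mult_right_mono) auto
    also have "\<dots> = norm z powr - (?d + 2 * s)"
      unfolding powr_minus_divide by (simp add: frac_kernel_def)
    also have "\<dots> \<le> ?a k"
      by (rule powr_mono2'[OF nonpos(1) _ k(1)]) simp
    finally have "ennreal (norm (cut_kernel s z))
        \<le> ennreal (?a k) * indicator (ball 0 (2 powr (real k + 1))) z"
      using k(2) by (simp add: ennreal_leI)
    also have "\<dots> \<le> ?A z"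
      by (rule ennreal_le_suminf[of "\<lambda>k. ennreal (?a k) * indicator (ball 0 (2 powr (real k + 1))) z" k])
    finally show ?thesis by (simp add: add_increasing2)
  next
    case False
    show ?thesis
    proof (cases "z = 0")
      case True
      then show ?thesis by (simp add: cut_kernel_def frac_kernel_def)
    next
      case z: False
      with False obtain k :: nat where k: "2 powr (- real k - 1) \<le> norm z" "norm z < 2 powr (- real k)"
        using dyadic_shell_inner[of "norm z"] by auto
      have "cut_kernel s z \<le> norm z powr (1 + s) * frac_kernel s z 0"
        unfolding cut_kernel_def by (intro mult_right_mono) auto
      also have "\<dots> = norm z powr (1 + s) * norm z powr - (?d + 2 * s)"
        unfolding powr_minus_divide by (simp add: frac_kernel_def)
      also have "\<dots> = norm z powr (1 - s - ?d)"
        by (simp only: powr_add[symmetric]) (rule arg_cong[where f = "\<lambda>t. norm z powr t"], linarith)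
      also have "\<dots> \<le> ?b k"
        by (rule powr_mono2'[OF nonpos(2) _ k(1)]) simp
      finally have "ennreal (norm (cut_kernel s z))
          \<le> ennreal (?b k) * indicator (ball 0 (2 powr (- real k))) z"
        using k(2) by (simp add: ennreal_leI)
      also have "\<dots> \<le> ?B z"
        by (rule ennreal_le_suminf[of "\<lambda>k. ennreal (?b k) * indicator (ball 0 (2 powr (- real k))) z" k])
      finally show ?thesis by (simp add: add_increasing)
    qed
  qed
  have "(\<integral>\<^sup>+z. ennreal (norm (cut_kernel s (z::'a))) \<partial>lborel) \<le> (\<integral>\<^sup>+z. ?A z + ?B z \<partial>lborel)"
    by (intro nn_integral_mono bound)
  also have "\<dots> = (\<integral>\<^sup>+z. ?A z \<partial>lborel) + (\<integral>\<^sup>+z. ?B z \<partial>lborel)"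
    by (intro nn_integral_add borel_measurable_ball_series)
  also have "\<dots> < \<infinity>"
  proof -
    have "(\<integral>\<^sup>+z. ?A z \<partial>lborel) < \<infinity>"
    proof (rule nn_integral_ball_series[where q = "2 powr (- 2 * s)" and A = "2 powr ?d"])
      show "?a k * (2 powr (real k + 1)) ^ DIM('a) = 2 powr ?d * (2 powr (- 2 * s)) ^ k" for k
        unfolding two_powr_power powr_powr powr_add[symmetric]
        by (rule arg_cong[where f = "\<lambda>t. 2 powr t"]) (simp add: algebra_simps)
      show "2 powr (- 2 * s) < 1" using assms by (simp add: powr_less_one)
    qed auto
    moreover have "(\<integral>\<^sup>+z. ?B z \<partial>lborel) < \<infinity>"
    proof (rule nn_integral_ball_series[where q = "2 powr (s - 1)" and A = "2 powr (?d - 1 + s)"])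
      show "?b k * (2 powr (- real k)) ^ DIM('a) = 2 powr (?d - 1 + s) * (2 powr (s - 1)) ^ k" for k
        unfolding two_powr_power powr_powr powr_add[symmetric]
        by (rule arg_cong[where f = "\<lambda>t. 2 powr t"]) (simp add: algebra_simps)
      show "2 powr (s - 1) < 1" using assms by (simp add: powr_less_one)
    qed auto
    ultimately show ?thesis unfolding infinity_ennreal_def ennreal_add_less_top by (rule conjI)
  qed
  finally show "(\<integral>\<^sup>+z. ennreal (norm (cut_kernel s (z::'a))) \<partial>lborel) < \<infinity>" .
qed auto

section \<open>Reflections and translations of Lebesgue measure\<close>

lemma lborel_distr_diff: "distr lborel borel (\<lambda>y. t - y) = (lborel :: 'a::euclidean_space measure)"
  using lborel_affine[of "-1" t] by (simp add: density_1)

lemma nn_integral_lborel_diff: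
  assumes [measurable]: "f \<in> borel_measurable borel"
  shows "(\<integral>\<^sup>+y. f (t - y) \<partial>lborel) = (\<integral>\<^sup>+y. f y \<partial>(lborel :: 'a::euclidean_space measure))"
  by (subst (2) lborel_distr_diff[of t, symmetric]) (simp add: nn_integral_distr)

lemma integral_lborel_translate:
  fixes f :: "'a::euclidean_space \<Rightarrow> real"
  assumes [measurable]: "f \<in> borel_measurable borel"
  shows "(\<integral>y. f (t - y) \<partial>lborel) = (\<integral>y. f y \<partial>lborel)"
    and "(\<integral>y. f (t + y) \<partial>lborel) = (\<integral>y. f y \<partial>lborel)"
    and "integrable lborel (\<lambda>y. f (t - y)) \<longleftrightarrow> integrable lborel f"
    and "integrable lborel (\<lambda>y. f (t + y)) \<longleftrightarrow> integrable lborel f"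
proof -
  show "(\<integral>y. f (t - y) \<partial>lborel) = (\<integral>y. f y \<partial>lborel)"
    by (subst (2) lborel_distr_diff[of t, symmetric]) (simp add: integral_distr)
  show "(\<integral>y. f (t + y) \<partial>lborel) = (\<integral>y. f y \<partial>lborel)"
    by (subst (2) lborel_distr_plus[of t, symmetric]) (simp add: integral_distr)
  show "integrable lborel (\<lambda>y. f (t - y)) \<longleftrightarrow> integrable lborel f"
    by (subst (2) lborel_distr_diff[of t, symmetric]) (simp add: integrable_distr_eq)
  show "integrable lborel (\<lambda>y. f (t + y)) \<longleftrightarrow> integrable lborel f"
    by (subst (2) lborel_distr_plus[of t, symmetric]) (simp add: integrable_distr_eq)
qed

text \<open>For n < 1 write D^2 = D^(1+s) D^(1-s): the first factor takes the Lipschitz bound and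
  supplies the weight of \<open>cut_kernel\<close>, the second takes the sup bound and supplies the
  power of \<epsilon>. For n \<ge> 1 the sup bound alone is enough.\<close>

lemma lipschitz_square_bound:
  fixes D :: real
  assumes "0 \<le> s" "s \<le> 1" "0 \<le> L" "0 \<le> \<epsilon>" "0 \<le> n" "0 \<le> D" "D \<le> L * n" "D \<le> 2 * \<epsilon>"
  shows "D\<^sup>2 \<le> (4 * \<epsilon>\<^sup>2 + L powr (1 + s) * (2 * \<epsilon>) powr (1 - s)) * min 1 (n powr (1 + s))"
proof (cases "n \<ge> 1")
  case True
  then have "min 1 (n powr (1 + s)) = 1"
    using assms by (simp add: ge_one_powr_ge_zero)
  moreover have "D\<^sup>2 \<le> (2 * \<epsilon>)\<^sup>2" using assms by (intro power_mono) auto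
  ultimately show ?thesis by (simp add: power2_eq_square add_increasing2)
next
  case False
  then have m: "min 1 (n powr (1 + s)) = n powr (1 + s)"
    using assms powr_le1[of "1 + s" n] by simp
  have "D\<^sup>2 = D powr (1 + s) * D powr (1 - s)"
    using assms by (cases "D = 0") (simp_all add: powr_add[symmetric] powr_numeral)
  also have "\<dots> \<le> (L * n) powr (1 + s) * (2 * \<epsilon>) powr (1 - s)"
    using assms by (intro mult_mono powr_mono2) auto
  also have "\<dots> = (L powr (1 + s) * (2 * \<epsilon>) powr (1 - s)) * n powr (1 + s)"
    using assms by (simp add: powr_mult)
  also have "\<dots> \<le> (4 * \<epsilon>\<^sup>2 + L powr (1 + s) * (2 * \<epsilon>) powr (1 - s)) * n powr (1 + s)"
    by (intro mult_right_mono) auto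
  finally show ?thesis unfolding m .
qed

text \<open>If v vanishes off B, its Gagliardo quotient lives on pairs with a coordinate in B. By
  Tonelli and translation invariance each of the two strips has the mass of B times the integral of
  \<open>cut_kernel\<close>.\<close>

lemma nn_integral_cut_kernel_strip:
  fixes B :: "'a::euclidean_space set"
  assumes "B \<in> sets borel"
  shows "(\<integral>\<^sup>+p. (indicator B (fst p) + indicator B (snd p)) * ennreal (cut_kernel s (fst p - snd p))
      \<partial>(lborel \<Otimes>\<^sub>M lborel)) = 2 * (emeasure lborel B * (\<integral>\<^sup>+z. ennreal (cut_kernel s (z::'a)) \<partial>lborel))"
proof -
  let ?I = "\<integral>\<^sup>+z. ennreal (cut_kernel s (z::'a)) \<partial>lborel"
  have [measurable]: "B \<in> sets lborel" using assms by simp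
  have [measurable]: "cut_kernel s \<in> borel_measurable lborel" by simp
  have I: "(\<integral>\<^sup>+y. ennreal (cut_kernel s (x - y)) \<partial>lborel) = ?I" for x :: 'a
    using nn_integral_lborel_diff[of "\<lambda>z. ennreal (cut_kernel s z)" x] by simp
  have "(\<integral>\<^sup>+p. indicator B (fst p) * ennreal (cut_kernel s (fst p - snd p)) \<partial>(lborel \<Otimes>\<^sub>M lborel))
      = (\<integral>\<^sup>+x. \<integral>\<^sup>+y. indicator B x * ennreal (cut_kernel s (x - y)) \<partial>lborel \<partial>lborel)"
    by (subst lborel.nn_integral_fst[symmetric]) auto
  also have "\<dots> = emeasure lborel B * ?I"
    using assms by (simp add: nn_integral_cmult I nn_integral_multc)
  finally have 1: "(\<integral>\<^sup>+p. indicator B (fst p) * ennreal (cut_kernel s (fst p - snd p)) \<partial>(lborel \<Otimes>\<^sub>M lborel))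
      = emeasure lborel B * ?I" .
  have "(\<integral>\<^sup>+p. indicator B (snd p) * ennreal (cut_kernel s (fst p - snd p)) \<partial>(lborel \<Otimes>\<^sub>M lborel))
      = (\<integral>\<^sup>+y. \<integral>\<^sup>+x. indicator B y * ennreal (cut_kernel s (x - y)) \<partial>lborel \<partial>lborel)"
    by (subst lborel_pair.nn_integral_snd[symmetric]) auto
  also have "\<dots> = emeasure lborel B * ?I"
    by (subst cut_kernel_minus) (use assms in \<open>simp add: nn_integral_cmult I nn_integral_multc\<close>)
  finally have 2: "(\<integral>\<^sup>+p. indicator B (snd p) * ennreal (cut_kernel s (fst p - snd p)) \<partial>(lborel \<Otimes>\<^sub>M lborel))
      = emeasure lborel B * ?I" .
  show ?thesis
    unfolding distrib_right by (subst nn_integral_add) (auto simp: 1 2 mult_2)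
qed

text \<open>The source of membership and of smallness in \<open>Hs\<close> for concrete functions:
  with L fixed, the bound tends to 0 together with the supremum \<epsilon>. A is chosen before v, L
  and \<epsilon>, so it is uniform over meshes and mollifiers.\<close>

lemma lipschitz_Hs:
  fixes B :: "'a::euclidean_space set"
  assumes "0 < c" "0 < s" "s < 1" "bounded B" "B \<in> sets borel"
  obtains A where "0 \<le> A" "\<And>L \<epsilon> v. 0 \<le> L \<Longrightarrow> 0 \<le> \<epsilon> \<Longrightarrow> (\<And>x y. \<bar>v x - v y\<bar> \<le> L * norm (x - y)) \<Longrightarrow>
      (\<And>x. \<bar>v x\<bar> \<le> \<epsilon>) \<Longrightarrow> (\<And>x. x \<notin> B \<Longrightarrow> v x = 0) \<Longrightarrow>
      v \<in> Hs s \<and> (Hs_norm c s v)\<^sup>2 \<le> A * (\<epsilon>\<^sup>2 + L powr (1 + s) * \<epsilon> powr (1 - s))"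
proof -
  define m where "m = measure lborel B"
  define I where "I = (\<integral>z. cut_kernel s (z::'a) \<partial>lborel)"
  have mB: "emeasure lborel B = ennreal m" "0 \<le> m"
    using emeasure_bounded_finite[OF \<open>bounded B\<close>] by (auto simp: m_def emeasure_eq_ennreal_measure top.not_eq_extremum)
  have I: "(\<integral>\<^sup>+z. ennreal (cut_kernel s (z::'a)) \<partial>lborel) = ennreal I" "0 \<le> I"
    using nn_integral_eq_integral[OF integrable_cut_kernel[OF assms(2,3), where 'a = 'a]]
    by (auto simp: I_def)
  \<comment> \<open>The summand m belongs to the L2 part. With X the bracket in the claim, the form
    contributes \<open>c / 2 * (4 * X) * (2 * m * I)\<close>, where the 2 counts the strips and the
    4 comes from \<open>E \<le> 4 * X\<close>.\<close>
  define A where "A = m + c * m * I * 4"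
  have "v \<in> Hs s \<and> (Hs_norm c s v)\<^sup>2 \<le> A * (\<epsilon>\<^sup>2 + L powr (1 + s) * \<epsilon> powr (1 - s))"
    if L: "0 \<le> L" "0 \<le> \<epsilon>" "\<And>x y. \<bar>v x - v y\<bar> \<le> L * norm (x - y)" and \<epsilon>: "\<And>x. \<bar>v x\<bar> \<le> \<epsilon>"
      and B: "\<And>x. x \<notin> B \<Longrightarrow> v x = 0" for L \<epsilon> v
  proof -
    define E where "E = 4 * \<epsilon>\<^sup>2 + L powr (1 + s) * (2 * \<epsilon>) powr (1 - s)"
    have "0 \<le> E" by (simp add: E_def)
    have "continuous_on UNIV v"
      by (rule lipschitz_on_continuous_on[of L]) (use L in \<open>auto simp: lipschitz_on_def dist_norm\<close>)
    then have [measurable]: "v \<in> borel_measurable borel" by (rule borel_measurable_continuous_onI)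
    have vb: "v \<in> square_integrable lborel" "(\<integral>x. (v x)\<^sup>2 \<partial>lborel) \<le> m * \<epsilon>\<^sup>2"
    proof -
      have i: "integrable lborel (\<lambda>x. indicator B x * \<epsilon>\<^sup>2)"
        using mB assms(5) by (intro integrable_mult_left) (auto intro!: integrable_real_indicator)
      have le: "(v x)\<^sup>2 \<le> indicator B x * \<epsilon>\<^sup>2" for x
        using B[of x] \<epsilon>[of x] power_mono[of "\<bar>v x\<bar>" \<epsilon> 2] by (cases "x \<in> B") auto
      have i2: "integrable lborel (\<lambda>x. (v x)\<^sup>2)"
        by (rule Bochner_Integration.integrable_bound[OF i]) (use le in \<open>auto intro: order_trans\<close>)
      then show "v \<in> square_integrable lborel" by (simp add: square_integrable_def)
      have "(\<integral>x. (v x)\<^sup>2 \<partial>lborel) \<le> (\<integral>x. indicator B x * \<epsilon>\<^sup>2 \<partial>lborel)"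
        using i i2 le by (intro integral_mono) auto
      also have "\<dots> = m * \<epsilon>\<^sup>2" using assms(5) by (simp add: m_def)
      finally show "(\<integral>x. (v x)\<^sup>2 \<partial>lborel) \<le> m * \<epsilon>\<^sup>2" .
    qed
    have le: "(gagliardo_quotient s v p)\<^sup>2
        \<le> E * ((indicator B (fst p) + indicator B (snd p)) * cut_kernel s (fst p - snd p))" for p
    proof (cases "fst p \<in> B \<or> snd p \<in> B")
      case True
      obtain x y where p: "p = (x, y)" by (cases p)
      have "\<bar>v x - v y\<bar> \<le> 2 * \<epsilon>" using \<epsilon>[of x] \<epsilon>[of y] by linarith
      then have "\<bar>v x - v y\<bar>\<^sup>2 \<le> E * min 1 (norm (x - y) powr (1 + s))"
        unfolding E_def using L assms by (intro lipschitz_square_bound) auto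
      then have "(v x - v y)\<^sup>2 * frac_kernel s x y \<le> E * min 1 (norm (x - y) powr (1 + s)) * frac_kernel s x y"
        by (intro mult_right_mono) auto
      also have "\<dots> = E * (1 * cut_kernel s (x - y))"
        unfolding cut_kernel_def using frac_kernel_diff[of s x y] by simp
      also have "\<dots> \<le> E * ((indicator B x + indicator B y) * cut_kernel s (x - y))"
        using True p \<open>0 \<le> E\<close> by (intro mult_left_mono mult_right_mono) auto
      finally show ?thesis by (simp add: p gagliardo_quotient_def power_mult_distrib)
    next
      case False
      then show ?thesis using B by (simp add: gagliardo_quotient_def)
    qed
    have "(\<integral>\<^sup>+p. ennreal ((gagliardo_quotient s v p)\<^sup>2) \<partial>(lborel \<Otimes>\<^sub>M lborel))
        \<le> (\<integral>\<^sup>+p. ennreal E * ((indicator B (fst p) + indicator B (snd p))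
            * ennreal (cut_kernel s (fst p - snd p))) \<partial>(lborel \<Otimes>\<^sub>M lborel))"
    proof (rule nn_integral_mono)
      fix p :: "'a \<times> 'a"
      have "ennreal ((gagliardo_quotient s v p)\<^sup>2)
        \<le> ennreal (E * ((indicator B (fst p) + indicator B (snd p)) * cut_kernel s (fst p - snd p)))"
        by (rule ennreal_leI[OF le])
      also have "\<dots> = ennreal E * ((indicator B (fst p) + indicator B (snd p))
            * ennreal (cut_kernel s (fst p - snd p)))"
        using \<open>0 \<le> E\<close> by (simp add: ennreal_mult' ennreal_mult ennreal_indicator ennreal_plus)
      finally show "ennreal ((gagliardo_quotient s v p)\<^sup>2) \<le> ennreal E *
          ((indicator B (fst p) + indicator B (snd p)) * ennreal (cut_kernel s (fst p - snd p)))" .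
    qed
    also have "\<dots> = ennreal E * (2 * (ennreal m * ennreal I))"
    proof -
      have [measurable]: "B \<in> sets lborel" "cut_kernel s \<in> borel_measurable lborel" using assms by simp_all
      show ?thesis
        by (subst nn_integral_cmult) (auto simp: nn_integral_cut_kernel_strip[OF assms(5)] mB I)
    qed
    also have "\<dots> = ennreal (E * (2 * (m * I)))"
      using \<open>0 \<le> E\<close> mB(2) I(2) by (simp add: ennreal_mult' ennreal_mult)
    finally have nn: "(\<integral>\<^sup>+p. ennreal ((gagliardo_quotient s v p)\<^sup>2) \<partial>(lborel \<Otimes>\<^sub>M lborel))
        \<le> ennreal (E * (2 * (m * I)))" .
    have gi: "integrable (lborel \<Otimes>\<^sub>M lborel) (\<lambda>p. (gagliardo_quotient s v p)\<^sup>2)"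
      by (rule integrableI_bounded) (use nn in \<open>auto simp: le_less_trans\<close>)
    have "(\<integral>p. (gagliardo_quotient s v p)\<^sup>2 \<partial>(lborel \<Otimes>\<^sub>M lborel)) \<le> E * (2 * (m * I))"
      using nn nn_integral_eq_integral[OF gi] \<open>0 \<le> E\<close> mB(2) I(2) by simp
    then have "frac_form c s v v \<le> c / 2 * (E * (2 * (m * I)))"
      unfolding frac_form_eq using \<open>0 < c\<close> by (intro mult_left_mono) (auto simp: power2_eq_square)
    moreover have "(L2_norm UNIV v)\<^sup>2 \<le> m * \<epsilon>\<^sup>2"
      using vb unfolding L2_norm_UNIV_power2 L2_inner_eq by (simp add: power2_eq_square)
    moreover have "E \<le> 4 * (\<epsilon>\<^sup>2 + L powr (1 + s) * \<epsilon> powr (1 - s))"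
    proof -
      have "(2 * \<epsilon>) powr (1 - s) = 2 powr (1 - s) * \<epsilon> powr (1 - s)" using L by (simp add: powr_mult)
      also have "\<dots> \<le> 2 powr 1 * \<epsilon> powr (1 - s)" using assms by (intro mult_right_mono powr_mono) auto
      also have "\<dots> \<le> 4 * \<epsilon> powr (1 - s)" by simp
      finally have "L powr (1 + s) * (2 * \<epsilon>) powr (1 - s) \<le> L powr (1 + s) * (4 * \<epsilon> powr (1 - s))"
        by (intro mult_left_mono) auto
      then show ?thesis by (simp add: E_def algebra_simps)
    qed
    then have "c / 2 * (E * (2 * (m * I)))
        \<le> c / 2 * ((4 * (\<epsilon>\<^sup>2 + L powr (1 + s) * \<epsilon> powr (1 - s))) * (2 * (m * I)))"
      using mB(2) I(2) assms(1) by (intro mult_left_mono mult_right_mono) auto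
    moreover have "m * \<epsilon>\<^sup>2 \<le> m * (\<epsilon>\<^sup>2 + L powr (1 + s) * \<epsilon> powr (1 - s))"
      using mB(2) by (intro mult_left_mono) auto
    ultimately have "(Hs_norm c s v)\<^sup>2 \<le> A * (\<epsilon>\<^sup>2 + L powr (1 + s) * \<epsilon> powr (1 - s))"
      using frac_form_nonneg[OF \<open>0 < c\<close>, of s v] by (simp add: Hs_norm_def A_def algebra_simps)
    moreover have "v \<in> Hs s"
      using vb gi by (auto simp: Hs_iff square_integrable_def)
    ultimately show ?thesis by blast
  qed
  moreover have "0 \<le> A" using mB(2) I(2) assms(1) by (simp add: A_def)
  ultimately show thesis using that by blast
qed

lemma test_function_measurable:
  assumes "\<phi> \<in> test_functions D"
  shows "continuous_on UNIV \<phi>" "\<phi> \<in> borel_measurable borel"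
proof -
  have "C_k 0 \<phi>" using assms unfolding test_functions_iff by blast
  then show "continuous_on UNIV \<phi>" by simp
  then show "\<phi> \<in> borel_measurable borel" by (rule borel_measurable_continuous_onI)
qed

lemma test_functions_Hs:
  assumes "\<phi> \<in> test_functions D" "0 < s" "s < 1"
  shows "\<phi> \<in> Hs s"
proof -
  obtain K where K: "compact K" "\<And>x. x \<notin> K \<Longrightarrow> \<phi> x = 0"
    using assms by (auto simp: test_functions_iff)
  obtain B where "\<And>x. \<bar>\<phi> x\<bar> \<le> B" "0 \<le> B" using test_function_bounded[OF assms(1)] by blast
  moreover obtain L where "0 \<le> L" "\<And>x y. \<bar>\<phi> x - \<phi> y\<bar> \<le> L * norm (x - y)"
    using test_function_lipschitz[OF assms(1)] by blast
  moreover have "K \<in> sets borel" "bounded K"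
    using K(1) by (auto intro: compact_imp_bounded borel_compact)
  ultimately show ?thesis
    using lipschitz_Hs[of 1 s K] K assms by (metis zero_less_one)
qed

text \<open>Outside the ball the weight in \<open>cut_kernel\<close> is at least
  \<open>min 1 (\<epsilon> powr (1 + s))\<close>; dividing by this constant dominates the
  kernel.\<close>

lemma frac_kernel_integrable_off_ball:
  fixes x :: "'a::euclidean_space"
  assumes "0 < s" "s < 1" "0 < \<epsilon>"
  shows "integrable lborel (\<lambda>y. indicator (- ball x \<epsilon>) y * frac_kernel s x y)"
proof (rule Bochner_Integration.integrable_bound)
  let ?C = "1 / min 1 (\<epsilon> powr (1 + s))"
  show "integrable lborel (\<lambda>y. ?C * cut_kernel s (x - y))"
    using integral_lborel_translate(3)[of "cut_kernel s" x] integrable_cut_kernel[OF assms(1,2)] by auto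
  have "indicator (- ball x \<epsilon>) y * frac_kernel s x y \<le> ?C * cut_kernel s (x - y)" for y
  proof (cases "y \<in> ball x \<epsilon>")
    case False
    then have "\<epsilon> powr (1 + s) \<le> norm (x - y) powr (1 + s)"
      using assms by (intro powr_mono2) (auto simp: dist_norm)
    then have "1 \<le> ?C * min 1 (norm (x - y) powr (1 + s))"
      using assms by (auto simp: field_simps min_def)
    then have "1 * frac_kernel s x y \<le> ?C * min 1 (norm (x - y) powr (1 + s)) * frac_kernel s x y"
      by (rule mult_right_mono) simp
    then show ?thesis using False by (simp add: cut_kernel_def frac_kernel_diff[of s x y])
  qed auto
  then show "AE y in lborel. norm (indicator (- ball x \<epsilon>) y * frac_kernel s x y)
      \<le> norm (?C * cut_kernel s (x - y))"
    by (auto intro: order_trans[OF _ abs_ge_self])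
qed auto

section \<open>The principal value\<close>

text \<open>The function \<phi>(x + tz) + \<phi>(x - tz) of t has as derivative a difference of
  gradients at points 2t|z| apart, applied to z. The gradient is Lipschitz because partial
  derivatives of test functions are test functions, so the mean value theorem on [0,1] yields the
  second power of |z|.\<close>

lemma test_function_second_difference:
  fixes \<phi> :: "'a::euclidean_space \<Rightarrow> real"
  assumes "\<phi> \<in> test_functions D"
  obtains C where "0 \<le> C" "\<And>x z. \<bar>2 * \<phi> x - \<phi> (x + z) - \<phi> (x - z)\<bar> \<le> C * (norm z)\<^sup>2"
proof -
  have diff: "\<phi> differentiable at x" for x
    using assms C_k.simps(2)[of 0 \<phi>] by (auto simp: test_functions_iff)
  have "\<exists>L. \<forall>x y. \<bar>partial_deriv b \<phi> x - partial_deriv b \<phi> y\<bar> \<le> L * norm (x - y)" if "b \<in> Basis" for b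
    using test_function_lipschitz[OF test_functions_partial_deriv[OF assms that]] by metis
  then obtain L where L: "\<And>b x y. b \<in> Basis \<Longrightarrow>
      \<bar>partial_deriv b \<phi> x - partial_deriv b \<phi> y\<bar> \<le> L b * norm (x - y)" by metis
  define M where "M = (\<Sum>b\<in>Basis. \<bar>L b\<bar>)"
  let ?F = "\<lambda>x. frechet_derivative \<phi> (at x)"
  have F: "\<bar>?F x h - ?F y h\<bar> \<le> M * norm (x - y) * norm h" for x y h
  proof -
    have "?F x h - ?F y h = (\<Sum>b\<in>Basis. (h \<bullet> b) * (partial_deriv b \<phi> x - partial_deriv b \<phi> y))"
      by (simp add: frechet_derivative_sum diff sum_subtractf right_diff_distrib)
    also have "\<bar>\<dots>\<bar> \<le> (\<Sum>b\<in>Basis. \<bar>(h \<bullet> b) * (partial_deriv b \<phi> x - partial_deriv b \<phi> y)\<bar>)"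
      by (rule sum_abs)
    also have "\<dots> \<le> (\<Sum>b\<in>Basis. \<bar>L b\<bar> * (norm (x - y) * norm h))"
    proof (rule sum_mono)
      fix b :: 'a assume b: "b \<in> Basis"
      have "\<bar>partial_deriv b \<phi> x - partial_deriv b \<phi> y\<bar> \<le> \<bar>L b\<bar> * norm (x - y)"
        using L[OF b, of x y] by (rule order_trans) (auto intro: mult_right_mono)
      then have "\<bar>h \<bullet> b\<bar> * \<bar>partial_deriv b \<phi> x - partial_deriv b \<phi> y\<bar> \<le> norm h * (\<bar>L b\<bar> * norm (x - y))"
        using Basis_le_norm[OF b, of h] by (intro mult_mono) auto
      then show "\<bar>(h \<bullet> b) * (partial_deriv b \<phi> x - partial_deriv b \<phi> y)\<bar> \<le> \<bar>L b\<bar> * (norm (x - y) * norm h)"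
        by (simp add: abs_mult mult_ac)
    qed
    also have "\<dots> = M * norm (x - y) * norm h" by (simp add: M_def sum_distrib_right mult.assoc)
    finally show ?thesis .
  qed
  have "\<bar>2 * \<phi> x - \<phi> (x + z) - \<phi> (x - z)\<bar> \<le> 2 * M * (norm z)\<^sup>2" for x z
  proof -
    let ?k = "\<lambda>t. \<phi> (x + t *\<^sub>R z) + \<phi> (x - t *\<^sub>R z)"
    let ?k' = "\<lambda>t. ?F (x + t *\<^sub>R z) z - ?F (x - t *\<^sub>R z) z"
    have lin: "linear (?F y)" for y using has_derivative_frechet[OF diff] by (rule has_derivative_linear)
    have "(?k has_real_derivative ?k' t) (at t)" for t
    proof -
      have "(?k has_derivative (\<lambda>h. ?F (x + t *\<^sub>R z) (h *\<^sub>R z) + ?F (x - t *\<^sub>R z) (- (h *\<^sub>R z)))) (at t)"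
        by (intro has_derivative_add has_derivative_compose[OF _ has_derivative_frechet[OF diff]])
           (auto intro!: derivative_eq_intros)
      then show ?thesis
        unfolding has_field_derivative_def
        by (rule has_derivative_eq_rhs) (auto simp: fun_eq_iff linear_scale[OF lin] linear_neg[OF lin] algebra_simps)
    qed
    then obtain \<xi> :: real where \<xi>: "0 < \<xi>" "\<xi> < 1" "?k 1 - ?k 0 = (1 - 0) * ?k' \<xi>"
      using MVT2[of 0 1 ?k ?k'] by auto
    have "\<bar>?k' \<xi>\<bar> \<le> M * norm ((2 * \<xi>) *\<^sub>R z) * norm z"
      using F[of "x + \<xi> *\<^sub>R z" z "x - \<xi> *\<^sub>R z"] by (simp add: scaleR_2[symmetric] algebra_simps)
    also have "\<dots> \<le> 2 * M * (norm z)\<^sup>2"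
    proof -
      have "\<xi> * (M * (norm z)\<^sup>2) \<le> 1 * (M * (norm z)\<^sup>2)"
        using \<xi> by (intro mult_right_mono) (auto simp: M_def sum_nonneg)
      then show ?thesis using \<xi> by (simp add: power2_eq_square algebra_simps)
    qed
    finally show ?thesis using \<xi>(3) by (simp add: abs_le_iff)
  qed
  moreover have "0 \<le> 2 * M" by (simp add: M_def sum_nonneg)
  ultimately show thesis using that by blast
qed

lemma set_integrable_difference_kernel:
  fixes \<phi> :: "'a::euclidean_space \<Rightarrow> real"
  assumes "0 < s" "s < 1" "0 < \<epsilon>" "\<And>x. \<bar>\<phi> x\<bar> \<le> B" and [measurable]: "\<phi> \<in> borel_measurable borel"
  shows "set_integrable lborel (UNIV - ball x \<epsilon>) (\<lambda>y. (\<phi> x - \<phi> y) * frac_kernel s x y)"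
  unfolding set_integrable_def
proof (rule Bochner_Integration.integrable_bound)
  have [measurable]: "ball x \<epsilon> \<in> sets borel" by simp
  show "(\<lambda>y. indicator (UNIV - ball x \<epsilon>) y *\<^sub>R ((\<phi> x - \<phi> y) * frac_kernel s x y))
      \<in> borel_measurable lborel" by measurable
  show "integrable lborel (\<lambda>y. (2 * B) * (indicator (- ball x \<epsilon>) y * frac_kernel s x y))"
    using frac_kernel_integrable_off_ball[OF assms(1-3)] by auto
  have "\<bar>(\<phi> x - \<phi> y) * frac_kernel s x y\<bar> \<le> 2 * B * frac_kernel s x y" for y
    using assms(4)[of x] assms(4)[of y] by (auto simp: abs_mult intro!: mult_right_mono)
  then show "AE y in lborel. norm (indicator (UNIV - ball x \<epsilon>) y *\<^sub>R ((\<phi> x - \<phi> y) * frac_kernel s x y))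
      \<le> norm ((2 * B) * (indicator (- ball x \<epsilon>) y * frac_kernel s x y))"
    by (auto simp: indicator_def intro: order_trans[OF _ abs_ge_self])
qed

text \<open>Averaging the substitutions y = x + z and y = x - z cancels the odd part of the
  singularity: the integrand becomes a second difference, of order |z|^2, where the first difference
  is only of order |z|.\<close>

lemma frac_lap_cutoff_symmetric:
  fixes \<phi> :: "'a::euclidean_space \<Rightarrow> real"
  assumes "0 < s" "s < 1" "0 < \<epsilon>" "\<And>x. \<bar>\<phi> x\<bar> \<le> B" and [measurable]: "\<phi> \<in> borel_measurable borel"
  shows "frac_lap_cutoff c s UNIV \<phi> x \<epsilon> =
    c / 2 * (\<integral>z. indicator (- ball 0 \<epsilon>) z * ((2 * \<phi> x - \<phi> (x + z) - \<phi> (x - z)) * frac_kernel s z 0) \<partial>lborel)"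
proof -
  let ?f = "\<lambda>y. indicator (- ball x \<epsilon>) y * ((\<phi> x - \<phi> y) * frac_kernel s x y)"
  have f: "integrable lborel ?f"
    using set_integrable_difference_kernel[OF assms] by (simp add: set_integrable_def Compl_eq_Diff_UNIV)
  have [measurable]: "?f \<in> borel_measurable borel" by measurable
  have ind: "indicator (- ball x \<epsilon>) (x + z) = indicator (- ball 0 \<epsilon>) z"
    "indicator (- ball x \<epsilon>) (x - z) = indicator (- ball 0 \<epsilon>) z" for z
    by (auto simp: indicator_def dist_norm)
  have k: "frac_kernel s x (x + z) = frac_kernel s z 0" "frac_kernel s x (x - z) = frac_kernel s z 0" for z
    by (simp_all add: frac_kernel_def)
  have "2 * (\<integral>y. ?f y \<partial>lborel) = (\<integral>z. ?f (x + z) \<partial>lborel) + (\<integral>z. ?f (x - z) \<partial>lborel)"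
    using integral_lborel_translate(1,2)[of ?f x] by simp
  also have "\<dots> = (\<integral>z. ?f (x + z) + ?f (x - z) \<partial>lborel)"
    using integral_lborel_translate(3,4)[of ?f x] f by (intro Bochner_Integration.integral_add[symmetric]) auto
  also have "\<dots> = (\<integral>z. indicator (- ball 0 \<epsilon>) z * ((2 * \<phi> x - \<phi> (x + z) - \<phi> (x - z)) * frac_kernel s z 0) \<partial>lborel)"
    unfolding ind k by (rule Bochner_Integration.integral_cong) (auto simp: algebra_simps)
  finally show ?thesis
    by (simp add: frac_lap_cutoff_def set_lebesgue_integral_def Compl_eq_Diff_UNIV)
qed

text \<open>\<open>frac_lap\<close> is defined by \<open>Lim\<close>, which carries information only
  for a convergent cutoff. Convergence for test functions is what later allows
  \<open>frac_lap\<close> of a sum to be split.\<close>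

lemma frac_lap_cutoff_convergent:
  fixes \<phi> :: "'a::euclidean_space \<Rightarrow> real"
  assumes "0 < s" "s < 1" "\<phi> \<in> test_functions D"
  shows "\<exists>l. (frac_lap_cutoff c s UNIV \<phi> x \<longlongrightarrow> l) (at_right 0)"
proof -
  obtain B where B: "\<And>x. \<bar>\<phi> x\<bar> \<le> B" "0 \<le> B" using test_function_bounded[OF assms(3)] by blast
  obtain C where C: "0 \<le> C" "\<And>x z. \<bar>2 * \<phi> x - \<phi> (x + z) - \<phi> (x - z)\<bar> \<le> C * (norm z)\<^sup>2"
    using test_function_second_difference[OF assms(3)] by blast
  have [measurable]: "\<phi> \<in> borel_measurable borel" using test_function_measurable[OF assms(3)] by blast
  let ?g = "\<lambda>z. (2 * \<phi> x - \<phi> (x + z) - \<phi> (x - z)) * frac_kernel s z 0"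
  \<comment> \<open>C serves |z| < 1, where |z|^2 \<le> |z|^(1+s); 4 B serves |z| \<ge> 1, where the
    weight of \<open>cut_kernel\<close> is 1.\<close>
  let ?M = "max C (4 * B)"
  have g: "\<bar>?g z\<bar> \<le> ?M * cut_kernel s z" for z
  proof -
    have "\<bar>2 * \<phi> x - \<phi> (x + z) - \<phi> (x - z)\<bar> \<le> ?M * min 1 (norm z powr (1 + s))"
    proof (cases "norm z \<ge> 1")
      case True
      then have "min 1 (norm z powr (1 + s)) = 1" using assms by (simp add: ge_one_powr_ge_zero)
      moreover have "\<bar>2 * \<phi> x - \<phi> (x + z) - \<phi> (x - z)\<bar> \<le> 4 * B"
        using B(1)[of x] B(1)[of "x + z"] B(1)[of "x - z"] by linarith
      ultimately show ?thesis by simp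
    next
      case False
      then have "(norm z)\<^sup>2 \<le> norm z powr (1 + s)"
        using powr_mono'[of "1 + s" 2 "norm z"] assms by (simp add: powr_numeral)
      then have "\<bar>2 * \<phi> x - \<phi> (x + z) - \<phi> (x - z)\<bar> \<le> C * norm z powr (1 + s)"
        using order_trans[OF C(2)] C(1) mult_left_mono by blast
      also have "\<dots> \<le> ?M * norm z powr (1 + s)" by (intro mult_right_mono) auto
      finally show ?thesis using False assms powr_le1[of "1 + s" "norm z"] by simp
    qed
    then have "\<bar>2 * \<phi> x - \<phi> (x + z) - \<phi> (x - z)\<bar> * frac_kernel s z 0
        \<le> ?M * min 1 (norm z powr (1 + s)) * frac_kernel s z 0" by (rule mult_right_mono) simp
    then show ?thesis by (simp add: abs_mult cut_kernel_def)
  qed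
  have i: "integrable lborel (\<lambda>z. ?M * cut_kernel s (z::'a))"
    using integrable_cut_kernel[OF assms(1,2)] by auto
  let ?G = "\<lambda>\<epsilon> z. indicator (- ball 0 \<epsilon>) z * ?g z"
  have "((\<lambda>\<epsilon>. \<integral>z. ?G \<epsilon> z \<partial>lborel) \<longlongrightarrow> (\<integral>z. ?g z \<partial>lborel)) (at_right 0)"
  proof (rule tendsto_at_right_sequentially[of 0 1])
    fix S :: "nat \<Rightarrow> real"
    assume S: "\<And>n. 0 < S n" "\<And>n. S n < 1" "decseq S" "S \<longlonglongrightarrow> 0"
    show "(\<lambda>n. \<integral>z. ?G (S n) z \<partial>lborel) \<longlonglongrightarrow> (\<integral>z. ?g z \<partial>lborel)"
    proof (rule integral_dominated_convergence[OF _ _ i])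
      show "AE z in lborel. (\<lambda>n. ?G (S n) z) \<longlonglongrightarrow> ?g z"
      proof (rule AE_I2)
        fix z :: 'a
        show "(\<lambda>n. ?G (S n) z) \<longlonglongrightarrow> ?g z"
        proof (cases "z = 0")
          \<comment> \<open>At the origin the kernel has the default value 0, so the whole sequence
            and its limit vanish there.\<close>
          case True then show ?thesis by (simp add: frac_kernel_def)
        next
          case False
          then have "\<forall>\<^sub>F n in sequentially. S n < norm z" using order_tendstoD(2)[OF S(4)] by auto
          then have "\<forall>\<^sub>F n in sequentially. ?g z = ?G (S n) z" by eventually_elim (auto simp: indicator_def)
          then show ?thesis by (rule Lim_transform_eventually[OF tendsto_const])
        qed
      qed
      show "AE z in lborel. norm (?G (S n) z) \<le> ?M * cut_kernel s z" for n
        using g B(2) by (auto simp: indicator_def intro!: mult_nonneg_nonneg)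
    qed measurable
  qed simp
  then have "((\<lambda>\<epsilon>. c / 2 * (\<integral>z. ?G \<epsilon> z \<partial>lborel)) \<longlongrightarrow> c / 2 * (\<integral>z. ?g z \<partial>lborel)) (at_right 0)"
    by (intro tendsto_intros)
  moreover have "\<forall>\<^sub>F \<epsilon> in at_right 0. c / 2 * (\<integral>z. ?G \<epsilon> z \<partial>lborel) = frac_lap_cutoff c s UNIV \<phi> x \<epsilon>"
    using frac_lap_cutoff_symmetric[OF assms(1,2) _ B(1), where c = c and x = x]
    by (auto simp: eventually_at_right_field intro!: exI[of _ 1])
  ultimately show ?thesis using Lim_transform_eventually by blast
qed

section \<open>The measurement operator\<close>

lemma Hs_borel [measurable_dest]: "v \<in> Hs s \<Longrightarrow> v \<in> borel_measurable borel"
  by (simp add: Hs_def)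

locale fractional_measurement =
  fixes c s d0 :: real and \<Omega> W :: "'a::euclidean_space set"
  assumes c_pos: "0 < c" and s_pos: "0 < s" and s_less: "s < 1"
    and open_\<Omega>: "open \<Omega>" and bounded_\<Omega>: "bounded \<Omega>"
    and open_W: "open W" and bounded_W: "bounded W"
    and W_exterior: "closure W \<subseteq> exterior \<Omega>"
    and setdist_W: "setdist W \<Omega> = d0" and d0_pos: "0 < d0"
begin

sublocale H: semi_inner "Hs s :: ('a \<Rightarrow> real) set" "Hs_inner c s"
  by (rule semi_inner_Hs[OF c_pos])

abbreviation hs ("\<parallel>_\<parallel>") where "\<parallel>v\<parallel> \<equiv> Hs_norm c s v"

lemma hs_nonneg: "0 \<le> \<parallel>v\<parallel>" by (rule Hs_norm_nonneg[OF c_pos])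

lemma hs_add: "u \<in> Hs s \<Longrightarrow> v \<in> Hs s \<Longrightarrow> \<parallel>\<lambda>x. u x + v x\<parallel> \<le> \<parallel>u\<parallel> + \<parallel>v\<parallel>" for u v :: "'a \<Rightarrow> real"
  using H.triangle[of u v] by (simp add: Hs_norm_eq)

lemma hs_scale: "u \<in> Hs s \<Longrightarrow> \<parallel>\<lambda>x. a * u x\<parallel> = \<bar>a\<bar> * \<parallel>u\<parallel>" for u :: "'a \<Rightarrow> real"
  using H.scale_left[of u "\<lambda>x. a * u x" a] H.scale_right[of u u a] H.scale_mem[of u a]
  by (simp add: Hs_norm_eq real_sqrt_mult power2_eq_square[symmetric] mult.assoc[symmetric] real_sqrt_abs)

lemma hs_minus_commute: "u \<in> Hs s \<Longrightarrow> v \<in> Hs s \<Longrightarrow> \<parallel>\<lambda>x. u x - v x\<parallel> = \<parallel>\<lambda>x. v x - u x\<parallel>" for u v :: "'a \<Rightarrow> real"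
  using hs_scale[OF H.diff_mem[of u v], of "-1"] by simp

lemma hs_triangle3:
  fixes u v z :: "'a \<Rightarrow> real"
  assumes "u \<in> Hs s" "v \<in> Hs s" "z \<in> Hs s"
  shows "\<parallel>\<lambda>x. u x - z x\<parallel> \<le> \<parallel>\<lambda>x. u x - v x\<parallel> + \<parallel>\<lambda>x. v x - z x\<parallel>"
  using hs_add[OF H.diff_mem[OF assms(1,2)] H.diff_mem[OF assms(2,3)]] by simp

lemma Hs_tildeD: "v \<in> Hs_tilde c s \<Omega> \<Longrightarrow> v \<in> Hs s"
  by (simp add: Hs_tilde_def)

lemma Hs_tilde_subset_L2: "v \<in> Hs_tilde c s \<Omega> \<Longrightarrow> v \<in> L2 UNIV"
  using Hs_tildeD Hs_subset_L2 by blast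

lemma test_functions_Hs_tilde: "\<phi> \<in> test_functions \<Omega> \<Longrightarrow> \<phi> \<in> Hs_tilde c s \<Omega>"
proof -
  assume \<phi>: "\<phi> \<in> test_functions \<Omega>"
  have "\<parallel>\<lambda>x. \<phi> x - \<phi> x\<parallel> = 0" by (simp add: Hs_norm_def frac_form_eq gagliardo_quotient_def L2_norm_def L2_inner_eq)
  then show ?thesis
    unfolding Hs_tilde_def using \<phi> test_functions_Hs[OF \<phi> s_pos s_less] by (auto intro!: bexI[of _ \<phi>])
qed

lemma Hs_tilde_approx:
  assumes "v \<in> Hs_tilde c s \<Omega>" "0 < \<epsilon>"
  obtains \<phi> where "\<phi> \<in> test_functions \<Omega>" "\<phi> \<in> Hs s" "\<parallel>\<lambda>x. v x - \<phi> x\<parallel> < \<epsilon>"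
  using assms test_functions_Hs[OF _ s_pos s_less] unfolding Hs_tilde_def by blast

lemma Hs_tilde_limit:
  assumes "v \<in> Hs s" "\<And>\<epsilon>. 0 < \<epsilon> \<Longrightarrow> \<exists>z\<in>Hs_tilde c s \<Omega>. \<parallel>\<lambda>x. v x - z x\<parallel> < \<epsilon>"
  shows "v \<in> Hs_tilde c s \<Omega>"
  unfolding Hs_tilde_def
proof (intro CollectI conjI allI impI assms(1))
  fix \<epsilon> :: real assume "0 < \<epsilon>"
  then obtain z where z: "z \<in> Hs_tilde c s \<Omega>" "\<parallel>\<lambda>x. v x - z x\<parallel> < \<epsilon> / 2"
    using assms(2)[of "\<epsilon> / 2"] by auto
  obtain \<phi> where \<phi>: "\<phi> \<in> test_functions \<Omega>" "\<phi> \<in> Hs s" "\<parallel>\<lambda>x. z x - \<phi> x\<parallel> < \<epsilon> / 2"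
    using Hs_tilde_approx[OF z(1), of "\<epsilon> / 2"] \<open>0 < \<epsilon>\<close> by auto
  have "\<parallel>\<lambda>x. v x - \<phi> x\<parallel> < \<epsilon>"
    using hs_triangle3[OF assms(1) Hs_tildeD[OF z(1)] \<phi>(2)] z \<phi> by linarith
  with \<phi>(1) show "\<exists>\<phi>\<in>test_functions \<Omega>. \<parallel>\<lambda>x. v x - \<phi> x\<parallel> < \<epsilon>" by blast
qed

lemma Hs_tilde_lincomb:
  assumes u: "u \<in> Hs_tilde c s \<Omega>" and v: "v \<in> Hs_tilde c s \<Omega>"
  shows "(\<lambda>x. a * u x + b * v x) \<in> Hs_tilde c s \<Omega>"
proof (rule Hs_tilde_limit)
  show "(\<lambda>x. a * u x + b * v x) \<in> Hs s" using H.lincomb_mem u v Hs_tildeD by blast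
next
  fix \<epsilon> :: real assume "0 < \<epsilon>"
  define k where "k = \<epsilon> / (\<bar>a\<bar> + \<bar>b\<bar> + 1)"
  have "0 < k" using \<open>0 < \<epsilon>\<close> by (simp add: k_def add_nonneg_pos)
  moreover have "k * (\<bar>a\<bar> + \<bar>b\<bar> + 1) = \<epsilon>" by (simp add: k_def)
  ultimately have k: "0 < k" "\<bar>a\<bar> * k + \<bar>b\<bar> * k < \<epsilon>" by (auto simp: algebra_simps)
  obtain \<phi> where \<phi>: "\<phi> \<in> test_functions \<Omega>" "\<phi> \<in> Hs s" "\<parallel>\<lambda>x. u x - \<phi> x\<parallel> < k"
    using Hs_tilde_approx[OF u k(1)] by blast
  obtain \<psi> where \<psi>: "\<psi> \<in> test_functions \<Omega>" "\<psi> \<in> Hs s" "\<parallel>\<lambda>x. v x - \<psi> x\<parallel> < k"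
    using Hs_tilde_approx[OF v k(1)] by blast
  have d: "(\<lambda>x. u x - \<phi> x) \<in> Hs s" "(\<lambda>x. v x - \<psi> x) \<in> Hs s"
    using H.diff_mem \<phi> \<psi> u v Hs_tildeD by auto
  have "\<parallel>\<lambda>x. a * (u x - \<phi> x) + b * (v x - \<psi> x)\<parallel> \<le> \<bar>a\<bar> * \<parallel>\<lambda>x. u x - \<phi> x\<parallel> + \<bar>b\<bar> * \<parallel>\<lambda>x. v x - \<psi> x\<parallel>"
    using hs_add[OF H.scale_mem[OF d(1), of a] H.scale_mem[OF d(2), of b]] hs_scale d by simp
  also have "\<dots> \<le> \<bar>a\<bar> * k + \<bar>b\<bar> * k"
    using \<phi> \<psi> by (intro add_mono mult_left_mono) auto
  finally have "\<parallel>\<lambda>x. (a * u x + b * v x) - (a * \<phi> x + b * \<psi> x)\<parallel> < \<epsilon>"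
    using k(2) by (simp add: algebra_simps)
  then show "\<exists>z\<in>Hs_tilde c s \<Omega>. \<parallel>\<lambda>x. (a * u x + b * v x) - z x\<parallel> < \<epsilon>"
    by (rule bexI[of _ "\<lambda>x. a * \<phi> x + b * \<psi> x"])
       (rule test_functions_Hs_tilde[OF test_functions_lincomb[OF \<phi>(1) \<psi>(1)]])
qed

lemma Hs_tilde_diff: "u \<in> Hs_tilde c s \<Omega> \<Longrightarrow> v \<in> Hs_tilde c s \<Omega> \<Longrightarrow> (\<lambda>x. u x - v x) \<in> Hs_tilde c s \<Omega>"
  using Hs_tilde_lincomb[of u v 1 "-1"] by simp

text \<open>Test functions vanish off \<Omega>, so the squared mass of v there is at most its
  squared L2 distance to any of them, and this distance can be made arbitrarily small.\<close>

lemma Hs_tilde_AE_0: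
  assumes "v \<in> Hs_tilde c s \<Omega>"
  shows "AE x in lborel. x \<notin> \<Omega> \<longrightarrow> v x = 0"
proof -
  have [measurable]: "\<Omega> \<in> sets borel" using open_\<Omega> by simp
  have [measurable]: "v \<in> borel_measurable borel" using Hs_tildeD[OF assms] by (rule Hs_borel)
  let ?g = "\<lambda>x. indicator (- \<Omega>) x * (v x)\<^sup>2"
  have vi: "integrable lborel (\<lambda>x. (v x)\<^sup>2)" using Hs_tildeD[OF assms] by (simp add: Hs_def)
  have gi: "integrable lborel ?g"
    by (rule Bochner_Integration.integrable_bound[OF vi]) (auto simp: indicator_def)
  have "(\<integral>x. ?g x \<partial>lborel) \<le> 0"
  proof (rule field_le_epsilon)
    fix \<epsilon> :: real assume "0 < \<epsilon>"
    then obtain \<phi> where \<phi>: "\<phi> \<in> test_functions \<Omega>" "\<phi> \<in> Hs s" "\<parallel>\<lambda>x. v x - \<phi> x\<parallel> < sqrt \<epsilon>"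
      using Hs_tilde_approx[OF assms, of "sqrt \<epsilon>"] by auto
    have d: "(\<lambda>x. v x - \<phi> x) \<in> Hs s" using H.diff_mem[OF Hs_tildeD[OF assms] \<phi>(2)] .
    have "?g x \<le> (v x - \<phi> x)\<^sup>2" for x
      using \<phi>(1) by (cases "x \<in> \<Omega>") (auto simp: test_functions_iff)
    moreover have "integrable lborel (\<lambda>x. (v x - \<phi> x)\<^sup>2)" using d by (simp add: Hs_def)
    ultimately have "(\<integral>x. ?g x \<partial>lborel) \<le> (\<integral>x. (v x - \<phi> x)\<^sup>2 \<partial>lborel)"
      using gi by (intro integral_mono) auto
    also have "\<dots> = (L2_norm UNIV (\<lambda>x. v x - \<phi> x))\<^sup>2"
      unfolding L2_norm_UNIV_power2 L2_inner_eq by (simp add: power2_eq_square)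
    also have "\<dots> \<le> (sqrt \<epsilon>)\<^sup>2"
      using L2_norm_le_Hs_norm[OF c_pos, of "\<lambda>x. v x - \<phi> x" s] \<phi>(3) by (intro power_mono) auto
    finally show "(\<integral>x. ?g x \<partial>lborel) \<le> 0 + \<epsilon>" using \<open>0 < \<epsilon>\<close> by simp
  qed
  moreover have "0 \<le> (\<integral>x. ?g x \<partial>lborel)" by (intro integral_nonneg_AE) auto
  ultimately have "(\<integral>x. ?g x \<partial>lborel) = 0" by simp
  then have "AE x in lborel. ?g x = 0"
    using integral_nonneg_eq_0_iff_AE[OF gi] by auto
  then show ?thesis by eventually_elim (auto simp: indicator_def)
qed

section \<open>Bounds and continuity of the measurement at positive distance\<close>

lemma dist_W_\<Omega>: "x \<in> closure W \<Longrightarrow> y \<in> \<Omega> \<Longrightarrow> d0 \<le> norm (x - y)"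
  using setdist_le_dist[of x "closure W" y \<Omega>] setdist_W by (simp add: dist_norm)

definition kernel_max :: real where "kernel_max = d0 powr - (real DIM('a) + 2 * s)"

lemma kernel_le: "x \<in> closure W \<Longrightarrow> y \<in> \<Omega> \<Longrightarrow> frac_kernel s x y \<le> kernel_max"
  using dist_W_\<Omega>[of x y] d0_pos s_pos
  unfolding frac_kernel_def kernel_max_def powr_minus_divide[symmetric]
  by (intro powr_mono2') auto

lemma kernel_max_nonneg: "0 \<le> kernel_max" by (simp add: kernel_max_def)

lemma indicator_\<Omega>_square_integrable: "indicator \<Omega> \<in> square_integrable (lborel :: 'a measure)"
proof -
  have "integrable lborel (indicator \<Omega> :: 'a \<Rightarrow> real)"
    using open_\<Omega> emeasure_bounded_finite[OF bounded_\<Omega>] by (intro integrable_real_indicator) auto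
  moreover have "(\<lambda>x. (indicator \<Omega> x)\<^sup>2) = (indicator \<Omega> :: 'a \<Rightarrow> real)" by (auto simp: indicator_def)
  ultimately show ?thesis using open_\<Omega> by (simp add: square_integrable_def)
qed

lemma L2_integrable_\<Omega>:
  assumes "v \<in> L2 UNIV"
  shows "integrable lborel (\<lambda>y. indicator \<Omega> y * v y)"
    and "integrable lborel (\<lambda>y. indicator \<Omega> y * \<bar>v y\<bar>)"
    and "(\<integral>y. indicator \<Omega> y * \<bar>v y\<bar> \<partial>lborel) \<le> sqrt (measure lborel \<Omega>) * L2_norm UNIV v"
proof -
  interpret S: semi_inner "square_integrable (lborel :: 'a measure)" "\<lambda>f g. \<integral>x. f x * g x \<partial>lborel"
    by (rule semi_inner_square_integrable)
  have v: "v \<in> square_integrable lborel" "(\<lambda>x. \<bar>v x\<bar>) \<in> square_integrable lborel"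
    using assms by (auto simp: L2_UNIV square_integrable_def)
  show "integrable lborel (\<lambda>y. indicator \<Omega> y * v y)" "integrable lborel (\<lambda>y. indicator \<Omega> y * \<bar>v y\<bar>)"
    using square_integrable_mult[OF indicator_\<Omega>_square_integrable] v by auto
  have "(\<integral>y. indicator \<Omega> y * \<bar>v y\<bar> \<partial>lborel)
      \<le> sqrt (\<integral>y. indicator \<Omega> y * indicator \<Omega> y \<partial>lborel) * sqrt (\<integral>y. \<bar>v y\<bar> * \<bar>v y\<bar> \<partial>lborel)"
    using S.Cauchy_Schwarz[OF indicator_\<Omega>_square_integrable v(2)] by linarith
  also have "(\<integral>y. indicator \<Omega> y * indicator \<Omega> y \<partial>lborel) = measure lborel \<Omega>"
    using open_\<Omega> by (simp add: indicator_inter_arith[symmetric])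
  also have "sqrt (\<integral>y. \<bar>v y\<bar> * \<bar>v y\<bar> \<partial>lborel) = L2_norm UNIV v"
    by (simp add: L2_norm_def L2_inner_eq)
  finally show "(\<integral>y. indicator \<Omega> y * \<bar>v y\<bar> \<partial>lborel) \<le> sqrt (measure lborel \<Omega>) * L2_norm UNIV v" .
qed

lemma meas_op_eq: "meas_op c s \<Omega> v x = - c * (\<integral>y. indicator \<Omega> y * (v y * frac_kernel s x y) \<partial>lborel)"
  by (simp add: meas_op_def set_lebesgue_integral_def)

lemma kernel_dominated:
  assumes "x \<in> closure W"
  shows "\<bar>indicator \<Omega> y * (v y * frac_kernel s x y)\<bar> \<le> kernel_max * (indicator \<Omega> y * \<bar>v y\<bar>)"
  using kernel_le[OF assms, of y] mult_right_mono[of "frac_kernel s x y" kernel_max "\<bar>v y\<bar>"]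
  by (auto simp: indicator_def abs_mult mult.commute)

lemma kernel_integrable:
  assumes "v \<in> L2 UNIV" "x \<in> closure W"
  shows "integrable lborel (\<lambda>y. indicator \<Omega> y * (v y * frac_kernel s x y))"
proof (rule Bochner_Integration.integrable_bound)
  have [measurable]: "\<Omega> \<in> sets borel" "v \<in> borel_measurable borel"
    using open_\<Omega> L2_UNIV_borel[OF assms(1)] by auto
  show "(\<lambda>y. indicator \<Omega> y * (v y * frac_kernel s x y)) \<in> borel_measurable lborel" by measurable
  show "integrable lborel (\<lambda>y. kernel_max * (indicator \<Omega> y * \<bar>v y\<bar>))"
    using L2_integrable_\<Omega>(2)[OF assms(1)] by auto
  show "AE y in lborel. norm (indicator \<Omega> y * (v y * frac_kernel s x y))
      \<le> norm (kernel_max * (indicator \<Omega> y * \<bar>v y\<bar>))"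
    using kernel_dominated[OF assms(2)] by (auto intro: order_trans[OF _ abs_ge_self])
qed

lemma meas_op_lincomb:
  assumes "u \<in> L2 UNIV" "v \<in> L2 UNIV" "x \<in> closure W"
  shows "meas_op c s \<Omega> (\<lambda>x. a * u x + b * v x) x = a * meas_op c s \<Omega> u x + b * meas_op c s \<Omega> v x"
proof -
  have "(\<integral>y. indicator \<Omega> y * ((a * u y + b * v y) * frac_kernel s x y) \<partial>lborel)
      = (\<integral>y. a * (indicator \<Omega> y * (u y * frac_kernel s x y)) + b * (indicator \<Omega> y * (v y * frac_kernel s x y)) \<partial>lborel)"
    by (rule Bochner_Integration.integral_cong) (auto simp: algebra_simps)
  also have "\<dots> = a * (\<integral>y. indicator \<Omega> y * (u y * frac_kernel s x y) \<partial>lborel)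
      + b * (\<integral>y. indicator \<Omega> y * (v y * frac_kernel s x y) \<partial>lborel)"
    using kernel_integrable[OF assms(1,3)] kernel_integrable[OF assms(2,3)] by simp
  finally show ?thesis unfolding meas_op_eq by (simp add: algebra_simps)
qed

definition meas_bound :: real where
  "meas_bound = c * kernel_max * sqrt (measure lborel \<Omega>)"

lemma meas_bound_nonneg: "0 \<le> meas_bound"
  using c_pos kernel_max_nonneg by (simp add: meas_bound_def)

lemma meas_op_bound:
  assumes "v \<in> L2 UNIV" "x \<in> closure W"
  shows "\<bar>meas_op c s \<Omega> v x\<bar> \<le> meas_bound * L2_norm UNIV v"
proof -
  have "\<bar>\<integral>y. indicator \<Omega> y * (v y * frac_kernel s x y) \<partial>lborel\<bar>
      \<le> (\<integral>y. \<bar>indicator \<Omega> y * (v y * frac_kernel s x y)\<bar> \<partial>lborel)" by (rule integral_abs_bound)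
  also have "\<dots> \<le> (\<integral>y. kernel_max * (indicator \<Omega> y * \<bar>v y\<bar>) \<partial>lborel)"
    using kernel_integrable[OF assms] L2_integrable_\<Omega>(2)[OF assms(1)] kernel_dominated[OF assms(2)]
    by (intro integral_mono) auto
  also have "\<dots> \<le> kernel_max * (sqrt (measure lborel \<Omega>) * L2_norm UNIV v)"
    using L2_integrable_\<Omega>(3)[OF assms(1)] kernel_max_nonneg by (simp add: mult_left_mono)
  finally show ?thesis
    using c_pos unfolding meas_op_eq meas_bound_def by (simp add: abs_mult mult.assoc)
qed

lemma meas_op_measurable:
  assumes "v \<in> L2 UNIV"
  shows "meas_op c s \<Omega> v \<in> borel_measurable borel"
proof -
  have [measurable]: "\<Omega> \<in> sets borel" "v \<in> borel_measurable borel" "v \<in> borel_measurable lborel"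
    using open_\<Omega> L2_UNIV_borel[OF assms(1)] by auto
  have [measurable]: "(\<lambda>p. frac_kernel s (fst p) (snd p)) \<in> borel_measurable (borel \<Otimes>\<^sub>M lborel)"
    unfolding frac_kernel_def by measurable
  show ?thesis unfolding meas_op_eq[abs_def] by measurable
qed

lemma bounded_in_L2_W:
  assumes [measurable]: "g \<in> borel_measurable borel" and b: "\<And>x. x \<in> W \<Longrightarrow> \<bar>g x\<bar> \<le> B" "0 \<le> B"
  shows "g \<in> L2 W" "L2_norm W g \<le> sqrt (measure lborel W) * B"
proof -
  have [measurable]: "W \<in> sets borel" using open_W by simp
  have i: "integrable lborel (\<lambda>x. indicator W x * B\<^sup>2)"
    using emeasure_bounded_finite[OF bounded_W] by (intro integrable_mult_left integrable_real_indicator) auto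
  have le: "(indicator W x * g x)\<^sup>2 \<le> indicator W x * B\<^sup>2" for x
    using b(1)[of x] power_mono[of "\<bar>g x\<bar>" B 2] by (auto simp: indicator_def)
  have gi: "integrable lborel (\<lambda>x. (indicator W x * g x)\<^sup>2)"
    by (rule Bochner_Integration.integrable_bound[OF i]) (use le in \<open>auto intro: order_trans[OF _ abs_ge_self]\<close>)
  then show "g \<in> L2 W" unfolding L2_iff square_integrable_def by simp
  have "L2_inner W g g = (\<integral>x. (indicator W x * g x)\<^sup>2 \<partial>lborel)"
    by (simp add: L2_inner_eq power2_eq_square)
  also have "\<dots> \<le> (\<integral>x. indicator W x * B\<^sup>2 \<partial>lborel)" using gi i le by (intro integral_mono) auto
  also have "\<dots> = measure lborel W * B\<^sup>2" by simp
  finally show "L2_norm W g \<le> sqrt (measure lborel W) * B"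
    using b(2) unfolding L2_norm_def by (intro real_le_lsqrt) (auto simp: power_mult_distrib)
qed

lemma meas_op_L2:
  assumes "v \<in> L2 UNIV"
  shows "meas_op c s \<Omega> v \<in> L2 W"
    and "L2_norm W (meas_op c s \<Omega> v) \<le> sqrt (measure lborel W) * (meas_bound * L2_norm UNIV v)"
  using bounded_in_L2_W[OF meas_op_measurable[OF assms], of "meas_bound * L2_norm UNIV v"]
    meas_op_bound[OF assms] closure_subset meas_bound_nonneg by auto

text \<open>On the closure of W the pole of the kernel stays at distance d0 from \<Omega>, which
  gives an integrable majorant for dominated convergence. The interpolation estimate is assumed for
  continuous functions, hence continuity has to be supplied.\<close>

lemma meas_op_continuous:
  assumes "v \<in> L2 UNIV"
  shows "continuous_on (closure W) (meas_op c s \<Omega> v)"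
proof (rule continuous_on_sequentiallyI)
  fix f a assume f: "\<forall>n. f n \<in> closure W" "a \<in> closure W" "f \<longlonglongrightarrow> a"
  have [measurable]: "\<Omega> \<in> sets borel" "v \<in> borel_measurable borel"
    using open_\<Omega> L2_UNIV_borel[OF assms(1)] by auto
  have "(\<lambda>n. \<integral>y. indicator \<Omega> y * (v y * frac_kernel s (f n) y) \<partial>lborel)
      \<longlonglongrightarrow> (\<integral>y. indicator \<Omega> y * (v y * frac_kernel s a y) \<partial>lborel)"
  proof (rule integral_dominated_convergence[where w = "\<lambda>y. kernel_max * (indicator \<Omega> y * \<bar>v y\<bar>)"])
    show "AE y in lborel. (\<lambda>n. indicator \<Omega> y * (v y * frac_kernel s (f n) y))
        \<longlonglongrightarrow> indicator \<Omega> y * (v y * frac_kernel s a y)"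
    proof (rule AE_I2)
      fix y
      show "(\<lambda>n. indicator \<Omega> y * (v y * frac_kernel s (f n) y)) \<longlonglongrightarrow> indicator \<Omega> y * (v y * frac_kernel s a y)"
      proof (cases "y \<in> \<Omega>")
        case True
        then have "norm (a - y) \<noteq> 0" using dist_W_\<Omega>[OF f(2) True] d0_pos by linarith
        then have "norm (a - y) powr (real DIM('a) + 2 * s) \<noteq> 0" by simp
        then show ?thesis
          unfolding frac_kernel_def using f(3) \<open>norm (a - y) \<noteq> 0\<close> by (intro tendsto_intros) auto
      qed simp
    qed
    show "AE y in lborel. norm (indicator \<Omega> y * (v y * frac_kernel s (f n) y)) \<le> kernel_max * (indicator \<Omega> y * \<bar>v y\<bar>)" for n
      using kernel_dominated f(1) by auto
    show "integrable lborel (\<lambda>y. kernel_max * (indicator \<Omega> y * \<bar>v y\<bar>))"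
      using L2_integrable_\<Omega>(2)[OF assms(1)] by auto
  qed measurable
  then show "(\<lambda>n. meas_op c s \<Omega> v (f n)) \<longlonglongrightarrow> meas_op c s \<Omega> v a"
    unfolding meas_op_eq by (intro tendsto_intros)
qed

text \<open>For \<epsilon> < d0 the ball around x misses \<Omega>, and v vanishes almost everywhere
  off \<Omega>, so excising the ball removes nothing and the cutoff is constant in \<epsilon>. The
  single value \<open>v x\<close> enters every difference and is not controlled by equality almost
  everywhere.\<close>

lemma frac_lap_cutoff_far:
  assumes "v \<in> Hs_tilde c s \<Omega>" "x \<in> closure W" "v x = 0" "0 < \<epsilon>" "\<epsilon> < d0"
  shows "set_integrable lborel (UNIV - ball x \<epsilon>) (\<lambda>y. (v x - v y) * frac_kernel s x y)"
    and "frac_lap_cutoff c s UNIV v x \<epsilon> = meas_op c s \<Omega> v x"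
proof -
  have v: "v \<in> L2 UNIV" using Hs_tilde_subset_L2[OF assms(1)] .
  have [measurable]: "\<Omega> \<in> sets borel" "ball x \<epsilon> \<in> sets borel" "v \<in> borel_measurable borel"
    using open_\<Omega> L2_UNIV_borel[OF v] by auto
  let ?f = "\<lambda>y. indicator (UNIV - ball x \<epsilon>) y * ((v x - v y) * frac_kernel s x y)"
  let ?g = "\<lambda>y. - (indicator \<Omega> y * (v y * frac_kernel s x y))"
  have ae: "AE y in lborel. ?g y = ?f y"
    using Hs_tilde_AE_0[OF assms(1)]
  proof eventually_elim
    case (elim y)
    show ?case
    proof (cases "y \<in> \<Omega>")
      case True
      then have "y \<notin> ball x \<epsilon>" using dist_W_\<Omega>[OF assms(2) True] assms(5) by (simp add: dist_norm)
      then show ?thesis using True assms(3) by simp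
    qed (use elim assms(3) in simp)
  qed
  have "integrable lborel ?g" using kernel_integrable[OF v assms(2)] by simp
  then have "integrable lborel ?f" using ae by (subst integrable_cong_AE[of _ _ ?g]) (auto, measurable)
  then show "set_integrable lborel (UNIV - ball x \<epsilon>) (\<lambda>y. (v x - v y) * frac_kernel s x y)"
    by (simp add: set_integrable_def)
  have "(\<integral>y. ?f y \<partial>lborel) = (\<integral>y. ?g y \<partial>lborel)"
    using ae by (intro integral_cong_AE) (auto, measurable)
  then show "frac_lap_cutoff c s UNIV v x \<epsilon> = meas_op c s \<Omega> v x"
    by (simp add: frac_lap_cutoff_def set_lebesgue_integral_def meas_op_eq)
qed

text \<open>With v = u0 and \<phi> the exterior datum this is the equation relating the measurement
  of u0 to the preprocessed data. The cutoff integral of v is constant for small \<epsilon> and that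
  of \<phi> converges, so the limit of the sum splits.\<close>

lemma meas_op_eq_data:
  assumes v: "v \<in> Hs_tilde c s \<Omega>" "\<And>x. x \<in> exterior \<Omega> \<Longrightarrow> v x = 0"
    and \<phi>: "\<phi> \<in> test_functions D" and x: "x \<in> closure W"
  shows "meas_op c s \<Omega> v x = frac_lap c s (\<lambda>x. v x + \<phi> x) x - frac_lap c s \<phi> x"
proof -
  obtain l where l: "(frac_lap_cutoff c s UNIV \<phi> x \<longlongrightarrow> l) (at_right 0)"
    using frac_lap_cutoff_convergent[OF s_pos s_less \<phi>] by blast
  obtain B where B: "\<And>x. \<bar>\<phi> x\<bar> \<le> B" using test_function_bounded[OF \<phi>] by blast
  have "((\<lambda>\<epsilon>. meas_op c s \<Omega> v x + frac_lap_cutoff c s UNIV \<phi> x \<epsilon>) \<longlongrightarrow> meas_op c s \<Omega> v x + l) (at_right 0)"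
    by (intro tendsto_intros l)
  moreover have "\<forall>\<^sub>F \<epsilon> in at_right 0. meas_op c s \<Omega> v x + frac_lap_cutoff c s UNIV \<phi> x \<epsilon>
      = frac_lap_cutoff c s UNIV (\<lambda>x. v x + \<phi> x) x \<epsilon>"
  proof -
    have "meas_op c s \<Omega> v x + frac_lap_cutoff c s UNIV \<phi> x \<epsilon> = frac_lap_cutoff c s UNIV (\<lambda>x. v x + \<phi> x) x \<epsilon>"
      if \<epsilon>: "0 < \<epsilon>" "\<epsilon> < d0" for \<epsilon>
    proof -
      have vx: "v x = 0" using v(2) x W_exterior by blast
      note a = frac_lap_cutoff_far[OF v(1) x vx \<epsilon>]
      note b = set_integrable_difference_kernel[OF s_pos s_less \<epsilon>(1) B test_function_measurable(2)[OF \<phi>], of x]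
      show ?thesis
        unfolding a(2)[symmetric] frac_lap_cutoff_def distrib_left[symmetric] set_integral_add(2)[OF a(1) b, symmetric]
        by (simp add: algebra_simps)
    qed
    then show ?thesis using d0_pos by (auto simp: eventually_at_right_field intro!: exI[of _ d0])
  qed
  ultimately have "(frac_lap_cutoff c s UNIV (\<lambda>x. v x + \<phi> x) x \<longlongrightarrow> meas_op c s \<Omega> v x + l) (at_right 0)"
    by (rule Lim_transform_eventually)
  then have "frac_lap c s (\<lambda>x. v x + \<phi> x) x = meas_op c s \<Omega> v x + l" "frac_lap c s \<phi> x = l"
    unfolding frac_lap_on_def using l by (auto intro!: tendsto_Lim)
  then show ?thesis by simp
qed

end

section \<open>Spectral source condition\<close>

context semi_inner
begin

lemma sum_mem: "(\<And>i. i \<in> I \<Longrightarrow> f i \<in> V) \<Longrightarrow> (\<lambda>x. \<Sum>i\<in>I. a i * f i x) \<in> V"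
proof (induction I rule: infinite_finite_induct)
  case (insert i I)
  then show ?case using add_mem[OF scale_mem[of "f i" "a i"], of "\<lambda>x. \<Sum>i\<in>I. a i * f i x"] by simp
qed (auto simp: zero_mem)

lemma zero_left: "z \<in> V \<Longrightarrow> B (\<lambda>x. 0) z = 0"
  using scale_left[of "\<lambda>x. 0" z 0] zero_mem by simp

lemma sum_left:
  "(\<And>i. i \<in> I \<Longrightarrow> f i \<in> V) \<Longrightarrow> z \<in> V \<Longrightarrow> B (\<lambda>x. \<Sum>i\<in>I. a i * f i x) z = (\<Sum>i\<in>I. a i * B (f i) z)"
proof (induction I rule: infinite_finite_induct)
  case (insert i I)
  then show ?case
    using add_left[OF scale_mem[of "f i" "a i"] sum_mem[of I f a]] scale_left[of "f i" z "a i"] by simp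
qed (auto simp: zero_left)

lemma orthonormal_sum_inner:
  assumes "\<And>j. e j \<in> V" "\<And>i j. B (e i) (e j) = (if i = j then 1 else 0 :: real)"
  shows "B (\<lambda>x. \<Sum>j<n::nat. a j * e j x) (e k) = (if k < n then a k else 0)"
proof -
  have "B (\<lambda>x. \<Sum>j<n. a j * e j x) (e k) = (\<Sum>j<n. a j * B (e j) (e k))"
    using sum_left[of "{..<n}" e "e k" a] assms(1) by simp
  then show ?thesis by (simp add: assms(2) if_distrib cong: if_cong)
qed

lemma orthonormal_sum_norm:
  assumes "\<And>j. e j \<in> V" "\<And>i j. B (e i) (e j) = (if i = j then 1 else 0 :: real)"
  shows "B (\<lambda>x. \<Sum>j<n::nat. a j * e j x) (\<lambda>x. \<Sum>j<n. a j * e j x) = (\<Sum>j<n. (a j)\<^sup>2)"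
proof -
  let ?S = "\<lambda>x. \<Sum>j<n. a j * e j x"
  have S: "?S \<in> V" using sum_mem[of "{..<n}" e a] assms(1) by simp
  have "B ?S ?S = (\<Sum>j<n. a j * B (e j) ?S)" using sum_left[of "{..<n}" e ?S a] assms(1) S by simp
  also have "\<dots> = (\<Sum>j<n. (a j)\<^sup>2)"
    using orthonormal_sum_inner[OF assms, of a n] commute[of "e _" ?S]
    by (intro sum.cong) (auto simp: power2_eq_square)
  finally show ?thesis .
qed

lemma Bessel:
  assumes "\<And>j. e j \<in> V" "\<And>i j. B (e i) (e j) = (if i = j then 1 else 0 :: real)" "v \<in> V"
  shows "(\<Sum>j<n::nat. (B v (e j))\<^sup>2) \<le> B v v"
proof -
  let ?S = "\<lambda>x. \<Sum>j<n. B v (e j) * e j x"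
  have S: "?S \<in> V" using sum_mem[of "{..<n}" e "\<lambda>j. B v (e j)"] assms(1) by simp
  have "B ?S v = (\<Sum>j<n. (B v (e j))\<^sup>2)"
    using sum_left[of "{..<n}" e v "\<lambda>j. B v (e j)"] assms(1,3) commute[of v]
    by (simp add: power2_eq_square)
  then have "B (\<lambda>x. v x - ?S x) (\<lambda>x. v x - ?S x) = B v v - (\<Sum>j<n. (B v (e j))\<^sup>2)"
    using square_diff[OF assms(3) S] orthonormal_sum_norm[OF assms(1,2), of "\<lambda>j. B v (e j)" n]
      commute[of v ?S] by simp
  then show ?thesis using nonneg[OF diff_mem[OF assms(3) S]] by simp
qed

text \<open>For n > k the partial sum has k-th coefficient exactly \<open>a k\<close>, so
  Cauchy-Schwarz bounds the discrepancy by the norm of the remainder. This reads off the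
  coefficients of A^\<nu> w, which is given only as a limit of partial sums.\<close>

lemma orthonormal_expansion_coeff:
  assumes "\<And>j. e j \<in> V" "\<And>i j. B (e i) (e j) = (if i = j then 1 else 0 :: real)" "z \<in> V"
    and lim: "(\<lambda>n. sqrt (B (\<lambda>x. z x - (\<Sum>j<n. a j * e j x)) (\<lambda>x. z x - (\<Sum>j<n. a j * e j x)))) \<longlonglongrightarrow> 0"
  shows "B z (e k) = a k"
proof -
  let ?S = "\<lambda>n x. \<Sum>j<n. a j * e j x"
  have S: "?S n \<in> V" for n using sum_mem[of "{..<n}" e a] assms(1) by simp
  have "\<bar>B z (e k) - a k\<bar> \<le> sqrt (B (\<lambda>x. z x - ?S n x) (\<lambda>x. z x - ?S n x))" if "k < n" for n
  proof -
    have "B (\<lambda>x. z x - ?S n x) (e k) = B z (e k) - a k"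
      using diff_left[OF assms(3) S assms(1)] orthonormal_sum_inner[OF assms(1,2), of a n k] that by simp
    then show ?thesis
      using Cauchy_Schwarz[OF diff_mem[OF assms(3) S] assms(1), of n k] assms(2)[of k k] by simp
  qed
  then have "\<forall>\<^sub>F n in sequentially. \<bar>B z (e k) - a k\<bar> \<le> sqrt (B (\<lambda>x. z x - ?S n x) (\<lambda>x. z x - ?S n x))"
    using eventually_gt_at_top[of k] by (rule eventually_mono[rotated])
  then have "\<bar>B z (e k) - a k\<bar> \<le> 0"
    by (rule tendsto_lowerbound[OF lim]) simp
  then show ?thesis by simp
qed

end

text \<open>Since l and \<alpha> are both at most l + \<alpha>, the product l^\<nu>
  \<alpha>^(1-\<nu>) is at most l + \<alpha>; multiply by \<alpha>^\<nu> and divide. Both exponents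
  have to be nonnegative, which is the saturation limit \<nu> \<le> 1 of Tikhonov
  regularization.\<close>

lemma tikhonov_filter_bound:
  fixes l \<alpha> \<nu> :: real
  assumes "0 < l" "0 < \<alpha>" "0 < \<nu>" "\<nu> \<le> 1"
  shows "\<alpha> / (l + \<alpha>) * l powr \<nu> \<le> \<alpha> powr \<nu>"
proof -
  have "l powr \<nu> * \<alpha> powr (1 - \<nu>) \<le> (l + \<alpha>) powr \<nu> * (l + \<alpha>) powr (1 - \<nu>)"
    using assms by (intro mult_mono powr_mono2) auto
  also have "\<dots> = l + \<alpha>" using assms by (simp add: powr_add[symmetric])
  finally have "l powr \<nu> * \<alpha> powr (1 - \<nu>) * \<alpha> powr \<nu> \<le> (l + \<alpha>) * \<alpha> powr \<nu>"
    by (intro mult_right_mono) auto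
  then have "l powr \<nu> * \<alpha> \<le> (l + \<alpha>) * \<alpha> powr \<nu>"
    using assms by (simp add: mult.assoc powr_add[symmetric])
  then show ?thesis using assms by (simp add: field_simps)
qed

context fractional_measurement
begin

text \<open>Set to \<open>0\<close> off \<open>closure W\<close>, where the kernel integral need not exist and \<open>meas_op\<close> need not be linear.\<close>

definition meas_cut :: "('a \<Rightarrow> real) \<Rightarrow> 'a \<Rightarrow> real" where
  "meas_cut v x = (if x \<in> closure W then meas_op c s \<Omega> v x else 0)"

lemma meas_cut_L2:
  assumes "v \<in> L2 UNIV"
  shows "meas_cut v \<in> L2 W"
    and "L2_norm W (meas_cut v) \<le> sqrt (measure lborel W) * (meas_bound * L2_norm UNIV v)"
proof -
  have *: "(\<lambda>x. indicator W x * meas_cut v x) = (\<lambda>x. indicator W x * meas_op c s \<Omega> v x)"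
    using closure_subset[of W] by (auto simp: meas_cut_def indicator_def fun_eq_iff)
  show "meas_cut v \<in> L2 W" using meas_op_L2(1)[OF assms] unfolding L2_iff * .
  have "L2_norm W (meas_cut v) = L2_norm W (meas_op c s \<Omega> v)"
    unfolding L2_norm_def L2_inner_eq using fun_cong[OF *] by (simp only:)
  then show "L2_norm W (meas_cut v) \<le> sqrt (measure lborel W) * (meas_bound * L2_norm UNIV v)"
    using meas_op_L2(2)[OF assms] by simp
qed

lemma L2_inner_meas_cut: "L2_inner W (meas_cut u) (meas_cut v) = L2_inner W (meas_op c s \<Omega> u) (meas_op c s \<Omega> v)"
proof -
  have "indicator W x * meas_cut v x = indicator W x * meas_op c s \<Omega> v x" for v x
    using closure_subset[of W] by (auto simp: meas_cut_def indicator_def)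
  then show ?thesis unfolding L2_inner_eq by (simp only:)
qed

lemma meas_cut_lincomb:
  "u \<in> L2 UNIV \<Longrightarrow> v \<in> L2 UNIV \<Longrightarrow> meas_cut (\<lambda>x. u x + t * v x) = (\<lambda>x. meas_cut u x + t * meas_cut v x)"
  using meas_op_lincomb[of u v _ 1 t] by (auto simp: meas_cut_def fun_eq_iff)

lemma tikhonov_setting_continuous:
  assumes "0 < \<alpha>"
  shows "tikhonov_setting (Hs s) (Hs_inner c s) (L2 W) (L2_inner W) (Hs_tilde c s \<Omega>) meas_cut \<alpha>"
  using assms Hs_tildeD Hs_tilde_lincomb[of _ _ 1] meas_cut_L2(1) meas_cut_lincomb Hs_tilde_subset_L2
  by unfold_locales auto

lemma tikhonov_eq_J:
  assumes "0 < \<alpha>" and "\<And>x. x \<in> W \<Longrightarrow> \<mu> x = meas_cut u x" "u \<in> L2 UNIV" "v \<in> L2 UNIV"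
  shows "tikhonov c s \<Omega> W \<mu> \<alpha> v
    = tikhonov_setting.J (Hs_inner c s) (L2_inner W) meas_cut \<alpha> (meas_cut u) v"
proof -
  interpret tikhonov_setting "Hs s" "Hs_inner c s" "L2 W" "L2_inner W" "Hs_tilde c s \<Omega>" meas_cut \<alpha>
    by (rule tikhonov_setting_continuous[OF assms(1)])
  have "L2_norm W (\<lambda>x. meas_op c s \<Omega> v x - \<mu> x) = L2_norm W (\<lambda>x. meas_cut v x - meas_cut u x)"
    using assms(2) closure_subset by (intro L2_norm_cong) (auto simp: meas_cut_def)
  then show ?thesis
    using L2_norm_power2[OF L2.diff_mem[OF meas_cut_L2(1)[OF assms(4)] meas_cut_L2(1)[OF assms(3)]]]
    by (simp add: tikhonov_def J_def Hs_norm_power2[OF c_pos])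
qed

text \<open>The eigenbasis diagonalizes the optimality equation: tested with \<open>e j\<close>, it
  says that \<open>lam j + \<alpha>\<close> times the coefficient of ua - u0 is - \<alpha> times the
  coefficient of u0. On the source part the filter bound yields \<alpha>^\<nu>; on the remainder the
  factor \<open>\<alpha> / (lam j + \<alpha>)\<close> is bounded by 1.\<close>

lemma tikhonov_source_error:
  assumes \<alpha>: "0 < \<alpha>" and \<nu>: "0 < \<nu>" "\<nu> \<le> 1"
    and adj: "hilbert_adjoint c s \<Omega> W (meas_op c s \<Omega>) Lstar"
    and eb: "orthonormal_eigenbasis c s \<Omega> (\<lambda>v. Lstar (meas_op c s \<Omega> v)) e lam"
    and u0: "u0 \<in> Hs_tilde c s \<Omega>" and \<mu>: "\<And>x. x \<in> W \<Longrightarrow> \<mu> x = meas_op c s \<Omega> u0 x"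
    and min: "is_arg_min (tikhonov c s \<Omega> W \<mu> \<alpha>) (\<lambda>v. v \<in> Hs_tilde c s \<Omega>) ua"
    and w: "w \<in> Hs_tilde c s \<Omega>" and r: "r \<in> Hs_tilde c s \<Omega>"
    and z: "frac_power_eq c s e lam \<nu> w z" and u0_eq: "AE x in lborel. u0 x = z x + r x"
  shows "\<parallel>\<lambda>x. ua x - u0 x\<parallel> \<le> \<alpha> powr \<nu> * \<parallel>w\<parallel> + \<parallel>r\<parallel>"
proof -
  interpret T: tikhonov_setting "Hs s" "Hs_inner c s" "L2 W" "L2_inner W" "Hs_tilde c s \<Omega>" meas_cut \<alpha>
    by (rule tikhonov_setting_continuous[OF \<alpha>])
  have e: "e j \<in> Hs_tilde c s \<Omega>" "e j \<in> Hs s" for j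
    using eb Hs_tildeD by (auto simp: orthonormal_eigenbasis_def)
  have on: "Hs_inner c s (e i) (e j) = (if i = j then 1 else 0)" for i j
    using eb by (auto simp: orthonormal_eigenbasis_def)
  have lam: "0 < lam j" "AE x in lborel. Lstar (meas_op c s \<Omega> (e j)) x = lam j * e j x" for j
    using eb by (auto simp: orthonormal_eigenbasis_def)
  have ua: "ua \<in> Hs_tilde c s \<Omega>" using min by (simp add: is_arg_min_def)
  define d where "d = (\<lambda>x. ua x - u0 x)"
  have d: "d \<in> Hs_tilde c s \<Omega>" "d \<in> Hs s"
    using Hs_tilde_diff[OF ua u0] Hs_tildeD by (auto simp: d_def)
  have zH: "z \<in> Hs s" using z by (simp add: frac_power_eq_def Hs_sums_def)
  have coeff: "Hs_inner c s u0 (e j) = lam j powr \<nu> * Hs_inner c s w (e j) + Hs_inner c s r (e j)" for j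
  proof -
    have "Hs_inner c s u0 (e j) = Hs_inner c s (\<lambda>x. z x + r x) (e j)"
      using u0_eq Hs_tildeD[OF u0] H.add_mem[OF zH Hs_tildeD[OF r]] e(2)[of j]
      by (intro Hs_inner_cong_AE) (auto dest: Hs_borel)
    also have "\<dots> = Hs_inner c s z (e j) + Hs_inner c s r (e j)"
      using H.add_left[OF zH Hs_tildeD[OF r] e(2)] .
    also have "Hs_inner c s z (e j) = lam j powr \<nu> * Hs_inner c s w (e j)"
      using z by (intro H.orthonormal_expansion_coeff[OF e(2) on zH])
        (simp add: frac_power_eq_def Hs_sums_def Hs_norm_eq)
    finally show ?thesis .
  qed
  have dj: "Hs_inner c s d (e j) = - (\<alpha> / (lam j + \<alpha>)) * Hs_inner c s u0 (e j)" for j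
  proof -
    have "L2_inner W (\<lambda>x. meas_cut ua x - meas_cut u0 x) (meas_cut (e j)) + \<alpha> * Hs_inner c s ua (e j) = 0"
    proof (rule T.minimizer_equation)
      show "meas_cut u0 \<in> L2 W" using meas_cut_L2(1)[OF Hs_tilde_subset_L2[OF u0]] .
      have "\<mu> x = meas_cut u0 x" if "x \<in> W" for x
        using \<mu>[OF that] that closure_subset by (auto simp: meas_cut_def)
      then show "is_arg_min (T.J (meas_cut u0)) (\<lambda>v. v \<in> Hs_tilde c s \<Omega>) ua"
        using tikhonov_eq_J[OF \<alpha> _ Hs_tilde_subset_L2[OF u0] Hs_tilde_subset_L2, of \<mu>]
        by (intro is_arg_min_cong[OF _ min]) auto
    qed (rule e)
    also have "(\<lambda>x. meas_cut ua x - meas_cut u0 x) = meas_cut d"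
      unfolding d_def using T.T_diff[OF ua u0] by simp
    also have "L2_inner W (meas_cut d) (meas_cut (e j)) = Hs_inner c s d (Lstar (meas_op c s \<Omega> (e j)))"
      using adj d(1) meas_op_L2(1)[OF Hs_tilde_subset_L2[OF e(1)]]
      by (simp add: L2_inner_meas_cut hilbert_adjoint_def)
    also have "\<dots> = Hs_inner c s (\<lambda>x. lam j * e j x) d"
    proof -
      have "Lstar (meas_op c s \<Omega> (e j)) \<in> Hs s"
        using adj meas_op_L2(1)[OF Hs_tilde_subset_L2[OF e(1)]] Hs_tildeD by (auto simp: hilbert_adjoint_def)
      then show ?thesis
        unfolding H.commute[of d] using lam(2) H.scale_mem[OF e(2), of "lam j" j] d(2)
        by (intro Hs_inner_cong_AE) (auto dest: Hs_borel)
    qed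
    also have "\<dots> = lam j * Hs_inner c s d (e j)"
      using H.scale_left[OF e(2) d(2)] H.commute by simp
    also have "Hs_inner c s ua (e j) = Hs_inner c s d (e j) + Hs_inner c s u0 (e j)"
      using H.add_left[OF d(2) Hs_tildeD[OF u0] e(2), of j] by (simp add: d_def)
    finally show ?thesis
      using lam(1)[of j] \<alpha> by (simp add: field_simps)
  qed
  have djb: "\<bar>Hs_inner c s d (e j)\<bar> \<le> \<alpha> powr \<nu> * \<bar>Hs_inner c s w (e j)\<bar> + \<bar>Hs_inner c s r (e j)\<bar>" for j
  proof -
    let ?k = "\<alpha> / (lam j + \<alpha>)"
    have k: "0 \<le> ?k" "?k \<le> 1" using lam(1)[of j] \<alpha> by auto
    have "\<bar>Hs_inner c s d (e j)\<bar> = ?k * \<bar>lam j powr \<nu> * Hs_inner c s w (e j) + Hs_inner c s r (e j)\<bar>"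
      unfolding dj coeff abs_mult abs_minus_cancel abs_of_nonneg[OF k(1)] ..
    also have "\<dots> \<le> ?k * (lam j powr \<nu> * \<bar>Hs_inner c s w (e j)\<bar> + \<bar>Hs_inner c s r (e j)\<bar>)"
      using k(1) by (intro mult_left_mono order_trans[OF abs_triangle_ineq]) (auto simp: abs_mult)
    also have "\<dots> = ?k * lam j powr \<nu> * \<bar>Hs_inner c s w (e j)\<bar> + ?k * \<bar>Hs_inner c s r (e j)\<bar>"
      by (simp add: algebra_simps)
    also have "\<dots> \<le> \<alpha> powr \<nu> * \<bar>Hs_inner c s w (e j)\<bar> + 1 * \<bar>Hs_inner c s r (e j)\<bar>"
      using tikhonov_filter_bound[OF lam(1) \<alpha> \<nu>] k by (intro add_mono mult_right_mono) auto
    finally show ?thesis by simp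
  qed
  let ?S = "\<lambda>n x. \<Sum>j<n. Hs_inner c s d (e j) * e j x"
  have S: "?S n \<in> Hs s" for n using H.sum_mem[of "{..<n}" e] e(2) by simp
  \<comment> \<open>\<open>L2_set\<close> is the Euclidean norm of the first n coefficients. Its
    triangle inequality separates the contributions of w and r, and Bessel bounds each of
    them.\<close>
  have norm_S: "\<parallel>?S n\<parallel> \<le> \<alpha> powr \<nu> * \<parallel>w\<parallel> + \<parallel>r\<parallel>" for n
  proof -
    have "\<parallel>?S n\<parallel> = L2_set (\<lambda>j. Hs_inner c s d (e j)) {..<n}"
      unfolding Hs_norm_eq L2_set_def using H.orthonormal_sum_norm[OF e(2) on] by simp
    also have "\<dots> = L2_set (\<lambda>j. \<bar>Hs_inner c s d (e j)\<bar>) {..<n}" by (simp add: L2_set_def)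
    also have "\<dots> \<le> L2_set (\<lambda>j. \<alpha> powr \<nu> * \<bar>Hs_inner c s w (e j)\<bar> + \<bar>Hs_inner c s r (e j)\<bar>) {..<n}"
      using djb by (intro L2_set_mono) auto
    also have "\<dots> \<le> L2_set (\<lambda>j. \<alpha> powr \<nu> * \<bar>Hs_inner c s w (e j)\<bar>) {..<n} + L2_set (\<lambda>j. \<bar>Hs_inner c s r (e j)\<bar>) {..<n}"
      by (rule L2_set_triangle_ineq)
    also have "\<dots> = \<alpha> powr \<nu> * L2_set (\<lambda>j. Hs_inner c s w (e j)) {..<n} + L2_set (\<lambda>j. Hs_inner c s r (e j)) {..<n}"
      by (subst L2_set_right_distrib[symmetric]) (auto simp: L2_set_def)
    also have "\<dots> \<le> \<alpha> powr \<nu> * \<parallel>w\<parallel> + \<parallel>r\<parallel>"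
      using H.Bessel[OF e(2) on Hs_tildeD[OF w], of n] H.Bessel[OF e(2) on Hs_tildeD[OF r], of n]
      by (intro add_mono mult_left_mono) (auto simp: L2_set_def Hs_norm_eq)
    finally show ?thesis .
  qed
  have lim: "(\<lambda>n. \<parallel>\<lambda>x. d x - ?S n x\<parallel>) \<longlonglongrightarrow> 0"
    using eb d(1) by (auto simp: orthonormal_eigenbasis_def Hs_sums_def)
  \<comment> \<open>The bound is uniform in n and passes to d, since the partial sums converge to it
    in norm.\<close>
  have "\<parallel>d\<parallel> \<le> \<parallel>\<lambda>x. d x - ?S n x\<parallel> + (\<alpha> powr \<nu> * \<parallel>w\<parallel> + \<parallel>r\<parallel>)" for n
    using hs_add[OF H.diff_mem[OF d(2) S[of n]] S[of n]] norm_S[of n] by simp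
  then have "\<parallel>d\<parallel> \<le> 0 + (\<alpha> powr \<nu> * \<parallel>w\<parallel> + \<parallel>r\<parallel>)"
    by (intro tendsto_lowerbound[OF tendsto_add[OF lim tendsto_const]]) auto
  then show ?thesis by (simp add: d_def)
qed

end

section \<open>Finite element functions\<close>

text \<open>The sup bound travels with the Lipschitz bound because the Lipschitz constant of a
  product involves the suprema of the factors. The notion is thereby closed under forming
  polynomials on bounded sets.\<close>

definition bounded_lipschitz :: "'a::euclidean_space set \<Rightarrow> ('a \<Rightarrow> real) \<Rightarrow> bool" where
  "bounded_lipschitz K f \<longleftrightarrow>
     (\<exists>B L. 0 \<le> B \<and> 0 \<le> L \<and> (\<forall>x\<in>K. \<bar>f x\<bar> \<le> B) \<and> (\<forall>x\<in>K. \<forall>y\<in>K. \<bar>f x - f y\<bar> \<le> L * norm (x - y)))"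

lemma bounded_lipschitzI:
  "0 \<le> B \<Longrightarrow> 0 \<le> L \<Longrightarrow> (\<And>x. x \<in> K \<Longrightarrow> \<bar>f x\<bar> \<le> B) \<Longrightarrow>
   (\<And>x y. x \<in> K \<Longrightarrow> y \<in> K \<Longrightarrow> \<bar>f x - f y\<bar> \<le> L * norm (x - y)) \<Longrightarrow> bounded_lipschitz K f"
  unfolding bounded_lipschitz_def by blast

lemma bounded_lipschitzE:
  assumes "bounded_lipschitz K f"
  obtains B L where "0 \<le> B" "0 \<le> L" "\<And>x. x \<in> K \<Longrightarrow> \<bar>f x\<bar> \<le> B"
    "\<And>x y. x \<in> K \<Longrightarrow> y \<in> K \<Longrightarrow> \<bar>f x - f y\<bar> \<le> L * norm (x - y)"
  using assms unfolding bounded_lipschitz_def by metis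

lemma bounded_lipschitz_const: "bounded_lipschitz K (\<lambda>x. a)"
  by (rule bounded_lipschitzI[of "\<bar>a\<bar>" 0]) auto

lemma bounded_lipschitz_inner:
  assumes "bounded K" "b \<in> Basis"
  shows "bounded_lipschitz K (\<lambda>x. x \<bullet> b)"
proof -
  obtain M where "0 < M" "\<forall>x\<in>K. norm x \<le> M" using assms(1) by (auto simp: bounded_pos)
  then show ?thesis
  proof (intro bounded_lipschitzI[of M 1])
    show "\<bar>x \<bullet> b\<bar> \<le> M" if "x \<in> K" for x
      using Basis_le_norm[OF assms(2), of x] \<open>\<forall>x\<in>K. norm x \<le> M\<close> that by force
    show "\<bar>x \<bullet> b - y \<bullet> b\<bar> \<le> 1 * norm (x - y)" for x y
      using Basis_le_norm[OF assms(2), of "x - y"] by (simp add: inner_diff_left)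
  qed auto
qed

lemma bounded_lipschitz_add:
  assumes "bounded_lipschitz K f" "bounded_lipschitz K g"
  shows "bounded_lipschitz K (\<lambda>x. f x + g x)"
proof -
  obtain B L where f: "0 \<le> B" "0 \<le> L" "\<And>x. x \<in> K \<Longrightarrow> \<bar>f x\<bar> \<le> B"
    "\<And>x y. x \<in> K \<Longrightarrow> y \<in> K \<Longrightarrow> \<bar>f x - f y\<bar> \<le> L * norm (x - y)"
    using bounded_lipschitzE[OF assms(1)] by metis
  obtain B' L' where g: "0 \<le> B'" "0 \<le> L'" "\<And>x. x \<in> K \<Longrightarrow> \<bar>g x\<bar> \<le> B'"
    "\<And>x y. x \<in> K \<Longrightarrow> y \<in> K \<Longrightarrow> \<bar>g x - g y\<bar> \<le> L' * norm (x - y)"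
    using bounded_lipschitzE[OF assms(2)] by metis
  show ?thesis
  proof (rule bounded_lipschitzI[of "B + B'" "L + L'"])
    show "\<bar>f x + g x\<bar> \<le> B + B'" if "x \<in> K" for x using f(3)[OF that] g(3)[OF that] by linarith
    show "\<bar>f x + g x - (f y + g y)\<bar> \<le> (L + L') * norm (x - y)" if "x \<in> K" "y \<in> K" for x y
      using f(4)[OF that] g(4)[OF that] by (simp add: distrib_right)
  qed (use f g in auto)
qed

lemma bounded_lipschitz_mult:
  assumes "bounded_lipschitz K f" "bounded_lipschitz K g"
  shows "bounded_lipschitz K (\<lambda>x. f x * g x)"
proof -
  obtain B L where f: "0 \<le> B" "0 \<le> L" "\<And>x. x \<in> K \<Longrightarrow> \<bar>f x\<bar> \<le> B"
    "\<And>x y. x \<in> K \<Longrightarrow> y \<in> K \<Longrightarrow> \<bar>f x - f y\<bar> \<le> L * norm (x - y)"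
    using bounded_lipschitzE[OF assms(1)] by metis
  obtain B' L' where g: "0 \<le> B'" "0 \<le> L'" "\<And>x. x \<in> K \<Longrightarrow> \<bar>g x\<bar> \<le> B'"
    "\<And>x y. x \<in> K \<Longrightarrow> y \<in> K \<Longrightarrow> \<bar>g x - g y\<bar> \<le> L' * norm (x - y)"
    using bounded_lipschitzE[OF assms(2)] by metis
  show ?thesis
  proof (rule bounded_lipschitzI[of "B * B'" "B * L' + L * B'"])
    show "\<bar>f x * g x\<bar> \<le> B * B'" if "x \<in> K" for x
      using f(1) f(3)[OF that] g(3)[OF that] unfolding abs_mult by (intro mult_mono) auto
    show "\<bar>f x * g x - f y * g y\<bar> \<le> (B * L' + L * B') * norm (x - y)" if "x \<in> K" "y \<in> K" for x y
    proof -
      have "f x * g x - f y * g y = f x * (g x - g y) + (f x - f y) * g y" by (simp add: algebra_simps)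
      then have "\<bar>f x * g x - f y * g y\<bar> \<le> \<bar>f x\<bar> * \<bar>g x - g y\<bar> + \<bar>f x - f y\<bar> * \<bar>g y\<bar>"
        using abs_triangle_ineq[of "f x * (g x - g y)" "(f x - f y) * g y"] by (simp add: abs_mult)
      also have "\<dots> \<le> B * (L' * norm (x - y)) + (L * norm (x - y)) * B'"
        using f g that by (intro add_mono mult_mono) auto
      finally show ?thesis by (simp add: algebra_simps)
    qed
  qed (use f g in auto)
qed

lemma bounded_lipschitz_sum:
  "(\<And>i. i \<in> I \<Longrightarrow> bounded_lipschitz K (f i)) \<Longrightarrow> bounded_lipschitz K (\<lambda>x. \<Sum>i\<in>I. f i x)"
  by (induction I rule: infinite_finite_induct) (auto simp: bounded_lipschitz_const bounded_lipschitz_add)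

lemma bounded_lipschitz_prod:
  "(\<And>i. i \<in> I \<Longrightarrow> bounded_lipschitz K (f i)) \<Longrightarrow> bounded_lipschitz K (\<lambda>x. \<Prod>i\<in>I. f i x)"
  by (induction I rule: infinite_finite_induct) (auto simp: bounded_lipschitz_const bounded_lipschitz_mult)

lemma bounded_lipschitz_polynomial:
  assumes "Q \<in> polynomials_upto p" "bounded K"
  shows "bounded_lipschitz K Q"
proof -
  have "bounded_lipschitz K (\<lambda>x. (x \<bullet> b) ^ n)" if "b \<in> Basis" for b n
    using bounded_lipschitz_inner[OF assms(2) that]
    by (induction n) (auto simp: bounded_lipschitz_const bounded_lipschitz_mult)
  moreover obtain a where "Q = (\<lambda>x. \<Sum>\<beta>\<in>multi_indices p. a \<beta> * (\<Prod>b\<in>Basis. (x \<bullet> b) ^ \<beta> b))"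
    using assms(1) unfolding polynomials_upto_def by blast
  ultimately show ?thesis
    by (simp only:) (intro bounded_lipschitz_sum bounded_lipschitz_mult bounded_lipschitz_const bounded_lipschitz_prod)
qed

text \<open>On the segment from x to y the preimages of the pieces are finitely many closed sets
  covering [0,1], and Lipschitz bounds on such a cover glue with the same constant. Working on a
  segment admits nonconvex pieces such as the exterior of the cube.\<close>

lemma piecewise_lipschitz:
  fixes v :: "'a::euclidean_space \<Rightarrow> real"
  assumes "finite \<K>" "\<And>K. K \<in> \<K> \<Longrightarrow> closed K" "\<Union>\<K> = UNIV" "0 \<le> L"
    and "\<And>K x y. K \<in> \<K> \<Longrightarrow> x \<in> K \<Longrightarrow> y \<in> K \<Longrightarrow> \<bar>v x - v y\<bar> \<le> L * norm (x - y)"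
  shows "\<bar>v x - v y\<bar> \<le> L * norm (x - y)"
proof -
  let ?g = "\<lambda>t::real. x + t *\<^sub>R (y - x)"
  let ?M = "L * norm (x - y)"
  have "?M-lipschitz_on {0..1} (\<lambda>t. v (?g t))"
  proof (rule lipschitz_on_closed_Union[where I = \<K> and U = "\<lambda>K. ?g -` K"])
    fix K assume K: "K \<in> \<K>"
    show "?M-lipschitz_on (?g -` K) (\<lambda>t. v (?g t))"
    proof (rule lipschitz_onI)
      fix t t' assume "t \<in> ?g -` K" "t' \<in> ?g -` K"
      then have "\<bar>v (?g t) - v (?g t')\<bar> \<le> L * norm (?g t - ?g t')" using assms(5)[OF K] unfolding vimage_def by blast
      also have "?g t - ?g t' = (t - t') *\<^sub>R (y - x)" by (simp add: algebra_simps)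
      finally show "dist (v (?g t)) (v (?g t')) \<le> ?M * dist t t'"
        by (simp add: dist_real_def norm_minus_commute mult_ac)
    qed (use assms(4) in simp)
    show "closed (?g -` K)" using assms(2)[OF K] by (intro closed_vimage) (auto intro!: continuous_intros)
  next
    show "{0..1} \<subseteq> (\<Union>K\<in>\<K>. ?g -` K)" using assms(3) by blast
  qed (use assms in simp_all)
  from lipschitz_onD[OF this, of 0 1] show ?thesis by (simp add: dist_real_def)
qed

section \<open>Finite element spaces as spaces of functions on the whole space\<close>

lemma open_cube: "open (cube R)" and bounded_cube: "bounded (cube R)"
  by (auto simp: cube_def)

lemma simplicial_meshD:
  assumes "simplicial_mesh \<T> D"
  shows "finite \<T>" "\<Union>\<T> = closure D" "K \<in> \<T> \<Longrightarrow> int DIM('a) simplex K"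
    "K \<in> \<T> \<Longrightarrow> compact K" "K \<in> \<T> \<Longrightarrow> convex (K :: 'a::euclidean_space set)"
  using assms by (auto simp: simplicial_mesh_def triangulation_def compact_simplex convex_simplex)

lemma fe_spaceD:
  assumes "v \<in> fe_space p \<T> D"
  shows "continuous_on (closure D) v" "K \<in> \<T> \<Longrightarrow> \<exists>Q\<in>polynomials_upto p. \<forall>x\<in>K. v x = Q x"
    "x \<notin> closure D \<Longrightarrow> v x = 0"
  using assms unfolding fe_space_def mem_Collect_eq by blast+

lemma polynomials_upto_lincomb:
  assumes "Q \<in> polynomials_upto p" "Q' \<in> polynomials_upto p"
  shows "(\<lambda>x. Q x + t * Q' x) \<in> polynomials_upto p"
proof -
  obtain a where a: "Q = (\<lambda>x. \<Sum>\<beta>\<in>multi_indices p. a \<beta> * (\<Prod>b\<in>Basis. (x \<bullet> b) ^ \<beta> b))"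
    using assms(1) unfolding polynomials_upto_def by blast
  obtain a' where a': "Q' = (\<lambda>x. \<Sum>\<beta>\<in>multi_indices p. a' \<beta> * (\<Prod>b\<in>Basis. (x \<bullet> b) ^ \<beta> b))"
    using assms(2) unfolding polynomials_upto_def by blast
  have "(\<lambda>x. Q x + t * Q' x)
      = (\<lambda>x. \<Sum>\<beta>\<in>multi_indices p. (a \<beta> + t * a' \<beta>) * (\<Prod>b\<in>Basis. (x \<bullet> b) ^ \<beta> b))"
    by (simp add: a a' sum.distrib distrib_right sum_distrib_left mult.assoc)
  then show ?thesis
    unfolding polynomials_upto_def mem_Collect_eq by (intro exI[of _ "\<lambda>\<beta>. a \<beta> + t * a' \<beta>"])
qed

lemma fe_space_lincomb:
  assumes "u \<in> fe_space p \<T> D" "v \<in> fe_space p \<T> D"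
  shows "(\<lambda>x. u x + t * v x) \<in> fe_space p \<T> D"
proof -
  have "\<exists>Q\<in>polynomials_upto p. \<forall>x\<in>K. u x + t * v x = Q x" if K: "K \<in> \<T>" for K
  proof -
    obtain Q Q' where Q: "Q \<in> polynomials_upto p" "\<forall>x\<in>K. u x = Q x" "Q' \<in> polynomials_upto p" "\<forall>x\<in>K. v x = Q' x"
      using fe_spaceD(2)[OF assms(1) K] fe_spaceD(2)[OF assms(2) K] by blast
    show ?thesis
      by (rule bexI[OF _ polynomials_upto_lincomb[OF Q(1,3), of t]]) (use Q(2,4) in simp)
  qed
  moreover have "continuous_on (closure D) (\<lambda>x. u x + t * v x)"
    using fe_spaceD(1)[OF assms(1)] fe_spaceD(1)[OF assms(2)] by (intro continuous_intros)
  ultimately show ?thesis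
    using fe_spaceD(3)[OF assms(1)] fe_spaceD(3)[OF assms(2)] unfolding fe_space_def by simp
qed

lemma fe_space_0_lincomb:
  "u \<in> fe_space_0 p \<T> D \<Omega> \<Longrightarrow> v \<in> fe_space_0 p \<T> D \<Omega> \<Longrightarrow> (\<lambda>x. u x + t * v x) \<in> fe_space_0 p \<T> D \<Omega>"
  by (auto simp: fe_space_0_def fe_space_lincomb)

lemma fe_space_L2:
  fixes v :: "'a::euclidean_space \<Rightarrow> real"
  assumes "v \<in> fe_space p \<T> D" "bounded D"
  shows "v \<in> L2 UNIV"
proof -
  have K: "compact (closure D)" using assms(2) by (simp add: compact_closure)
  have v: "continuous_on (closure D) v" "\<And>x. x \<notin> closure D \<Longrightarrow> v x = 0"
    using fe_spaceD[OF assms(1)] by blast+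
  have "(\<lambda>x. indicator (closure D) x *\<^sub>R v x) \<in> borel_measurable borel"
    using v(1) by (intro borel_measurable_continuous_on_indicator) auto
  moreover have "(\<lambda>x. indicator (closure D) x *\<^sub>R v x) = v" using v(2) by (auto simp: indicator_def fun_eq_iff)
  ultimately have [measurable]: "v \<in> borel_measurable borel" by simp
  obtain B where B: "\<And>x. x \<in> closure D \<Longrightarrow> \<bar>v x\<bar> \<le> B"
    using compact_imp_bounded[OF compact_continuous_image[OF v(1) K]] by (auto simp: bounded_iff)
  have "integrable lborel (\<lambda>x. indicator (closure D) x * B\<^sup>2)"
    using emeasure_bounded_finite[OF compact_imp_bounded[OF K]]
    by (intro integrable_mult_left integrable_real_indicator) auto
  then have "integrable lborel (\<lambda>x. (v x)\<^sup>2)"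
  proof (rule Bochner_Integration.integrable_bound)
    have "(v x)\<^sup>2 \<le> indicator (closure D) x * B\<^sup>2" for x
      using v(2)[of x] B[of x] power_mono[of "\<bar>v x\<bar>" B 2] by (cases "x \<in> closure D") auto
    then show "AE x in lborel. norm ((v x)\<^sup>2) \<le> norm (indicator (closure D) x * B\<^sup>2)"
      by (auto intro: order_trans[OF _ abs_ge_self])
  qed simp
  then show ?thesis by (simp add: L2_UNIV square_integrable_def)
qed

lemma fe_space_0_eq_0:
  assumes "v \<in> fe_space_0 p \<T> D \<Omega>" "x \<notin> \<Omega>"
  shows "v x = 0"
  using assms fe_spaceD(3)[of v p \<T> D x] unfolding fe_space_0_def by blast

text \<open>The complement of the open cube is closed and v vanishes on it, because \<Omega> lies in
  the cube. Together with the mesh it is a finite closed cover of the space, with v polynomial or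
  zero on each piece. The constants may depend on the mesh: only membership in \<open>Hs\<close> and
  \<open>Hs_tilde\<close> is drawn from them.\<close>

lemma fe_space_0_lipschitz:
  fixes v :: "'a::euclidean_space \<Rightarrow> real"
  assumes "v \<in> fe_space_0 p \<T> (cube R) \<Omega>" "simplicial_mesh \<T> (cube R)" "\<Omega> \<subseteq> cube R"
  obtains B L where "0 \<le> B" "0 \<le> L" "\<And>x. \<bar>v x\<bar> \<le> B" "\<And>x y. \<bar>v x - v y\<bar> \<le> L * norm (x - y)"
proof -
  note \<T> = simplicial_meshD[OF assms(2)]
  let ?\<K> = "insert (- cube R) \<T>"
  have "bounded_lipschitz K v" if "K \<in> ?\<K>" for K
  proof (cases "K = - cube R")
    case True
    then have "v x = 0" if "x \<in> K" for x using fe_space_0_eq_0[OF assms(1)] that assms(3) by auto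
    then show ?thesis by (intro bounded_lipschitzI[of 0 0]) auto
  next
    case False
    then have K: "K \<in> \<T>" using that by simp
    then obtain Q where Q: "Q \<in> polynomials_upto p" "\<forall>x\<in>K. v x = Q x"
      using assms(1) fe_spaceD(2)[of v p \<T> "cube R" K] unfolding fe_space_0_def by blast
    show ?thesis
      using bounded_lipschitz_polynomial[OF Q(1) compact_imp_bounded[OF \<T>(4)[OF K]]] Q(2)
      unfolding bounded_lipschitz_def by auto
  qed
  then obtain B L where BL: "\<And>K. K \<in> ?\<K> \<Longrightarrow> 0 \<le> B K" "\<And>K. K \<in> ?\<K> \<Longrightarrow> 0 \<le> L K"
    "\<And>K x. K \<in> ?\<K> \<Longrightarrow> x \<in> K \<Longrightarrow> \<bar>v x\<bar> \<le> B K"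
    "\<And>K x y. K \<in> ?\<K> \<Longrightarrow> x \<in> K \<Longrightarrow> y \<in> K \<Longrightarrow> \<bar>v x - v y\<bar> \<le> L K * norm (x - y)"
  proof -
    let ?P = "\<lambda>K q. 0 \<le> fst q \<and> 0 \<le> snd q \<and> (\<forall>x\<in>K. \<bar>v x\<bar> \<le> fst q) \<and>
        (\<forall>x\<in>K. \<forall>y\<in>K. \<bar>v x - v y\<bar> \<le> snd q * norm (x - y))"
    assume *: "\<And>K. K \<in> ?\<K> \<Longrightarrow> bounded_lipschitz K v"
    have "\<forall>K\<in>?\<K>. \<exists>q. ?P K q"
    proof
      fix K assume "K \<in> ?\<K>"
      then have "bounded_lipschitz K v" by (rule *)
      then obtain B L where "?P K (B, L)" unfolding bounded_lipschitz_def fst_conv snd_conv by blast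
      then show "\<exists>q. ?P K q" ..
    qed
    then obtain q where q: "\<forall>K\<in>?\<K>. ?P K (q K)" by (rule bchoice[THEN exE])
    show thesis by (rule that[of "\<lambda>K. fst (q K)" "\<lambda>K. snd (q K)"]) (use q in blast)+
  qed
  have fin: "finite ?\<K>" using \<T>(1) by simp
  have cov: "\<Union>?\<K> = UNIV" using \<T>(2) closure_subset[of "cube R"] by auto
  \<comment> \<open>The local constants are nonnegative, so their sums over the cover serve as
    maxima.\<close>
  have le: "B K \<le> sum B ?\<K>" "L K \<le> sum L ?\<K>" if "K \<in> ?\<K>" for K
    using BL(1,2) by (intro member_le_sum[OF that _ fin]; blast)+
  show thesis
  proof (rule that[of "sum B ?\<K>" "sum L ?\<K>"])
    show "0 \<le> sum B ?\<K>" by (rule sum_nonneg) (rule BL(1))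
    show L: "0 \<le> sum L ?\<K>" by (rule sum_nonneg) (rule BL(2))
    show "\<bar>v x\<bar> \<le> sum B ?\<K>" for x
    proof -
      obtain K where K: "K \<in> ?\<K>" "x \<in> K" using cov by blast
      show ?thesis using BL(3)[OF K] le(1)[OF K(1)] by (rule order_trans)
    qed
    show "\<bar>v x - v y\<bar> \<le> sum L ?\<K> * norm (x - y)" for x y
    proof (rule piecewise_lipschitz[OF fin _ cov L])
      fix K assume "K \<in> ?\<K>"
      then consider "K = - cube R" | "K \<in> \<T>" by blast
      then show "closed K"
        by cases (simp_all add: closed_Compl open_cube compact_imp_closed[OF \<T>(4)])
    next
      fix K x y assume K: "K \<in> ?\<K>" "x \<in> K" "y \<in> K"
      have "L K * norm (x - y) \<le> sum L ?\<K> * norm (x - y)"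
        using le(2)[OF K(1)] by (rule mult_right_mono) simp
      with BL(4)[OF K] show "\<bar>v x - v y\<bar> \<le> sum L ?\<K> * norm (x - y)" by (rule order_trans)
    qed
  qed
qed

section \<open>The discrete Tikhonov functional\<close>

lemma L2_mono:
  assumes "v \<in> L2 UNIV" "W \<in> sets borel"
  shows "v \<in> L2 W"
proof -
  have [measurable]: "v \<in> borel_measurable borel" "W \<in> sets borel"
    using assms by (auto simp: L2_UNIV square_integrable_def)
  have "integrable lborel (\<lambda>x. (v x)\<^sup>2)" using assms(1) by (simp add: L2_UNIV square_integrable_def)
  then have "integrable lborel (\<lambda>x. (indicator W x * v x)\<^sup>2)"
    by (rule Bochner_Integration.integrable_bound) (auto simp: indicator_def)
  then show ?thesis by (simp add: L2_iff square_integrable_def)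
qed

lemma (in semi_inner) sum_sum:
  assumes "\<And>i. i \<in> I \<Longrightarrow> f i \<in> V"
  shows "B (\<lambda>x. \<Sum>i\<in>I. a i * f i x) (\<lambda>x. \<Sum>i\<in>I. b i * f i x) = (\<Sum>i\<in>I. \<Sum>j\<in>I. a i * B (f i) (f j) * b j)"
proof -
  have S: "(\<lambda>x. \<Sum>i\<in>I. b i * f i x) \<in> V" using sum_mem[of I f b] assms by simp
  have "B (f i) (\<lambda>x. \<Sum>i\<in>I. b i * f i x) = (\<Sum>j\<in>I. b j * B (f i) (f j))" if "i \<in> I" for i
    using sum_left[of I f "f i" b] assms that commute[of "f i"] by simp
  then show ?thesis
    using sum_left[of I f _ a] assms S by (simp add: sum_distrib_left mult_ac)
qed

text \<open>The mass matrix is the Gram matrix of the nodal basis, so the data norm of a vector is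
  the L2 norm of the function with these nodal values. The discrete problem can therefore use
  \<open>L2 W\<close> as its data space as well.\<close>

lemma Y_norm_eq_L2_norm:
  assumes "\<And>k. k < n \<Longrightarrow> \<theta> k \<in> L2 W"
  shows "Y_norm W n \<theta> y = L2_norm W (\<lambda>x. \<Sum>k<n. y k * \<theta> k x)"
proof -
  have "(LINT x:W|lborel. \<theta> i x * \<theta> j x) = L2_inner W (\<theta> i) (\<theta> j)" for i j
    by (simp add: L2_inner_def)
  then show ?thesis
    unfolding Y_norm_def L2_norm_def using L2.sum_sum[of "{..<n}" \<theta> W y y] assms by simp
qed

lemma Y_norm_add3:
  assumes "\<And>k. k < n \<Longrightarrow> \<theta> k \<in> L2 W"
  shows "Y_norm W n \<theta> (\<lambda>k. y1 k + y2 k + y3 k) \<le> Y_norm W n \<theta> y1 + (Y_norm W n \<theta> y2 + Y_norm W n \<theta> y3)"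
proof -
  let ?I = "\<lambda>y x. \<Sum>k<n. y k * \<theta> k x"
  have m: "?I y \<in> L2 W" for y using L2.sum_mem[of "{..<n}" \<theta> W y] assms by simp
  have "?I (\<lambda>k. y1 k + y2 k + y3 k) = (\<lambda>x. ?I y1 x + (?I y2 x + ?I y3 x))"
    by (simp add: fun_eq_iff sum.distrib distrib_right)
  then show ?thesis
    using L2.triangle[OF m[of y1] L2.add_mem[OF m[of y2] m[of y3]]] L2.triangle[OF m[of y2] m[of y3]]
      Y_norm_eq_L2_norm[OF assms] by (simp add: L2_norm_def)
qed

text \<open>Of the four products formed from C and its complement, the one off C in both variables
  contributes nothing, and the two mixed ones agree by swapping the variables. On a mixed one the
  squared quotient is \<open>(v x)^2\<close> times the kernel, so the integral over y becomes a
  weight in x.\<close>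

lemma integral_complement_strip:
  fixes v :: "'a::euclidean_space \<Rightarrow> real" and C :: "'a set"
  assumes "v \<in> Hs s" "\<And>x. x \<notin> C \<Longrightarrow> v x = 0" and C: "C \<in> sets borel"
  shows "(\<integral>p. (gagliardo_quotient s v p)\<^sup>2 \<partial>(lborel \<Otimes>\<^sub>M lborel))
    = (\<integral>p. indicator (C \<times> C) p * (gagliardo_quotient s v p)\<^sup>2 \<partial>(lborel \<Otimes>\<^sub>M lborel))
      + 2 * (\<integral>x. indicator C x * ((v x)\<^sup>2 * (\<integral>y. indicator (- C) y * frac_kernel s x y \<partial>lborel)) \<partial>lborel)"
proof -
  have [measurable]: "C \<in> sets lborel" "C \<in> sets borel" "v \<in> borel_measurable borel" "v \<in> borel_measurable lborel"
    using C Hs_borel[OF assms(1)] by auto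
  let ?G = "\<lambda>p. (gagliardo_quotient s v p)\<^sup>2"
  let ?M = "lborel \<Otimes>\<^sub>M (lborel :: 'a measure)"
  have Gi: "integrable ?M ?G" using assms(1) by (simp add: Hs_iff square_integrable_def)
  have ind: "integrable ?M (\<lambda>p. indicator (A \<times> A') p * ?G p)" if "A \<in> sets borel" "A' \<in> sets borel" for A A' :: "'a set"
  proof (rule Bochner_Integration.integrable_bound[OF Gi])
    have "A \<times> A' \<in> sets ?M" using that by (intro pair_measureI) auto
    then show "(\<lambda>p. indicator (A \<times> A') p * ?G p) \<in> borel_measurable ?M" by measurable
  qed (auto simp: indicator_def)
  have Cc: "- C \<in> sets borel" using C by auto
  note i1 = ind[OF C C] and i2 = ind[OF C Cc] and i3 = ind[OF Cc C]
  have "?G p = indicator (C \<times> C) p * ?G p + (indicator (C \<times> (- C)) p * ?G p + indicator ((- C) \<times> C) p * ?G p)" for p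
    using assms(2) by (cases p) (auto simp: indicator_def gagliardo_quotient_def)
  then have "(\<integral>p. ?G p \<partial>?M) = (\<integral>p. indicator (C \<times> C) p * ?G p +
      (indicator (C \<times> (- C)) p * ?G p + indicator ((- C) \<times> C) p * ?G p) \<partial>?M)" by (rule Bochner_Integration.integral_cong[OF refl])
  also have "\<dots> = (\<integral>p. indicator (C \<times> C) p * ?G p \<partial>?M) +
      ((\<integral>p. indicator (C \<times> (- C)) p * ?G p \<partial>?M) + (\<integral>p. indicator ((- C) \<times> C) p * ?G p \<partial>?M))"
    using i1 i2 i3 by simp
  also have "(\<integral>p. indicator ((- C) \<times> C) p * ?G p \<partial>?M) = (\<integral>p. indicator (C \<times> (- C)) p * ?G p \<partial>?M)"
  proof -
    have "(\<integral>(x, y). indicator ((- C) \<times> C) (y, x) * ?G (y, x) \<partial>?M) = (\<integral>p. indicator ((- C) \<times> C) p * ?G p \<partial>?M)"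
      using i3 by (intro lborel_pair.integral_product_swap) auto
    moreover have "(\<lambda>(x, y). indicator ((- C) \<times> C) (y, x) * ?G (y, x)) = (\<lambda>p. indicator (C \<times> (- C)) p * ?G p)"
      using frac_kernel_commute[of s]
      by (auto simp: fun_eq_iff gagliardo_quotient_def indicator_def power_mult_distrib power2_commute)
    ultimately show ?thesis by simp
  qed
  also have "(\<integral>p. indicator (C \<times> (- C)) p * ?G p \<partial>?M)
      = (\<integral>x. \<integral>y. indicator (C \<times> (- C)) (x, y) * ?G (x, y) \<partial>lborel \<partial>lborel)"
    by (rule lborel_pair.integral_fst'[OF i2, symmetric])
  also have "\<dots> = (\<integral>x. indicator C x * ((v x)\<^sup>2 * (\<integral>y. indicator (- C) y * frac_kernel s x y \<partial>lborel)) \<partial>lborel)"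
  proof (rule Bochner_Integration.integral_cong[OF refl])
    fix x
    have "indicator (C \<times> (- C)) (x, y) * ?G (x, y) = indicator C x * (v x)\<^sup>2 * (indicator (- C) y * frac_kernel s x y)" for y
      using assms(2)[of y] by (cases "y \<in> C") (auto simp: indicator_def gagliardo_quotient_def power_mult_distrib)
    then show "(\<integral>y. indicator (C \<times> (- C)) (x, y) * ?G (x, y) \<partial>lborel)
        = indicator C x * ((v x)\<^sup>2 * (\<integral>y. indicator (- C) y * frac_kernel s x y \<partial>lborel))"
      by simp
  qed
  finally show ?thesis by simp
qed

text \<open>The tail weight in \<open>box_form\<close> is exactly the mixed part of the full form.
  The discrete penalty is therefore the \<open>Hs\<close> norm itself, whatever R is.\<close>

lemma box_norm_eq_Hs_norm:
  fixes v :: "'a::euclidean_space \<Rightarrow> real"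
  assumes "v \<in> Hs s" "\<And>x. x \<notin> cube R \<Longrightarrow> v x = 0"
  shows "box_norm c s R v = Hs_norm c s v"
proof -
  have "box_form c s R v v = frac_form c s v v"
  proof -
    have "frac_form c s v v = c / 2 * (\<integral>p. (gagliardo_quotient s v p)\<^sup>2 \<partial>(lborel \<Otimes>\<^sub>M lborel))"
      unfolding frac_form_eq by (simp add: power2_eq_square)
    also have "(\<integral>p. (gagliardo_quotient s v p)\<^sup>2 \<partial>(lborel \<Otimes>\<^sub>M lborel))
        = (\<integral>p. indicator (cube R \<times> cube R) p * (gagliardo_quotient s v p)\<^sup>2 \<partial>(lborel \<Otimes>\<^sub>M lborel))
        + 2 * (\<integral>x. indicator (cube R) x * ((v x)\<^sup>2 * (\<integral>y. indicator (- cube R) y * frac_kernel s x y \<partial>lborel)) \<partial>lborel)"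
      using assms(2) by (intro integral_complement_strip[OF assms(1)] borel_open[OF open_cube])
    finally show ?thesis
      unfolding box_form_def set_lebesgue_integral_def gagliardo_quotient_mult[symmetric]
      by (simp add: power2_eq_square distrib_left)
  qed
  moreover have "L2_norm (cube R) v = L2_norm UNIV v"
    unfolding L2_norm_def L2_inner_eq
    using assms(2) by (intro arg_cong[where f = sqrt] Bochner_Integration.integral_cong) (auto simp: indicator_def)
  ultimately show ?thesis by (simp add: box_norm_def Hs_norm_def add.commute)
qed

context fractional_measurement
begin

lemma fe_space_0_Hs:
  assumes "v \<in> fe_space_0 p \<T> (cube R) \<Omega>" "simplicial_mesh \<T> (cube R)" "\<Omega> \<subseteq> cube R"
  shows "v \<in> Hs s"
proof -
  obtain B L where "0 \<le> B" "0 \<le> L" "\<And>x. \<bar>v x\<bar> \<le> B" "\<And>x y. \<bar>v x - v y\<bar> \<le> L * norm (x - y)"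
    using fe_space_0_lipschitz[OF assms] by blast
  then show ?thesis
    using lipschitz_Hs[OF c_pos s_pos s_less bounded_\<Omega> borel_open[OF open_\<Omega>]] fe_space_0_eq_0[OF assms(1)] by metis
qed

lemma nodal_basis_L2:
  assumes "nodal_basis W (fe_space pW \<T>W W) n X \<theta>" "k < n"
  shows "\<theta> k \<in> L2 W" "X k \<in> closure W"
  using assms fe_space_L2[OF _ bounded_W] L2_mono[OF _ borel_open[OF open_W]] by (auto simp: nodal_basis_def)

lemma nodal_interp_L2:
  assumes "nodal_basis W (fe_space pW \<T>W W) n X \<theta>"
  shows "nodal_interp n X \<theta> \<psi> \<in> L2 W"
  using L2.sum_mem[of "{..<n}" \<theta> W "\<lambda>k. \<psi> (X k)"] nodal_basis_L2(1)[OF assms] by (simp add: nodal_interp_def[abs_def])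

lemma discrete_tikhonov_setting:
  assumes "nodal_basis W (fe_space pW \<T>W W) n X \<theta>" "simplicial_mesh \<T> (cube R)" "\<Omega> \<subseteq> cube R" "0 < \<alpha>"
  shows "tikhonov_setting (Hs s) (Hs_inner c s) (L2 W) (L2_inner W) (fe_space_0 p \<T> (cube R) \<Omega>)
    (\<lambda>v. nodal_interp n X \<theta> (meas_op c s \<Omega> v)) \<alpha>"
proof
  fix u v :: "'a \<Rightarrow> real" and t :: real
  assume uv: "u \<in> fe_space_0 p \<T> (cube R) \<Omega>" "v \<in> fe_space_0 p \<T> (cube R) \<Omega>"
  then have "u \<in> L2 UNIV" "v \<in> L2 UNIV"
    using fe_space_0_Hs[OF _ assms(2,3)] Hs_subset_L2 by blast+
  then show "nodal_interp n X \<theta> (meas_op c s \<Omega> (\<lambda>x. u x + t * v x))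
      = (\<lambda>x. nodal_interp n X \<theta> (meas_op c s \<Omega> u) x + t * nodal_interp n X \<theta> (meas_op c s \<Omega> v) x)"
    using meas_op_lincomb[of u v _ 1 t] nodal_basis_L2(2)[OF assms(1)]
    by (simp add: nodal_interp_def fun_eq_iff sum.distrib distrib_right sum_distrib_left mult.assoc)
qed (use fe_space_0_Hs[OF _ assms(2,3)] fe_space_0_lincomb nodal_interp_L2[OF assms(1)] assms(4) in auto)

lemma discrete_tikhonov_eq_J:
  assumes nb: "nodal_basis W (fe_space pW \<T>W W) n X \<theta>" and "simplicial_mesh \<T> (cube R)" "\<Omega> \<subseteq> cube R" "0 < \<alpha>"
    and v: "v \<in> fe_space_0 p \<T> (cube R) \<Omega>"
  shows "discrete_tikhonov c s \<Omega> W R n X \<theta> y \<alpha> v = tikhonov_setting.J (Hs_inner c s) (L2_inner W)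
    (\<lambda>v. nodal_interp n X \<theta> (meas_op c s \<Omega> v)) \<alpha> (\<lambda>x. \<Sum>k<n. y k * \<theta> k x) v"
proof -
  interpret tikhonov_setting "Hs s" "Hs_inner c s" "L2 W" "L2_inner W" "fe_space_0 p \<T> (cube R) \<Omega>"
    "\<lambda>v. nodal_interp n X \<theta> (meas_op c s \<Omega> v)" \<alpha>
    using discrete_tikhonov_setting[OF assms(1-4)] .
  have \<theta>: "\<And>k. k < n \<Longrightarrow> \<theta> k \<in> L2 W" using nodal_basis_L2(1)[OF nb] .
  have vH: "v \<in> Hs s" using fe_space_0_Hs[OF v assms(2,3)] .
  have "box_norm c s R v = \<parallel>v\<parallel>"
    using fe_space_0_eq_0[OF v] assms(3) by (intro box_norm_eq_Hs_norm vH) auto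
  moreover have "(\<lambda>x. \<Sum>k<n. (meas_op c s \<Omega> v (X k) - y k) * \<theta> k x)
      = (\<lambda>x. nodal_interp n X \<theta> (meas_op c s \<Omega> v) x - (\<Sum>k<n. y k * \<theta> k x))"
    by (simp add: nodal_interp_def fun_eq_iff left_diff_distrib sum_subtractf)
  ultimately show ?thesis
    using L2_norm_power2[OF L2.diff_mem[OF nodal_interp_L2[OF nb] L2.sum_mem[of "{..<n}" \<theta> W y]]] \<theta>
    by (simp add: discrete_tikhonov_def J_def Y_norm_eq_L2_norm Hs_norm_power2[OF c_pos])
qed

lemma discrete_tikhonov_stable:
  assumes nb: "nodal_basis W (fe_space pW \<T>W W) n X \<theta>" and "simplicial_mesh \<T> (cube R)" "\<Omega> \<subseteq> cube R" "0 < \<alpha>"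
    and u: "is_arg_min (discrete_tikhonov c s \<Omega> W R n X \<theta> y \<alpha>) (\<lambda>v. v \<in> fe_space_0 p \<T> (cube R) \<Omega>) u"
    and u': "is_arg_min (discrete_tikhonov c s \<Omega> W R n X \<theta> y' \<alpha>) (\<lambda>v. v \<in> fe_space_0 p \<T> (cube R) \<Omega>) u'"
  shows "sqrt \<alpha> * \<parallel>\<lambda>x. u x - u' x\<parallel> \<le> Y_norm W n \<theta> (\<lambda>k. y k - y' k)"
proof -
  interpret tikhonov_setting "Hs s" "Hs_inner c s" "L2 W" "L2_inner W" "fe_space_0 p \<T> (cube R) \<Omega>"
    "\<lambda>v. nodal_interp n X \<theta> (meas_op c s \<Omega> v)" \<alpha>
    using discrete_tikhonov_setting[OF assms(1-4)] .
  have \<theta>: "\<And>k. k < n \<Longrightarrow> \<theta> k \<in> L2 W" using nodal_basis_L2(1)[OF nb] .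
  have m: "(\<lambda>x. \<Sum>k<n. y k * \<theta> k x) \<in> L2 W" for y using L2.sum_mem[of "{..<n}" \<theta> W y] \<theta> by simp
  have eq: "discrete_tikhonov c s \<Omega> W R n X \<theta> y \<alpha> v = J (\<lambda>x. \<Sum>k<n. y k * \<theta> k x) v"
    if "v \<in> fe_space_0 p \<T> (cube R) \<Omega>" for y v
    using discrete_tikhonov_eq_J[OF assms(1-4) that] .
  have "sqrt \<alpha> * \<parallel>\<lambda>x. u x - u' x\<parallel> \<le> L2_norm W (\<lambda>x. (\<Sum>k<n. y k * \<theta> k x) - (\<Sum>k<n. y' k * \<theta> k x))"
    unfolding Hs_norm_eq L2_norm_def
    by (rule minimizer_stable[OF m m is_arg_min_cong[OF eq u] is_arg_min_cong[OF eq u']])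
  also have "\<dots> = Y_norm W n \<theta> (\<lambda>k. y k - y' k)"
    by (simp add: Y_norm_eq_L2_norm[OF \<theta>] left_diff_distrib sum_subtractf)
  finally show ?thesis .
qed

end

section \<open>Lipschitz functions vanishing outside the domain\<close>

text \<open>F is a function of the mollifier \<eta>: its partial derivative is F of a partial
  derivative of \<eta>, so smoothness of all orders follows by induction over test functions
  although v is only continuous. Integration over a fixed box keeps the differentiation under the
  integral on a compact set.\<close>

lemma has_derivative_mollified:
  fixes v \<eta> :: "'a::euclidean_space \<Rightarrow> real" and a b x :: 'a
  assumes v: "continuous_on UNIV v" and \<eta>: "\<eta> \<in> test_functions D"
  defines "F \<equiv> \<lambda>\<eta> x. integral (cbox a b) (\<lambda>y. v y * \<eta> (x - y))"
  shows "F \<eta> differentiable at x" "i \<in> Basis \<Longrightarrow> partial_deriv i (F \<eta>) x = F (partial_deriv i \<eta>) x"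
proof -
  have \<eta>d: "\<eta> differentiable at x" for x
    using \<eta> C_k.simps(2)[of 0 \<eta>] by (auto simp: test_functions_iff)
  have \<eta>c: "continuous_on UNIV \<eta>" using test_function_measurable(1)[OF \<eta>] .
  have dc: "continuous_on UNIV (partial_deriv i \<eta>)" if "i \<in> Basis" for i
    using test_function_measurable(1)[OF test_functions_partial_deriv[OF \<eta> that]] .
  \<comment> \<open>The Leibniz rule wants the derivative as a continuous family of bounded linear
    maps; it is assembled from the partial derivatives, whose continuity is known.\<close>
  define D where "D x y = (\<Sum>i\<in>Basis. (v y * partial_deriv i \<eta> (x - y)) *\<^sub>R blinfun_inner_left i)" for x y
  have D_apply: "blinfun_apply (D x y) h = v y * frechet_derivative \<eta> (at (x - y)) h" for x y h
    unfolding D_def frechet_derivative_sum[OF \<eta>d]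
    by (simp add: blinfun.sum_left blinfun.scaleR_left sum_distrib_left inner_commute mult_ac)
  have D_Basis: "blinfun_apply (D x y) i = v y * partial_deriv i \<eta> (x - y)" for x y i
    unfolding D_apply partial_deriv_def ..
  have Dc: "continuous_on A (\<lambda>(x, y). D x y)" for A
    unfolding D_def split_beta
    by (intro continuous_intros continuous_on_compose2[OF v] continuous_on_compose2[OF dc]) auto
  have Dc1: "continuous_on (cbox a b) (D x)" for x
    unfolding D_def
    by (intro continuous_intros continuous_on_compose2[OF v] continuous_on_compose2[OF dc]) auto
  have der: "(F \<eta> has_derivative blinfun_apply (integral (cbox a b) (D x))) (at x)" for x
    unfolding F_def
  proof (rule leibniz_rule[where U = UNIV and f = "\<lambda>x y. v y * \<eta> (x - y)" and fx = D])
    fix x t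
    have "((\<lambda>x. \<eta> (x - t)) has_derivative frechet_derivative \<eta> (at (x - t))) (at x)"
      by (rule has_derivative_compose[of "\<lambda>x. x - t" "\<lambda>h. h" x UNIV \<eta>])
         (auto intro!: derivative_eq_intros has_derivative_frechet \<eta>d)
    then have "((\<lambda>x. v t * \<eta> (x - t)) has_derivative (\<lambda>h. v t * frechet_derivative \<eta> (at (x - t)) h)) (at x)"
      by (rule has_derivative_mult_right)
    then show "((\<lambda>x. v t * \<eta> (x - t)) has_derivative blinfun_apply (D x t)) (at x)"
      by (rule has_derivative_eq_rhs) (simp add: fun_eq_iff D_apply)
  next
    fix x
    show "(\<lambda>y. v y * \<eta> (x - y)) integrable_on cbox a b"
      by (intro integrable_continuous continuous_intros continuous_on_compose2[OF v] continuous_on_compose2[OF \<eta>c]) auto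
  qed (auto simp: Dc)
  then show "F \<eta> differentiable at x" by (auto simp: differentiable_def)
  show "partial_deriv i (F \<eta>) x = F (partial_deriv i \<eta>) x"
  proof -
    have "partial_deriv i (F \<eta>) x = blinfun_apply (integral (cbox a b) (D x)) i"
      by (rule partial_deriv_eq[OF der])
    also have "\<dots> = integral (cbox a b) (\<lambda>y. blinfun_apply (D x y) i)"
      by (rule blinfun_apply_integral) (rule integrable_continuous[OF Dc1])
    also have "\<dots> = F (partial_deriv i \<eta>) x" unfolding F_def D_Basis ..
    finally show ?thesis .
  qed
qed

lemma C_k_mollified:
  fixes v \<eta> :: "'a::euclidean_space \<Rightarrow> real"
  assumes v: "continuous_on UNIV v"
  shows "\<eta> \<in> test_functions D \<Longrightarrow> C_k k (\<lambda>x. integral (cbox a b) (\<lambda>y. v y * \<eta> (x - y)))"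
proof (induction k arbitrary: \<eta>)
  case 0
  have "continuous_on UNIV (\<lambda>x. integral (cbox a b) (\<lambda>y. v y * \<eta> (x - y)))"
    using has_derivative_mollified(1)[OF v 0]
    by (intro continuous_at_imp_continuous_on ballI differentiable_imp_continuous_within)
  then show ?case by simp
next
  case (Suc k)
  have "partial_deriv i (\<lambda>x. integral (cbox a b) (\<lambda>y. v y * \<eta> (x - y)))
      = (\<lambda>x. integral (cbox a b) (\<lambda>y. v y * partial_deriv i \<eta> (x - y)))" if "i \<in> Basis" for i
    using has_derivative_mollified(2)[OF v Suc.prems that] by blast
  then show ?case
    using has_derivative_mollified(1)[OF v Suc.prems] Suc.IH[OF test_functions_partial_deriv[OF Suc.prems]]
    by simp
qed

lemma mollifier_exists:
  assumes "0 < \<delta>"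
  obtains \<eta> :: "'a::euclidean_space \<Rightarrow> real" where "\<eta> \<in> test_functions (cball 0 \<delta>)"
    "\<And>x. 0 \<le> \<eta> x" "integrable lborel \<eta>" "(\<integral>x. \<eta> x \<partial>lborel) = 1"
proof -
  obtain a b where ab: "cbox a b \<subseteq> ball (0::'a) \<delta>" "0 \<in> box a b"
    using open_contains_cbox[of "ball (0::'a) \<delta>" 0] assms by (metis open_ball centre_in_ball)
  let ?\<rho> = "box_bump a b"
  have t: "?\<rho> \<in> test_functions (cball 0 \<delta>)"
    using ab(1) ball_subset_cball by (intro box_bump_test_function) blast
  obtain B where B: "\<And>x. \<bar>?\<rho> x\<bar> \<le> B" "0 \<le> B" using test_function_bounded[OF t] by blast
  have [measurable]: "?\<rho> \<in> borel_measurable borel" using test_function_measurable(2)[OF t] .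
  have i: "integrable lborel ?\<rho>"
  proof (rule Bochner_Integration.integrable_bound)
    show "integrable lborel (\<lambda>x. indicator (cbox a b) x * B)"
      by (intro integrable_mult_left integrable_real_indicator)
         (use emeasure_lborel_cbox_finite in auto)
    have "\<bar>?\<rho> x\<bar> \<le> indicator (cbox a b) x * B" for x
      using B box_bump_eq_0[of x a b] box_subset_cbox[of a b] by (cases "x \<in> cbox a b") auto
    then show "AE x in lborel. norm (?\<rho> x) \<le> norm (indicator (cbox a b) x * B)"
      by (auto intro: order_trans[OF _ abs_ge_self])
  qed simp
  \<comment> \<open>The bump is positive on the open box, and the box has positive volume because it
    contains 0.\<close>
  have "(\<integral>x. ?\<rho> x \<partial>lborel) \<noteq> 0"
  proof
    assume "(\<integral>x. ?\<rho> x \<partial>lborel) = 0"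
    then have "AE x in lborel. ?\<rho> x = 0"
      using integral_nonneg_eq_0_iff_AE[OF i] box_bump_nonneg by auto
    then have "AE x in lborel. x \<notin> box a b" by eventually_elim (metis box_bump_pos less_irrefl)
    then have "emeasure lborel (box a b) = 0"
      by (subst (asm) AE_iff_measurable[of "box a b"]) auto
    moreover have "a \<bullet> i < b \<bullet> i" if "i \<in> Basis" for i using ab(2) that by (force simp: mem_box)
    then have "emeasure lborel (box a b) = ennreal (\<Prod>i\<in>Basis. (b - a) \<bullet> i)" "0 < (\<Prod>i\<in>Basis. (b - a) \<bullet> i)"
      by (auto simp: emeasure_lborel_box less_imp_le inner_diff_left intro!: prod_pos)
    ultimately show False by (metis ennreal_eq_0_iff not_le)
  qed
  moreover have "0 \<le> (\<integral>x. ?\<rho> x \<partial>lborel)" using box_bump_nonneg by (intro integral_nonneg_AE) auto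
  ultimately have pos: "0 < (\<integral>x. ?\<rho> x \<partial>lborel)" by simp
  let ?k = "1 / (\<integral>x. ?\<rho> x \<partial>lborel)"
  show thesis
  proof (rule that[of "\<lambda>x. ?k * ?\<rho> x"])
    show "(\<lambda>x. ?k * ?\<rho> x) \<in> test_functions (cball 0 \<delta>)"
      using test_functions_lincomb[OF t t, of ?k 0] by simp
    show "0 \<le> ?k * ?\<rho> x" for x using pos box_bump_nonneg[of a b x] by simp
    show "integrable lborel (\<lambda>x. ?k * ?\<rho> x)" using i by simp
    show "(\<integral>x. ?k * ?\<rho> x \<partial>lborel) = 1" using pos by simp
  qed
qed

text \<open>Besides the sup error the Lipschitz constant is recorded: averaging translates of v does
  not increase it. At every scale \<delta> the error w - v then has Lipschitz constant at most 2 L,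
  which is the situation of \<open>lipschitz_small\<close>.\<close>

lemma mollify:
  fixes v :: "'a::euclidean_space \<Rightarrow> real"
  assumes L: "0 \<le> L" "\<And>x y. \<bar>v x - v y\<bar> \<le> L * norm (x - y)"
    and K: "compact K" "\<And>x. x \<notin> K \<Longrightarrow> v x = 0" and \<delta>: "0 < \<delta>" "(\<Union>x\<in>K. cball x \<delta>) \<subseteq> D"
  obtains w where "w \<in> test_functions D" "\<And>x. \<bar>w x - v x\<bar> \<le> L * \<delta>"
    "\<And>x y. \<bar>w x - w y\<bar> \<le> L * norm (x - y)"
proof -
  obtain \<eta> :: "'a \<Rightarrow> real" where \<eta>: "\<eta> \<in> test_functions (cball 0 \<delta>)" "\<And>x. 0 \<le> \<eta> x"
    "integrable lborel \<eta>" "(\<integral>x. \<eta> x \<partial>lborel) = 1"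
    using mollifier_exists[OF \<delta>(1)] by blast
  have vc: "continuous_on UNIV v"
    by (rule lipschitz_on_continuous_on[of L]) (use L in \<open>auto simp: lipschitz_on_def dist_norm\<close>)
  have [measurable]: "v \<in> borel_measurable borel" "\<eta> \<in> borel_measurable borel"
    using vc test_function_measurable(2)[OF \<eta>(1)] by (auto intro: borel_measurable_continuous_onI)
  obtain B where B: "\<And>x. \<bar>v x\<bar> \<le> B" using compact_support_bounded[OF vc K] by blast
  obtain a b where ab: "K \<subseteq> cbox a b" using bounded_subset_cbox_symmetric[OF compact_imp_bounded[OF K(1)]] by metis
  have \<eta>0: "\<eta> z = 0" if "z \<notin> cball 0 \<delta>" for z using \<eta>(1) that by (auto simp: test_functions_iff)
  define w where "w = (\<lambda>x. integral (cbox a b) (\<lambda>y. v y * \<eta> (x - y)))"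
  have i: "integrable lborel (\<lambda>z. v (x - z) * \<eta> z)" for x
  proof (rule Bochner_Integration.integrable_bound)
    show "integrable lborel (\<lambda>z. B * \<eta> z)" using \<eta>(3) by simp
    show "AE z in lborel. norm (v (x - z) * \<eta> z) \<le> norm (B * \<eta> z)"
      using B \<eta>(2) by (auto simp: abs_mult intro!: mult_right_mono order_trans[OF B abs_ge_self])
  qed simp
  \<comment> \<open>Two forms of one convolution: the defining one has x in the smooth factor and
    yields differentiability, this one has x in v and yields the Lipschitz and sup
    estimates.\<close>
  have w: "w x = (\<integral>z. v (x - z) * \<eta> z \<partial>lborel)" for x
  proof -
    have "(\<integral>z. v (x - z) * \<eta> z \<partial>lborel) = (\<integral>y. v (x - (x - y)) * \<eta> (x - y) \<partial>lborel)"
      by (rule integral_lborel_translate(1)[symmetric]) simp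
    also have "\<dots> = (LINT y:cbox a b|lborel. v y * \<eta> (x - y))"
      unfolding set_lebesgue_integral_def
      using K(2) ab by (intro Bochner_Integration.integral_cong) (auto simp: indicator_def)
    also have "\<dots> = w x" unfolding w_def
    proof (rule set_borel_integral_eq_integral(2))
      have "integrable lborel (\<lambda>y. v (x - (x - y)) * \<eta> (x - y))"
        using i[of x] integral_lborel_translate(3)[of "\<lambda>z. v (x - z) * \<eta> z" x] by simp
      then have "integrable lborel (\<lambda>y. v y * \<eta> (x - y))" by simp
      then show "set_integrable lborel (cbox a b) (\<lambda>y. v y * \<eta> (x - y))"
        unfolding set_integrable_def by (intro integrable_mult_indicator) auto
    qed
    finally show ?thesis by simp
  qed
  show thesis
  proof (rule that)
    have "\<forall>k. C_k k w" unfolding w_def using C_k_mollified[OF vc \<eta>(1)] by blast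
    moreover have "w x = 0" if "x \<notin> (\<Union>x\<in>K. \<Union>y\<in>cball 0 \<delta>. {x + y})" for x
    proof -
      have "v (x - z) * \<eta> z = 0" for z
      proof (cases "x - z \<in> K \<and> z \<in> cball 0 \<delta>")
        case True
        then have "x \<in> (\<Union>x\<in>K. \<Union>y\<in>cball 0 \<delta>. {x + y})" by (intro UN_I[of "x - z"] UN_I[of z]) auto
        with that show ?thesis by blast
      qed (use K(2) \<eta>0 in auto)
      then have "(\<lambda>z. v (x - z) * \<eta> z) = (\<lambda>z. 0)" by blast
      then show ?thesis unfolding w by (simp only: integral_zero)
    qed
    moreover have "compact (\<Union>x\<in>K. \<Union>y\<in>cball 0 \<delta>. {x + y})"
      using compact_sums'[OF K(1) compact_cball] .
    moreover have "(\<Union>x\<in>K. \<Union>y\<in>cball 0 \<delta>. {x + y}) \<subseteq> D"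
    proof clarify
      fix x y :: 'a assume "x \<in> K" "y \<in> cball 0 \<delta>"
      then have "x + y \<in> cball x \<delta>" by (simp add: dist_norm)
      then show "x + y \<in> D" using \<delta>(2) \<open>x \<in> K\<close> by blast
    qed
    ultimately show "w \<in> test_functions D"
      unfolding test_functions_iff
      by (intro conjI exI[of _ "\<Union>x\<in>K. \<Union>y\<in>cball 0 \<delta>. {x + y}"] allI impI) blast+
  next
    fix x
    have "w x - v x = (\<integral>z. v (x - z) * \<eta> z - v x * \<eta> z \<partial>lborel)"
      unfolding w using i[of x] \<eta>(3,4) by (subst Bochner_Integration.integral_diff) auto
    also have "\<bar>\<dots>\<bar> \<le> (\<integral>z. \<bar>v (x - z) * \<eta> z - v x * \<eta> z\<bar> \<partial>lborel)" by (rule integral_abs_bound)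
    also have "\<dots> \<le> (\<integral>z. (L * \<delta>) * \<eta> z \<partial>lborel)"
    proof (rule integral_mono)
      show "\<bar>v (x - z) * \<eta> z - v x * \<eta> z\<bar> \<le> (L * \<delta>) * \<eta> z" for z
      proof (cases "z \<in> cball 0 \<delta>")
        case True
        then have "L * norm z \<le> L * \<delta>" using L(1) by (intro mult_left_mono) auto
        then have "\<bar>v (x - z) - v x\<bar> \<le> L * \<delta>" using L(2)[of "x - z" x] by simp
        then have "\<bar>v (x - z) - v x\<bar> * \<eta> z \<le> (L * \<delta>) * \<eta> z" using \<eta>(2) by (rule mult_right_mono)
        then show ?thesis using \<eta>(2)[of z] by (simp add: abs_mult flip: left_diff_distrib)
      qed (simp add: \<eta>0)
    qed (use i[of x] \<eta>(3) in auto)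
    also have "\<dots> = L * \<delta>" using \<eta>(4) by simp
    finally show "\<bar>w x - v x\<bar> \<le> L * \<delta>" .
  next
    fix x y
    have "w x - w y = (\<integral>z. v (x - z) * \<eta> z - v (y - z) * \<eta> z \<partial>lborel)"
      unfolding w using i by simp
    also have "\<bar>\<dots>\<bar> \<le> (\<integral>z. \<bar>v (x - z) * \<eta> z - v (y - z) * \<eta> z\<bar> \<partial>lborel)" by (rule integral_abs_bound)
    also have "\<dots> \<le> (\<integral>z. (L * norm (x - y)) * \<eta> z \<partial>lborel)"
    proof (rule integral_mono)
      fix z
      have "\<bar>v (x - z) - v (y - z)\<bar> * \<eta> z \<le> (L * norm (x - y)) * \<eta> z"
        using L(2)[of "x - z" "y - z"] \<eta>(2) by (intro mult_right_mono) auto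
      then show "\<bar>v (x - z) * \<eta> z - v (y - z) * \<eta> z\<bar> \<le> (L * norm (x - y)) * \<eta> z"
        using \<eta>(2)[of z] by (simp add: abs_mult flip: left_diff_distrib)
    qed (use i \<eta>(3) in auto)
    also have "\<dots> = L * norm (x - y)" using \<eta>(4) by simp
    finally show "\<bar>w x - w y\<bar> \<le> L * norm (x - y)" .
  qed
qed

context fractional_measurement
begin

text \<open>With L fixed, A (\<epsilon>^2 + L^(1+s) \<epsilon>^(1-s)) tends to 0 with \<epsilon>
  because s < 1. One \<epsilon> serves all functions with this Lipschitz constant that vanish off
  \<Omega>, so approximation in \<open>Hs\<close> reduces to uniform approximation.\<close>

lemma lipschitz_small:
  assumes "0 \<le> L" "0 < \<tau>"
  shows "\<exists>\<epsilon>>0. \<forall>v. (\<forall>x y. \<bar>v x - v y\<bar> \<le> L * norm (x - y)) \<longrightarrow> (\<forall>x. \<bar>v x\<bar> \<le> \<epsilon>) \<longrightarrow>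
      (\<forall>x. x \<notin> \<Omega> \<longrightarrow> v x = 0) \<longrightarrow> v \<in> Hs s \<and> \<parallel>v\<parallel> < \<tau>"
proof -
  obtain A where A: "0 \<le> A" "\<And>L \<epsilon> v. 0 \<le> L \<Longrightarrow> 0 \<le> \<epsilon> \<Longrightarrow> (\<And>x y. \<bar>v x - v y\<bar> \<le> L * norm (x - y)) \<Longrightarrow>
      (\<And>x. \<bar>v x\<bar> \<le> \<epsilon>) \<Longrightarrow> (\<And>x. x \<notin> \<Omega> \<Longrightarrow> v x = 0) \<Longrightarrow>
      v \<in> Hs s \<and> \<parallel>v\<parallel>\<^sup>2 \<le> A * (\<epsilon>\<^sup>2 + L powr (1 + s) * \<epsilon> powr (1 - s))"
    using lipschitz_Hs[OF c_pos s_pos s_less bounded_\<Omega> borel_open[OF open_\<Omega>]] by metis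
  have "\<forall>\<^sub>F \<epsilon> in at_right 0. 0 \<le> (\<epsilon>::real)"
    using eventually_at_right_less[of 0] by eventually_elim simp
  then have "((\<lambda>\<epsilon>. A * (\<epsilon>\<^sup>2 + L powr (1 + s) * \<epsilon> powr (1 - s))) \<longlongrightarrow> A * (0\<^sup>2 + L powr (1 + s) * 0)) (at_right 0)"
    using s_less by (intro tendsto_intros tendsto_zero_powrI[where b = "1 - s"]) auto
  then have "\<forall>\<^sub>F \<epsilon> in at_right 0. A * (\<epsilon>\<^sup>2 + L powr (1 + s) * \<epsilon> powr (1 - s)) < \<tau>\<^sup>2"
    using assms(2) by (intro order_tendstoD) auto
  then have "\<forall>\<^sub>F \<epsilon> in at_right (0::real). 0 < \<epsilon> \<and> A * (\<epsilon>\<^sup>2 + L powr (1 + s) * \<epsilon> powr (1 - s)) < \<tau>\<^sup>2"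
    using eventually_at_right_less by eventually_elim auto
  then obtain \<epsilon> where \<epsilon>: "0 < \<epsilon>" "A * (\<epsilon>\<^sup>2 + L powr (1 + s) * \<epsilon> powr (1 - s)) < \<tau>\<^sup>2"
    using eventually_happens trivial_limit_at_right_real by blast
  show ?thesis
  proof (intro exI[of _ \<epsilon>] conjI[OF \<epsilon>(1)] allI impI)
    fix v assume v: "\<forall>x y. \<bar>v x - v y\<bar> \<le> L * norm (x - y)" "\<forall>x. \<bar>v x\<bar> \<le> \<epsilon>" "\<forall>x. x \<notin> \<Omega> \<longrightarrow> v x = 0"
    have "v \<in> Hs s" "\<parallel>v\<parallel>\<^sup>2 < \<tau>\<^sup>2"
      using A(2)[of L \<epsilon> v] v assms(1) \<epsilon> by auto
    then show "v \<in> Hs s \<and> \<parallel>v\<parallel> < \<tau>" using assms(2) by (auto intro: power_less_imp_less_base)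
  qed
qed

lemma lipschitz_Hs_tilde:
  assumes L: "0 \<le> L" "\<And>x y. \<bar>v x - v y\<bar> \<le> L * norm (x - y)" and v: "\<And>x. x \<notin> \<Omega> \<Longrightarrow> v x = 0" "v \<in> Hs s"
  shows "v \<in> Hs_tilde c s \<Omega>"
proof (rule Hs_tilde_limit[OF v(2)])
  fix \<tau> :: real assume "0 < \<tau>"
  have L2: "0 \<le> 2 * L" using L(1) by simp
  obtain \<epsilon> where \<epsilon>: "0 < \<epsilon>" "\<forall>v. (\<forall>x y. \<bar>v x - v y\<bar> \<le> (2 * L) * norm (x - y)) \<longrightarrow> (\<forall>x. \<bar>v x\<bar> \<le> \<epsilon>) \<longrightarrow>
      (\<forall>x. x \<notin> \<Omega> \<longrightarrow> v x = 0) \<longrightarrow> v \<in> Hs s \<and> \<parallel>v\<parallel> < \<tau>"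
    using lipschitz_small[OF L2 \<open>0 < \<tau>\<close>] by (elim exE conjE)
  define k where "k = \<epsilon> / 2"
  \<comment> \<open>Soft thresholding at level k: it moves v by at most k, keeps the Lipschitz
    constant and vanishes where |v| < k. The set |v| \<ge> k is compact inside \<Omega>, because v
    is continuous and zero off the bounded set \<Omega>.\<close>
  define t where "t = (\<lambda>x. max (v x - k) 0 - max (- v x - k) 0)"
  have "0 < k" using \<epsilon>(1) by (simp add: k_def)
  have tL: "\<bar>t x - t y\<bar> \<le> L * norm (x - y)" for x y
  proof -
    have "\<bar>t x - t y\<bar> \<le> \<bar>v x - v y\<bar>" using \<open>0 < k\<close> unfolding t_def by (simp add: max_def)
    then show ?thesis using L(2)[of x y] by simp
  qed
  have tv: "\<bar>v x - t x\<bar> \<le> k" for x using \<open>0 < k\<close> unfolding t_def by (simp add: max_def abs_le_iff)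
  let ?K = "{x. k \<le> \<bar>v x\<bar>}"
  have vc: "continuous_on UNIV v"
    by (rule lipschitz_on_continuous_on[of L]) (use L in \<open>auto simp: lipschitz_on_def dist_norm\<close>)
  have sub: "?K \<subseteq> \<Omega>" using v(1) \<open>0 < k\<close> by force
  have "closed ?K" using vc by (intro closed_Collect_le continuous_intros)
  moreover have "bounded ?K" using sub bounded_\<Omega> bounded_subset by blast
  ultimately have K: "compact ?K" by (simp add: compact_eq_bounded_closed)
  have t0: "t x = 0" if "x \<notin> ?K" for x
    using that unfolding t_def by (auto simp: max_def not_le abs_less_iff)
  obtain d where d: "0 < d" "(\<Union>x\<in>?K. cball x d) \<subseteq> \<Omega>"
    using compact_subset_open_imp_cball_epsilon_subset[OF K open_\<Omega> sub] by blast
  \<comment> \<open>The bound by d keeps the mollified support inside \<Omega>; the other one gives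
    \<open>L * \<delta> \<le> k\<close>, so that truncation and mollification cost k = \<epsilon> /
    2 each. L + 1 guards against L = 0.\<close>
  define \<delta> where "\<delta> = min d (k / (L + 1))"
  have \<delta>: "0 < \<delta>" "\<delta> \<le> d" using d(1) \<open>0 < k\<close> L(1) by (auto simp: \<delta>_def)
  have "L * \<delta> \<le> (L + 1) * (k / (L + 1))"
    using L(1) \<delta>(1) by (intro mult_mono) (auto simp: \<delta>_def)
  also have "\<dots> = k" using L(1) by simp
  finally have L\<delta>: "L * \<delta> \<le> k" .
  have "(\<Union>x\<in>?K. cball x \<delta>) \<subseteq> \<Omega>" using d(2) \<delta>(2) by force
  then obtain w where w: "w \<in> test_functions \<Omega>" "\<And>x. \<bar>w x - t x\<bar> \<le> L * \<delta>"
    "\<And>x y. \<bar>w x - w y\<bar> \<le> L * norm (x - y)"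
    using mollify[OF L(1) tL K t0 \<delta>(1), where D = \<Omega>] by metis
  have "(\<lambda>x. v x - w x) \<in> Hs s \<and> \<parallel>\<lambda>x. v x - w x\<parallel> < \<tau>"
  proof (rule \<epsilon>(2)[rule_format])
    show "\<bar>v x - w x - (v y - w y)\<bar> \<le> (2 * L) * norm (x - y)" for x y
      using L(2)[of x y] w(3)[of x y] by simp
    show "\<bar>v x - w x\<bar> \<le> \<epsilon>" for x
      using tv[of x] w(2)[of x] L\<delta> unfolding k_def by linarith
    show "v x - w x = 0" if "x \<notin> \<Omega>" for x
      using v(1)[OF that] w(1) that by (auto simp: test_functions_iff)
  qed
  then show "\<exists>z\<in>Hs_tilde c s \<Omega>. \<parallel>\<lambda>x. v x - z x\<parallel> < \<tau>"
    using test_functions_Hs_tilde[OF w(1)] by blast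
qed

lemma fe_space_0_Hs_tilde:
  assumes "v \<in> fe_space_0 p \<T> (cube R) \<Omega>" "simplicial_mesh \<T> (cube R)" "\<Omega> \<subseteq> cube R"
  shows "v \<in> Hs_tilde c s \<Omega>"
proof -
  obtain B L where "0 \<le> B" and L: "0 \<le> L" and "\<And>x. \<bar>v x\<bar> \<le> B"
    and l: "\<And>x y. \<bar>v x - v y\<bar> \<le> L * norm (x - y)"
    using fe_space_0_lipschitz[OF assms] by blast
  show ?thesis
    by (rule lipschitz_Hs_tilde[OF L l fe_space_0_eq_0[OF assms(1)] fe_space_0_Hs[OF assms]])
qed

end

section \<open>Piecewise linear interpolation\<close>

lemma finite_multi_indices: "finite (multi_indices m :: ('a::euclidean_space \<Rightarrow> nat) set)"
proof (rule finite_subset)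
  show "finite {f :: 'a \<Rightarrow> nat. \<forall>x. (x \<in> Basis \<longrightarrow> f x \<in> {..m}) \<and> (x \<notin> Basis \<longrightarrow> f x = 0)}"
    by (rule finite_set_of_finite_funs) auto
  have "\<beta> b \<le> m" if "\<beta> \<in> multi_indices m" "b \<in> Basis" for \<beta> and b :: 'a
    using that member_le_sum[of b Basis \<beta>] by (auto simp: multi_indices_def)
  then show "multi_indices m \<subseteq> {f :: 'a \<Rightarrow> nat. \<forall>x. (x \<in> Basis \<longrightarrow> f x \<in> {..m}) \<and> (x \<notin> Basis \<longrightarrow> f x = 0)}"
    by (auto simp: multi_indices_def)
qed

lemma monomial_in_polynomials:
  assumes "\<beta>\<^sub>0 \<in> multi_indices p"
  shows "(\<lambda>x::'a::euclidean_space. \<Prod>b\<in>Basis. (x \<bullet> b) ^ \<beta>\<^sub>0 b) \<in> polynomials_upto p"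
  unfolding polynomials_upto_def
proof (intro CollectI exI)
  let ?a = "\<lambda>\<beta>. if \<beta> = \<beta>\<^sub>0 then 1 else 0 :: real"
  show "(\<lambda>x::'a. \<Prod>b\<in>Basis. (x \<bullet> b) ^ \<beta>\<^sub>0 b) = (\<lambda>x. \<Sum>\<beta>\<in>multi_indices p. ?a \<beta> * (\<Prod>b\<in>Basis. (x \<bullet> b) ^ \<beta> b))"
    using assms by (simp add: if_distrib[of "\<lambda>t. t * _"] finite_multi_indices cong: if_cong)
qed

lemma affine_in_polynomials:
  assumes "1 \<le> p"
  shows "(\<lambda>x::'a::euclidean_space. \<alpha> + x \<bullet> g) \<in> polynomials_upto p"
proof -
  have 0: "(\<lambda>x::'a. 1) \<in> polynomials_upto p"
    using monomial_in_polynomials[of "\<lambda>_. 0" p] by (simp add: multi_indices_def)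
  have b: "(\<lambda>x::'a. x \<bullet> b) \<in> polynomials_upto p" if "b \<in> Basis" for b
  proof -
    have "(\<lambda>x::'a. \<Prod>i\<in>Basis. (x \<bullet> i) ^ (if i = b then 1 else 0)) \<in> polynomials_upto p"
      using that assms by (intro monomial_in_polynomials) (auto simp: multi_indices_def)
    moreover have "(\<Prod>i\<in>Basis. (x \<bullet> i) ^ (if i = b then 1 else 0)) = x \<bullet> b" for x
    proof -
      have "(\<Prod>i\<in>Basis. (x \<bullet> i) ^ (if i = b then 1 else 0)) = (\<Prod>i\<in>Basis. if i = b then x \<bullet> i else 1)"
        by (rule prod.cong) auto
      then show ?thesis using that by simp
    qed
    ultimately show ?thesis by simp
  qed
  have "(\<lambda>x::'a. \<alpha> + (\<Sum>b\<in>S. (x \<bullet> b) * (g \<bullet> b))) \<in> polynomials_upto p" if "finite S" "S \<subseteq> Basis" for S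
    using that
  proof (induction S rule: finite_induct)
    case empty
    show ?case using polynomials_upto_lincomb[OF 0 0, of "\<alpha> - 1"] by simp
  next
    case (insert i S)
    then show ?case
      using polynomials_upto_lincomb[OF insert.IH b[of i], of "g \<bullet> i"] by (simp add: algebra_simps)
  qed
  from this[OF finite_Basis order_refl] show ?thesis by (simp add: euclidean_inner[symmetric])
qed

lemma affine_interpolant:
  fixes \<phi> :: "'a::euclidean_space \<Rightarrow> real"
  assumes "\<not> affine_dependent C"
  shows "\<exists>\<alpha> g. \<forall>x\<in>C. \<phi> x = \<alpha> + x \<bullet> g"
proof (cases "C = {}")
  case False
  then obtain a where a: "a \<in> C" by blast
  have "independent ((\<lambda>x. - a + x) ` (C - {a}))"
    using affine_dependent_iff_dependent2[OF a] assms by simp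
  then obtain l where l: "linear l" "\<forall>x\<in>(\<lambda>x. - a + x) ` (C - {a}). l x = \<phi> (x + a) - \<phi> a"
    using linear_independent_extend[of _ "\<lambda>x. \<phi> (x + a) - \<phi> a"] by blast
  define g where "g = (\<Sum>b\<in>Basis. l b *\<^sub>R b)"
  have lg: "l x = x \<bullet> g" for x
  proof -
    have "l (\<Sum>b\<in>Basis. (x \<bullet> b) *\<^sub>R b) = (\<Sum>b\<in>Basis. (x \<bullet> b) * l b)"
      by (simp only: linear_sum[OF l(1)] linear_scale[OF l(1)] real_scaleR_def)
    then have "l x = (\<Sum>b\<in>Basis. (x \<bullet> b) * l b)" by (simp only: euclidean_representation)
    then show ?thesis by (simp add: g_def inner_sum_right mult.commute)
  qed
  have "\<phi> x = (\<phi> a - l a) + x \<bullet> g" if "x \<in> C" for x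
  proof (cases "x = a")
    case False
    then have "l (- a + x) = \<phi> x - \<phi> a" using l(2) that by auto
    then show ?thesis using linear_add[OF l(1), of "- a" x] linear_neg[OF l(1), of a] by (simp add: lg)
  qed (simp add: lg)
  then show ?thesis by blast
qed auto

text \<open>A slab between two parallel hyperplanes is convex, so it contains K along with the
  vertices. With B = 0 this says that an affine function vanishing at the vertices vanishes on
  K.\<close>

lemma affine_hull_bound:
  fixes g :: "'a::euclidean_space"
  assumes "K = convex hull C" "\<And>z. z \<in> C \<Longrightarrow> \<bar>\<alpha> + z \<bullet> g\<bar> \<le> B" "x \<in> K"
  shows "\<bar>\<alpha> + x \<bullet> g\<bar> \<le> B"
proof -
  have "K \<subseteq> {x. g \<bullet> x \<le> B - \<alpha>} \<inter> {x. g \<bullet> x \<ge> - B - \<alpha>}"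
    unfolding assms(1)
  proof (rule hull_minimal)
    show "C \<subseteq> {x. g \<bullet> x \<le> B - \<alpha>} \<inter> {x. g \<bullet> x \<ge> - B - \<alpha>}"
    proof
      fix z assume "z \<in> C"
      from assms(2)[OF this] have "g \<bullet> z \<le> B - \<alpha>" "- B - \<alpha> \<le> g \<bullet> z"
        unfolding inner_commute[of g] by linarith+
      then show "z \<in> {x. g \<bullet> x \<le> B - \<alpha>} \<inter> {x. g \<bullet> x \<ge> - B - \<alpha>}" by simp
    qed
  qed (intro convex_Int convex_halfspace_le convex_halfspace_ge)
  with assms(3) have "g \<bullet> x \<le> B - \<alpha>" "- B - \<alpha> \<le> g \<bullet> x" by blast+
  then show ?thesis unfolding inner_commute[of g] by linarith
qed

lemma simplex_hull:
  assumes "n simplex K"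
  obtains C where "\<not> affine_dependent C" "K = convex hull C" "C = {z. z extreme_point_of K}"
  using assms unfolding simplex_def
  by (metis (mono_tags, lifting) Collect_cong Collect_mem_eq extreme_point_of_convex_hull_affine_independent)

text \<open>The point is that the local affine interpolants agree where simplices meet. The
  intersection is a common face, its extreme points are vertices of both simplices, and the
  difference of the two affine functions vanishes at them, hence on the whole face.\<close>

lemma simplicial_mesh_interpolant:
  fixes \<phi> :: "'a::euclidean_space \<Rightarrow> real"
  assumes m: "simplicial_mesh \<T> D"
  obtains v \<alpha> g where "\<And>K x. K \<in> \<T> \<Longrightarrow> x \<in> K \<Longrightarrow> v x = \<alpha> K + x \<bullet> g K"
    "\<And>x. x \<notin> closure D \<Longrightarrow> v x = 0" "\<And>K z. K \<in> \<T> \<Longrightarrow> z extreme_point_of K \<Longrightarrow> \<alpha> K + z \<bullet> g K = \<phi> z"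
proof -
  note \<T> = simplicial_meshD[OF m]
  have "\<exists>q. \<forall>z. z extreme_point_of K \<longrightarrow> fst q + z \<bullet> snd q = \<phi> z" if K: "K \<in> \<T>" for K
  proof -
    obtain C where C: "\<not> affine_dependent C" "K = convex hull C" "C = {z. z extreme_point_of K}"
      using simplex_hull[OF \<T>(3)[OF K]] by blast
    obtain \<alpha> g where "\<forall>x\<in>C. \<phi> x = \<alpha> + x \<bullet> g" using affine_interpolant[OF C(1)] by blast
    then show ?thesis using C(3) by (intro exI[of _ "(\<alpha>, g)"]) simp
  qed
  then have "\<forall>K\<in>\<T>. \<exists>q. \<forall>z. z extreme_point_of K \<longrightarrow> fst q + z \<bullet> snd q = \<phi> z" by (rule ballI)
  then obtain q where "\<forall>K\<in>\<T>. \<forall>z. z extreme_point_of K \<longrightarrow> fst (q K) + z \<bullet> snd (q K) = \<phi> z"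
    by (rule bchoice[THEN exE])
  then have q: "fst (q K) + z \<bullet> snd (q K) = \<phi> z" if "K \<in> \<T>" "z extreme_point_of K" for K z
    using that by (elim ballE[of _ _ K] allE[of _ z]) simp_all
  define v where "v = (\<lambda>x. if x \<in> closure D then let K = (SOME K. K \<in> \<T> \<and> x \<in> K) in fst (q K) + x \<bullet> snd (q K) else 0)"
  have agree: "fst (q K) + x \<bullet> snd (q K) = fst (q K') + x \<bullet> snd (q K')"
    if K: "K \<in> \<T>" "x \<in> K" and K': "K' \<in> \<T>" "x \<in> K'" for K K' x
  proof -
    let ?F = "K \<inter> K'"
    have faces: "?F face_of K" "?F face_of K'"
    proof -
      have "\<forall>T T'. T \<in> \<T> \<and> T' \<in> \<T> \<longrightarrow> T \<inter> T' face_of T"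
        using m unfolding simplicial_mesh_def triangulation_def by (elim conjE)
      then have "K \<inter> K' face_of K" "K' \<inter> K face_of K'" using K(1) K'(1) by blast+
      then show "?F face_of K" "?F face_of K'" unfolding Int_commute[of K' K] .
    qed
    have "compact ?F" "convex ?F"
      using \<T>(4,5) K(1) K'(1) by (auto intro: compact_Int convex_Int)
    then have F: "?F = convex hull {z. z extreme_point_of ?F}" by (rule Krein_Milman_Minkowski)
    have "\<bar>(fst (q K) - fst (q K')) + x \<bullet> (snd (q K) - snd (q K'))\<bar> \<le> 0"
    proof (rule affine_hull_bound[OF F])
      fix z assume "z \<in> {z. z extreme_point_of ?F}"
      then have "z extreme_point_of K" "z extreme_point_of K'"
        using extreme_point_of_face[OF faces(1), of z] extreme_point_of_face[OF faces(2), of z] by simp_all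
      then have "fst (q K) + z \<bullet> snd (q K) = \<phi> z" "fst (q K') + z \<bullet> snd (q K') = \<phi> z"
        using q[OF K(1)] q[OF K'(1)] by simp_all
      then show "\<bar>(fst (q K) - fst (q K')) + z \<bullet> (snd (q K) - snd (q K'))\<bar> \<le> 0"
        by (simp add: inner_diff_right)
    qed (use K K' in simp)
    then show ?thesis by (simp add: inner_diff_right)
  qed
  show thesis
  proof (rule that)
    fix K x assume K: "K \<in> \<T>" "x \<in> K"
    then have x: "x \<in> closure D" using \<T>(2) by blast
    have "(SOME K. K \<in> \<T> \<and> x \<in> K) \<in> \<T> \<and> x \<in> (SOME K. K \<in> \<T> \<and> x \<in> K)"
      by (rule someI[of _ K]) (use K in blast)
    then show "v x = fst (q K) + x \<bullet> snd (q K)"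
      using agree[of "SOME K. K \<in> \<T> \<and> x \<in> K" x K] K x unfolding v_def Let_def by (simp only: if_True)
  next
    show "v x = 0" if "x \<notin> closure D" for x using that by (simp add: v_def)
  next
    show "fst (q K) + z \<bullet> snd (q K) = \<phi> z" if "K \<in> \<T>" "z extreme_point_of K" for K z
      using q[OF that] .
  qed
qed

context fractional_measurement
begin

text \<open>The interpolant has a gradient bound independent of h, obtained from the balls inscribed
  in a shape-regular mesh, and a sup error of order h; \<open>lipschitz_small\<close> converts this
  into smallness in \<open>Hs\<close>. The threshold h0 depends neither on R nor on the mesh. Degree
  1 suffices, since affine functions belong to the polynomials of every degree p \<ge> 1.\<close>

lemma interpolation_approx:
  assumes \<phi>: "\<phi> \<in> test_functions \<Omega>" and \<sigma>: "0 < \<sigma>" and \<tau>: "0 < \<tau>" and p: "1 \<le> p"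
  shows "\<exists>h0>0. \<forall>h R \<T>. 0 < h \<and> h \<le> h0 \<and> \<Omega> \<subseteq> cube R \<and> simplicial_mesh \<T> (cube R) \<and> mesh_size \<T> = h
    \<and> quasi_uniform \<sigma> \<T> \<longrightarrow> (\<exists>v\<in>fe_space_0 p \<T> (cube R) \<Omega>. \<parallel>\<lambda>x. v x - \<phi> x\<parallel> < \<tau>)"
proof -
  obtain L where L: "0 \<le> L" "\<And>x y. \<bar>\<phi> x - \<phi> y\<bar> \<le> L * norm (x - y)"
    using test_function_lipschitz[OF \<phi>] by blast
  obtain S where S: "compact S" "S \<subseteq> \<Omega>" "\<And>x. x \<notin> S \<Longrightarrow> \<phi> x = 0"
    using \<phi> unfolding test_functions_iff by blast
  obtain d where d: "0 < d" "(\<Union>x\<in>S. cball x d) \<subseteq> \<Omega>"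
    using compact_subset_open_imp_cball_epsilon_subset[OF S(1) open_\<Omega> S(2)] by blast
  \<comment> \<open>Over a simplex the interpolant oscillates by at most 2 L times the diameter, and
    the simplex contains a ball of radius diameter / \<sigma>; the quotient is the gradient
    bound.\<close>
  define L' where "L' = 2 * L * \<sigma>"
  have L': "0 \<le> L'" "0 \<le> L' + L" using L(1) \<sigma> by (auto simp: L'_def)
  obtain \<epsilon> where \<epsilon>: "0 < \<epsilon>" "\<forall>v. (\<forall>x y. \<bar>v x - v y\<bar> \<le> (L' + L) * norm (x - y)) \<longrightarrow> (\<forall>x. \<bar>v x\<bar> \<le> \<epsilon>) \<longrightarrow>
      (\<forall>x. x \<notin> \<Omega> \<longrightarrow> v x = 0) \<longrightarrow> v \<in> Hs s \<and> \<parallel>v\<parallel> < \<tau>"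
    using lipschitz_small[OF L'(2) \<tau>] by (elim exE conjE)
  \<comment> \<open>The bound by d ensures that a simplex with a point outside \<Omega> has no
    vertex in the support of \<phi>, so that the interpolant vanishes on it; the other bound makes
    the sup error at most \<epsilon>.\<close>
  define h0 where "h0 = min d (\<epsilon> / (2 * L + 1))"
  have h0: "0 < h0" "h0 \<le> d" using d(1) \<epsilon>(1) L(1) by (auto simp: h0_def)
  have "2 * L * h0 \<le> (2 * L + 1) * (\<epsilon> / (2 * L + 1))"
    using L(1) h0(1) by (intro mult_mono) (auto simp: h0_def)
  also have "\<dots> = \<epsilon>" using L(1) by simp
  finally have Lh0: "2 * L * h0 \<le> \<epsilon>" .
  have "\<exists>v\<in>fe_space_0 p \<T> (cube R) \<Omega>. \<parallel>\<lambda>x. v x - \<phi> x\<parallel> < \<tau>"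
    if h: "0 < h" "h \<le> h0" and R: "\<Omega> \<subseteq> cube R" and m: "simplicial_mesh \<T> (cube R)"
      and size: "mesh_size \<T> = h" and qu: "quasi_uniform \<sigma> \<T>" for h R \<T>
  proof -
    note \<T> = simplicial_meshD[OF m]
    obtain v \<alpha> g where v: "\<And>K x. K \<in> \<T> \<Longrightarrow> x \<in> K \<Longrightarrow> v x = \<alpha> K + x \<bullet> g K"
      "\<And>x. x \<notin> closure (cube R) \<Longrightarrow> v x = 0"
      and vert: "\<And>K z. K \<in> \<T> \<Longrightarrow> z extreme_point_of K \<Longrightarrow> \<alpha> K + z \<bullet> g K = \<phi> z"
      using simplicial_mesh_interpolant[OF m, of \<phi>] by metis
    have diam: "norm (x - y) \<le> h" if "K \<in> \<T>" "x \<in> K" "y \<in> K" for K x y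
    proof -
      have "norm (x - y) \<le> diameter K"
        using diameter_bounded_bound[OF compact_imp_bounded[OF \<T>(4)[OF that(1)]] that(2,3)] by (simp add: dist_norm)
      also have "\<dots> \<le> h" unfolding size[symmetric] mesh_size_def using \<T>(1) that(1) by (intro Max_ge) auto
      finally show ?thesis .
    qed
    have hull: "K = convex hull {z. z extreme_point_of K}" if "K \<in> \<T>" for K
      using Krein_Milman_Minkowski[OF \<T>(4)[OF that] \<T>(5)[OF that]] .
    have ext: "z \<in> K" if "z extreme_point_of K" for z and K :: "'a set"
      using that by (simp add: extreme_point_of_def)
    have near: "\<bar>(\<alpha> K - \<phi> y) + x \<bullet> g K\<bar> \<le> L * diameter K" if K: "K \<in> \<T>" "y \<in> K" "x \<in> K" for K x y
    proof (rule affine_hull_bound[OF hull[OF K(1)] _ K(3)])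
      fix z assume "z \<in> {z. z extreme_point_of K}"
      then have z: "z extreme_point_of K" "z \<in> K" using ext by auto
      have "norm (z - y) \<le> diameter K"
        using diameter_bounded_bound[OF compact_imp_bounded[OF \<T>(4)[OF K(1)]] z(2) K(2)] by (simp add: dist_norm)
      then have "L * norm (z - y) \<le> L * diameter K" using L(1) by (rule mult_left_mono)
      then show "\<bar>(\<alpha> K - \<phi> y) + z \<bullet> g K\<bar> \<le> L * diameter K"
        using vert[OF K(1) z(1)] L(2)[of z y] by (simp add: algebra_simps)
    qed
    have grad: "norm (g K) \<le> L'" if K: "K \<in> \<T>" for K
    proof -
      obtain z where z: "cball z (diameter K / \<sigma>) \<subseteq> K"
        using qu K unfolding quasi_uniform_def shape_regular_def by blast
      have "h \<le> \<sigma> * diameter K" using qu K size unfolding quasi_uniform_def by blast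
      with h(1) have "0 < \<sigma> * diameter K" by linarith
      then have dp: "0 < diameter K" using \<sigma> by (rule zero_less_mult_pos)
      show ?thesis
      proof (cases "g K = 0")
        case False
        \<comment> \<open>From the centre of the inscribed ball, a step along the gradient to the
          sphere stays in K and changes the interpolant by the radius times the norm of the
          gradient.\<close>
        define x where "x = z + (diameter K / \<sigma> / norm (g K)) *\<^sub>R g K"
        have "x \<in> cball z (diameter K / \<sigma>)" "z \<in> cball z (diameter K / \<sigma>)"
          using False dp \<sigma> by (auto simp: x_def dist_norm)
        then have xz: "x \<in> K" "z \<in> K" using z by blast+
        have "\<bar>x \<bullet> g K - z \<bullet> g K\<bar> \<le> 2 * (L * diameter K)"
          using near[OF K xz(2) xz(1)] near[OF K xz(2) xz(2)] by linarith
        moreover have "x \<bullet> g K - z \<bullet> g K = diameter K / \<sigma> * norm (g K)"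
          using False by (simp add: x_def inner_add_left power2_norm_eq_inner[symmetric] power2_eq_square)
        ultimately have "diameter K / \<sigma> * norm (g K) \<le> 2 * (L * diameter K)" by linarith
        then have "diameter K * norm (g K) \<le> diameter K * L'"
          using \<sigma> by (simp add: L'_def field_simps)
        then show ?thesis using dp by simp
      qed (use L' in simp)
    qed
    have zero: "v x = 0" if x: "x \<notin> \<Omega>" for x
    proof (cases "x \<in> closure (cube R)")
      case True
      then obtain K where K: "K \<in> \<T>" "x \<in> K" using \<T>(2) by blast
      have "\<bar>\<alpha> K + x \<bullet> g K\<bar> \<le> 0"
      proof (rule affine_hull_bound[OF hull[OF K(1)] _ K(2)])
        fix z assume "z \<in> {z. z extreme_point_of K}"
        then have z: "z extreme_point_of K" "z \<in> K" using ext by auto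
        have "x \<in> cball z d" using diam[OF K(1) z(2) K(2)] h h0 by (simp add: dist_norm)
        then have "z \<notin> S" using d(2) x by blast
        then show "\<bar>\<alpha> K + z \<bullet> g K\<bar> \<le> 0" using S(3) vert[OF K(1) z(1)] by simp
      qed
      then show ?thesis using v(1)[OF K] by simp
    qed (rule v(2))
    have vlip: "\<bar>v x - v y\<bar> \<le> L' * norm (x - y)" for x y
    proof (rule piecewise_lipschitz[of "insert (- cube R) \<T>", OF _ _ _ L'(1)])
      show "finite (insert (- cube R) \<T>)" using \<T>(1) by simp
      show "\<Union> (insert (- cube R) \<T>) = UNIV" using \<T>(2) closure_subset[of "cube R"] by auto
    next
      fix K assume "K \<in> insert (- cube R) \<T>"
      then consider "K = - cube R" | "K \<in> \<T>" by blast
      then show "closed K" by cases (simp_all add: closed_Compl open_cube compact_imp_closed[OF \<T>(4)])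
    next
      fix K x y assume K: "K \<in> insert (- cube R) \<T>" "x \<in> K" "y \<in> K"
      then consider "K = - cube R" | "K \<in> \<T>" by blast
      then show "\<bar>v x - v y\<bar> \<le> L' * norm (x - y)"
      proof cases
        case 1
        then have "v x = 0" "v y = 0" using zero K R by auto
        then show ?thesis using L'(1) by simp
      next
        case 2
        have "v x - v y = (x - y) \<bullet> g K" using v(1)[OF 2] K by (simp add: inner_diff_left)
        then have "\<bar>v x - v y\<bar> \<le> norm (x - y) * norm (g K)" using Cauchy_Schwarz_ineq2 by metis
        also have "\<dots> \<le> norm (x - y) * L'" using grad[OF 2] by (rule mult_left_mono) simp
        finally show ?thesis by (simp add: mult.commute)
      qed
    qed
    have err: "\<bar>v x - \<phi> x\<bar> \<le> \<epsilon>" for x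
    proof (cases "x \<in> closure (cube R)")
      case True
      then obtain K where K: "K \<in> \<T>" "x \<in> K" using \<T>(2) by blast
      have "\<bar>v x - \<phi> x\<bar> \<le> L * diameter K" using near[OF K(1,2,2)] v(1)[OF K] by (simp add: algebra_simps)
      also have "\<dots> \<le> L * h0"
      proof (rule mult_left_mono[OF _ L(1)])
        have "diameter K \<le> h" unfolding size[symmetric] mesh_size_def using \<T>(1) K(1) by (intro Max_ge) auto
        then show "diameter K \<le> h0" using h(2) by simp
      qed
      also have "\<dots> \<le> 2 * L * h0" using L(1) h0(1) by simp
      finally show ?thesis using Lh0 by simp
    next
      case False
      then have "x \<notin> \<Omega>" using R closure_subset[of "cube R"] by blast
      then have "\<phi> x = 0" using S by blast
      then show ?thesis using v(2)[OF False] \<epsilon>(1) by simp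
    qed
    have "v \<in> fe_space_0 p \<T> (cube R) \<Omega>"
    proof -
      have "continuous_on UNIV v"
        by (rule lipschitz_on_continuous_on[of L']) (use L' vlip in \<open>auto simp: lipschitz_on_def dist_norm\<close>)
      then have "continuous_on (closure (cube R)) v" by (rule continuous_on_subset) simp
      moreover have "\<forall>K\<in>\<T>. \<exists>Q\<in>polynomials_upto p. \<forall>x\<in>K. v x = Q x"
      proof
        fix K assume "K \<in> \<T>"
        then show "\<exists>Q\<in>polynomials_upto p. \<forall>x\<in>K. v x = Q x"
          using v(1) by (intro bexI[OF _ affine_in_polynomials[OF p, of "\<alpha> K" "g K"]]) blast
      qed
      ultimately show ?thesis
        unfolding fe_space_0_def fe_space_def using v(2) zero by simp
    qed
    moreover have "(\<lambda>x. v x - \<phi> x) \<in> Hs s \<and> \<parallel>\<lambda>x. v x - \<phi> x\<parallel> < \<tau>"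
    proof (rule \<epsilon>(2)[rule_format])
      show "\<bar>v x - \<phi> x - (v y - \<phi> y)\<bar> \<le> (L' + L) * norm (x - y)" for x y
        using vlip[of x y] L(2)[of x y] by (simp add: distrib_right)
      show "v x - \<phi> x = 0" if "x \<notin> \<Omega>" for x
      proof -
        have "x \<notin> S" using that S(2) by blast
        then show ?thesis using zero[OF that] S(3) by simp
      qed
    qed (rule err)
    ultimately show ?thesis by blast
  qed
  note main = this
  show ?thesis
    by (intro exI[of _ h0] conjI allI impI h0(1)) (elim conjE, rule main; assumption)
qed

end

section \<open>Weak derivatives of the measurements\<close>

subsection \<open>Uniqueness of weak derivatives\<close>

lemma Int_stable_boxes: "Int_stable (range (\<lambda>(a, b). box a b :: 'a::euclidean_space set))"
  by (auto simp: Int_stable_def box_Int_box)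

text \<open>Boxes are stable under intersection and generate the Borel sets, so vanishing integrals
  spread to all Borel sets by Dynkin's lemma. The sets where G is positive and where it is negative
  then give the claim.\<close>

lemma integral_boxes_eq_0_imp_AE:
  fixes G :: "'a::euclidean_space \<Rightarrow> real"
  assumes G: "integrable lborel G" and box: "\<And>a b. (\<integral>x. indicator (box a b) x * G x \<partial>lborel) = 0"
  shows "AE x in lborel. G x = 0"
proof -
  have [measurable]: "G \<in> borel_measurable borel" using G by auto
  have i: "integrable lborel (\<lambda>x. indicator A x * G x)" if "A \<in> sets borel" for A
    using integrable_mult_indicator[of A lborel G] that G by simp
  \<comment> \<open>The complement step of the Dynkin argument needs the whole space, which is the
    limit of growing cubes.\<close>
  have UN: "(\<integral>x. G x \<partial>lborel) = 0"
  proof -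
    have "(\<lambda>n. \<integral>x. indicator (box (- real n *\<^sub>R One) (real n *\<^sub>R One)) x * G x \<partial>lborel) \<longlonglongrightarrow> (\<integral>x. G x \<partial>lborel)"
    proof (rule integral_dominated_convergence[where w = "\<lambda>x. \<bar>G x\<bar>"])
      show "AE x in lborel. (\<lambda>n. indicator (box (- real n *\<^sub>R One) (real n *\<^sub>R One)) x * G x) \<longlonglongrightarrow> G x"
      proof (rule AE_I2)
        fix x :: 'a
        obtain n0 :: nat where n0: "norm x < real n0" using reals_Archimedean2 by blast
        have "x \<in> box (- real n *\<^sub>R One) (real n *\<^sub>R One)" if "n \<ge> n0" for n
        proof -
          have "norm x < real n" using n0 that by linarith
          then have "\<bar>x \<bullet> i\<bar> < real n" if "i \<in> Basis" for i using Basis_le_norm[OF that, of x] by linarith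
          then show ?thesis by (auto simp: mem_box abs_less_iff) (metis minus_less_iff)
        qed
        then have "\<forall>\<^sub>F n in sequentially. G x = indicator (box (- real n *\<^sub>R One) (real n *\<^sub>R One)) x * G x"
          unfolding eventually_sequentially by (intro exI[of _ n0]) simp
        then show "(\<lambda>n. indicator (box (- real n *\<^sub>R One) (real n *\<^sub>R One)) x * G x) \<longlonglongrightarrow> G x"
          by (rule Lim_transform_eventually[OF tendsto_const])
      qed
    qed (use G in \<open>auto simp: indicator_def\<close>)
    then show ?thesis unfolding box using LIMSEQ_unique[OF _ tendsto_const] by metis
  qed
  have P: "(\<integral>x. indicator A x * G x \<partial>lborel) = 0" if A: "A \<in> sets borel" for A
  proof -
    have borel: "B \<in> sets borel" if "B \<in> sigma_sets UNIV (range (\<lambda>(a, b). box a b))" for B :: "'a set"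
      using that unfolding borel_eq_box by (simp add: sets_measure_of)
    have "A \<in> sigma_sets UNIV (range (\<lambda>(a, b). box a b))"
      using A unfolding borel_eq_box by (simp add: sets_measure_of)
    then show ?thesis
    proof (rule sigma_sets_induct_disjoint[OF Int_stable_boxes, rotated])
      show "(\<integral>x. indicator B x * G x \<partial>lborel) = 0" if "B \<in> range (\<lambda>(a, b). box a b)" for B
        using that box by auto
    next
      fix B assume B: "B \<in> sigma_sets UNIV (range (\<lambda>(a, b). box a b :: 'a set))"
        "(\<integral>x. indicator B x * G x \<partial>lborel) = 0"
      have "indicator (UNIV - B) x * G x = G x - indicator B x * G x" for x by (auto simp: indicator_def)
      then show "(\<integral>x. indicator (UNIV - B) x * G x \<partial>lborel) = 0" using i[OF borel[OF B(1)]] G B(2) UN by simp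
    next
      fix A :: "nat \<Rightarrow> 'a set"
      assume A: "disjoint_family A" "range A \<subseteq> sigma_sets UNIV (range (\<lambda>(a, b). box a b))"
        "\<And>n. (\<integral>x. indicator (A n) x * G x \<partial>lborel) = 0"
      then have Ab: "A n \<in> sets borel" for n using borel by blast
      have "(LINT x:(\<Union>n. A n)|lborel. G x) = (\<Sum>n. (LINT x:A n|lborel. G x))"
        using Ab A(1) i[of "\<Union>n. A n"]
        by (intro lebesgue_integral_countable_add) (auto simp: disjoint_family_on_def set_integrable_def)
      then show "(\<integral>x. indicator (\<Union>n. A n) x * G x \<partial>lborel) = 0" using A(3) by (simp add: set_lebesgue_integral_def)
    qed auto
  qed
  have "AE x in lborel. indicator {x. 0 < G x} x * G x = 0"
    using integral_nonneg_eq_0_iff_AE[OF i[of "{x. 0 < G x}"]] P[of "{x. 0 < G x}"] by (auto simp: indicator_def)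
  moreover have "AE x in lborel. - (indicator {x. G x < 0} x * G x) = 0"
    using integral_nonneg_eq_0_iff_AE[of lborel "\<lambda>x. - (indicator {x. G x < 0} x * G x)"] i[of "{x. G x < 0}"]
      P[of "{x. G x < 0}"] by (auto simp: indicator_def)
  ultimately show ?thesis
    by eventually_elim (metis indicator_simps(1) linorder_neqE_linordered_idom mem_Collect_eq mult_1 neg_equal_0_iff_equal)
qed

text \<open>Indicators of boxes whose closure lies in W are limits of test functions, so g
  integrates to 0 over each of them. Cut off to one such box, g integrates to 0 over every box,
  since boxes intersect in boxes; the preceding lemma applies, and countably many boxes cover
  W.\<close>

lemma fundamental_lemma:
  fixes g :: "'a::euclidean_space \<Rightarrow> real"
  assumes g: "g \<in> L2 W" and W: "open W" and 0: "\<And>\<phi>. \<phi> \<in> test_functions W \<Longrightarrow> (LINT x:W|lborel. g x * \<phi> x) = 0"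
  shows "AE x in lborel. x \<in> W \<longrightarrow> g x = 0"
proof -
  let ?G = "\<lambda>x. indicator W x * g x"
  have G2: "?G \<in> square_integrable lborel" using g by (simp add: L2_iff)
  then have [measurable]: "?G \<in> borel_measurable borel" by (simp add: square_integrable_def)
  have Gi: "integrable lborel (\<lambda>x. indicator (cbox a b) x * ?G x)" for a b
  proof (rule square_integrable_mult[OF _ G2])
    have "integrable lborel (indicator (cbox a b) :: 'a \<Rightarrow> real)"
      using emeasure_lborel_cbox_finite by (intro integrable_real_indicator) auto
    moreover have "(\<lambda>x. (indicator (cbox a b) x)\<^sup>2) = (indicator (cbox a b) :: 'a \<Rightarrow> real)"
      by (auto simp: indicator_def)
    ultimately show "indicator (cbox a b) \<in> square_integrable (lborel :: 'a measure)"
      by (simp add: square_integrable_def)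
  qed
  have box0: "(\<integral>x. indicator (box a b) x * ?G x \<partial>lborel) = 0" if ab: "cbox a b \<subseteq> W" for a b
  proof -
    obtain \<psi> :: "nat \<Rightarrow> 'a \<Rightarrow> real" where \<psi>: "\<And>n. \<psi> n \<in> test_functions W" "\<And>n x. 0 \<le> \<psi> n x"
      "\<And>n x. \<psi> n x \<le> indicator (box a b) x" "\<And>x. (\<lambda>n. \<psi> n x) \<longlonglongrightarrow> indicator (box a b) x"
      using box_indicator_approx[OF ab] by blast
    have [measurable]: "\<psi> n \<in> borel_measurable borel" for n using test_function_measurable(2)[OF \<psi>(1)] .
    have "(\<lambda>n. \<integral>x. \<psi> n x * ?G x \<partial>lborel) \<longlonglongrightarrow> (\<integral>x. indicator (box a b) x * ?G x \<partial>lborel)"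
    proof (rule integral_dominated_convergence[where w = "\<lambda>x. \<bar>indicator (cbox a b) x * ?G x\<bar>"])
      show "AE x in lborel. (\<lambda>n. \<psi> n x * ?G x) \<longlonglongrightarrow> indicator (box a b) x * ?G x"
        using \<psi>(4) by (intro AE_I2 tendsto_mult tendsto_const)
      have "\<bar>\<psi> n x * ?G x\<bar> \<le> \<bar>indicator (cbox a b) x * ?G x\<bar>" for n x
      proof -
        have "indicator (box a b) x \<le> (indicator (cbox a b) x :: real)"
          using box_subset_cbox[of a b] by (auto simp: indicator_def)
        then have "\<bar>\<psi> n x\<bar> \<le> indicator (cbox a b) x"
          using \<psi>(2,3)[of n x] by linarith
        then have "\<bar>\<psi> n x\<bar> \<le> \<bar>indicator (cbox a b) x\<bar>" by (rule order_trans) simp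
        then show ?thesis unfolding abs_mult[of "\<psi> n x"] abs_mult[of "indicator (cbox a b) x"]
          by (rule mult_right_mono) simp
      qed
      then show "AE x in lborel. norm (\<psi> n x * ?G x) \<le> \<bar>indicator (cbox a b) x * ?G x\<bar>" for n by simp
      show "integrable lborel (\<lambda>x. \<bar>indicator (cbox a b) x * ?G x\<bar>)" using Gi by (rule integrable_abs)
    qed auto
    moreover have "(\<integral>x. \<psi> n x * ?G x \<partial>lborel) = 0" for n
      using 0[OF \<psi>(1)[of n]] by (simp add: set_lebesgue_integral_def mult_ac)
    ultimately show ?thesis using LIMSEQ_unique[OF _ tendsto_const] by simp
  qed
  have ae: "AE x in lborel. x \<in> box a b \<longrightarrow> ?G x = 0" if ab: "cbox a b \<subseteq> W" for a b
  proof -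
    have "AE x in lborel. indicator (box a b) x * ?G x = 0"
    proof (rule integral_boxes_eq_0_imp_AE)
      have "integrable lborel (\<lambda>x. indicator (box a b) x *\<^sub>R (indicator (cbox a b) x * ?G x))"
        using Gi by (intro integrable_mult_indicator) auto
      moreover have "indicator (box a b) x *\<^sub>R (indicator (cbox a b) x * ?G x) = indicator (box a b) x * ?G x" for x
        using box_subset_cbox[of a b] by (auto simp: indicator_def)
      ultimately show "integrable lborel (\<lambda>x. indicator (box a b) x * ?G x)" by (simp only:)
      fix a' b' :: 'a
      obtain l u where lu: "box a b \<inter> box a' b' = box l u" using box_Int_box[of a b a' b'] by blast
      have "(\<integral>x. indicator (box l u) x * ?G x \<partial>lborel) = 0"
      proof (cases "box l u = {}")
        case False
        \<comment> \<open>For an empty open box the closed box may be a degenerate set outside W;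
          only in the nonempty case is it the closure, and then it stays within
          \<open>cbox a b\<close>.\<close>
        then have "cbox l u = closure (box l u)" by (simp add: closure_box)
        also have "\<dots> \<subseteq> closure (box a b)" using lu by (intro closure_mono) blast
        also have "\<dots> \<subseteq> cbox a b" by (intro closure_minimal box_subset_cbox closed_cbox)
        finally show ?thesis using ab by (intro box0) simp
      qed simp
      moreover have "indicator (box a' b') x * (indicator (box a b) x * ?G x) = indicator (box l u) x * ?G x" for x
        unfolding lu[symmetric] by (auto simp: indicator_def)
      ultimately show "(\<integral>x. indicator (box a' b') x * (indicator (box a b) x * ?G x) \<partial>lborel) = 0" by (simp only:)
    qed
    then show ?thesis
    proof eventually_elim
      case (elim x)
      then show ?case by (cases "x \<in> box a b") simp_all
    qed
  qed
  \<comment> \<open>Exceptional sets may be united only countably often, so the Lindelof property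
    extracts a countable subfamily with the same union.\<close>
  let ?\<F> = "{box a b | a b. cbox a b \<subseteq> W}"
  have op: "open S" if "S \<in> ?\<F>" for S using that by auto
  obtain \<F>' where \<F>': "\<F>' \<subseteq> ?\<F>" "countable \<F>'" "\<Union>\<F>' = \<Union>?\<F>"
    by (rule Lindelof[OF op])
  have cover: "x \<in> \<Union>\<F>'" if x: "x \<in> W" for x
  proof -
    obtain a b where ab: "cbox a b \<subseteq> W" "x \<in> box a b" "\<forall>i\<in>Basis. a \<bullet> i < b \<bullet> i"
      by (rule open_contains_cbox[OF W x])
    then have "box a b \<in> ?\<F>" by (intro CollectI exI conjI) auto
    then show ?thesis unfolding \<F>'(3) using ab(2) by (rule UnionI)
  qed
  have "AE x in lborel. \<forall>S\<in>\<F>'. x \<in> S \<longrightarrow> ?G x = 0"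
  proof (rule AE_ball_countable[OF \<F>'(2), THEN iffD2, rule_format])
    fix S assume "S \<in> \<F>'"
    then obtain a b where "S = box a b" "cbox a b \<subseteq> W" using \<F>'(1) by auto
    then show "AE x in lborel. x \<in> S \<longrightarrow> ?G x = 0" using ae by (simp only:)
  qed
  then show ?thesis
  proof eventually_elim
    case (elim x)
    show ?case
    proof
      assume x: "x \<in> W"
      then obtain S where "S \<in> \<F>'" "x \<in> S" using cover by (elim UnionE[OF cover])
      then have "?G x = 0" using bspec[OF elim, of S] by (simp only:)
      then show "g x = 0" using x by simp
    qed
  qed
qed

text \<open>\<open>weak_deriv\<close> is an arbitrary choice. Any two weak derivatives agree almost
  everywhere on W, so its norm can be computed from an explicit one.\<close>

lemma weak_deriv_norm_unique:
  assumes "g \<in> L2 W" "g' \<in> L2 W" "open W" "is_weak_deriv W \<beta> v g" "is_weak_deriv W \<beta> v g'"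
  shows "L2_norm W g = L2_norm W g'"
proof -
  have "(LINT x:W|lborel. (g x - g' x) * \<phi> x) = 0" if \<phi>: "\<phi> \<in> test_functions W" for \<phi>
  proof -
    have W: "W \<in> sets borel" using assms(3) by simp
    have \<phi>2: "\<phi> \<in> L2 W"
    proof (rule L2_mono[OF _ W])
      show "\<phi> \<in> L2 UNIV" using Hs_subset_L2[OF test_functions_Hs[OF \<phi>, of "1/2"]] by simp
    qed
    have "(-1) ^ (\<Sum>b\<in>Basis. \<beta> b) * (LINT x:W|lborel. g x * \<phi> x) = (-1) ^ (\<Sum>b\<in>Basis. \<beta> b) * (LINT x:W|lborel. g' x * \<phi> x)"
      using assms(4,5) \<phi> unfolding is_weak_deriv_def by metis
    then have "L2_inner W g \<phi> = L2_inner W g' \<phi>" unfolding L2_inner_def by simp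
    then have "L2_inner W (\<lambda>x. g x - g' x) \<phi> = 0" using L2.diff_left[OF assms(1,2) \<phi>2] by simp
    then show ?thesis by (simp add: L2_inner_def)
  qed
  then have ae: "AE x in lborel. x \<in> W \<longrightarrow> g x - g' x = 0"
    using fundamental_lemma[OF L2.diff_mem[OF assms(1,2)] assms(3)] by blast
  have "L2_inner W g g = L2_inner W g' g'"
    unfolding L2_inner_eq
  proof (rule integral_cong_AE)
    show "AE x in lborel. indicator W x * g x * (indicator W x * g x) = indicator W x * g' x * (indicator W x * g' x)"
      using ae by eventually_elim (auto simp: indicator_def)
  qed (use assms(1,2) in \<open>auto simp: L2_iff square_integrable_def\<close>)
  then show ?thesis by (simp add: L2_norm_def)
qed

subsection \<open>Derivatives of the kernel\<close>

text \<open>Contains the kernel and, up to values at the origin, all its partial derivatives.\<close>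

inductive kernel_class :: "('a::euclidean_space \<Rightarrow> real) \<Rightarrow> bool" where
  coord: "kernel_class (\<lambda>z. z \<bullet> b)"
| const: "kernel_class (\<lambda>z. a)"
| power: "kernel_class (\<lambda>z. norm z powr a)"
| add: "kernel_class f \<Longrightarrow> kernel_class g \<Longrightarrow> kernel_class (\<lambda>z. f z + g z)"
| mult: "kernel_class f \<Longrightarrow> kernel_class g \<Longrightarrow> kernel_class (\<lambda>z. f z * g z)"

lemma kernel_class_measurable: "kernel_class f \<Longrightarrow> f \<in> borel_measurable borel"
  by (induction rule: kernel_class.induct) auto

lemma kernel_class_partial_deriv:
  fixes f :: "'a::euclidean_space \<Rightarrow> real"
  assumes "kernel_class f"
  shows "\<exists>g. kernel_class g \<and> (\<forall>z. z \<noteq> 0 \<longrightarrow> f differentiable at z \<and> partial_deriv b f z = g z)"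
  using assms
proof (induction rule: kernel_class.induct)
  case (coord v)
  have d: "((\<lambda>z. z \<bullet> v) has_derivative (\<lambda>h. h \<bullet> v)) (at z)" for z :: 'a by (auto intro!: derivative_eq_intros)
  show ?case
    by (intro exI[of _ "\<lambda>z. b \<bullet> v"]) (use d partial_deriv_eq[OF d] in \<open>auto simp: differentiable_def intro: kernel_class.const\<close>)
next
  case (const a)
  have d: "((\<lambda>z. a) has_derivative (\<lambda>h. 0)) (at z)" for z :: 'a by (auto intro!: derivative_eq_intros)
  show ?case
    by (intro exI[of _ "\<lambda>z. 0"]) (use partial_deriv_eq[OF d] in \<open>auto intro: kernel_class.const\<close>)
next
  case (power a)
  have d: "((\<lambda>z::'a. norm z powr a) has_derivative (\<lambda>h. a * norm z powr (a - 1) * (h \<bullet> sgn z))) (at z)" if "z \<noteq> 0" for z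
  proof -
    have n: "(norm has_derivative (\<lambda>h. h \<bullet> sgn z)) (at z)" by (rule has_derivative_norm[OF that])
    have p: "((\<lambda>x. x powr a) has_derivative (\<lambda>h. (a * norm z powr (a - 1)) * h)) (at (norm z))"
      using has_real_derivative_powr[of "norm z" a] that by (simp add: has_field_derivative_def)
    show ?thesis using has_derivative_compose[OF n p] by simp
  qed
  \<comment> \<open>Since sgn z = z / |z|, the derivative a |z|^(a-1) sgn z is a power of the norm
    times a coordinate, which stays inside the class.\<close>
  let ?g = "\<lambda>z. (a * norm z powr (a - 2)) * (z \<bullet> b)"
  have "kernel_class ?g" by (intro kernel_class.intros)
  moreover have "partial_deriv b (\<lambda>z. norm z powr a) z = ?g z" if "z \<noteq> 0" for z
  proof -
    have "norm z powr (a - 1) = norm z powr (a - 2) * norm z"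
      using that powr_add[of "norm z" "a - 2" 1] by simp
    then show ?thesis
      unfolding partial_deriv_eq[OF d[OF that]] using that by (simp add: sgn_div_norm inner_commute)
  qed
  ultimately show ?case using d by (intro exI[of _ ?g]) (auto simp: differentiable_def)
next
  case (add f1 f2)
  then obtain g1 g2 where g: "kernel_class g1" "\<forall>z. z \<noteq> 0 \<longrightarrow> f1 differentiable at z \<and> partial_deriv b f1 z = g1 z"
    "kernel_class g2" "\<forall>z. z \<noteq> 0 \<longrightarrow> f2 differentiable at z \<and> partial_deriv b f2 z = g2 z" by blast
  show ?case
    by (intro exI[of _ "\<lambda>z. g1 z + g2 z"])
       (use g partial_deriv_lincomb[of f1 _ f2 b 1 1] in \<open>auto intro!: kernel_class.add\<close>)
next
  case (mult f1 f2)
  then obtain g1 g2 where g: "kernel_class g1" "\<forall>z. z \<noteq> 0 \<longrightarrow> f1 differentiable at z \<and> partial_deriv b f1 z = g1 z"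
    "kernel_class g2" "\<forall>z. z \<noteq> 0 \<longrightarrow> f2 differentiable at z \<and> partial_deriv b f2 z = g2 z" by blast
  have "kernel_class (\<lambda>z. f1 z * g2 z + g1 z * f2 z)"
    using mult.hyps g by (intro kernel_class.add kernel_class.mult)
  then show ?case
    by (intro exI[of _ "\<lambda>z. f1 z * g2 z + g1 z * f2 z"])
       (use g partial_deriv_mult[of f1 _ f2 b] in auto)
qed

lemma kernel_class_continuous:
  fixes f :: "'a::euclidean_space \<Rightarrow> real"
  assumes "kernel_class f" "0 \<notin> A"
  shows "continuous_on A f"
proof -
  have "f differentiable at z" if "z \<noteq> 0" for z
    using kernel_class_partial_deriv[OF assms(1), of 0] that by blast
  then show ?thesis
    using assms(2)
    by (intro continuous_at_imp_continuous_on ballI differentiable_imp_continuous_within) metis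
qed

text \<open>The difference quotients along b have integral 0 by translation invariance. By the mean
  value theorem they are bounded by B, and they vanish off a fixed ball, so dominated convergence
  carries the value 0 over to their limit G.\<close>

lemma integral_directional_deriv_eq_0:
  fixes F G :: "'a::euclidean_space \<Rightarrow> real"
  assumes [measurable]: "F \<in> borel_measurable borel" "G \<in> borel_measurable borel"
    and der: "\<And>x t. ((\<lambda>t. F (x + t *\<^sub>R b)) has_real_derivative G (x + t *\<^sub>R b)) (at t)"
    and K: "bounded K" "\<And>x. x \<notin> K \<Longrightarrow> F x = 0" and B: "\<And>x. \<bar>F x\<bar> \<le> B" "\<And>x. \<bar>G x\<bar> \<le> B"
  shows "(\<integral>x. G x \<partial>lborel) = 0"
proof -
  have B0: "0 \<le> B" using order_trans[OF abs_ge_zero B(1)[of 0]] .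
  obtain r where r: "\<And>x. x \<in> K \<Longrightarrow> norm x \<le> r" using K(1) by (auto simp: bounded_iff)
  \<comment> \<open>The steps have length at most \<open>norm b\<close>, so this ball contains the
    support of F and of all translates that occur.\<close>
  define C where "C = cball (0::'a) (r + norm b)"
  have C: "F x = 0" if "x \<notin> C" for x
    using K(2)[of x] r[of x] that norm_ge_zero[of b] by (cases "x \<in> K") (auto simp: C_def)
  have Ci: "integrable lborel (\<lambda>x. indicator C x * B)"
    unfolding C_def using emeasure_bounded_finite[OF bounded_cball]
    by (intro integrable_mult_left integrable_real_indicator) auto
  have Fi: "integrable lborel F"
    by (rule Bochner_Integration.integrable_bound[OF Ci])
       (use C B(1) in \<open>auto simp: indicator_def intro: order_trans[OF B(1) abs_ge_self]\<close>)
  define Q where "Q = (\<lambda>n x. real (Suc n) * (F (x + (1 / real (Suc n)) *\<^sub>R b) - F x))"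
  have "(\<lambda>n. \<integral>x. Q n x \<partial>lborel) \<longlonglongrightarrow> (\<integral>x. G x \<partial>lborel)"
  proof (rule integral_dominated_convergence[OF _ _ Ci])
    show "AE x in lborel. (\<lambda>n. Q n x) \<longlonglongrightarrow> G x"
    proof (rule AE_I2)
      fix x
      have "((\<lambda>h. (F (x + h *\<^sub>R b) - F x) / h) \<longlongrightarrow> G x) (at 0)"
        using der[of x 0] by (simp add: DERIV_def)
      moreover have "filterlim (\<lambda>n. 1 / real (Suc n)) (at 0) sequentially"
        using LIMSEQ_Suc[OF lim_1_over_n[where 'a = real]] by (simp add: filterlim_at)
      ultimately have "(\<lambda>n. (F (x + (1 / real (Suc n)) *\<^sub>R b) - F x) / (1 / real (Suc n))) \<longlonglongrightarrow> G x"
        by (rule filterlim_compose)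
      then show "(\<lambda>n. Q n x) \<longlonglongrightarrow> G x" by (simp add: Q_def mult.commute)
    qed
    show "AE x in lborel. norm (Q n x) \<le> indicator C x * B" for n
    proof (rule AE_I2)
      fix x
      let ?h = "1 / real (Suc n)"
      show "norm (Q n x) \<le> indicator C x * B"
      proof (cases "x \<in> C")
        case True
        obtain t where "F (x + ?h *\<^sub>R b) - F (x + 0 *\<^sub>R b) = (?h - 0) * G (x + t *\<^sub>R b)"
          using MVT2[of 0 ?h "\<lambda>t. F (x + t *\<^sub>R b)" "\<lambda>t. G (x + t *\<^sub>R b)"] der by auto
        then have "Q n x = G (x + t *\<^sub>R b)" by (simp add: Q_def)
        then show ?thesis using True B(2) by simp
      next
        case False
        have "x + ?h *\<^sub>R b \<notin> K"
        proof
          assume "x + ?h *\<^sub>R b \<in> K"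
          then have "norm (x + ?h *\<^sub>R b) \<le> r" by (rule r)
          moreover have "?h * norm b \<le> 1 * norm b" by (rule mult_right_mono) simp_all
          then have "norm (?h *\<^sub>R b) \<le> norm b" by simp
          ultimately have "norm x \<le> r + norm b" using norm_triangle_ineq4[of "x + ?h *\<^sub>R b" "?h *\<^sub>R b"] by simp
          with False show False by (simp add: C_def)
        qed
        then show ?thesis using K(2) C[OF False] False by (simp add: Q_def)
      qed
    qed
    show "Q n \<in> borel_measurable lborel" for n unfolding Q_def by measurable
  qed simp
  moreover have "(\<integral>x. Q n x \<partial>lborel) = 0" for n
  proof -
    have "integrable lborel (\<lambda>x. F ((1 / real (Suc n)) *\<^sub>R b + x))"
      using integral_lborel_translate(4)[of F] Fi by simp
    then show ?thesis
      unfolding Q_def using Fi integral_lborel_translate(2)[of F "(1 / real (Suc n)) *\<^sub>R b"] by (simp add: add.commute)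
  qed
  ultimately show ?thesis using LIMSEQ_unique[OF _ tendsto_const] by simp
qed

text \<open>The pole y lies outside W while \<phi> has compact support in W. The product of \<phi>
  with the shifted kernel and its derivative are therefore bounded and supported in K, and the
  integrated product rule has no boundary term.\<close>

lemma kernel_integration_by_parts:
  fixes f :: "'a::euclidean_space \<Rightarrow> real"
  assumes f: "kernel_class f" and g: "kernel_class g" "\<And>z. z \<noteq> 0 \<Longrightarrow> f differentiable at z" "\<And>z. z \<noteq> 0 \<Longrightarrow> partial_deriv b f z = g z"
    and b: "b \<in> Basis" and \<phi>: "\<phi> \<in> test_functions W" and y: "y \<notin> W"
  shows "(\<integral>x. f (x - y) * partial_deriv b \<phi> x \<partial>lborel) = - (\<integral>x. g (x - y) * \<phi> x \<partial>lborel)"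
proof -
  obtain K where K: "compact K" "K \<subseteq> W" "\<And>x. x \<notin> K \<Longrightarrow> \<phi> x = 0" using \<phi> unfolding test_functions_iff by blast
  have yK: "y \<notin> K" using K(2) y by blast
  note \<phi>' = test_functions_partial_deriv[OF \<phi> b]
  note K' = partial_deriv_eq_0[OF K(1,3)]
  have [measurable]: "f \<in> borel_measurable borel" "g \<in> borel_measurable borel" "\<phi> \<in> borel_measurable borel"
    "partial_deriv b \<phi> \<in> borel_measurable borel"
    using kernel_class_measurable f g(1) test_function_measurable(2) \<phi> \<phi>' by blast+
  have bd: "\<exists>B. \<forall>x. \<bar>k (x - y) * \<psi> x\<bar> \<le> B"
    if "kernel_class k" "continuous_on UNIV \<psi>" "\<And>x. x \<notin> K \<Longrightarrow> \<psi> x = 0" for k \<psi>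
  proof -
    have "continuous_on K (\<lambda>x. k (x - y) * \<psi> x)"
      using yK
      by (intro continuous_on_mult continuous_on_compose2[OF kernel_class_continuous[OF that(1), of "- {0}"]]
          continuous_on_subset[OF that(2)] continuous_intros) auto
    then obtain B where "\<forall>x\<in>K. \<bar>k (x - y) * \<psi> x\<bar> \<le> B"
      using compact_imp_bounded[OF compact_continuous_image[OF _ K(1)]] by (fastforce simp: bounded_iff)
    then have "\<bar>k (x - y) * \<psi> x\<bar> \<le> max B 0" for x using that(3)[of x] by (cases "x \<in> K") (auto intro: max.coboundedI1)
    then show ?thesis by blast
  qed
  have int: "integrable lborel (\<lambda>x. k (x - y) * \<psi> x)"
    if k: "kernel_class k" "continuous_on UNIV \<psi>" "\<And>x. x \<notin> K \<Longrightarrow> \<psi> x = 0" for k \<psi>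
  proof -
    obtain B where B: "\<And>x. \<bar>k (x - y) * \<psi> x\<bar> \<le> B" using bd[OF k] by blast
    have [measurable]: "k \<in> borel_measurable borel" "\<psi> \<in> borel_measurable borel"
      using kernel_class_measurable[OF k(1)] k(2) by (auto intro: borel_measurable_continuous_onI)
    have "integrable lborel (\<lambda>x. indicator K x * B)"
      using K(1) emeasure_bounded_finite[OF compact_imp_bounded[OF K(1)]]
      by (intro integrable_mult_left integrable_real_indicator) (auto intro: borel_compact)
    then show ?thesis
    proof (rule Bochner_Integration.integrable_bound)
      have "\<bar>k (x - y) * \<psi> x\<bar> \<le> \<bar>indicator K x * B\<bar>" for x
        using B[of x] k(3)[of x] by (cases "x \<in> K") auto
      then show "AE x in lborel. norm (k (x - y) * \<psi> x) \<le> norm (indicator K x * B)" by simp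
    qed simp
  qed
  let ?F = "\<lambda>x. f (x - y) * \<phi> x"
  let ?G = "\<lambda>x. f (x - y) * partial_deriv b \<phi> x + g (x - y) * \<phi> x"
  note \<phi>c = test_function_measurable(1)[OF \<phi>] and \<phi>'c = test_function_measurable(1)[OF \<phi>']
  obtain B1 B2 B3 where BB: "\<And>x. \<bar>f (x - y) * \<phi> x\<bar> \<le> B1" "\<And>x. \<bar>f (x - y) * partial_deriv b \<phi> x\<bar> \<le> B2"
    "\<And>x. \<bar>g (x - y) * \<phi> x\<bar> \<le> B3"
    using bd[OF f \<phi>c K(3)] bd[OF f \<phi>'c K'] bd[OF g(1) \<phi>c K(3)] by metis
  have "(\<integral>x. ?G x \<partial>lborel) = 0"
  proof (rule integral_directional_deriv_eq_0[where F = ?F and K = K and b = b and B = "\<bar>B1\<bar> + \<bar>B2\<bar> + \<bar>B3\<bar>"])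
    have \<phi>d: "\<phi> differentiable at x" for x using \<phi> C_k.simps(2)[of 0 \<phi>] by (auto simp: test_functions_iff)
    have line: "((\<lambda>t. u (x + t *\<^sub>R b)) has_real_derivative partial_deriv b u (x + t *\<^sub>R b)) (at t)"
      if "u differentiable at (x + t *\<^sub>R b)" for u :: "'a \<Rightarrow> real" and x t
    proof -
      have lin: "linear (frechet_derivative u (at (x + t *\<^sub>R b)))"
        using has_derivative_frechet[OF that] by (rule has_derivative_linear)
      have "((\<lambda>t. u (x + t *\<^sub>R b)) has_derivative (\<lambda>h. frechet_derivative u (at (x + t *\<^sub>R b)) (h *\<^sub>R b))) (at t)"
        by (rule has_derivative_compose[of "\<lambda>t. x + t *\<^sub>R b" "\<lambda>h. h *\<^sub>R b" t UNIV u])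
           (auto intro!: derivative_eq_intros has_derivative_frechet that)
      then show ?thesis
        unfolding has_field_derivative_def
        by (rule has_derivative_eq_rhs) (simp add: fun_eq_iff linear_scale[OF lin] partial_deriv_def)
    qed
    fix x and t :: real
    show "((\<lambda>t. ?F (x + t *\<^sub>R b)) has_real_derivative ?G (x + t *\<^sub>R b)) (at t)"
    proof (cases "x + t *\<^sub>R b = y")
      case False
      then have nz: "(x - y) + t *\<^sub>R b \<noteq> 0" by (simp add: algebra_simps)
      have "((\<lambda>t. f ((x - y) + t *\<^sub>R b)) has_real_derivative g ((x - y) + t *\<^sub>R b)) (at t)"
        using line[OF g(2)[OF nz]] g(3)[OF nz] by simp
      from DERIV_mult[OF this line[OF \<phi>d, of x t]] show ?thesis by (simp add: algebra_simps)
    next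
      case True
      \<comment> \<open>At the pole f need not be differentiable, but \<phi> vanishes in a
        neighbourhood of it, so the product is locally 0 and \<open>?G\<close> is 0 as well.\<close>
      have "open (- K)" using K(1) by (simp add: compact_imp_closed open_Compl)
      then have "open ((\<lambda>t. x + t *\<^sub>R b) -` (- K))"
        by (rule open_vimage) (auto intro!: continuous_intros)
      moreover have "t \<in> (\<lambda>t. x + t *\<^sub>R b) -` (- K)" using True yK by simp
      ultimately have "\<forall>\<^sub>F t in nhds t. 0 = ?F (x + t *\<^sub>R b)"
        using K(3) by (auto simp: eventually_nhds intro!: exI[of _ "(\<lambda>t. x + t *\<^sub>R b) -` (- K)"])
      from DERIV_cong_ev[OF refl this, of 0 0] have "((\<lambda>t. ?F (x + t *\<^sub>R b)) has_real_derivative 0) (at t)" by simp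
      moreover have "?G (x + t *\<^sub>R b) = 0" using True yK K(3) K' by simp
      ultimately show ?thesis by simp
    qed
  next
    show "\<bar>?F x\<bar> \<le> \<bar>B1\<bar> + \<bar>B2\<bar> + \<bar>B3\<bar>" for x using BB(1)[of x] by linarith
    show "\<bar>?G x\<bar> \<le> \<bar>B1\<bar> + \<bar>B2\<bar> + \<bar>B3\<bar>" for x using BB(2,3)[of x] by linarith
    show "bounded K" using K(1) by (rule compact_imp_bounded)
    show "?F x = 0" if "x \<notin> K" for x using K(3)[OF that] by simp
  qed measurable
  then show ?thesis using int[OF f \<phi>'c K'] int[OF g(1) \<phi>c K(3)] by simp
qed

text \<open>The kernel g has to be found before \<phi> and y are given, since it becomes the kernel
  of the weak derivative under the integral over y. Each use of
  \<open>kernel_integration_by_parts\<close> moves one derivative and contributes one sign.\<close>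

lemma kernel_class_funpow:
  fixes f :: "'a::euclidean_space \<Rightarrow> real"
  assumes "b \<in> Basis"
  shows "kernel_class f \<Longrightarrow> \<exists>g. kernel_class g \<and> (\<forall>\<phi>\<in>test_functions W. \<forall>y. y \<notin> W \<longrightarrow>
    (\<integral>x. f (x - y) * (partial_deriv b ^^ n) \<phi> x \<partial>lborel) = (-1) ^ n * (\<integral>x. g (x - y) * \<phi> x \<partial>lborel))"
proof (induction n arbitrary: f)
  case 0
  then show ?case by auto
next
  case (Suc n)
  obtain f' where f': "kernel_class f'" "\<And>z. z \<noteq> 0 \<Longrightarrow> f differentiable at z" "\<And>z. z \<noteq> 0 \<Longrightarrow> partial_deriv b f z = f' z"
    using kernel_class_partial_deriv[OF Suc.prems, of b] by blast
  obtain g where g: "kernel_class g" "\<forall>\<phi>\<in>test_functions W. \<forall>y. y \<notin> W \<longrightarrow>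
    (\<integral>x. f' (x - y) * (partial_deriv b ^^ n) \<phi> x \<partial>lborel) = (-1) ^ n * (\<integral>x. g (x - y) * \<phi> x \<partial>lborel)"
    using Suc.IH[OF f'(1)] by (elim exE conjE)
  have "(\<integral>x. f (x - y) * (partial_deriv b ^^ Suc n) \<phi> x \<partial>lborel) = (-1) ^ Suc n * (\<integral>x. g (x - y) * \<phi> x \<partial>lborel)"
    if \<phi>: "\<phi> \<in> test_functions W" and y: "y \<notin> W" for \<phi> y
  proof -
    have t: "(partial_deriv b ^^ n) \<phi> \<in> test_functions W"
      using \<phi> by (induction n) (auto intro: test_functions_partial_deriv[OF _ assms])
    show ?thesis
      using kernel_integration_by_parts[OF Suc.prems f' assms t y] g(2)[rule_format, OF \<phi> y] by simp
  qed
  with g(1) show ?case by (intro exI[of _ g] conjI ballI allI impI)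
qed

lemma foldr_partial_deriv_test:
  assumes "\<phi> \<in> test_functions W" "set bs \<subseteq> Basis"
  shows "foldr (\<lambda>b \<psi>. (partial_deriv b ^^ \<beta> b) \<psi>) bs \<phi> \<in> test_functions W"
  using assms(2)
proof (induction bs)
  case (Cons b bs)
  then have "(partial_deriv b ^^ n) (foldr (\<lambda>b \<psi>. (partial_deriv b ^^ \<beta> b) \<psi>) bs \<phi>) \<in> test_functions W" for n
    by (induction n) (auto intro: test_functions_partial_deriv)
  then show ?case by simp
qed (use assms in simp)

lemma kernel_class_foldr:
  fixes f :: "'a::euclidean_space \<Rightarrow> real"
  shows "set bs \<subseteq> Basis \<Longrightarrow> kernel_class f \<Longrightarrow> \<exists>g. kernel_class g \<and> (\<forall>\<phi>\<in>test_functions W. \<forall>y. y \<notin> W \<longrightarrow>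
    (\<integral>x. f (x - y) * foldr (\<lambda>b \<psi>. (partial_deriv b ^^ \<beta> b) \<psi>) bs \<phi> x \<partial>lborel)
      = (-1) ^ sum_list (map \<beta> bs) * (\<integral>x. g (x - y) * \<phi> x \<partial>lborel))"
proof (induction bs arbitrary: f)
  case Nil
  then show ?case by auto
next
  case (Cons b bs)
  then have b: "b \<in> Basis" "set bs \<subseteq> Basis" by auto
  obtain f' where f': "kernel_class f'" "\<forall>\<phi>\<in>test_functions W. \<forall>y. y \<notin> W \<longrightarrow>
    (\<integral>x. f (x - y) * (partial_deriv b ^^ \<beta> b) \<phi> x \<partial>lborel) = (-1) ^ \<beta> b * (\<integral>x. f' (x - y) * \<phi> x \<partial>lborel)"
    using kernel_class_funpow[OF b(1) Cons.prems(2), of W "\<beta> b"] by (elim exE conjE)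
  obtain g where g: "kernel_class g" "\<forall>\<phi>\<in>test_functions W. \<forall>y. y \<notin> W \<longrightarrow>
    (\<integral>x. f' (x - y) * foldr (\<lambda>b \<psi>. (partial_deriv b ^^ \<beta> b) \<psi>) bs \<phi> x \<partial>lborel)
      = (-1) ^ sum_list (map \<beta> bs) * (\<integral>x. g (x - y) * \<phi> x \<partial>lborel)"
    using Cons.IH[OF b(2) f'(1)] by (elim exE conjE)
  have "(\<integral>x. f (x - y) * foldr (\<lambda>b \<psi>. (partial_deriv b ^^ \<beta> b) \<psi>) (b # bs) \<phi> x \<partial>lborel)
      = (-1) ^ sum_list (map \<beta> (b # bs)) * (\<integral>x. g (x - y) * \<phi> x \<partial>lborel)"
    if \<phi>: "\<phi> \<in> test_functions W" and y: "y \<notin> W" for \<phi> y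
    using f'(2)[rule_format, OF foldr_partial_deriv_test[OF \<phi> b(2)] y] g(2)[rule_format, OF \<phi> y]
    by (simp add: power_add mult.assoc)
  with g(1) show ?case by (intro exI[of _ g] conjI ballI allI impI)
qed

lemma multi_deriv_eq_foldr:
  obtains bs :: "'a::euclidean_space list" where "distinct bs" "set bs = Basis"
    "multi_deriv \<beta> = (\<lambda>\<phi>. foldr (\<lambda>b \<psi>. (partial_deriv b ^^ \<beta> b) \<psi>) bs \<phi>)"
proof -
  have "\<exists>bs :: 'a list. distinct bs \<and> set bs = Basis"
    using finite_distinct_list[OF finite_Basis] by blast
  from someI_ex[OF this] show thesis
    by (intro that[of "SOME bs. distinct bs \<and> set bs = Basis"]) (simp_all add: fun_eq_iff multi_deriv_def)
qed

lemma multi_deriv_test_functions: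
  "\<phi> \<in> test_functions W \<Longrightarrow> multi_deriv \<beta> \<phi> \<in> test_functions W"
  using foldr_partial_deriv_test[of \<phi> W] by (metis multi_deriv_eq_foldr order_refl)

lemma kernel_class_multi_deriv:
  fixes f :: "'a::euclidean_space \<Rightarrow> real"
  assumes "kernel_class f"
  shows "\<exists>g. kernel_class g \<and> (\<forall>\<phi>\<in>test_functions W. \<forall>y. y \<notin> W \<longrightarrow>
    (\<integral>x. f (x - y) * multi_deriv \<beta> \<phi> x \<partial>lborel) = (-1) ^ (\<Sum>b\<in>Basis. \<beta> b) * (\<integral>x. g (x - y) * \<phi> x \<partial>lborel))"
proof -
  obtain bs :: "'a list" where bs: "distinct bs" "set bs = Basis"
    "multi_deriv \<beta> = (\<lambda>\<phi>. foldr (\<lambda>b \<psi>. (partial_deriv b ^^ \<beta> b) \<psi>) bs \<phi>)"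
    by (rule multi_deriv_eq_foldr[of \<beta>])
  have "sum_list (map \<beta> bs) = (\<Sum>b\<in>Basis. \<beta> b)"
    using bs(1,2) by (simp add: sum_list_distinct_conv_sum_set)
  then show ?thesis
    using kernel_class_foldr[OF eq_refl[OF bs(2)] assms, of W \<beta>] unfolding bs(3) by simp
qed

subsection \<open>Sobolev regularity of the measurements\<close>

context fractional_measurement
begin

lemma W_disjoint_\<Omega>: "x \<in> W \<Longrightarrow> x \<notin> \<Omega>"
  using dist_W_\<Omega>[of x x] d0_pos closure_subset[of W] by auto

text \<open>The differences x - y lie in a closed shell with inner radius d0, which is compact and
  avoids the singularity at the origin.\<close>

lemma kernel_class_bounded:
  fixes f :: "'a \<Rightarrow> real"
  assumes "kernel_class f"
  obtains B where "0 \<le> B" "\<forall>x\<in>W. \<forall>y\<in>\<Omega>. \<bar>f (x - y)\<bar> \<le> B"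
proof -
  obtain r1 r2 where r: "\<forall>x\<in>W. norm x \<le> r1" "\<forall>y\<in>\<Omega>. norm y \<le> r2"
    using bounded_W bounded_\<Omega> by (auto simp: bounded_iff)
  let ?S = "cball (0::'a) (r1 + r2) - ball 0 d0"
  have "compact ?S" by (intro compact_diff compact_cball open_ball)
  moreover have "continuous_on ?S f" using d0_pos by (intro kernel_class_continuous[OF assms]) simp
  ultimately have "bounded (f ` ?S)" by (intro compact_imp_bounded compact_continuous_image)
  then obtain B where B: "\<forall>z\<in>?S. \<bar>f z\<bar> \<le> B" by (auto simp: bounded_iff)
  have "\<bar>f (x - y)\<bar> \<le> max B 0" if "x \<in> W" "y \<in> \<Omega>" for x y
  proof -
    have "norm (x - y) \<le> norm x + norm y" by (rule norm_triangle_ineq4)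
    also have "\<dots> \<le> r1 + r2" using r that by (intro add_mono) auto
    finally have "x - y \<in> ?S" using dist_W_\<Omega>[of x y] that closure_subset[of W] by auto
    then have "\<bar>f (x - y)\<bar> \<le> B" using B by blast
    then show ?thesis by simp
  qed
  then show thesis by (intro that[of "max B 0"]) auto
qed

text \<open>The operator \<open>meas_op\<close> with an arbitrary kernel and without the factor -c.
  The weak derivatives of a measurement have the same form, with other members of
  \<open>kernel_class\<close> as kernels.\<close>

definition kernel_op :: "('a \<Rightarrow> real) \<Rightarrow> ('a \<Rightarrow> real) \<Rightarrow> 'a \<Rightarrow> real" where
  "kernel_op f v x = (\<integral>y. indicator \<Omega> y * (v y * f (x - y)) \<partial>lborel)"

lemma meas_op_kernel_op:
  "meas_op c s \<Omega> v x = - c * kernel_op (\<lambda>z. norm z powr - (real DIM('a) + 2 * s)) v x"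
  unfolding meas_op_eq kernel_op_def frac_kernel_def powr_minus_divide ..

lemma kernel_op_facts:
  assumes f: "kernel_class f" and B: "0 \<le> B" "\<forall>x\<in>W. \<forall>y\<in>\<Omega>. \<bar>f (x - y)\<bar> \<le> B" and v: "v \<in> L2 UNIV"
  shows "kernel_op f v \<in> borel_measurable borel"
    and "x \<in> W \<Longrightarrow> integrable lborel (\<lambda>y. indicator \<Omega> y * (v y * f (x - y)))"
    and "x \<in> W \<Longrightarrow> (\<integral>y. \<bar>indicator \<Omega> y * (v y * f (x - y))\<bar> \<partial>lborel) \<le> B * (sqrt (measure lborel \<Omega>) * L2_norm UNIV v)"
    and "kernel_op f v \<in> L2 W"
    and "L2_norm W (kernel_op f v) \<le> sqrt (measure lborel W) * (B * (sqrt (measure lborel \<Omega>) * L2_norm UNIV v))"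
proof -
  have [measurable]: "\<Omega> \<in> sets borel" "v \<in> borel_measurable borel" "v \<in> borel_measurable lborel" "f \<in> borel_measurable borel"
    using open_\<Omega> L2_UNIV_borel[OF v] kernel_class_measurable[OF f] by auto
  show m: "kernel_op f v \<in> borel_measurable borel"
    unfolding kernel_op_def[abs_def] by measurable
  have le: "\<bar>indicator \<Omega> y * (v y * f (x - y))\<bar> \<le> B * (indicator \<Omega> y * \<bar>v y\<bar>)" if "x \<in> W" for x y
  proof (cases "y \<in> \<Omega>")
    case True
    have "\<bar>v y\<bar> * \<bar>f (x - y)\<bar> \<le> \<bar>v y\<bar> * B" using B(2)[rule_format, OF that True] by (rule mult_left_mono) simp
    then show ?thesis using True by (simp add: abs_mult mult.commute)
  qed simp
  note vi = L2_integrable_\<Omega>(2,3)[OF v]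
  have i: "integrable lborel (\<lambda>y. indicator \<Omega> y * (v y * f (x - y)))" if x: "x \<in> W" for x
  proof (rule Bochner_Integration.integrable_bound)
    show "integrable lborel (\<lambda>y. B * (indicator \<Omega> y * \<bar>v y\<bar>))" using vi(1) by simp
    show "AE y in lborel. norm (indicator \<Omega> y * (v y * f (x - y))) \<le> norm (B * (indicator \<Omega> y * \<bar>v y\<bar>))"
      using le[OF x] by (intro AE_I2) (auto intro: order_trans[OF _ abs_ge_self])
  qed measurable
  then show "x \<in> W \<Longrightarrow> integrable lborel (\<lambda>y. indicator \<Omega> y * (v y * f (x - y)))" .
  have b: "(\<integral>y. \<bar>indicator \<Omega> y * (v y * f (x - y))\<bar> \<partial>lborel) \<le> B * (sqrt (measure lborel \<Omega>) * L2_norm UNIV v)"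
    if x: "x \<in> W" for x
  proof -
    have "(\<integral>y. \<bar>indicator \<Omega> y * (v y * f (x - y))\<bar> \<partial>lborel) \<le> (\<integral>y. B * (indicator \<Omega> y * \<bar>v y\<bar>) \<partial>lborel)"
      using integrable_abs[OF i[OF x]] vi(1) le[OF x] by (intro integral_mono) auto
    also have "\<dots> = B * (\<integral>y. indicator \<Omega> y * \<bar>v y\<bar> \<partial>lborel)" by (rule integral_mult_right_zero)
    also have "\<dots> \<le> B * (sqrt (measure lborel \<Omega>) * L2_norm UNIV v)" using vi(2) B(1) by (rule mult_left_mono)
    finally show ?thesis .
  qed
  then show "x \<in> W \<Longrightarrow> (\<integral>y. \<bar>indicator \<Omega> y * (v y * f (x - y))\<bar> \<partial>lborel) \<le> B * (sqrt (measure lborel \<Omega>) * L2_norm UNIV v)" .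
  have "\<bar>kernel_op f v x\<bar> \<le> B * (sqrt (measure lborel \<Omega>) * L2_norm UNIV v)" if "x \<in> W" for x
    unfolding kernel_op_def using integral_abs_bound b[OF that] by (rule order_trans)
  moreover have "0 \<le> B * (sqrt (measure lborel \<Omega>) * L2_norm UNIV v)" using B(1) by simp
  ultimately show "kernel_op f v \<in> L2 W"
    "L2_norm W (kernel_op f v) \<le> sqrt (measure lborel W) * (B * (sqrt (measure lborel \<Omega>) * L2_norm UNIV v))"
    using bounded_in_L2_W[OF m] by blast+
qed

text \<open>Absolute integrability on the product holds because \<psi> is bounded and vanishes off
  the bounded set W, over which the integrals in y are uniformly bounded.\<close>

lemma kernel_op_Fubini:
  assumes f: "kernel_class f" and v: "v \<in> L2 UNIV" and \<psi>: "\<psi> \<in> test_functions W"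
  shows "(LINT x:W|lborel. kernel_op f v x * \<psi> x)
    = (\<integral>y. indicator \<Omega> y * (v y * (\<integral>x. f (x - y) * \<psi> x \<partial>lborel)) \<partial>lborel)"
proof -
  obtain B where B: "0 \<le> B" "\<forall>x\<in>W. \<forall>y\<in>\<Omega>. \<bar>f (x - y)\<bar> \<le> B"
    using kernel_class_bounded[OF f] by metis
  note k = kernel_op_facts[OF f B v]
  have [measurable]: "\<Omega> \<in> sets borel" "\<Omega> \<in> sets lborel" "v \<in> borel_measurable borel" "v \<in> borel_measurable lborel"
    "f \<in> borel_measurable borel" "\<psi> \<in> borel_measurable borel" "\<psi> \<in> borel_measurable lborel" "W \<in> sets borel" "W \<in> sets lborel"
    using open_\<Omega> open_W L2_UNIV_borel[OF v] kernel_class_measurable[OF f] test_function_measurable(2)[OF \<psi>] by auto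
  obtain Bp where Bp: "\<And>x. \<bar>\<psi> x\<bar> \<le> Bp" "0 \<le> Bp" using test_function_bounded[OF \<psi>] by blast
  have \<psi>0: "\<psi> x = 0" if "x \<notin> W" for x using \<psi> that unfolding test_functions_iff by blast
  let ?C = "B * (sqrt (measure lborel \<Omega>) * L2_norm UNIV v)"
  let ?H = "\<lambda>x y. indicator \<Omega> y * (v y * f (x - y)) * \<psi> x"
  have "integrable (lborel \<Otimes>\<^sub>M lborel) (\<lambda>(x, y). ?H x y)"
  proof (rule lborel_pair.Fubini_integrable)
    have [measurable]: "f \<in> borel_measurable lborel" by simp
    show "(\<lambda>(x, y). ?H x y) \<in> borel_measurable (lborel \<Otimes>\<^sub>M lborel)" by measurable
    have Wi: "integrable lborel (\<lambda>x. indicator W x * (?C * Bp))"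
      using emeasure_bounded_finite[OF bounded_W] by (intro integrable_mult_left integrable_real_indicator) auto
    show "integrable lborel (\<lambda>x. \<integral>y. norm (case (x, y) of (x, y) \<Rightarrow> ?H x y) \<partial>lborel)"
    proof (rule Bochner_Integration.integrable_bound[OF Wi])
      show "(\<lambda>x. \<integral>y. norm (case (x, y) of (x, y) \<Rightarrow> ?H x y) \<partial>lborel) \<in> borel_measurable lborel" by measurable
      show "AE x in lborel. norm (\<integral>y. norm (case (x, y) of (x, y) \<Rightarrow> ?H x y) \<partial>lborel) \<le> norm (indicator W x * (?C * Bp))"
      proof (rule AE_I2)
        fix x
        have "(\<integral>y. norm (case (x, y) of (x, y) \<Rightarrow> ?H x y) \<partial>lborel)
            = (\<integral>y. \<bar>indicator \<Omega> y * (v y * f (x - y))\<bar> * \<bar>\<psi> x\<bar> \<partial>lborel)"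
          by (rule Bochner_Integration.integral_cong) (auto simp: abs_mult)
        also have "\<dots> = (\<integral>y. \<bar>indicator \<Omega> y * (v y * f (x - y))\<bar> \<partial>lborel) * \<bar>\<psi> x\<bar>" by (rule integral_mult_left_zero)
        finally have eq: "(\<integral>y. norm (case (x, y) of (x, y) \<Rightarrow> ?H x y) \<partial>lborel)
            = (\<integral>y. \<bar>indicator \<Omega> y * (v y * f (x - y))\<bar> \<partial>lborel) * \<bar>\<psi> x\<bar>" .
        show "norm (\<integral>y. norm (case (x, y) of (x, y) \<Rightarrow> ?H x y) \<partial>lborel) \<le> norm (indicator W x * (?C * Bp))"
        proof (cases "x \<in> W")
          case True
          have nn: "0 \<le> (\<integral>y. \<bar>indicator \<Omega> y * (v y * f (x - y))\<bar> \<partial>lborel)" by simp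
          have "(\<integral>y. \<bar>indicator \<Omega> y * (v y * f (x - y))\<bar> \<partial>lborel) * \<bar>\<psi> x\<bar> \<le> ?C * Bp"
            using k(3)[OF True] Bp order_trans[OF nn k(3)[OF True]] by (intro mult_mono) auto
          moreover have "0 \<le> (\<integral>y. \<bar>indicator \<Omega> y * (v y * f (x - y))\<bar> \<partial>lborel) * \<bar>\<psi> x\<bar>" using nn by simp
          ultimately show ?thesis unfolding eq using True by simp
        next
          case False
          then show ?thesis unfolding eq using \<psi>0 by simp
        qed
      qed
    qed
    show "AE x in lborel. integrable lborel (\<lambda>y. case (x, y) of (x, y) \<Rightarrow> ?H x y)"
    proof (rule AE_I2)
      fix x
      show "integrable lborel (\<lambda>y. case (x, y) of (x, y) \<Rightarrow> ?H x y)"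
        using k(2)[of x] \<psi>0[of x] by (cases "x \<in> W") auto
    qed
  qed
  then have "(\<integral>y. (\<integral>x. ?H x y \<partial>lborel) \<partial>lborel) = (\<integral>x. (\<integral>y. ?H x y \<partial>lborel) \<partial>lborel)"
    by (rule lborel_pair.Fubini_integral)
  moreover have "(\<integral>y. ?H x y \<partial>lborel) = indicator W x * (kernel_op f v x * \<psi> x)" for x
  proof -
    have "(\<integral>y. ?H x y \<partial>lborel) = kernel_op f v x * \<psi> x" unfolding kernel_op_def by (rule integral_mult_left_zero)
    then show ?thesis using \<psi>0[of x] by (cases "x \<in> W") auto
  qed
  moreover have "(\<integral>x. ?H x y \<partial>lborel) = indicator \<Omega> y * (v y * (\<integral>x. f (x - y) * \<psi> x \<partial>lborel))" for y
  proof -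
    have "(\<integral>x. ?H x y \<partial>lborel) = (\<integral>x. (indicator \<Omega> y * v y) * (f (x - y) * \<psi> x) \<partial>lborel)"
      by (simp add: mult.assoc)
    also have "\<dots> = (indicator \<Omega> y * v y) * (\<integral>x. f (x - y) * \<psi> x \<partial>lborel)" by (rule integral_mult_right_zero)
    finally show ?thesis by (simp add: mult.assoc)
  qed
  ultimately show ?thesis by (simp only: set_lebesgue_integral_def real_scaleR_def)
qed

text \<open>Exchange the integrals, integrate by parts in x for each fixed y in \<Omega>, which lies
  outside W, and exchange back: all derivatives land on the kernel and none on v. Hence C is uniform
  in v and only the L2 norm of v appears.\<close>

lemma meas_op_weak_deriv:
  shows "\<exists>C\<ge>0. \<forall>v\<in>L2 UNIV. \<exists>g\<in>L2 W. is_weak_deriv W \<beta> (meas_op c s \<Omega> v) g \<and> L2_norm W g \<le> C * L2_norm UNIV v"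
proof -
  let ?f = "\<lambda>z::'a. norm z powr - (real DIM('a) + 2 * s)"
  have f: "kernel_class ?f" by (rule kernel_class.power)
  obtain g where g: "kernel_class g" "\<forall>\<phi>\<in>test_functions W. \<forall>y. y \<notin> W \<longrightarrow>
    (\<integral>x. ?f (x - y) * multi_deriv \<beta> \<phi> x \<partial>lborel) = (-1) ^ (\<Sum>b\<in>Basis. \<beta> b) * (\<integral>x. g (x - y) * \<phi> x \<partial>lborel)"
    using kernel_class_multi_deriv[OF f, of W \<beta>] by (elim exE conjE)
  obtain B where B: "0 \<le> B" "\<forall>x\<in>W. \<forall>y\<in>\<Omega>. \<bar>g (x - y)\<bar> \<le> B"
    by (rule kernel_class_bounded[OF g(1)])
  define C where "C = c * (sqrt (measure lborel W) * (B * sqrt (measure lborel \<Omega>)))"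
  have "\<exists>g\<in>L2 W. is_weak_deriv W \<beta> (meas_op c s \<Omega> v) g \<and> L2_norm W g \<le> C * L2_norm UNIV v" if v: "v \<in> L2 UNIV" for v
  proof -
    note k = kernel_op_facts[OF g(1) B v]
    let ?g = "\<lambda>x. - c * kernel_op g v x"
    have "is_weak_deriv W \<beta> (meas_op c s \<Omega> v) ?g"
      unfolding is_weak_deriv_def
    proof
      fix \<phi> assume \<phi>: "\<phi> \<in> test_functions W"
      let ?s = "(-1) ^ (\<Sum>b\<in>Basis. \<beta> b) :: real"
      have "(LINT x:W|lborel. meas_op c s \<Omega> v x * multi_deriv \<beta> \<phi> x)
          = - c * (LINT x:W|lborel. kernel_op ?f v x * multi_deriv \<beta> \<phi> x)"
        unfolding meas_op_kernel_op set_integral_mult_right[symmetric] by (simp only: mult.assoc)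
      also have "\<dots> = - c * (\<integral>y. indicator \<Omega> y * (v y * (\<integral>x. ?f (x - y) * multi_deriv \<beta> \<phi> x \<partial>lborel)) \<partial>lborel)"
        unfolding kernel_op_Fubini[OF f v multi_deriv_test_functions[OF \<phi>]] ..
      also have "(\<integral>y. indicator \<Omega> y * (v y * (\<integral>x. ?f (x - y) * multi_deriv \<beta> \<phi> x \<partial>lborel)) \<partial>lborel)
          = (\<integral>y. ?s * (indicator \<Omega> y * (v y * (\<integral>x. g (x - y) * \<phi> x \<partial>lborel))) \<partial>lborel)"
      proof (rule Bochner_Integration.integral_cong[OF refl])
        fix y
        show "indicator \<Omega> y * (v y * (\<integral>x. ?f (x - y) * multi_deriv \<beta> \<phi> x \<partial>lborel))
          = ?s * (indicator \<Omega> y * (v y * (\<integral>x. g (x - y) * \<phi> x \<partial>lborel)))"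
        proof (cases "y \<in> \<Omega>")
          case True
          then have "y \<notin> W" using W_disjoint_\<Omega> by blast
          from g(2)[rule_format, OF \<phi> this] show ?thesis by simp
        qed simp
      qed
      also have "\<dots> = ?s * (LINT x:W|lborel. kernel_op g v x * \<phi> x)"
        unfolding kernel_op_Fubini[OF g(1) v \<phi>] by (rule integral_mult_right_zero)
      also have "- c * (?s * (LINT x:W|lborel. kernel_op g v x * \<phi> x)) = ?s * (LINT x:W|lborel. ?g x * \<phi> x)"
      proof -
        have "(LINT x:W|lborel. ?g x * \<phi> x) = - c * (LINT x:W|lborel. kernel_op g v x * \<phi> x)"
          unfolding set_integral_mult_right[symmetric] by (simp only: mult.assoc)
        then show ?thesis by simp
      qed
      finally show "(LINT x:W|lborel. meas_op c s \<Omega> v x * multi_deriv \<beta> \<phi> x) = ?s * (LINT x:W|lborel. ?g x * \<phi> x)" .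
    qed
    moreover have "?g \<in> L2 W" using L2.scale_mem[OF k(4)] .
    moreover have "L2_norm W ?g \<le> C * L2_norm UNIV v"
    proof -
      have "L2_inner W ?g ?g = (- c) * ((- c) * L2_inner W (kernel_op g v) (kernel_op g v))"
        unfolding L2.scale_left[OF k(4) L2.scale_mem[OF k(4)]] L2.scale_right[OF k(4) k(4)] ..
      then have "L2_norm W ?g = c * L2_norm W (kernel_op g v)"
        using c_pos by (simp add: L2_norm_def real_sqrt_mult flip: mult.assoc)
      also have "\<dots> \<le> c * (sqrt (measure lborel W) * (B * (sqrt (measure lborel \<Omega>) * L2_norm UNIV v)))"
        using k(5) c_pos by (intro mult_left_mono) auto
      finally show ?thesis by (simp add: C_def mult.assoc)
    qed
    ultimately show ?thesis by (intro bexI[of _ ?g] conjI)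
  qed
  moreover have "0 \<le> C" using B(1) c_pos by (simp add: C_def)
  ultimately show ?thesis by (intro exI[of _ C] conjI ballI)
qed

lemma meas_op_Hm:
  obtains C where "0 \<le> C" "\<And>v. v \<in> L2 UNIV \<Longrightarrow> meas_op c s \<Omega> v \<in> Hm m W \<and>
    Hm_norm m W (meas_op c s \<Omega> v) \<le> C * L2_norm UNIV v"
proof -
  have "\<forall>\<beta> :: 'a \<Rightarrow> nat. \<exists>C. 0 \<le> C \<and> (\<forall>v\<in>L2 UNIV. \<exists>g\<in>L2 W. is_weak_deriv W \<beta> (meas_op c s \<Omega> v) g \<and> L2_norm W g \<le> C * L2_norm UNIV v)"
    using meas_op_weak_deriv by blast
  then obtain C where "\<forall>\<beta>. 0 \<le> C \<beta> \<and> (\<forall>v\<in>L2 UNIV. \<exists>g\<in>L2 W. is_weak_deriv W \<beta> (meas_op c s \<Omega> v) g \<and> L2_norm W g \<le> C \<beta> * L2_norm UNIV v)"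
    by (rule choice[THEN exE])
  then have C: "0 \<le> C \<beta>" "v \<in> L2 UNIV \<Longrightarrow> \<exists>g\<in>L2 W. is_weak_deriv W \<beta> (meas_op c s \<Omega> v) g \<and> L2_norm W g \<le> C \<beta> * L2_norm UNIV v"
    for \<beta> :: "'a \<Rightarrow> nat" and v :: "'a \<Rightarrow> real" by blast+
  let ?C = "sqrt (\<Sum>\<beta>\<in>multi_indices m. (C \<beta>)\<^sup>2)"
  show thesis
  proof (rule that[of ?C])
    show "0 \<le> ?C" by (simp add: sum_nonneg)
    fix v :: "'a \<Rightarrow> real" assume v: "v \<in> L2 UNIV"
    have mem: "meas_op c s \<Omega> v \<in> Hm m W" unfolding Hm_def using meas_op_L2(1)[OF v] C(2)[OF v] by blast
    have wd: "L2_norm W (weak_deriv W \<beta> (meas_op c s \<Omega> v)) \<le> C \<beta> * L2_norm UNIV v" for \<beta>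
    proof -
      obtain g where g: "g \<in> L2 W" "is_weak_deriv W \<beta> (meas_op c s \<Omega> v) g" "L2_norm W g \<le> C \<beta> * L2_norm UNIV v"
        using C(2)[OF v] by blast
      \<comment> \<open>The existence of the explicit g makes the choice in
        \<open>weak_deriv\<close> meaningful; uniqueness then transfers the bound from g to the
        chosen derivative.\<close>
      have "weak_deriv W \<beta> (meas_op c s \<Omega> v) \<in> L2 W \<and> is_weak_deriv W \<beta> (meas_op c s \<Omega> v) (weak_deriv W \<beta> (meas_op c s \<Omega> v))"
        unfolding weak_deriv_def by (rule someI[of _ g]) (use g in blast)
      then show ?thesis using weak_deriv_norm_unique[OF _ g(1) open_W _ g(2)] g(3) by simp
    qed
    have "Hm_norm m W (meas_op c s \<Omega> v) \<le> sqrt (\<Sum>\<beta>\<in>multi_indices m. (C \<beta> * L2_norm UNIV v)\<^sup>2)"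
      unfolding Hm_norm_def by (intro real_sqrt_le_mono sum_mono power_mono wd) simp
    also have "\<dots> = ?C * L2_norm UNIV v"
      by (simp add: power_mult_distrib real_sqrt_mult flip: sum_distrib_right)
    finally show "meas_op c s \<Omega> v \<in> Hm m W \<and> Hm_norm m W (meas_op c s \<Omega> v) \<le> ?C * L2_norm UNIV v"
      using mem by (intro conjI)
  qed
qed

end

section \<open>Convergence of the discrete minimizers\<close>

context fractional_measurement
begin

lemma meas_op_norm:
  obtains C where "0 \<le> C" "\<forall>v\<in>Hs s. L2_norm W (meas_op c s \<Omega> v) \<le> C * \<parallel>v\<parallel>"
proof -
  let ?C = "sqrt (measure lborel W) * meas_bound"
  have "L2_norm W (meas_op c s \<Omega> v) \<le> ?C * \<parallel>v\<parallel>" if "v \<in> Hs s" for v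
  proof -
    have "L2_norm W (meas_op c s \<Omega> v) \<le> ?C * L2_norm UNIV v"
      using meas_op_L2(2)[OF Hs_subset_L2[OF that]] by (simp add: mult.assoc)
    also have "\<dots> \<le> ?C * \<parallel>v\<parallel>"
      using L2_norm_le_Hs_norm[OF c_pos, of v s] meas_bound_nonneg by (intro mult_left_mono) auto
    finally show ?thesis .
  qed
  then show thesis using meas_bound_nonneg by (intro that[of ?C] ballI) auto
qed

text \<open>Here \<kappa> stands for h^m with h at most 1. The interpolation error of a measurement
  is at most \<open>\<kappa> * C * CH\<close> times the norm of v, as \<open>CH\<close> controls all
  derivatives involved; the second bound factors the difference of squares.\<close>

lemma interpolated_measurement_bound:
  assumes nb: "nodal_basis W (fe_space pW \<T>W W) n X \<theta>" and "0 \<le> C" "0 \<le> CH" "0 \<le> \<kappa>" "0 \<le> CL" "\<kappa> \<le> 1"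
    and v: "v \<in> Hs s"
    and Hm: "\<forall>v\<in>L2 UNIV. meas_op c s \<Omega> v \<in> Hm m W \<and> Hm_norm m W (meas_op c s \<Omega> v) \<le> CH * L2_norm UNIV v"
    and CL: "\<forall>v\<in>Hs s. L2_norm W (meas_op c s \<Omega> v) \<le> CL * \<parallel>v\<parallel>"
    and interp: "\<forall>\<phi>\<in>Hm m W. continuous_on (closure W) \<phi> \<longrightarrow>
      L2_norm W (\<lambda>x. nodal_interp n X \<theta> \<phi> x - \<phi> x) \<le> C * \<kappa> * Hm_norm m W \<phi>"
  shows "L2_norm W (nodal_interp n X \<theta> (meas_op c s \<Omega> v)) \<le> (CL + C * CH) * \<parallel>v\<parallel>"
    and "\<bar>(L2_norm W (nodal_interp n X \<theta> (meas_op c s \<Omega> v)))\<^sup>2 - (L2_norm W (meas_op c s \<Omega> v))\<^sup>2\<bar>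
      \<le> 2 * C * CH * (CL + C * CH) * \<kappa> * \<parallel>v\<parallel>\<^sup>2"
proof -
  have vL: "v \<in> L2 UNIV" using Hs_subset_L2[OF v] .
  let ?a = "L2_norm W (nodal_interp n X \<theta> (meas_op c s \<Omega> v))" and ?b = "L2_norm W (meas_op c s \<Omega> v)"
  have "\<bar>?a - ?b\<bar> \<le> L2_norm W (\<lambda>x. nodal_interp n X \<theta> (meas_op c s \<Omega> v) x - meas_op c s \<Omega> v x)"
    by (rule L2_norm_triangle_diff[OF nodal_interp_L2[OF nb] meas_op_L2(1)[OF vL]])
  also have "\<dots> \<le> C * \<kappa> * Hm_norm m W (meas_op c s \<Omega> v)"
    using interp Hm vL meas_op_continuous[OF vL] by blast
  also have "\<dots> \<le> C * \<kappa> * (CH * \<parallel>v\<parallel>)"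
  proof (rule mult_left_mono)
    have "Hm_norm m W (meas_op c s \<Omega> v) \<le> CH * L2_norm UNIV v" using Hm vL by blast
    also have "\<dots> \<le> CH * \<parallel>v\<parallel>" using L2_norm_le_Hs_norm[OF c_pos] assms(3) by (rule mult_left_mono)
    finally show "Hm_norm m W (meas_op c s \<Omega> v) \<le> CH * \<parallel>v\<parallel>" .
  qed (use assms in simp)
  finally have d: "\<bar>?a - ?b\<bar> \<le> \<kappa> * (C * CH * \<parallel>v\<parallel>)" by (simp add: mult_ac)
  have "\<kappa> * (C * CH * \<parallel>v\<parallel>) \<le> 1 * (C * CH * \<parallel>v\<parallel>)"
    using assms(2,3,6) hs_nonneg[of v] by (intro mult_right_mono) auto
  moreover have b: "?b \<le> CL * \<parallel>v\<parallel>" using CL v by blast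
  ultimately show a: "?a \<le> (CL + C * CH) * \<parallel>v\<parallel>" using d by (simp add: distrib_right)
  have "0 \<le> C * CH * \<parallel>v\<parallel>" using assms(2,3) hs_nonneg[of v] by simp
  then have b': "?b \<le> (CL + C * CH) * \<parallel>v\<parallel>" using b by (simp add: distrib_right)
  have "\<bar>?a\<^sup>2 - ?b\<^sup>2\<bar> = \<bar>?a - ?b\<bar> * (?a + ?b)"
  proof -
    have "?a\<^sup>2 - ?b\<^sup>2 = (?a - ?b) * (?a + ?b)" by (simp add: power2_eq_square algebra_simps)
    then show ?thesis by (simp add: abs_mult)
  qed
  also have "\<dots> \<le> (\<kappa> * (C * CH * \<parallel>v\<parallel>)) * (2 * ((CL + C * CH) * \<parallel>v\<parallel>))"
    using a b' d assms hs_nonneg[of v] by (intro mult_mono) auto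
  also have "\<dots> = 2 * C * CH * (CL + C * CH) * \<kappa> * \<parallel>v\<parallel>\<^sup>2"
    by (simp add: power2_eq_square algebra_simps)
  finally show "\<bar>?a\<^sup>2 - ?b\<^sup>2\<bar> \<le> 2 * C * CH * (CL + C * CH) * \<kappa> * \<parallel>v\<parallel>\<^sup>2" .
qed

text \<open>The quadratic functionals are compared at the two minimizers; no compactness is needed since the
  discrete measurement operators converge in operator norm.\<close>

lemma discrete_minimizer_error:
  assumes nb: "nodal_basis W (fe_space pW \<T>W W) n X \<theta>" and mesh: "simplicial_mesh \<T> (cube R)" and R: "\<Omega> \<subseteq> cube R" and \<alpha>: "0 < \<alpha>"
    and u0: "u0 \<in> Hs_tilde c s \<Omega>" and \<mu>: "\<And>x. x \<in> closure W \<Longrightarrow> \<mu> x = meas_op c s \<Omega> u0 x"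
    and ua: "is_arg_min (tikhonov c s \<Omega> W \<mu> \<alpha>) (\<lambda>v. v \<in> Hs_tilde c s \<Omega>) ua"
    and uh: "is_arg_min (discrete_tikhonov c s \<Omega> W R n X \<theta> (\<lambda>k. \<mu> (X k)) \<alpha>) (\<lambda>v. v \<in> fe_space_0 p \<T> (cube R) \<Omega>) uh"
    and v: "v \<in> fe_space_0 p \<T> (cube R) \<Omega>"
    and q: "\<forall>w\<in>Hs s. \<bar>(L2_norm W (nodal_interp n X \<theta> (meas_op c s \<Omega> w)))\<^sup>2 - (L2_norm W (meas_op c s \<Omega> w))\<^sup>2\<bar> \<le> q * \<parallel>w\<parallel>\<^sup>2"
    and CL: "\<forall>v\<in>Hs s. L2_norm W (meas_op c s \<Omega> v) \<le> CL * \<parallel>v\<parallel>"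
  shows "\<alpha> * \<parallel>\<lambda>x. uh x - ua x\<parallel>\<^sup>2 \<le> q * \<parallel>\<lambda>x. uh x - u0 x\<parallel>\<^sup>2 + q * \<parallel>\<lambda>x. v x - u0 x\<parallel>\<^sup>2 + (CL\<^sup>2 + \<alpha>) * \<parallel>\<lambda>x. v x - ua x\<parallel>\<^sup>2"
    and "\<alpha> * \<parallel>uh\<parallel>\<^sup>2 \<le> (L2_norm W (nodal_interp n X \<theta> (meas_op c s \<Omega> u0)))\<^sup>2"
proof -
  interpret T: tikhonov_setting "Hs s" "Hs_inner c s" "L2 W" "L2_inner W" "Hs_tilde c s \<Omega>" meas_cut \<alpha>
    by (rule tikhonov_setting_continuous[OF \<alpha>])
  let ?V = "fe_space_0 p \<T> (cube R) \<Omega>" and ?I = "\<lambda>w. nodal_interp n X \<theta> (meas_op c s \<Omega> w)"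
  have VT: "w \<in> Hs_tilde c s \<Omega>" if "w \<in> ?V" for w using fe_space_0_Hs_tilde[OF that mesh R] .
  have uhV: "uh \<in> ?V" using uh by (simp add: is_arg_min_def)
  have uaT: "ua \<in> Hs_tilde c s \<Omega>" using ua by (simp add: is_arg_min_def)
  note H = Hs_tildeD and L = Hs_tilde_subset_L2
  \<comment> \<open>On W the data are the measurement of u0, so in both functionals the data term
    depends on w - u0 and the penalty is the same. They differ only by the two quadratic forms that
    q compares.\<close>
  have cont: "T.J (meas_cut u0) w = (L2_norm W (meas_op c s \<Omega> (\<lambda>x. w x - u0 x)))\<^sup>2 + \<alpha> * \<parallel>w\<parallel>\<^sup>2"
    if "w \<in> Hs_tilde c s \<Omega>" for w
  proof -
    have "(\<lambda>x. meas_cut w x - meas_cut u0 x) = meas_cut (\<lambda>x. w x - u0 x)" using T.T_diff[OF that u0] by simp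
    then show ?thesis
      using L2_norm_power2[OF meas_op_L2(1)[OF L[OF Hs_tilde_diff[OF that u0]]]]
      by (simp add: T.J_def L2_inner_meas_cut Hs_norm_power2[OF c_pos])
  qed
  have disc: "discrete_tikhonov c s \<Omega> W R n X \<theta> (\<lambda>k. \<mu> (X k)) \<alpha> w = (L2_norm W (?I (\<lambda>x. w x - u0 x)))\<^sup>2 + \<alpha> * \<parallel>w\<parallel>\<^sup>2"
    if w: "w \<in> ?V" for w
  proof -
    have "box_norm c s R w = \<parallel>w\<parallel>"
      using fe_space_0_eq_0[OF w] R by (intro box_norm_eq_Hs_norm H[OF VT[OF w]]) auto
    moreover have "(\<Sum>k<n. (meas_op c s \<Omega> w (X k) - \<mu> (X k)) * \<theta> k x) = ?I (\<lambda>x. w x - u0 x) x" for x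
      unfolding nodal_interp_def
      using meas_op_lincomb[OF L[OF VT[OF w]] L[OF u0], of _ 1 "-1"] nodal_basis_L2(2)[OF nb] \<mu>
      by (intro sum.cong refl) simp
    ultimately show ?thesis
      using Y_norm_eq_L2_norm[OF nodal_basis_L2(1)[OF nb], of n] by (simp add: discrete_tikhonov_def)
  qed
  have arg: "is_arg_min (T.J (meas_cut u0)) (\<lambda>v. v \<in> Hs_tilde c s \<Omega>) ua"
  proof (rule is_arg_min_cong[OF _ ua])
    have "\<mu> x = meas_cut u0 x" if "x \<in> W" for x using \<mu>[of x] that closure_subset[of W] by (auto simp: meas_cut_def)
    then show "tikhonov c s \<Omega> W \<mu> \<alpha> v = T.J (meas_cut u0) v" if "v \<in> Hs_tilde c s \<Omega>" for v
      by (intro tikhonov_eq_J[OF \<alpha> _ L[OF u0] L[OF that]])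
  qed
  have gap: "T.J (meas_cut u0) w - T.J (meas_cut u0) ua
      = (L2_norm W (meas_op c s \<Omega> (\<lambda>x. w x - ua x)))\<^sup>2 + \<alpha> * \<parallel>\<lambda>x. w x - ua x\<parallel>\<^sup>2" if "w \<in> Hs_tilde c s \<Omega>" for w
    using T.minimizer_gap[OF meas_cut_L2(1)[OF L[OF u0]] arg that]
      L2_norm_power2[OF meas_op_L2(1)[OF L[OF Hs_tilde_diff[OF that uaT]]]]
    by (simp add: L2_inner_meas_cut Hs_norm_power2[OF c_pos])
  have le: "discrete_tikhonov c s \<Omega> W R n X \<theta> (\<lambda>k. \<mu> (X k)) \<alpha> uh \<le> discrete_tikhonov c s \<Omega> W R n X \<theta> (\<lambda>k. \<mu> (X k)) \<alpha> w"
    if "w \<in> ?V" for w using uh that by (auto simp: is_arg_min_linorder)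
  have d: "(\<lambda>x. w x - u0 x) \<in> Hs s" if "w \<in> ?V" for w using H[OF Hs_tilde_diff[OF VT[OF that] u0]] .
  \<comment> \<open>The chain runs from the continuous value at uh to the discrete value at uh, to
    the discrete value at v by minimality, and to the continuous value at v. Each change of
    functional costs one term with q, and both ends are measured from the minimum at ua.\<close>
  have "\<alpha> * \<parallel>\<lambda>x. uh x - ua x\<parallel>\<^sup>2 \<le> T.J (meas_cut u0) uh - T.J (meas_cut u0) ua"
    unfolding gap[OF VT[OF uhV]] by simp
  moreover have "T.J (meas_cut u0) uh \<le> discrete_tikhonov c s \<Omega> W R n X \<theta> (\<lambda>k. \<mu> (X k)) \<alpha> uh + q * \<parallel>\<lambda>x. uh x - u0 x\<parallel>\<^sup>2"
    using q[rule_format, OF d[OF uhV]] unfolding cont[OF VT[OF uhV]] disc[OF uhV] by linarith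
  moreover have "discrete_tikhonov c s \<Omega> W R n X \<theta> (\<lambda>k. \<mu> (X k)) \<alpha> v \<le> T.J (meas_cut u0) v + q * \<parallel>\<lambda>x. v x - u0 x\<parallel>\<^sup>2"
    using q[rule_format, OF d[OF v]] unfolding cont[OF VT[OF v]] disc[OF v] by linarith
  moreover have "T.J (meas_cut u0) v - T.J (meas_cut u0) ua \<le> (CL\<^sup>2 + \<alpha>) * \<parallel>\<lambda>x. v x - ua x\<parallel>\<^sup>2"
  proof -
    have "L2_norm W (meas_op c s \<Omega> (\<lambda>x. v x - ua x)) \<le> CL * \<parallel>\<lambda>x. v x - ua x\<parallel>"
      using CL H[OF Hs_tilde_diff[OF VT[OF v] uaT]] by blast
    then have "(L2_norm W (meas_op c s \<Omega> (\<lambda>x. v x - ua x)))\<^sup>2 \<le> (CL * \<parallel>\<lambda>x. v x - ua x\<parallel>)\<^sup>2"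
      by (rule power_mono) simp
    then show ?thesis unfolding gap[OF VT[OF v]] by (simp add: power_mult_distrib distrib_right)
  qed
  ultimately show "\<alpha> * \<parallel>\<lambda>x. uh x - ua x\<parallel>\<^sup>2 \<le> q * \<parallel>\<lambda>x. uh x - u0 x\<parallel>\<^sup>2 + q * \<parallel>\<lambda>x. v x - u0 x\<parallel>\<^sup>2 + (CL\<^sup>2 + \<alpha>) * \<parallel>\<lambda>x. v x - ua x\<parallel>\<^sup>2"
    using le[OF v] by linarith
  \<comment> \<open>Comparison with the zero function bounds uh by the data; this controls the term
    in which q multiplies the norm of uh - u0.\<close>
  have z: "(\<lambda>x. 0) \<in> ?V" using fe_space_0_lincomb[OF uhV uhV, of "-1"] by simp
  have "\<alpha> * \<parallel>uh\<parallel>\<^sup>2 \<le> discrete_tikhonov c s \<Omega> W R n X \<theta> (\<lambda>k. \<mu> (X k)) \<alpha> uh"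
    unfolding disc[OF uhV] by simp
  also have "\<dots> \<le> (L2_norm W (?I (\<lambda>x. 0 - u0 x)))\<^sup>2 + \<alpha> * \<parallel>\<lambda>x::'a. 0\<parallel>\<^sup>2"
    using le[OF z] unfolding disc[OF z] .
  also have "\<dots> = (L2_norm W (?I u0))\<^sup>2"
  proof -
    have "?I (\<lambda>x. 0 - u0 x) x = - ?I u0 x" for x
    proof -
      have "meas_op c s \<Omega> (\<lambda>x. 0 - u0 x) (X k) = - meas_op c s \<Omega> u0 (X k)" if "k < n" for k
        using meas_op_lincomb[OF L[OF u0] L[OF u0], of "X k" "-1" 0] nodal_basis_L2(2)[OF nb that] by simp
      then show ?thesis unfolding nodal_interp_def by (simp flip: sum_negf)
    qed
    moreover have "\<parallel>\<lambda>x::'a. 0\<parallel> = 0" by (simp add: Hs_norm_def frac_form_eq gagliardo_quotient_def L2_norm_def L2_inner_eq)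
    ultimately show ?thesis by (simp add: L2_norm_def L2_inner_def)
  qed
  finally show "\<alpha> * \<parallel>uh\<parallel>\<^sup>2 \<le> (L2_norm W (?I u0))\<^sup>2" .
qed

text \<open>In the comparison estimate q is of order h^m and multiplies norms bounded independently
  of h and R, while v is made close to ua by interpolating a test function near ua. The threshold h1
  is therefore independent of R.\<close>

lemma discrete_minimizers_converge:
  assumes \<alpha>: "0 < \<alpha>"
    and u0: "u0 \<in> Hs_tilde c s \<Omega>" and \<mu>: "\<And>x. x \<in> closure W \<Longrightarrow> \<mu> x = meas_op c s \<Omega> u0 x"
    and ua: "is_arg_min (tikhonov c s \<Omega> W \<mu> \<alpha>) (\<lambda>v. v \<in> Hs_tilde c s \<Omega>) ua"
    and p: "1 \<le> p" and \<sigma>: "0 < \<sigma>" and C: "0 < C" and m: "0 < m"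
    and M: "\<And>h R. (h, R) \<in> M \<Longrightarrow> 0 < h" "\<And>h R. (h, R) \<in> M \<Longrightarrow> \<Omega> \<subseteq> cube R"
      "\<And>h R. (h, R) \<in> M \<Longrightarrow> simplicial_mesh (\<T> h R) (cube R)" "\<And>h R. (h, R) \<in> M \<Longrightarrow> mesh_size (\<T> h R) = h"
      "\<And>h R. (h, R) \<in> M \<Longrightarrow> quasi_uniform \<sigma> (\<T> h R)"
      "\<And>h R. (h, R) \<in> M \<Longrightarrow> nodal_basis W (fe_space pW (TW h) W) (N h) (X h) (\<theta> h)"
    and interp: "\<And>h R. (h, R) \<in> M \<Longrightarrow> \<forall>\<phi>\<in>Hm m W. continuous_on (closure W) \<phi> \<longrightarrow>
      L2_norm W (\<lambda>x. nodal_interp (N h) (X h) (\<theta> h) \<phi> x - \<phi> x) \<le> C * h ^ m * Hm_norm m W \<phi>"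
    and uh: "\<And>h R. (h, R) \<in> M \<Longrightarrow> is_arg_min (discrete_tikhonov c s \<Omega> W R (N h) (X h) (\<theta> h) (\<lambda>k. \<mu> (X h k)) \<alpha>)
      (\<lambda>v. v \<in> fe_space_0 p (\<T> h R) (cube R) \<Omega>) (uh h R)"
    and \<tau>: "0 < \<tau>"
  shows "\<exists>h1>0. \<forall>h R. (h, R) \<in> M \<longrightarrow> h < h1 \<longrightarrow> \<parallel>\<lambda>x. uh h R x - ua x\<parallel> < \<tau>"
proof -
  obtain CL where CL: "0 \<le> CL" "\<forall>v\<in>Hs s. L2_norm W (meas_op c s \<Omega> v) \<le> CL * \<parallel>v\<parallel>"
    by (rule meas_op_norm)
  obtain CH where "0 \<le> CH" "\<And>v. v \<in> L2 UNIV \<Longrightarrow> meas_op c s \<Omega> v \<in> Hm m W \<and> Hm_norm m W (meas_op c s \<Omega> v) \<le> CH * L2_norm UNIV v"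
    using meas_op_Hm[of m] by blast
  then have CH: "0 \<le> CH" "\<forall>v\<in>L2 UNIV. meas_op c s \<Omega> v \<in> Hm m W \<and> Hm_norm m W (meas_op c s \<Omega> v) \<le> CH * L2_norm UNIV v"
    by blast+
  have uaT: "ua \<in> Hs_tilde c s \<Omega>" using ua by (simp add: is_arg_min_def)
  define NB where "NB = CL + C * CH"
  define Q where "Q = 2 * C * CH * NB"
  \<comment> \<open>D1 bounds uh - u0, by the comparison of uh with the zero function. D2 bounds v -
    u0, since v will be within \<open>2 * \<tau>1 \<le> 2\<close> of ua.\<close>
  define D1 where "D1 = NB * \<parallel>u0\<parallel> / sqrt \<alpha> + \<parallel>u0\<parallel>"
  define D2 where "D2 = 2 + \<parallel>\<lambda>x. ua x - u0 x\<parallel>"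
  have nn: "0 \<le> NB" "0 \<le> Q" "0 \<le> D1" "0 \<le> D2"
    using CL(1) CH(1) C \<alpha> hs_nonneg[of u0] hs_nonneg[of "\<lambda>x. ua x - u0 x"]
    by (auto simp: NB_def Q_def D1_def D2_def intro!: add_nonneg_nonneg divide_nonneg_nonneg)
  \<comment> \<open>Chosen so that the approximation term, with v within \<open>2 * \<tau>1\<close>
    of ua, is at most \<alpha> \<tau>^2 / 4; the 16 consists of the square of this 2 and of the 4 in
    the target.\<close>
  define \<tau>1 where "\<tau>1 = min 1 (\<tau> * sqrt (\<alpha> / (16 * (CL\<^sup>2 + \<alpha>))))"
  have pos: "0 < CL\<^sup>2 + \<alpha>" using \<alpha> by (simp add: add_nonneg_pos)
  have \<tau>1: "0 < \<tau>1" "\<tau>1 \<le> 1" using \<tau> \<alpha> pos by (auto simp: \<tau>1_def)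
  have \<tau>1sq: "(CL\<^sup>2 + \<alpha>) * (2 * \<tau>1)\<^sup>2 \<le> \<alpha> * \<tau>\<^sup>2 / 4"
  proof -
    have "\<tau>1\<^sup>2 \<le> (\<tau> * sqrt (\<alpha> / (16 * (CL\<^sup>2 + \<alpha>))))\<^sup>2" using \<tau>1 by (intro power_mono) (auto simp: \<tau>1_def)
    also have "\<dots> = \<tau>\<^sup>2 * (\<alpha> / (16 * (CL\<^sup>2 + \<alpha>)))" using \<alpha> pos by (simp add: power_mult_distrib)
    finally have "(CL\<^sup>2 + \<alpha>) * (4 * \<tau>1\<^sup>2) \<le> (CL\<^sup>2 + \<alpha>) * (4 * (\<tau>\<^sup>2 * (\<alpha> / (16 * (CL\<^sup>2 + \<alpha>)))))"
      using pos by (intro mult_left_mono) auto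
    also have "\<dots> = \<alpha> * \<tau>\<^sup>2 / 4" using pos by (simp add: field_simps)
    finally show ?thesis by (simp add: power_mult_distrib)
  qed
  obtain \<phi> where \<phi>: "\<phi> \<in> test_functions \<Omega>" "\<phi> \<in> Hs s" "\<parallel>\<lambda>x. ua x - \<phi> x\<parallel> < \<tau>1"
    using Hs_tilde_approx[OF uaT \<tau>1(1)] by blast
  obtain h0 where h0: "0 < h0" "\<forall>h R \<T>. 0 < h \<and> h \<le> h0 \<and> \<Omega> \<subseteq> cube R \<and> simplicial_mesh \<T> (cube R) \<and> mesh_size \<T> = h
    \<and> quasi_uniform \<sigma> \<T> \<longrightarrow> (\<exists>v\<in>fe_space_0 p \<T> (cube R) \<Omega>. \<parallel>\<lambda>x. v x - \<phi> x\<parallel> < \<tau>1)"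
    using interpolation_approx[OF \<phi>(1) \<sigma> \<tau>1(1) p] by (elim exE conjE)
  define S where "S = Q * (D1\<^sup>2 + D2\<^sup>2) + 1"
  have S: "0 < S" using nn(2) by (simp add: S_def add_nonneg_pos)
  \<comment> \<open>The last entry makes the two terms with q at most \<alpha> \<tau>^2 / 4
    together; h1 \<le> 1 gives h^m \<le> h because m is positive. The summand 1 in S only ensures S
    > 0.\<close>
  define h1 where "h1 = min (min 1 h0) (\<alpha> * \<tau>\<^sup>2 / 4 / S)"
  have h1: "0 < h1" "h1 \<le> 1" "h1 \<le> h0" "h1 * S \<le> \<alpha> * \<tau>\<^sup>2 / 4"
  proof -
    have "h1 * S \<le> \<alpha> * \<tau>\<^sup>2 / 4 / S * S" using S by (intro mult_right_mono) (auto simp: h1_def)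
    then show "h1 * S \<le> \<alpha> * \<tau>\<^sup>2 / 4" using S by simp
  qed (use h0(1) \<alpha> \<tau> S in \<open>auto simp: h1_def\<close>)
  have "\<parallel>\<lambda>x. uh h R x - ua x\<parallel> < \<tau>" if hR: "(h, R) \<in> M" "h < h1" for h R
  proof -
    note Mh = M[OF hR(1)]
    have hm: "0 \<le> h ^ m" "h ^ m \<le> h" "h ^ m \<le> 1"
    proof -
      have "h ^ m \<le> h ^ 1" using m Mh(1) hR(2) h1(2) by (intro power_decreasing) auto
      then show "h ^ m \<le> h" "h ^ m \<le> 1" using hR(2) h1(2) by simp_all
    qed (use Mh(1) in simp)
    obtain v where v: "v \<in> fe_space_0 p (\<T> h R) (cube R) \<Omega>" "\<parallel>\<lambda>x. v x - \<phi> x\<parallel> < \<tau>1"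
    proof -
      have "0 < h \<and> h \<le> h0 \<and> \<Omega> \<subseteq> cube R \<and> simplicial_mesh (\<T> h R) (cube R) \<and> mesh_size (\<T> h R) = h \<and> quasi_uniform \<sigma> (\<T> h R)"
        using Mh hR(2) h1(3) by simp
      from h0(2)[rule_format, OF this] show thesis by (elim bexE) (rule that)
    qed
    have uhV: "uh h R \<in> fe_space_0 p (\<T> h R) (cube R) \<Omega>" using uh[OF hR(1)] by (simp add: is_arg_min_def)
    have HH: "v \<in> Hs s" "uh h R \<in> Hs s" "u0 \<in> Hs s" "ua \<in> Hs s"
      using fe_space_0_Hs[OF _ Mh(3,2)] v(1) uhV Hs_tildeD u0 uaT by auto
    note ib = interpolated_measurement_bound[OF Mh(6) less_imp_le[OF C] CH(1) hm(1) CL(1) hm(3) _ CH(2) CL(2) interp[OF hR(1)]]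
    have q: "\<forall>w\<in>Hs s. \<bar>(L2_norm W (nodal_interp (N h) (X h) (\<theta> h) (meas_op c s \<Omega> w)))\<^sup>2 - (L2_norm W (meas_op c s \<Omega> w))\<^sup>2\<bar>
        \<le> (Q * h ^ m) * \<parallel>w\<parallel>\<^sup>2"
      using ib(2) by (simp add: Q_def NB_def)
    note err = discrete_minimizer_error[OF Mh(6,3,2) \<alpha> u0 \<mu> ua uh[OF hR(1)] v(1) q CL(2)]
    have "\<parallel>uh h R\<parallel> \<le> NB * \<parallel>u0\<parallel> / sqrt \<alpha>"
    proof -
      have "\<alpha> * \<parallel>uh h R\<parallel>\<^sup>2 \<le> (NB * \<parallel>u0\<parallel>)\<^sup>2"
        using err(2) power_mono[OF ib(1)[OF HH(3)], of 2] by (simp add: NB_def)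
      then have "sqrt (\<alpha> * \<parallel>uh h R\<parallel>\<^sup>2) \<le> sqrt ((NB * \<parallel>u0\<parallel>)\<^sup>2)" by (rule real_sqrt_le_mono)
      then have "sqrt \<alpha> * \<parallel>uh h R\<parallel> \<le> NB * \<parallel>u0\<parallel>"
        using hs_nonneg[of "uh h R"] hs_nonneg[of u0] nn(1) by (simp add: real_sqrt_mult)
      then show ?thesis using \<alpha> by (simp add: pos_le_divide_eq mult.commute)
    qed
    moreover have "\<parallel>\<lambda>x. uh h R x - u0 x\<parallel> \<le> \<parallel>uh h R\<parallel> + \<parallel>u0\<parallel>"
      using hs_add[OF HH(2) H.scale_mem[OF HH(3), of "-1"]] hs_scale[OF HH(3), of "-1"] by simp
    ultimately have "\<parallel>\<lambda>x. uh h R x - u0 x\<parallel> \<le> D1" by (simp add: D1_def)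
    then have e1: "\<parallel>\<lambda>x. uh h R x - u0 x\<parallel>\<^sup>2 \<le> D1\<^sup>2" using hs_nonneg by (rule power_mono)
    have va: "\<parallel>\<lambda>x. v x - ua x\<parallel> \<le> 2 * \<tau>1"
      using hs_triangle3[OF HH(1) \<phi>(2) HH(4)] hs_minus_commute[OF HH(4) \<phi>(2)] \<phi>(3) v(2) by simp
    then have e3: "\<parallel>\<lambda>x. v x - ua x\<parallel>\<^sup>2 \<le> (2 * \<tau>1)\<^sup>2" using hs_nonneg by (rule power_mono)
    have "\<parallel>\<lambda>x. v x - u0 x\<parallel> \<le> D2"
      using hs_triangle3[OF HH(1,4,3)] va \<tau>1(2) by (simp add: D2_def)
    then have e2: "\<parallel>\<lambda>x. v x - u0 x\<parallel>\<^sup>2 \<le> D2\<^sup>2" using hs_nonneg by (rule power_mono)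
    have Qh: "0 \<le> Q * h ^ m" using nn(2) hm(1) by simp
    have "\<alpha> * \<parallel>\<lambda>x. uh h R x - ua x\<parallel>\<^sup>2 \<le> (Q * h ^ m) * D1\<^sup>2 + (Q * h ^ m) * D2\<^sup>2 + (CL\<^sup>2 + \<alpha>) * (2 * \<tau>1)\<^sup>2"
      using err(1) mult_left_mono[OF e1 Qh] mult_left_mono[OF e2 Qh] mult_left_mono[OF e3 less_imp_le[OF pos]] by linarith
    also have "(Q * h ^ m) * D1\<^sup>2 + (Q * h ^ m) * D2\<^sup>2 = h ^ m * (Q * (D1\<^sup>2 + D2\<^sup>2))" by (simp add: algebra_simps)
    also have "h ^ m * (Q * (D1\<^sup>2 + D2\<^sup>2)) \<le> h1 * S"
    proof (rule mult_mono)
      show "h ^ m \<le> h1" using hm(2) hR(2) by simp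
    qed (use h1(1) nn(2) in \<open>auto simp: S_def\<close>)
    also have "h1 * S + (CL\<^sup>2 + \<alpha>) * (2 * \<tau>1)\<^sup>2 \<le> \<alpha> * \<tau>\<^sup>2 / 2" using h1(4) \<tau>1sq by simp
    also have "\<dots> < \<alpha> * \<tau>\<^sup>2" using \<alpha> \<tau> by simp
    finally have "\<parallel>\<lambda>x. uh h R x - ua x\<parallel>\<^sup>2 < \<tau>\<^sup>2" using \<alpha> by simp
    then show ?thesis using \<tau> by (auto intro: power_less_imp_less_base)
  qed
  then show ?thesis using h1(1) by blast
qed

end

section \<open>The error estimate\<close>

text \<open>The exponent 2 / (2\<nu> + 1) balances the noise term t / sqrt \<alpha> against the bias
  \<alpha>^\<nu>: both become t^(2\<nu> / (2\<nu> + 1)). The lower bound on \<alpha> serves the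
  first, the upper bound the second.\<close>

lemma parameter_choice:
  fixes \<nu> t \<alpha> c1 c2 :: real
  assumes "0 < \<nu>" "0 < t" "0 < c1" "0 < \<alpha>"
    and l: "c1 * t powr (2 / (2 * \<nu> + 1)) \<le> \<alpha>" and u: "\<alpha> \<le> c2 * t powr (2 / (2 * \<nu> + 1))"
  shows "t / sqrt \<alpha> \<le> 1 / sqrt c1 * t powr (2 * \<nu> / (2 * \<nu> + 1))"
    and "\<alpha> powr \<nu> \<le> c2 powr \<nu> * t powr (2 * \<nu> / (2 * \<nu> + 1))"
proof -
  have e1: "1 / (2 * \<nu> + 1) + 2 * \<nu> / (2 * \<nu> + 1) = 1"
    using assms(1) by (simp add: add_divide_distrib[symmetric])
  have "sqrt c1 * t powr (1 / (2 * \<nu> + 1)) = sqrt (c1 * t powr (2 / (2 * \<nu> + 1)))"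
  proof -
    have "sqrt (t powr (2 / (2 * \<nu> + 1))) = t powr (2 / (2 * \<nu> + 1) * (1 / 2))"
      unfolding powr_half_sqrt[OF powr_ge_zero, symmetric] powr_powr ..
    also have "2 / (2 * \<nu> + 1) * (1 / 2) = 1 / (2 * \<nu> + 1)" by (simp add: field_simps)
    finally show ?thesis by (simp add: real_sqrt_mult)
  qed
  also have "\<dots> \<le> sqrt \<alpha>" using l by simp
  finally have s: "sqrt c1 * t powr (1 / (2 * \<nu> + 1)) \<le> sqrt \<alpha>" .
  have "t / sqrt \<alpha> \<le> t / (sqrt c1 * t powr (1 / (2 * \<nu> + 1)))"
    using s assms by (intro divide_left_mono) auto
  also have "\<dots> = 1 / sqrt c1 * t powr (2 * \<nu> / (2 * \<nu> + 1))"
  proof -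
    have "t = t powr (1 / (2 * \<nu> + 1)) * t powr (2 * \<nu> / (2 * \<nu> + 1))"
      using assms(2) by (simp add: powr_add[symmetric] e1)
    then show ?thesis using assms by (simp add: field_simps)
  qed
  finally show "t / sqrt \<alpha> \<le> 1 / sqrt c1 * t powr (2 * \<nu> / (2 * \<nu> + 1))" .
  have "0 < c2 * t powr (2 / (2 * \<nu> + 1))" using u assms(4) by linarith
  then have c2: "0 < c2" using assms(2) by (simp add: zero_less_mult_iff)
  have "\<alpha> powr \<nu> \<le> (c2 * t powr (2 / (2 * \<nu> + 1))) powr \<nu>"
    using u assms by (intro powr_mono2) auto
  also have "\<dots> = c2 powr \<nu> * t powr (2 * \<nu> / (2 * \<nu> + 1))"
    using c2 by (simp add: powr_mult powr_powr)
  finally show "\<alpha> powr \<nu> \<le> c2 powr \<nu> * t powr (2 * \<nu> / (2 * \<nu> + 1))" .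
qed

theorem theorem3p11:
  fixes c s d0 \<nu> :: real
    and \<Omega> W :: "'a::euclidean_space set"
    and q f u u0 :: "'a \<Rightarrow> real"
    and Lstar :: "('a \<Rightarrow> real) \<Rightarrow> 'a \<Rightarrow> real"
    and e :: "nat \<Rightarrow> 'a \<Rightarrow> real" and lam :: "nat \<Rightarrow> real"
    (* M: the discretization parameters (h, R); P: the parameters (h, R, \<delta>, \<alpha>) *)
    and M :: "(real \<times> real) set" and P :: "(real \<times> real \<times> real \<times> real) set"
    and p pW :: nat
    and \<T> :: "real \<Rightarrow> real \<Rightarrow> 'a set set" and TW :: "real \<Rightarrow> 'a set set"
    and N :: "real \<Rightarrow> nat" and X :: "real \<Rightarrow> nat \<Rightarrow> 'a"
    and \<theta> :: "real \<Rightarrow> nat \<Rightarrow> 'a \<Rightarrow> real"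
    and uhf :: "real \<Rightarrow> real \<Rightarrow> 'a \<Rightarrow> real"
    and gd :: "real \<Rightarrow> real \<Rightarrow> real \<Rightarrow> 'a \<Rightarrow> real"
    and u0a :: "real \<Rightarrow> 'a \<Rightarrow> real"
    and uhat :: "real \<Rightarrow> real \<Rightarrow> real \<Rightarrow> 'a \<Rightarrow> real"
    and u0h :: "real \<Rightarrow> real \<Rightarrow> real \<Rightarrow> real \<Rightarrow> 'a \<Rightarrow> real"
    and w r :: "real \<Rightarrow> real \<Rightarrow> real \<Rightarrow> real \<Rightarrow> 'a \<Rightarrow> real"
    and eps :: "real \<Rightarrow> real \<Rightarrow> real \<Rightarrow> real \<Rightarrow> real"
    and ubar g \<mu> :: "'a \<Rightarrow> real" and \<eta> :: "real \<Rightarrow> real \<Rightarrow> real"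
    and \<rho> :: "real \<Rightarrow> real \<Rightarrow> real \<Rightarrow> real"
    and F :: "(real \<times> real \<times> real \<times> real) filter" and rate :: "real \<times> real \<times> real \<times> real \<Rightarrow> real"
  assumes "ubar = zero_extension (exterior \<Omega>) f"
    and "g = frac_lap c s u"
    and "\<mu> = (\<lambda>x. g x - frac_lap c s ubar x)"
    and "\<eta> = (\<lambda>h R. interp_consistency c s W (N h) (X h) (\<theta> h) ubar (uhf h R)
                    + trunc_consistency c s W R (N h) (X h) (\<theta> h) (uhf h R))"
    and "\<rho> = (\<lambda>h R \<alpha>. Hs_norm c s (\<lambda>x. uhat h R \<alpha> x - u0a \<alpha> x))"
    (* F: the parameters vary in P with \<delta> + \<eta> h R \<rightarrow> 0 *)
    and "F = inf (filtercomap (\<lambda>(h, R, \<delta>, \<alpha>). \<delta> + \<eta> h R) (at_right 0)) (principal P)"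
    and "rate = (\<lambda>(h, R, \<delta>, \<alpha>). (\<delta> + \<eta> h R) powr (2 * \<nu> / (2 * \<nu> + 1)))"
    (* continuous problem *)
    and "c > 0" and "0 < s" and "s < 1"
    and "lipschitz_polyhedral_domain \<Omega>"
    and "open W" and "W \<noteq> {}" and "bounded W"
    and "closure W \<subseteq> exterior \<Omega>" and "setdist W \<Omega> = d0" and "d0 > 0"
    and "q \<in> L_infinity \<Omega>" and "only_trivial_solution c s \<Omega> q"
    and "f \<in> test_functions W"
    and "exterior_value_solution c s \<Omega> q f u"
    and "u0 \<in> Hs_tilde c s \<Omega>" and "\<forall>x. u x = u0 x + ubar x"
    and "hilbert_adjoint c s \<Omega> W (meas_op c s \<Omega>) Lstar"
    and "orthonormal_eigenbasis c s \<Omega> (\<lambda>v. Lstar (meas_op c s \<Omega> v)) e lam"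
    and "\<forall>\<alpha>>0. is_arg_min (tikhonov c s \<Omega> W \<mu> \<alpha>) (\<lambda>v. v \<in> Hs_tilde c s \<Omega>) (u0a \<alpha>)"
    (* discretization *)
    and "\<forall>(h, R)\<in>M. 0 < h \<and> 0 < R \<and> \<Omega> \<union> W \<subseteq> cube R"
    and "p \<ge> 1" and "pW \<ge> 1"
    and "\<exists>\<sigma>>0. \<forall>(h, R)\<in>M. simplicial_mesh (\<T> h R) (cube R) \<and> mesh_size (\<T> h R) = h \<and>
           quasi_uniform \<sigma> (\<T> h R)"
    and "\<exists>h0>0. \<forall>(h, R)\<in>M. h \<le> h0 \<longrightarrow> fitted_to (\<T> h R) \<Omega>"
    and "\<exists>\<sigma>>0. \<forall>(h, R)\<in>M. simplicial_mesh (TW h) W \<and> quasi_uniform \<sigma> (TW h)"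
    and "\<forall>(h, R)\<in>M. nodal_basis W (fe_space pW (TW h) W) (N h) (X h) (\<theta> h)"
    and "\<exists>m C. real m > real DIM('a) / 2 \<and> C > 0 \<and>
           (\<forall>(h, R)\<in>M. \<forall>\<phi>\<in>Hm m W. continuous_on (closure W) \<phi> \<longrightarrow>
              L2_norm W (\<lambda>x. nodal_interp (N h) (X h) (\<theta> h) \<phi> x - \<phi> x) \<le> C * h ^ m * Hm_norm m W \<phi>)"
    and "\<forall>(h, R)\<in>M. is_nodal_interpolant p (\<T> h R) (cube R) ubar (uhf h R)"
    and "\<forall>(h, R)\<in>M. \<forall>k<N h. frac_lap_exists c s (uhf h R) (X h k)"
    (* data, discrete minimizers, source condition *)
    and "P \<subseteq> {(h, R, \<delta>, \<alpha>). (h, R) \<in> M \<and> 0 \<le> \<delta> \<and> 0 < \<alpha>}"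
    and "\<forall>(h, R, \<delta>, \<alpha>)\<in>P. Y_norm W (N h) (\<theta> h) (\<lambda>k. gd h R \<delta> (X h k) - g (X h k)) \<le> \<delta>"
    and "\<forall>(h, R, \<delta>, \<alpha>)\<in>P.
           is_arg_min (discrete_tikhonov c s \<Omega> W R (N h) (X h) (\<theta> h)
               (\<lambda>k. gd h R \<delta> (X h k) - frac_lap_on c s (cube R) (uhf h R) (X h k)) \<alpha>)
             (\<lambda>v. v \<in> fe_space_0 p (\<T> h R) (cube R) \<Omega>) (u0h h R \<delta> \<alpha>)"
    and "\<forall>(h, R)\<in>M. \<forall>\<alpha>>0.
           is_arg_min (discrete_tikhonov c s \<Omega> W R (N h) (X h) (\<theta> h) (\<lambda>k. \<mu> (X h k)) \<alpha>)
             (\<lambda>v. v \<in> fe_space_0 p (\<T> h R) (cube R) \<Omega>) (uhat h R \<alpha>)"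
    and "0 < \<nu>" and "\<nu> \<le> 1"
    and "\<forall>(h, R, \<delta>, \<alpha>)\<in>P. w h R \<delta> \<alpha> \<in> Hs_tilde c s \<Omega> \<and> r h R \<delta> \<alpha> \<in> Hs_tilde c s \<Omega> \<and>
           (\<exists>z. frac_power_eq c s e lam \<nu> (w h R \<delta> \<alpha>) z \<and>
                (AE x in lborel. u0 x = z x + r h R \<delta> \<alpha> x)) \<and>
           Hs_norm c s (r h R \<delta> \<alpha>) \<le> eps h R \<delta> \<alpha>"
    and "(\<lambda>(h, R, \<delta>, \<alpha>). eps h R \<delta> \<alpha>) \<in> O[F](rate)"
  shows "(\<forall>x\<in>closure W. meas_op c s \<Omega> u0 x = \<mu> x)
    \<and> (\<exists>C>0. \<forall>(h, R, \<delta>, \<alpha>)\<in>P.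
          Hs_norm c s (\<lambda>x. u0h h R \<delta> \<alpha> x + uhf h R x - u x)
          \<le> C * ((\<delta> + \<eta> h R) / sqrt \<alpha> + \<rho> h R \<alpha> + Hs_norm c s (\<lambda>x. uhf h R x - ubar x)
                 + \<alpha> powr \<nu> * Hs_norm c s (w h R \<delta> \<alpha>) + eps h R \<delta> \<alpha>))
    \<and> (\<forall>w'\<in>Hs_tilde c s \<Omega>. frac_power_eq c s e lam \<nu> w' u0 \<longrightarrow>
          (\<exists>C>0. \<forall>(h, R, \<delta>, \<alpha>)\<in>P.
             Hs_norm c s (\<lambda>x. u0h h R \<delta> \<alpha> x + uhf h R x - u x)
             \<le> C * ((\<delta> + \<eta> h R) / sqrt \<alpha> + \<rho> h R \<alpha> + Hs_norm c s (\<lambda>x. uhf h R x - ubar x)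
                    + \<alpha> powr \<nu> * Hs_norm c s w')))
    \<and> (\<forall>\<alpha>>0. ((\<lambda>(h, R). \<rho> h R \<alpha>) \<longlongrightarrow> 0) (inf (at_right 0 \<times>\<^sub>F at_top) (principal M)))
    \<and> ((\<lambda>(h, R, \<delta>, \<alpha>). \<rho> h R \<alpha> + Hs_norm c s (\<lambda>x. uhf h R x - ubar x) + eps h R \<delta> \<alpha>) \<in> O[F](rate)
       \<longrightarrow> (\<exists>B. \<forall>(h, R, \<delta>, \<alpha>)\<in>P. Hs_norm c s (w h R \<delta> \<alpha>) \<le> B)
       \<longrightarrow> (\<exists>c1>0. \<exists>c2>0. \<forall>(h, R, \<delta>, \<alpha>)\<in>P.
              c1 * (\<delta> + \<eta> h R) powr (2 / (2 * \<nu> + 1)) \<le> \<alpha> \<and>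
              \<alpha> \<le> c2 * (\<delta> + \<eta> h R) powr (2 / (2 * \<nu> + 1)))
       \<longrightarrow> (\<lambda>(h, R, \<delta>, \<alpha>). Hs_norm c s (\<lambda>x. u0h h R \<delta> \<alpha> x + uhf h R x - u x)) \<in> O[F](rate))"
proof -
  note ubar = assms(1) and g = assms(2) and \<mu> = assms(3) and \<eta> = assms(4) and \<rho> = assms(5)
    and F = assms(6) and rate = assms(7)
  note M_basic = assms(27) and mesh = assms(30) and nb = assms(33) and interp = assms(34)
    and P_sub = assms(37) and data = assms(38) and u0h = assms(39) and uhat = assms(40) and source = assms(43)
  interpret fractional_measurement c s d0 \<Omega> W
    using assms(8-17) by unfold_locales (auto simp: lipschitz_polyhedral_domain_def)
  have f0: "f x = 0" if "x \<notin> W" for x using assms(20) that unfolding test_functions_iff by blast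
  \<comment> \<open>The datum is supported in W, which lies in the exterior, so its zero extension
    is f itself and hence a test function.\<close>
  have ubar_f: "ubar = f"
    using f0 W_exterior closure_subset[of W] unfolding ubar zero_extension_def by fastforce
  have u0T: "u0 \<in> Hs_tilde c s \<Omega>" by fact
  have u_eq: "u = (\<lambda>x. u0 x + ubar x)" using assms(23) by blast
  \<comment> \<open>The exterior condition holds at every point, so u0 vanishes on the exterior
    pointwise and not merely almost everywhere, as the pointwise operator on the closure of W
    requires.\<close>
  have u0_ext: "u0 x = 0" if "x \<in> exterior \<Omega>" for x
    using assms(21,23) that ubar_f by (simp add: exterior_value_solution_def)
  have ubar_test: "ubar \<in> test_functions W" using assms(20) ubar_f by simp
  have data_eq: "\<mu> x = meas_op c s \<Omega> u0 x" if "x \<in> closure W" for x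
    unfolding \<mu> g u_eq using meas_op_eq_data[OF u0T u0_ext ubar_test that] by simp
  have data_eq_W: "\<mu> x = meas_op c s \<Omega> u0 x" if "x \<in> W" for x
    using data_eq that closure_subset[of W] by blast
  have ubar_L2: "ubar \<in> L2 UNIV" using Hs_subset_L2[OF test_functions_Hs[OF ubar_test s_pos s_less]] .
  have uaT: "u0a \<alpha> \<in> Hs_tilde c s \<Omega>" if "0 < \<alpha>" for \<alpha>
    using assms(26) that by (simp add: is_arg_min_def)

  \<comment> \<open>Stated for an arbitrary representation u0 = z + q, so as to cover both the
    source condition and the range case with remainder 0.\<close>
  have error: "Hs_norm c s (\<lambda>x. u0h h R \<delta> \<alpha> x + uhf h R x - u x)
      \<le> (\<delta> + \<eta> h R) / sqrt \<alpha> + \<rho> h R \<alpha> + Hs_norm c s (\<lambda>x. uhf h R x - ubar x)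
        + (\<alpha> powr \<nu> * Hs_norm c s v + Hs_norm c s q)"
    if P: "(h, R, \<delta>, \<alpha>) \<in> P" and v: "v \<in> Hs_tilde c s \<Omega>" and q: "q \<in> Hs_tilde c s \<Omega>"
      and z: "frac_power_eq c s e lam \<nu> v z" "AE x in lborel. u0 x = z x + q x" for h R \<delta> \<alpha> v q z
  proof -
    have M: "(h, R) \<in> M" and \<alpha>: "0 < \<alpha>" using P P_sub by auto
    have R: "\<Omega> \<subseteq> cube R" using M_basic M by auto
    have mR: "simplicial_mesh (\<T> h R) (cube R)" using mesh M by auto
    have nbh: "nodal_basis W (fe_space pW (TW h) W) (N h) (X h) (\<theta> h)" using nb M by auto
    let ?y = "\<lambda>k. gd h R \<delta> (X h k) - frac_lap_on c s (cube R) (uhf h R) (X h k)"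
    have mh: "is_arg_min (discrete_tikhonov c s \<Omega> W R (N h) (X h) (\<theta> h) ?y \<alpha>)
        (\<lambda>v. v \<in> fe_space_0 p (\<T> h R) (cube R) \<Omega>) (u0h h R \<delta> \<alpha>)" using u0h P by auto
    have mhat: "is_arg_min (discrete_tikhonov c s \<Omega> W R (N h) (X h) (\<theta> h) (\<lambda>k. \<mu> (X h k)) \<alpha>)
        (\<lambda>v. v \<in> fe_space_0 p (\<T> h R) (cube R) \<Omega>) (uhat h R \<alpha>)" using uhat M \<alpha> by auto
    have Hs: "u0h h R \<delta> \<alpha> \<in> Hs s" "uhat h R \<alpha> \<in> Hs s" "u0a \<alpha> \<in> Hs s" "u0 \<in> Hs s"
      using fe_space_0_Hs[OF _ mR R] mh mhat Hs_tildeD[OF uaT[OF \<alpha>]] Hs_tildeD[OF u0T]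
      by (auto simp: is_arg_min_def)
    have "Y_norm W (N h) (\<theta> h) (\<lambda>k. ?y k - \<mu> (X h k)) \<le> \<delta> + \<eta> h R"
    proof -
      let ?d = "\<lambda>k. gd h R \<delta> (X h k) - g (X h k)"
      let ?i = "\<lambda>k. frac_lap c s ubar (X h k) - frac_lap c s (uhf h R) (X h k)"
      let ?t = "\<lambda>k. frac_lap c s (uhf h R) (X h k) - frac_lap_on c s (cube R) (uhf h R) (X h k)"
      \<comment> \<open>Data, interpolation and truncation errors add up exactly to the deviation
        from the sampled \<mu>, because the intermediate values of \<open>frac_lap\<close> at
        \<open>uhf\<close> cancel.\<close>
      have "(\<lambda>k. ?y k - \<mu> (X h k)) = (\<lambda>k. ?d k + ?i k + ?t k)" unfolding \<mu> by auto
      moreover have "Y_norm W (N h) (\<theta> h) ?d \<le> \<delta>" using data P by auto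
      moreover have "Y_norm W (N h) (\<theta> h) (\<lambda>k. ?d k + ?i k + ?t k)
          \<le> Y_norm W (N h) (\<theta> h) ?d + (Y_norm W (N h) (\<theta> h) ?i + Y_norm W (N h) (\<theta> h) ?t)"
        by (rule Y_norm_add3) (rule nodal_basis_L2(1)[OF nbh])
      ultimately show ?thesis
        unfolding \<eta> interp_consistency_def trunc_consistency_def by (simp only:)
    qed
    then have "sqrt \<alpha> * Hs_norm c s (\<lambda>x. u0h h R \<delta> \<alpha> x - uhat h R \<alpha> x) \<le> \<delta> + \<eta> h R"
      using discrete_tikhonov_stable[OF nbh mR R \<alpha> mh mhat] by linarith
    then have e1: "Hs_norm c s (\<lambda>x. u0h h R \<delta> \<alpha> x - uhat h R \<alpha> x) \<le> (\<delta> + \<eta> h R) / sqrt \<alpha>"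
      using \<alpha> by (simp add: pos_le_divide_eq mult.commute)
    have e2: "Hs_norm c s (\<lambda>x. u0a \<alpha> x - u0 x) \<le> \<alpha> powr \<nu> * Hs_norm c s v + Hs_norm c s q"
      using tikhonov_source_error[OF \<alpha> assms(41,42,24,25) u0T data_eq_W _ v q z] assms(26) \<alpha> by blast
    have e3: "Hs_norm c s (\<lambda>x. u0h h R \<delta> \<alpha> x - u0 x)
        \<le> (\<delta> + \<eta> h R) / sqrt \<alpha> + \<rho> h R \<alpha> + (\<alpha> powr \<nu> * Hs_norm c s v + Hs_norm c s q)"
      using hs_triangle3[OF Hs(1,2,4)] hs_triangle3[OF Hs(2,3,4)] e1 e2 unfolding \<rho> by linarith
    \<comment> \<open>Only square integrability is extracted from the finite element structure of
      \<open>uhf\<close>; \<open>Hs_norm_triangle\<close> accepts this in its second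
      argument.\<close>
    have "uhf h R \<in> L2 UNIV"
      using bspec[OF assms(35) M] fe_space_L2[OF _ bounded_cube] unfolding is_nodal_interpolant_def by blast
    from L2.diff_mem[OF this ubar_L2]
    have "Hs_norm c s (\<lambda>x. (u0h h R \<delta> \<alpha> x - u0 x) + (uhf h R x - ubar x))
      \<le> Hs_norm c s (\<lambda>x. u0h h R \<delta> \<alpha> x - u0 x) + Hs_norm c s (\<lambda>x. uhf h R x - ubar x)"
      by (rule Hs_norm_triangle[OF c_pos H.diff_mem[OF Hs(1,4)]])
    moreover have "(\<lambda>x. u0h h R \<delta> \<alpha> x + uhf h R x - u x) = (\<lambda>x. (u0h h R \<delta> \<alpha> x - u0 x) + (uhf h R x - ubar x))"
      unfolding u_eq by auto
    ultimately show ?thesis using e3 by simp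
  qed

  have error_source: "Hs_norm c s (\<lambda>x. u0h h R \<delta> \<alpha> x + uhf h R x - u x)
      \<le> (\<delta> + \<eta> h R) / sqrt \<alpha> + \<rho> h R \<alpha> + Hs_norm c s (\<lambda>x. uhf h R x - ubar x)
        + \<alpha> powr \<nu> * Hs_norm c s (w h R \<delta> \<alpha>) + eps h R \<delta> \<alpha>"
    if P: "(h, R, \<delta>, \<alpha>) \<in> P" for h R \<delta> \<alpha>
  proof -
    obtain z where z: "w h R \<delta> \<alpha> \<in> Hs_tilde c s \<Omega>" "r h R \<delta> \<alpha> \<in> Hs_tilde c s \<Omega>"
      "frac_power_eq c s e lam \<nu> (w h R \<delta> \<alpha>) z" "AE x in lborel. u0 x = z x + r h R \<delta> \<alpha> x"
      "Hs_norm c s (r h R \<delta> \<alpha>) \<le> eps h R \<delta> \<alpha>"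
      using source P by auto
    show ?thesis using error[OF P z(1-4)] z(5) by linarith
  qed

  have range: "Hs_norm c s (\<lambda>x. u0h h R \<delta> \<alpha> x + uhf h R x - u x)
      \<le> (\<delta> + \<eta> h R) / sqrt \<alpha> + \<rho> h R \<alpha> + Hs_norm c s (\<lambda>x. uhf h R x - ubar x) + \<alpha> powr \<nu> * Hs_norm c s w'"
    if "w' \<in> Hs_tilde c s \<Omega>" "frac_power_eq c s e lam \<nu> w' u0" "(h, R, \<delta>, \<alpha>) \<in> P" for w' h R \<delta> \<alpha>
  proof -
    \<comment> \<open>The range condition is the representation with z = u0 and remainder 0, whose
      norm is 0.\<close>
    have "(\<lambda>x. 0) \<in> Hs_tilde c s \<Omega>" using Hs_tilde_lincomb[OF u0T u0T, of 0 0] by simp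
    moreover have "Hs_norm c s (\<lambda>x::'a. 0) = 0"
      by (simp add: Hs_norm_def frac_form_eq gagliardo_quotient_def L2_norm_def L2_inner_eq)
    ultimately show ?thesis using error[OF that(3,1) _ that(2), of "\<lambda>x. 0"] by simp
  qed

  have converge: "((\<lambda>(h, R). \<rho> h R \<alpha>) \<longlongrightarrow> 0) (inf (at_right 0 \<times>\<^sub>F at_top) (principal M))" if \<alpha>: "0 < \<alpha>" for \<alpha>
  proof (rule tendstoI)
    fix \<tau> :: real assume \<tau>: "0 < \<tau>"
    obtain \<sigma> where \<sigma>: "0 < \<sigma>" "\<forall>(h, R)\<in>M. simplicial_mesh (\<T> h R) (cube R) \<and> mesh_size (\<T> h R) = h \<and> quasi_uniform \<sigma> (\<T> h R)"
      using mesh by blast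
    obtain m C where mC: "real m > real DIM('a) / 2" "C > 0" "\<forall>(h, R)\<in>M. \<forall>\<phi>\<in>Hm m W. continuous_on (closure W) \<phi> \<longrightarrow>
        L2_norm W (\<lambda>x. nodal_interp (N h) (X h) (\<theta> h) \<phi> x - \<phi> x) \<le> C * h ^ m * Hm_norm m W \<phi>"
      using interp by blast
    have m: "0 < m" using mC(1) by (cases m) auto
    have "\<exists>h1>0. \<forall>h R. (h, R) \<in> M \<longrightarrow> h < h1 \<longrightarrow> Hs_norm c s (\<lambda>x. uhat h R \<alpha> x - u0a \<alpha> x) < \<tau>"
    proof (rule discrete_minimizers_converge[OF \<alpha> u0T data_eq _ assms(28) \<sigma>(1) mC(2) m])
      show "is_arg_min (tikhonov c s \<Omega> W \<mu> \<alpha>) (\<lambda>v. v \<in> Hs_tilde c s \<Omega>) (u0a \<alpha>)" using assms(26) \<alpha> by blast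
      fix h R assume M: "(h, R) \<in> M"
      show "0 < h" "\<Omega> \<subseteq> cube R" using M_basic M by auto
      show "simplicial_mesh (\<T> h R) (cube R)" "mesh_size (\<T> h R) = h" "quasi_uniform \<sigma> (\<T> h R)" using \<sigma>(2) M by auto
      show "nodal_basis W (fe_space pW (TW h) W) (N h) (X h) (\<theta> h)" using nb M by auto
      show "\<forall>\<phi>\<in>Hm m W. continuous_on (closure W) \<phi> \<longrightarrow>
        L2_norm W (\<lambda>x. nodal_interp (N h) (X h) (\<theta> h) \<phi> x - \<phi> x) \<le> C * h ^ m * Hm_norm m W \<phi>"
        using bspec[OF mC(3) M] by simp
      show "is_arg_min (discrete_tikhonov c s \<Omega> W R (N h) (X h) (\<theta> h) (\<lambda>k. \<mu> (X h k)) \<alpha>)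
        (\<lambda>v. v \<in> fe_space_0 p (\<T> h R) (cube R) \<Omega>) (uhat h R \<alpha>)"
        using bspec[OF uhat M] \<alpha> by simp
    qed (assumption | rule \<tau>)+
    then obtain h1 where h1: "0 < h1" "\<And>h R. (h, R) \<in> M \<Longrightarrow> h < h1 \<Longrightarrow> \<rho> h R \<alpha> < \<tau>"
      unfolding \<rho> by blast
    \<comment> \<open>The threshold h1 is uniform in R, so the rectangle h < h1 with arbitrary R
      already witnesses the eventuality in the product filter.\<close>
    have "\<forall>\<^sub>F x in at_right 0 \<times>\<^sub>F at_top. x \<in> M \<longrightarrow> dist (case x of (h, R) \<Rightarrow> \<rho> h R \<alpha>) 0 < \<tau>"
      unfolding eventually_prod_filter
    proof (intro exI conjI allI impI)
      show "\<forall>\<^sub>F h in at_right 0. h < h1" using h1(1) by (auto simp: eventually_at_right_field)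
      show "\<forall>\<^sub>F R in (at_top :: real filter). True" by simp
      fix h R :: real assume "h < h1" "(h, R) \<in> M"
      then show "dist (case (h, R) of (h, R) \<Rightarrow> \<rho> h R \<alpha>) 0 < \<tau>"
        using h1(2)[of h R] hs_nonneg[of "\<lambda>x. uhat h R \<alpha> x - u0a \<alpha> x"] unfolding \<rho> by simp
    qed
    then show "\<forall>\<^sub>F x in inf (at_right 0 \<times>\<^sub>F at_top) (principal M). dist (case x of (h, R) \<Rightarrow> \<rho> h R \<alpha>) 0 < \<tau>"
      unfolding eventually_inf_principal .
  qed

  have rates: "(\<lambda>(h, R, \<delta>, \<alpha>). Hs_norm c s (\<lambda>x. u0h h R \<delta> \<alpha> x + uhf h R x - u x)) \<in> O[F](rate)"
    if O: "(\<lambda>(h, R, \<delta>, \<alpha>). \<rho> h R \<alpha> + Hs_norm c s (\<lambda>x. uhf h R x - ubar x) + eps h R \<delta> \<alpha>) \<in> O[F](rate)"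
      and w_bounded: "\<exists>B. \<forall>(h, R, \<delta>, \<alpha>)\<in>P. Hs_norm c s (w h R \<delta> \<alpha>) \<le> B"
      and choice: "\<exists>c1>0. \<exists>c2>0. \<forall>(h, R, \<delta>, \<alpha>)\<in>P.
              c1 * (\<delta> + \<eta> h R) powr (2 / (2 * \<nu> + 1)) \<le> \<alpha> \<and>
              \<alpha> \<le> c2 * (\<delta> + \<eta> h R) powr (2 / (2 * \<nu> + 1))"
  proof -
    obtain B where B: "\<forall>(h, R, \<delta>, \<alpha>)\<in>P. Hs_norm c s (w h R \<delta> \<alpha>) \<le> B" using w_bounded by blast
    obtain c1 c2 where c12: "0 < c1" "0 < c2" "\<forall>(h, R, \<delta>, \<alpha>)\<in>P.
              c1 * (\<delta> + \<eta> h R) powr (2 / (2 * \<nu> + 1)) \<le> \<alpha> \<and>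
              \<alpha> \<le> c2 * (\<delta> + \<eta> h R) powr (2 / (2 * \<nu> + 1))" using choice by blast
    obtain C where C: "0 < C" "\<forall>\<^sub>F x in F. norm (case x of (h, R, \<delta>, \<alpha>) \<Rightarrow>
        \<rho> h R \<alpha> + Hs_norm c s (\<lambda>x. uhf h R x - ubar x) + eps h R \<delta> \<alpha>) \<le> C * norm (rate x)"
      using landau_o.bigE[OF O] by blast
    \<comment> \<open>Both membership in P and positivity of \<delta> + \<eta> are built into F; the
      latter comes from \<open>at_right\<close> and is what the power laws in
      \<open>parameter_choice\<close> ask for.\<close>
    have P: "\<forall>\<^sub>F x in F. x \<in> P" unfolding F eventually_inf_principal by simp
    have "\<forall>\<^sub>F t in at_right (0::real). 0 < t" by (rule eventually_at_right_less)
    then have "\<forall>\<^sub>F x in filtercomap (\<lambda>(h, R, \<delta>, \<alpha>). \<delta> + \<eta> h R) (at_right 0).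
        0 < (\<lambda>(h, R, \<delta>, \<alpha>::real). \<delta> + \<eta> h R) x" by (rule eventually_filtercomapI)
    then have t: "\<forall>\<^sub>F x in F. 0 < (\<lambda>(h, R, \<delta>, \<alpha>::real). \<delta> + \<eta> h R) x"
      unfolding F eventually_inf_principal by eventually_elim simp
    \<comment> \<open>One summand per error: the noise through the lower bound on \<alpha>, the
      assumed rate, and the bias through the upper bound. The absolute value is taken because B may
      be negative when P is empty.\<close>
    let ?K = "1 / sqrt c1 + C + c2 powr \<nu> * \<bar>B\<bar>"
    show ?thesis
    proof (rule bigoI[where c = ?K])
      show "\<forall>\<^sub>F x in F. norm (case x of (h, R, \<delta>, \<alpha>) \<Rightarrow> Hs_norm c s (\<lambda>x. u0h h R \<delta> \<alpha> x + uhf h R x - u x)) \<le> ?K * norm (rate x)"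
        using C(2) P t
      proof eventually_elim
        case (elim x)
        obtain h R \<delta> \<alpha> where x: "x = (h, R, \<delta>, \<alpha>)" by (cases x) auto
        have xP: "(h, R, \<delta>, \<alpha>) \<in> P" and t: "0 < \<delta> + \<eta> h R" using elim x by auto
        have \<alpha>: "0 < \<alpha>" using xP P_sub by auto
        let ?t = "(\<delta> + \<eta> h R) powr (2 * \<nu> / (2 * \<nu> + 1))"
        have rx: "norm (rate x) = ?t" unfolding rate x by simp
        have b: "\<rho> h R \<alpha> + Hs_norm c s (\<lambda>x. uhf h R x - ubar x) + eps h R \<delta> \<alpha> \<le> C * ?t"
          using elim(1) unfolding rx unfolding x by simp
        have cc: "c1 * (\<delta> + \<eta> h R) powr (2 / (2 * \<nu> + 1)) \<le> \<alpha>" "\<alpha> \<le> c2 * (\<delta> + \<eta> h R) powr (2 / (2 * \<nu> + 1))"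
          using bspec[OF c12(3) xP] by simp_all
        note pc = parameter_choice[OF assms(41) t c12(1) \<alpha> cc]
        have "Hs_norm c s (w h R \<delta> \<alpha>) \<le> \<bar>B\<bar>" using bspec[OF B xP] by simp
        then have "\<alpha> powr \<nu> * Hs_norm c s (w h R \<delta> \<alpha>) \<le> (c2 powr \<nu> * ?t) * \<bar>B\<bar>"
          using pc(2) hs_nonneg by (intro mult_mono) auto
        then have "Hs_norm c s (\<lambda>x. u0h h R \<delta> \<alpha> x + uhf h R x - u x) \<le> 1 / sqrt c1 * ?t + C * ?t + (c2 powr \<nu> * ?t) * \<bar>B\<bar>"
          using error_source[OF xP] pc(1) b by linarith
        also have "\<dots> = ?K * ?t" by (simp add: algebra_simps)
        finally show ?case unfolding rx unfolding x by (simp only: prod.case real_norm_def abs_of_nonneg[OF hs_nonneg])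
      qed
    qed
  qed

  show ?thesis
  proof (intro conjI ballI allI impI)
    show "meas_op c s \<Omega> u0 x = \<mu> x" if "x \<in> closure W" for x using data_eq[OF that] by simp
    show "\<exists>C>0. \<forall>(h, R, \<delta>, \<alpha>)\<in>P.
          Hs_norm c s (\<lambda>x. u0h h R \<delta> \<alpha> x + uhf h R x - u x)
          \<le> C * ((\<delta> + \<eta> h R) / sqrt \<alpha> + \<rho> h R \<alpha> + Hs_norm c s (\<lambda>x. uhf h R x - ubar x)
                 + \<alpha> powr \<nu> * Hs_norm c s (w h R \<delta> \<alpha>) + eps h R \<delta> \<alpha>)"
      \<comment> \<open>The estimates above carry no extra factor, so the constant is 1.\<close>
      using error_source by (intro exI[of _ 1]) auto
    show "\<exists>C>0. \<forall>(h, R, \<delta>, \<alpha>)\<in>P.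
             Hs_norm c s (\<lambda>x. u0h h R \<delta> \<alpha> x + uhf h R x - u x)
             \<le> C * ((\<delta> + \<eta> h R) / sqrt \<alpha> + \<rho> h R \<alpha> + Hs_norm c s (\<lambda>x. uhf h R x - ubar x)
                    + \<alpha> powr \<nu> * Hs_norm c s w')"
      if "w' \<in> Hs_tilde c s \<Omega>" "frac_power_eq c s e lam \<nu> w' u0" for w'
      using range[OF that] by (intro exI[of _ 1]) auto
  qed (rule converge rates; assumption)+
qed

end
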